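(* Let $V$ satisfy Assumption (A) of the context. If $\mu\in\mathcal{P}_2(\mathcal{X})$ is invariant under spatial shifts and is a stationary measure corresponding to $\mathscr{L}$, i.e. $$\int_{\mathcal{X}}\mathscr{L}f(\eta)\,\mu(d\eta)=0\quad\text{for all } f\in C^2_{\mathrm{loc}}(\mathcal{X}),$$ then $\mu$ is a Gibbs measure, i.e. for every finite $\Lambda\subset\mathbb{Z}^d$, $$\mu(\cdot\mid\mathscr{F}_{(\mathbb{Z}^d)^*\smallsetminus\overline{\Lambda^*}})=\mu_{\Lambda,\xi}(\cdot)\quad\text{for }\mu\text{-a.e. }\xi .$$
   Context: **Assumption (A).** $V=V_0+g$ with $V_0,g\in C^2(\mathbb{R})$ symmetric (even), $c_-\le V_0''\le c_+$ on $\mathbb{R}$ for some constants $c_\pm>0$, and $|g'(\eta)|+|g''(\eta)|\le C_g$ for all $\eta\in\mathbb{R}$, for some constant $C_g>0$. **Bonds and gradient fields.** $(\mathbb{Z}^d)^*$ is the set of directed bonds $b=(x,y)$, $x,y\in\mathbb{Z}^d$, $|x-y|=1$; $x_b=x$, $y_b=y$. For $\phi\in\mathbb{R}^{\mathbb{Z}^d}$, $\nabla\phi(b)=\phi(x)-\phi(y)$ for $b=(x,y)$. For $\Lambda\subset\mathbb{Z}^d$, $\overline{\Lambda^*}=\{b: x_b\in\Lambda\text{ or }y_b\in\Lambda\}$. $\mathcal{X}=\{\nabla\phi:\phi\in\mathbb{R}^{\mathbb{Z}^d}\}\subset\mathbb{R}^{(\mathbb{Z}^d)^*}$. $\mathcal{P}_2(\mathcal{X})$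 is the set of probability measures $\mu$ on $\mathcal{X}$ with $E^\mu[|\eta(b)|^2]<\infty$ for every $b$. **Generator.** $\mathscr{L}=\sum_{x\in\mathbb{Z}^d}\mathscr{L}_x$ with $$\mathscr{L}_x=\sum_{b,b'\in(\mathbb{Z}^d)^*:\,x_b=x_{b'}=x}\Big\{4\frac{\partial^2}{\partial\eta(b)\partial\eta(b')}-2V'(\eta(b))\frac{\partial}{\partial\eta(b')}\Big\}.$$ Here functions of $\eta\in\mathcal{X}$ (for which $\eta(-b)=-\eta(b)$, $-b=(y,x)$ for $b=(x,y)$) are written so that $\partial/\partial\eta(-b)=-\partial/\partial\eta(b)$. Equivalently, for $F$ local and $f(\phi)=F(\nabla\phi)$, one has $(\mathscr{L}_xF)(\nabla\phi)=\frac{\partial^2f}{\partial\phi(x)^2}-U_x(\phi)\frac{\partial f}{\partial\phi(x)}$ with $U_x(\phi)=\sum_{y:|x-y|=1}V'(\phi(x)-\phi(y))$. $C^2_{\mathrm{loc}}(\mathcal{X})$ is the set of functions on $\mathcal{X}$ depending on finitely many $\eta(b)$ through a $C^2$ function that is bounded with bounded first and second derivatives. **Finite-volume Gibbs measures.** For finite $\Lambda\subset\mathbb{Z}^d$ and $\xi\in\mathcal{X}$, let $\mathcal{X}_{\Lambda,\xi}=\{\eta\in\mathcal{X}:\eta(b)=\xi(b),\,b\notin\overline{\Lambda^*}\}$ and $$\mu_{\Lambda,\xi}(d\eta)=Z_{\Lambda,\xi}^{-1}\exp\Big(-\tfrac12\sum_{b\in\overline{\Lambda^*}}V(\eta(b))\Big)d\eta_{\overline{\Lambda^*},\xi},$$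 where $d\eta_{\overline{\Lambda^*},\xi}$ is Lebesgue measure on the affine space $\mathcal{X}_{\Lambda,\xi}$ and $Z_{\Lambda,\xi}$ normalizes. $\mathscr{F}_{(\mathbb{Z}^d)^*\smallsetminus\overline{\Lambda^*}}$ is the $\sigma$-algebra generated by $\{\eta(b):b\in(\mathbb{Z}^d)^*\smallsetminus\overline{\Lambda^*}\}$.
   Formalization: The formal theorem assumes d ≥ 2; for d = 1 the claim is false for every V, since the i.i.d. bond law with density ∝ exp(−V(u)+λu), λ≠0, is shift invariant, in P_2 and stationary, but its conditional laws on the closure of Λ* are tilted and differ from μ_{Λ,ξ}. *)

theory Defs
  imports "HOL-Probability.Probability"
begin

section \<open>Potentials\<close>

definition C2 :: "(real \<Rightarrow> real) \<Rightarrow> bool" where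
  "C2 f \<longleftrightarrow> (\<forall>x. f differentiable at x) \<and> (\<forall>x. deriv f differentiable at x)
     \<and> continuous_on UNIV (deriv (deriv f))"

definition assumption_A :: "(real \<Rightarrow> real) \<Rightarrow> bool" where
  "assumption_A V \<longleftrightarrow> (\<exists>V\<^sub>0 g. V = (\<lambda>x. V\<^sub>0 x + g x) \<and> C2 V\<^sub>0 \<and> C2 g
     \<and> (\<forall>x. V\<^sub>0 (- x) = V\<^sub>0 x) \<and> (\<forall>x. g (- x) = g x)
     \<and> (\<exists>c_minus > 0. \<exists>c_plus > 0. \<forall>x. c_minus \<le> deriv (deriv V\<^sub>0) x \<and> deriv (deriv V\<^sub>0) x \<le> c_plus)
     \<and> (\<exists>C_g > 0. \<forall>x. \<bar>deriv g x\<bar> + \<bar>deriv (deriv g) x\<bar> \<le> C_g))"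

section \<open>Bonds and gradient fields\<close>

type_synonym 'd site = "int ^ 'd"
type_synonym 'd bond = "'d site \<times> 'd site"

text \<open>For integer vectors, Euclidean distance 1 means that the squared coordinate differences sum to 1.\<close>

definition bonds :: "('d::finite) bond set" where
  "bonds = {(x, y). (\<Sum>i\<in>UNIV. (x $ i - y $ i)\<^sup>2) = 1}"

abbreviation rev_bond :: "('d::finite) bond \<Rightarrow> 'd bond" where
  "rev_bond b \<equiv> (snd b, fst b)"

definition bond_closure :: "('d::finite) site set \<Rightarrow> 'd bond set" where
  "bond_closure \<Lambda> = {b \<in> bonds. fst b \<in> \<Lambda> \<or> snd b \<in> \<Lambda>}"

text \<open>Real-valued functions on the bonds are represented, as in \<^const>\<open>PiM\<close>, by
  functions on all pairs of sites that are \<^const>\<open>undefined\<close> outside \<^const>\<open>bonds\<close>.\<close>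

definition grad :: "(('d::finite) site \<Rightarrow> real) \<Rightarrow> 'd bond \<Rightarrow> real" where
  "grad \<phi> = (\<lambda>b\<in>bonds. \<phi> (fst b) - \<phi> (snd b))"

definition gradient_fields :: "(('d::finite) bond \<Rightarrow> real) set" where
  "gradient_fields = range grad"

definition gradient_space :: "(('d::finite) bond \<Rightarrow> real) measure" where
  "gradient_space = restrict_space (PiM bonds (\<lambda>_. borel)) gradient_fields"

definition P2 :: "(('d::finite) bond \<Rightarrow> real) measure set" where
  "P2 = {\<mu>. prob_space \<mu> \<and> sets \<mu> = sets gradient_space
     \<and> (\<forall>b\<in>bonds. integrable \<mu> (\<lambda>\<eta>. \<bar>\<eta> b\<bar>\<^sup>2))}"

definition shift :: "('d::finite) site \<Rightarrow> ('d bond \<Rightarrow> real) \<Rightarrow> 'd bond \<Rightarrow> real" where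
  "shift z \<eta> = (\<lambda>b\<in>bonds. \<eta> (fst b + z, snd b + z))"

definition shift_invariant :: "(('d::finite) bond \<Rightarrow> real) measure \<Rightarrow> bool" where
  "shift_invariant \<mu> \<longleftrightarrow> (\<forall>z. distr \<mu> gradient_space (shift z) = \<mu>)"

section \<open>Generator and stationarity\<close>

definition pdiff :: "('d::finite) bond \<Rightarrow> (('d bond \<Rightarrow> real) \<Rightarrow> real) \<Rightarrow> bool" where
  "pdiff b F \<longleftrightarrow> (\<forall>\<eta>. (\<lambda>t. F (\<eta>(b := t))) differentiable at (\<eta> b))"

definition pd :: "('d::finite) bond \<Rightarrow> (('d bond \<Rightarrow> real) \<Rightarrow> real) \<Rightarrow> ('d bond \<Rightarrow> real) \<Rightarrow> real" where
  "pd b F \<eta> = deriv (\<lambda>t. F (\<eta>(b := t))) (\<eta> b)"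

text \<open>A local function on the gradient fields is given by an extension \<open>F\<close> to arbitrary real-valued
  functions on the bonds. As \<open>F\<close> depends on the coordinates in the finite set \<open>B\<close> only, continuity
  in the product topology is continuity in those finitely many variables.\<close>

definition C2_loc :: "((('d::finite) bond \<Rightarrow> real) \<Rightarrow> real) set" where
  "C2_loc = {F. (\<exists>B. finite B \<and> B \<subseteq> bonds \<and> (\<forall>\<eta> \<eta>'. (\<forall>b\<in>B. \<eta> b = \<eta>' b) \<longrightarrow> F \<eta> = F \<eta>'))
     \<and> continuous_on UNIV F \<and> bounded (range F)
     \<and> (\<forall>b\<in>bonds. pdiff b F \<and> continuous_on UNIV (pd b F) \<and> bounded (range (pd b F)))
     \<and> (\<forall>b\<in>bonds. \<forall>b'\<in>bonds. pdiff b (pd b' F) \<and> continuous_on UNIV (pd b (pd b' F))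
          \<and> bounded (range (pd b (pd b' F))))}"

text \<open>The convention under which the coefficients 4 and 2 of the generator are correct. It loses no
  test function: on gradient fields \<open>\<eta> (-b) = - \<eta> b\<close>, so replacing each variable \<open>\<eta> b\<close> of \<open>F\<close> by
  \<open>(\<eta> b - \<eta> (-b)) / 2\<close> leaves \<open>F\<close> unchanged there and enforces the convention. For such \<open>F\<close> and
  \<open>f \<phi> = F (grad \<phi>)\<close> the derivative of \<open>f\<close> in \<open>\<phi> x\<close> is twice the sum of \<open>pd b F\<close> over the bonds
  \<open>b\<close> starting at \<open>x\<close>; in particular the generator depends only on the values of \<open>F\<close> on gradient
  fields.\<close>

definition odd_convention :: "((('d::finite) bond \<Rightarrow> real) \<Rightarrow> real) \<Rightarrow> bool" where
  "odd_convention F \<longleftrightarrow> (\<forall>b\<in>bonds. \<forall>\<eta>. pd (rev_bond b) F \<eta> = - pd b F \<eta>)"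

definition generator_at ::
  "(real \<Rightarrow> real) \<Rightarrow> ('d::finite) site \<Rightarrow> (('d bond \<Rightarrow> real) \<Rightarrow> real) \<Rightarrow> ('d bond \<Rightarrow> real) \<Rightarrow> real" where
  "generator_at V x F \<eta> = (\<Sum>b\<in>{b \<in> bonds. fst b = x}. \<Sum>b'\<in>{b' \<in> bonds. fst b' = x}.
     4 * pd b (pd b' F) \<eta> - 2 * deriv V (\<eta> b) * pd b' F \<eta>)"

text \<open>For local \<open>F\<close> only finitely many terms of the sum are nonzero.\<close>

definition generator ::
  "(real \<Rightarrow> real) \<Rightarrow> ((('d::finite) bond \<Rightarrow> real) \<Rightarrow> real) \<Rightarrow> ('d bond \<Rightarrow> real) \<Rightarrow> real" where
  "generator V F \<eta> = (\<Sum>\<^sub>\<infinity>x\<in>UNIV. generator_at V x F \<eta>)"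

definition stationary :: "(real \<Rightarrow> real) \<Rightarrow> (('d::finite) bond \<Rightarrow> real) measure \<Rightarrow> bool" where
  "stationary V \<mu> \<longleftrightarrow>
     (\<forall>F\<in>C2_loc. odd_convention F \<longrightarrow> (\<integral>\<eta>. generator V F \<eta> \<partial>\<mu>) = 0)"

section \<open>Gibbs measures\<close>

definition fields_bc ::
  "('d::finite) site set \<Rightarrow> ('d bond \<Rightarrow> real) \<Rightarrow> ('d bond \<Rightarrow> real) set" where
  "fields_bc \<Lambda> \<xi> = {\<eta> \<in> gradient_fields. \<forall>b\<in>bonds - bond_closure \<Lambda>. \<eta> b = \<xi> b}"

definition affine_map ::
  "(('d::finite) bond \<Rightarrow> real) \<Rightarrow> nat \<Rightarrow> (nat \<Rightarrow> 'd bond \<Rightarrow> real) \<Rightarrow> (nat \<Rightarrow> real) \<Rightarrow> 'd bond \<Rightarrow> real" where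
  "affine_map \<xi> n v c = (\<lambda>b\<in>bonds. \<xi> b + (\<Sum>i<n. c i * v i b))"

text \<open>\<open>v 0, \<dots>, v (n - 1)\<close> is a basis of the direction space of the affine space
  \<open>fields_bc \<Lambda> \<xi>\<close>; that space does not depend on \<open>\<xi>\<close> and is \<open>fields_bc \<Lambda> 0\<close>.\<close>

definition direction_basis ::
  "('d::finite) site set \<Rightarrow> nat \<Rightarrow> (nat \<Rightarrow> 'd bond \<Rightarrow> real) \<Rightarrow> bool" where
  "direction_basis \<Lambda> n v \<longleftrightarrow>
     bij_betw (affine_map (\<lambda>_. 0) n v) ({..<n} \<rightarrow>\<^sub>E UNIV) (fields_bc \<Lambda> (\<lambda>_. 0))"

text \<open>Image of \<open>n\<close>-dimensional Lebesgue measure under an affine parametrisation of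
  \<open>fields_bc \<Lambda> \<xi>\<close>. Another basis changes it by a positive factor only, which the normalisation of
  the Gibbs measure cancels.\<close>

definition affine_lebesgue ::
  "('d::finite) site set \<Rightarrow> ('d bond \<Rightarrow> real) \<Rightarrow> ('d bond \<Rightarrow> real) measure" where
  "affine_lebesgue \<Lambda> \<xi> =
     (let (n, v) = (SOME (n, v). direction_basis \<Lambda> n v)
      in distr (PiM {..<n} (\<lambda>_. lborel)) gradient_space (affine_map \<xi> n v))"

definition boltzmann_weight ::
  "(real \<Rightarrow> real) \<Rightarrow> ('d::finite) site set \<Rightarrow> ('d bond \<Rightarrow> real) \<Rightarrow> real" where
  "boltzmann_weight V \<Lambda> \<eta> = exp (- (1/2) * (\<Sum>b\<in>bond_closure \<Lambda>. V (\<eta> b)))"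

definition partition_function ::
  "(real \<Rightarrow> real) \<Rightarrow> ('d::finite) site set \<Rightarrow> ('d bond \<Rightarrow> real) \<Rightarrow> ennreal" where
  "partition_function V \<Lambda> \<xi> = (\<integral>\<^sup>+\<eta>. ennreal (boltzmann_weight V \<Lambda> \<eta>) \<partial>affine_lebesgue \<Lambda> \<xi>)"

definition finite_gibbs ::
  "(real \<Rightarrow> real) \<Rightarrow> ('d::finite) site set \<Rightarrow> ('d bond \<Rightarrow> real) \<Rightarrow> ('d bond \<Rightarrow> real) measure" where
  "finite_gibbs V \<Lambda> \<xi> = density (affine_lebesgue \<Lambda> \<xi>)
     (\<lambda>\<eta>. ennreal (boltzmann_weight V \<Lambda> \<eta>) / partition_function V \<Lambda> \<xi>)"

definition exterior_algebra :: "('d::finite) site set \<Rightarrow> ('d bond \<Rightarrow> real) measure" where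
  "exterior_algebra \<Lambda> = sigma gradient_fields
     {{\<eta> \<in> gradient_fields. \<eta> b \<in> A} | b A. b \<in> bonds - bond_closure \<Lambda> \<and> A \<in> sets borel}"

definition gibbs_measure :: "(real \<Rightarrow> real) \<Rightarrow> (('d::finite) bond \<Rightarrow> real) measure \<Rightarrow> bool" where
  "gibbs_measure V \<mu> \<longleftrightarrow> (\<forall>\<Lambda>. finite \<Lambda> \<longrightarrow> (\<forall>A\<in>sets \<mu>. AE \<xi> in \<mu>.
     real_cond_exp \<mu> (exterior_algebra \<Lambda>) (indicator A) \<xi> = measure (finite_gibbs V \<Lambda> \<xi>) A))"

end

theory Submission
  imports Defs
begin

text \<open>Smear the law of finitely many bond variables with a product kernel whose logarithmic derivatives
  are bounded; it gets a smooth positive density \<open>\<rho>\<close> with scores \<open>s\<^sub>x = \<partial>\<^sub>x \<rho> / \<rho>\<close>, where \<open>\<partial>\<^sub>x\<close> is the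
  derivative in the height at \<open>x\<close>. Up to errors that vanish with the smearing, testing
  stationarity over a box with \<open>ln (\<rho> + \<delta>) + H\<close>, where \<open>H\<close> is the (truncated) energy of the box,
  gives \<open>\<Sum>\<^sub>x E ((s\<^sub>x + U\<^sub>x) (s\<^sub>x + \<partial>\<^sub>x H)) = 0\<close>, and hence
  \<open>\<Sum>\<^sub>x E (s\<^sub>x + \<partial>\<^sub>x H)\<^sup>2 \<le> \<Sum>\<^sub>x E (U\<^sub>x - \<partial>\<^sub>x H)\<^sup>2\<close>. The right side only sees the boundary of the box, because
  \<open>\<partial>\<^sub>x H = U\<^sub>x\<close> inside. By shift invariance all sites contribute equally to the resulting bound on
  \<open>(E (\<partial>\<^sub>x f - U\<^sub>x f))\<^sup>2\<close>, so division by the volume yields the integration by parts formula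
  \<open>E (\<partial>\<^sub>x f - U\<^sub>x f) = 0\<close> at every single site. With \<open>H\<close> the energy of
  the bonds meeting \<open>\<Lambda>\<close>, it says that \<open>e\<^sup>H \<mu>\<close> is invariant under the addition of gradients that vanish
  on all other bonds, because for \<open>d \<ge> 2\<close> these come from finitely supported height functions. By
  Fubini, this invariance determines the conditional distribution.\<close>

section \<open>Integration and product measures\<close>

text \<open>Ignore the smearing: if \<open>\<partial>\<^sub>x H = U\<^sub>x\<close> held at every
  site, the identity would read \<open>\<Sum> E (s + U)\<^sup>2 = 0\<close>, so
  \<open>s = - U\<close>, the Gibbs condition itself. At the rim of the box it fails, and what
  remains is \<open>2 S (S + R) \<ge> S\<^sup>2 - R\<^sup>2\<close> with
  \<open>S = s + \<partial>H\<close> and \<open>R = U - \<partial>H\<close>.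

  The noise is independent on each edge and so leaves the gradient fields. This is harmless:
  derivatives are taken only in the heights, and for a fixed value of the noise the smeared test
  function is a translate of a local function, to which stationarity of the original law applies
  exactly, with the force taken at the original field.

  The scores may blow up as the smearing vanishes. The estimate is therefore converted into a bound
  on \<open>(E (\<partial>f - U f))\<^sup>2\<close>, which mentions no density and survives the
  limit. Since the force grows at most linearly, second moments control the boundary terms.\<close>

lemma has_real_derivative_integral:
  fixes f f' :: "real \<Rightarrow> 'a \<Rightarrow> real"
  assumes r: "r > 0"
    and der: "\<And>s x. \<bar>s - t\<bar> < r \<Longrightarrow> x \<in> space M \<Longrightarrow> ((\<lambda>s. f s x) has_real_derivative f' s x) (at s)"
    and int: "\<And>s. \<bar>s - t\<bar> < r \<Longrightarrow> integrable M (f s)"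
    and f'm: "f' t \<in> borel_measurable M"
    and g: "integrable M g"
    and bd: "\<And>s x. \<bar>s - t\<bar> < r \<Longrightarrow> x \<in> space M \<Longrightarrow> \<bar>f' s x\<bar> \<le> g x"
  shows "((\<lambda>s. \<integral>x. f s x \<partial>M) has_real_derivative (\<integral>x. f' t x \<partial>M)) (at t)"
  unfolding DERIV_def tendsto_at_iff_sequentially
proof (intro allI impI)
  fix h0 :: "nat \<Rightarrow> real" assume h0: "\<forall>i. h0 i \<in> UNIV - {0}" "h0 \<longlonglongrightarrow> 0"
  \<comment> \<open>Only finitely many increments are altered; all then stay within the radius
    \<open>r\<close>, so the domination holds for every \<open>n\<close>.\<close>
  define h where "h n = (if \<bar>h0 n\<bar> < r then h0 n else r / 2)" for n
  have ev: "\<forall>\<^sub>F n in sequentially. h n = h0 n"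
    using order_tendstoD(2)[OF tendsto_rabs_zero[OF h0(2)] r]
    by eventually_elim (simp add: h_def)
  have h: "h n \<noteq> 0" "\<bar>h n\<bar> < r" for n using h0(1) r by (auto simp: h_def)
  have hl: "h \<longlonglongrightarrow> 0" using h0(2) tendsto_cong[OF ev] by blast
  have q: "\<bar>(f (t + h n) x - f t x) / h n\<bar> \<le> g x" if x: "x \<in> space M" for n x
  proof -
    have "\<exists>z. \<bar>z - t\<bar> < r \<and> f (t + h n) x - f t x = h n * f' z x"
    proof (cases "h n > 0")
      case True
      have "\<exists>z>t. z < t + h n \<and> f (t + h n) x - f t x = (t + h n - t) * f' z x"
        by (rule MVT2) (use True h(2)[of n] der x in auto)
      then obtain z where "z > t" "z < t + h n" "f (t + h n) x - f t x = h n * f' z x" by auto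
      then show ?thesis using h(2)[of n] by (intro exI[of _ z]) auto
    next
      case False
      then have n: "h n < 0" using h(1)[of n] by linarith
      have "\<exists>z>t + h n. z < t \<and> f t x - f (t + h n) x = (t - (t + h n)) * f' z x"
        by (rule MVT2) (use n h(2)[of n] der x in auto)
      then obtain z where "z < t" "z > t + h n" "f t x - f (t + h n) x = - h n * f' z x" by auto
      then show ?thesis using h(2)[of n] by (intro exI[of _ z]) auto
    qed
    then obtain z where "\<bar>z - t\<bar> < r" "f (t + h n) x - f t x = h n * f' z x" by blast
    then show ?thesis using bd[of z x] x h(1)[of n] by simp
  qed
  have I: "integrable M (f (t + h n))" "integrable M (f t)" for n
    using int h(2)[of n] r by (auto intro!: int)
  have "(\<lambda>n. \<integral>x. (f (t + h n) x - f t x) / h n \<partial>M) \<longlonglongrightarrow> (\<integral>x. f' t x \<partial>M)"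
  proof (rule integral_dominated_convergence[where w=g])
    show "AE x in M. (\<lambda>n. (f (t + h n) x - f t x) / h n) \<longlonglongrightarrow> f' t x"
    proof (rule AE_I2)
      fix x assume x: "x \<in> space M"
      have "((\<lambda>h. (f (t + h) x - f t x) / h) \<longlongrightarrow> f' t x) (at 0)"
        using der[of t x] x r by (simp add: DERIV_def)
      then show "(\<lambda>n. (f (t + h n) x - f t x) / h n) \<longlonglongrightarrow> f' t x"
        using h(1) hl unfolding tendsto_at_iff_sequentially by (auto simp: o_def)
    qed
    show "AE x in M. norm ((f (t + h n) x - f t x) / h n) \<le> g x" for n
      using q by (auto intro!: AE_I2)
  qed (use g f'm I in auto)
  also have "(\<lambda>n. \<integral>x. (f (t + h n) x - f t x) / h n \<partial>M) = (\<lambda>n. ((\<integral>x. f (t + h n) x \<partial>M) - (\<integral>x. f t x \<partial>M)) / h n)"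
    using I by auto
  finally show "((\<lambda>h. ((\<integral>x. f (t + h) x \<partial>M) - (\<integral>x. f t x \<partial>M)) / h) \<circ> h0) \<longlonglongrightarrow> (\<integral>x. f' t x \<partial>M)"
    by (rule Lim_transform_eventually) (use ev in eventually_elim, simp)
qed

lemma tendsto_coordinatewiseI:
  fixes x :: "'a \<Rightarrow> 'i \<Rightarrow> 'b::topological_space"
  assumes "\<And>i. ((\<lambda>n. x n i) \<longlongrightarrow> l i) F"
  shows "(x \<longlongrightarrow> l) F"
  using assms limitin_componentwise[of "\<lambda>_. euclidean" UNIV x l F]
  by (simp add: euclidean_product_topology flip: limitin_canonical_iff)

text \<open>Rectangles determine a product measure, and their preimages under a coordinatewise map
  are rectangles.\<close>

lemma distr_PiM_map:
  assumes M: "product_sigma_finite M" and M': "product_sigma_finite M'" and I: "finite I"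
    and f: "\<And>i. i \<in> I \<Longrightarrow> f i \<in> measurable (M i) (M' i)"
    and d: "\<And>i. i \<in> I \<Longrightarrow> distr (M i) (M' i) (f i) = M' i"
  shows "distr (PiM I M) (PiM I M') (\<lambda>x. \<lambda>i\<in>I. f i (x i)) = PiM I M'"
proof (rule product_sigma_finite.PiM_eqI[OF M' I])
  have m: "(\<lambda>x. \<lambda>i\<in>I. f i (x i)) \<in> measurable (PiM I M) (PiM I M')"
    using f by (intro measurable_restrict) (auto intro: measurable_compose[OF measurable_component_singleton])
  fix A assume A: "\<And>i. i \<in> I \<Longrightarrow> A i \<in> sets (M' i)"
  have eq: "(\<lambda>x. \<lambda>i\<in>I. f i (x i)) -` Pi\<^sub>E I A \<inter> space (PiM I M) = Pi\<^sub>E I (\<lambda>i. f i -` A i \<inter> space (M i))"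
    by (auto simp: space_PiM PiE_iff)
  have "emeasure (distr (PiM I M) (PiM I M') (\<lambda>x. \<lambda>i\<in>I. f i (x i))) (Pi\<^sub>E I A)
      = emeasure (PiM I M) (Pi\<^sub>E I (\<lambda>i. f i -` A i \<inter> space (M i)))"
    using m A I by (subst emeasure_distr) (auto simp: eq intro!: sets_PiM_I_finite)
  also have "\<dots> = (\<Prod>i\<in>I. emeasure (M i) (f i -` A i \<inter> space (M i)))"
    using f A I by (intro product_sigma_finite.emeasure_PiM[OF M]) (auto intro: measurable_sets)
  also have "\<dots> = (\<Prod>i\<in>I. emeasure (M' i) (A i))"
  proof (intro prod.cong refl)
    fix i assume i: "i \<in> I"
    have "emeasure (distr (M i) (M' i) (f i)) (A i) = emeasure (M i) (f i -` A i \<inter> space (M i))"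
      using f[OF i] A[OF i] by (rule emeasure_distr)
    then show "emeasure (M i) (f i -` A i \<inter> space (M i)) = emeasure (M' i) (A i)"
      using d[OF i] by simp
  qed
  finally show "emeasure (distr (PiM I M) (PiM I M') (\<lambda>x. \<lambda>i\<in>I. f i (x i))) (Pi\<^sub>E I A)
      = (\<Prod>i\<in>I. emeasure (M' i) (A i))" .
qed simp

lemma density_PiM:
  assumes M: "product_sigma_finite M" and M': "product_sigma_finite (\<lambda>i. density (M i) (f i))" and I: "finite I"
    and f: "\<And>i. i \<in> I \<Longrightarrow> f i \<in> borel_measurable (M i)"
  shows "density (PiM I M) (\<lambda>x. \<Prod>i\<in>I. f i (x i)) = PiM I (\<lambda>i. density (M i) (f i))"
proof (rule product_sigma_finite.PiM_eqI[OF M' I])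
  have fm: "(\<lambda>x. \<Prod>i\<in>I. f i (x i)) \<in> borel_measurable (PiM I M)"
  proof (rule borel_measurable_prod_ennreal)
    fix i assume i: "i \<in> I"
    show "(\<lambda>x. f i (x i)) \<in> borel_measurable (PiM I M)"
      by (rule measurable_compose[OF measurable_component_singleton[OF i], where g="f i"]) (use f[OF i] in simp)
  qed
  show "sets (density (PiM I M) (\<lambda>x. \<Prod>i\<in>I. f i (x i))) = sets (PiM I (\<lambda>i. density (M i) (f i)))"
    by (simp cong: sets_PiM_cong)
  fix A assume "\<And>i. i \<in> I \<Longrightarrow> A i \<in> sets (density (M i) (f i))"
  then have A: "\<And>i. i \<in> I \<Longrightarrow> A i \<in> sets (M i)" by simp
  have "emeasure (density (PiM I M) (\<lambda>x. \<Prod>i\<in>I. f i (x i))) (Pi\<^sub>E I A)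
     = (\<integral>\<^sup>+x. (\<Prod>i\<in>I. f i (x i)) * indicator (Pi\<^sub>E I A) x \<partial>PiM I M)"
    using fm A I by (intro emeasure_density) (auto intro!: sets_PiM_I_finite)
  also have "\<dots> = (\<integral>\<^sup>+x. (\<Prod>i\<in>I. f i (x i) * indicator (A i) (x i)) \<partial>PiM I M)"
  proof (intro nn_integral_cong)
    fix x assume "x \<in> space (PiM I M)"
    then have "indicator (Pi\<^sub>E I A) x = (\<Prod>i\<in>I. indicator (A i) (x i) :: ennreal)"
      using I by (auto simp: indicator_def space_PiM PiE_iff prod_zero_iff)
    then show "(\<Prod>i\<in>I. f i (x i)) * indicator (Pi\<^sub>E I A) x = (\<Prod>i\<in>I. f i (x i) * indicator (A i) (x i))"
      by (simp add: prod.distrib)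
  qed
  also have "\<dots> = (\<Prod>i\<in>I. \<integral>\<^sup>+x. f i x * indicator (A i) x \<partial>M i)"
    using f A I by (intro product_sigma_finite.product_nn_integral_prod[OF M]) auto
  also have "\<dots> = (\<Prod>i\<in>I. emeasure (density (M i) (f i)) (A i))"
    using f A by (intro prod.cong refl) (simp add: emeasure_density)
  finally show "emeasure (density (PiM I M) (\<lambda>x. \<Prod>i\<in>I. f i (x i))) (Pi\<^sub>E I A)
     = (\<Prod>i\<in>I. emeasure (density (M i) (f i)) (A i))" .
qed

section \<open>Smearing by a product kernel\<close>

text \<open>The kernel decays only polynomially so that its derivatives are bounded by multiples of itself.\<close>

definition cauchy :: "real \<Rightarrow> real" where "cauchy t = inverse (1 + t\<^sup>2)"
definition kern :: "real \<Rightarrow> real" where "kern t = (cauchy t)\<^sup>2"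
definition kern1 :: "real \<Rightarrow> real" where "kern1 t = - 4 * t * cauchy t ^ 3"
definition kern2 :: "real \<Rightarrow> real" where "kern2 t = 24 * t\<^sup>2 * cauchy t ^ 4 - 4 * cauchy t ^ 3"

lemma one_plus_square_pos [simp]: "0 < 1 + (t::real)\<^sup>2"
  by (meson add_pos_nonneg zero_le_power2 zero_less_one)

lemma one_plus_square_neq_0 [simp]: "1 + t\<^sup>2 \<noteq> (0::real)"
  using one_plus_square_pos[of t] by linarith

lemma cauchy_pos: "cauchy t > 0" by (simp add: cauchy_def)
lemma cauchy_le_1: "cauchy t \<le> 1" by (simp add: cauchy_def inverse_le_1_iff)

lemma cauchy_square: "t\<^sup>2 * cauchy t \<le> 1"
  by (simp add: cauchy_def field_simps)

lemma cauchy_abs: "\<bar>t\<bar> * cauchy t \<le> 1"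
proof -
  have "2 * \<bar>t\<bar> \<le> 1 + t\<^sup>2" using sum_squares_bound[of 1 "\<bar>t\<bar>"] by simp
  then show ?thesis by (simp add: cauchy_def field_simps)
qed

lemma cauchy_deriv: "(cauchy has_real_derivative - 2 * t * (cauchy t)\<^sup>2) (at t)"
proof -
  have "((\<lambda>t. inverse (1 + t\<^sup>2)) has_real_derivative - (inverse (1 + t\<^sup>2) * (2 * t) * inverse (1 + t\<^sup>2))) (at t)"
    by (rule derivative_eq_intros refl | simp)+
  then show ?thesis unfolding cauchy_def by (simp add: power2_eq_square mult_ac)
qed

lemma kern_pos: "kern t > 0" using cauchy_pos[of t] by (simp add: kern_def)

lemma kern_deriv: "(kern has_real_derivative kern1 t) (at t)"
  unfolding kern_def kern1_def
  by (rule derivative_eq_intros cauchy_deriv refl | simp add: power_numeral_reduce algebra_simps)+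

lemma kern1_deriv: "(kern1 has_real_derivative kern2 t) (at t)"
  unfolding kern1_def kern2_def
  by (rule derivative_eq_intros cauchy_deriv refl | simp add: power_numeral_reduce algebra_simps)+

lemma cauchy_cont: "continuous_on S f \<Longrightarrow> continuous_on S (\<lambda>t. cauchy (f t))"
  unfolding cauchy_def by (intro continuous_intros) auto

lemma kern_cont [continuous_intros]: "continuous_on S f \<Longrightarrow> continuous_on S (\<lambda>t. kern (f t))"
  unfolding kern_def by (intro continuous_intros cauchy_cont) auto

lemma kern1_cont [continuous_intros]: "continuous_on S f \<Longrightarrow> continuous_on S (\<lambda>t. kern1 (f t))"
  unfolding kern1_def by (intro continuous_intros cauchy_cont) auto

lemma kern2_cont [continuous_intros]: "continuous_on S f \<Longrightarrow> continuous_on S (\<lambda>t. kern2 (f t))"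
  unfolding kern2_def by (intro continuous_intros cauchy_cont) auto

lemma kern_le_cauchy: "kern t \<le> cauchy t"
  using cauchy_pos[of t] cauchy_le_1[of t] mult_left_mono[of "cauchy t" 1 "cauchy t"]
  by (simp add: kern_def power2_eq_square)

lemma kern_le_1: "kern t \<le> 1"
  using kern_le_cauchy[of t] cauchy_le_1[of t] by linarith

lemma kern1_le: "\<bar>kern1 t\<bar> \<le> 4 * kern t"
proof -
  have "(\<bar>t\<bar> * cauchy t) * (cauchy t)\<^sup>2 \<le> 1 * (cauchy t)\<^sup>2"
    using cauchy_abs by (intro mult_right_mono) auto
  then show ?thesis using cauchy_pos[of t]
    by (simp add: kern1_def kern_def abs_mult power_numeral_reduce mult_ac)
qed

lemma kern2_le: "\<bar>kern2 t\<bar> \<le> 28 * kern t"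
proof -
  have "(t\<^sup>2 * cauchy t) * (cauchy t * (cauchy t)\<^sup>2) \<le> 1 * (1 * (cauchy t)\<^sup>2)"
    using cauchy_square[of t] cauchy_le_1[of t] cauchy_pos[of t] by (intro mult_mono) auto
  then have 1: "t\<^sup>2 * cauchy t ^ 4 \<le> kern t" by (simp add: kern_def power_numeral_reduce mult_ac)
  have "cauchy t * (cauchy t)\<^sup>2 \<le> 1 * (cauchy t)\<^sup>2"
    using cauchy_le_1[of t] by (intro mult_right_mono) auto
  then have 2: "cauchy t ^ 3 \<le> kern t" by (simp add: kern_def power_numeral_reduce)
  have "0 \<le> t\<^sup>2 * cauchy t ^ 4" "0 \<le> cauchy t ^ 3" using cauchy_pos[of t] by auto
  then show ?thesis using 1 2 unfolding kern2_def abs_le_iff by linarith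
qed

lemma integrable_cauchy: "integrable lborel cauchy"
  using integrable_inverse_1_plus_square unfolding cauchy_def by (simp add: set_integrable_def)

lemma kern_measurable [measurable]: "kern \<in> borel_measurable borel" "kern1 \<in> borel_measurable borel" "kern2 \<in> borel_measurable borel"
  by (auto intro!: borel_measurable_continuous_onI continuous_intros)

lemma integrable_kern: "integrable lborel kern"
  by (rule Bochner_Integration.integrable_bound[OF integrable_cauchy])
     (use kern_le_cauchy kern_pos cauchy_pos in \<open>auto intro!: AE_I2 simp: less_imp_le abs_of_pos\<close>)

text \<open>This is why the kernel is the square of \<open>cauchy\<close>: \<open>cauchy\<close>
  alone has no second moment. The second moment of the noise helps to dominate the forces when the
  smearing is removed.\<close>

lemma integrable_kern_square: "integrable lborel (\<lambda>t. t\<^sup>2 * kern t)"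
proof (rule Bochner_Integration.integrable_bound[OF integrable_cauchy])
  have "t\<^sup>2 * kern t \<le> cauchy t" for t
    using mult_right_mono[OF cauchy_square[of t], of "cauchy t"] cauchy_pos[of t]
    by (simp add: kern_def power2_eq_square mult_ac)
  then show "AE t in lborel. norm (t\<^sup>2 * kern t) \<le> norm (cauchy t)"
    using kern_pos cauchy_pos by (auto intro!: AE_I2 simp: less_imp_le abs_of_pos abs_mult)
qed auto

definition kern_mass :: real where "kern_mass = (\<integral>t. kern t \<partial>lborel)"

lemma kern_mass_pos: "kern_mass > 0"
proof -
  have "kern_mass \<noteq> 0"
  proof
    assume "kern_mass = 0"
    then have "AE t in lborel. kern t = 0"
      unfolding kern_mass_def using integrable_kern kern_pos
      by (subst (asm) integral_nonneg_eq_0_iff_AE) (auto simp: less_imp_le)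
    then have "AE t in lborel. (t::real) \<notin> UNIV"
      by eventually_elim (use kern_pos in \<open>auto simp: less_imp_neq[symmetric]\<close>)
    then have "(UNIV :: real set) \<in> null_sets lborel"
      by (subst AE_iff_null_sets) auto
    then show False by (simp add: null_sets_def)
  qed
  moreover have "kern_mass \<ge> 0" unfolding kern_mass_def using kern_pos by (auto simp: less_imp_le)
  ultimately show ?thesis by simp
qed

definition noise :: "real measure" where
  "noise = density lborel (\<lambda>t. ennreal (kern t / kern_mass))"

lemma prob_space_noise: "prob_space noise"
proof
  have "(\<integral>\<^sup>+t. ennreal (kern t / kern_mass) \<partial>lborel) = ennreal (\<integral>t. kern t / kern_mass \<partial>lborel)"
    using integrable_kern kern_pos kern_mass_pos by (intro nn_integral_eq_integral) (auto simp: less_imp_le)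
  also have "\<dots> = 1" using kern_mass_pos by (simp flip: kern_mass_def)
  finally show "emeasure noise (space noise) = 1" by (simp add: noise_def emeasure_density)
qed

lemma sets_noise [measurable_cong, simp]: "sets noise = sets borel" by (simp add: noise_def)
lemma noise_second_moment: "integrable noise (\<lambda>t. t\<^sup>2)"
  unfolding noise_def using kern_pos kern_mass_pos integrable_kern_square
  by (subst integrable_density) (auto simp: less_imp_le mult.commute)

lemma emeasure_density_affine_kern:
  assumes "e > 0"
  shows "distr noise lborel (\<lambda>t. x + e * t) = density lborel (\<lambda>t. ennreal (kern ((t - x) / e) / (e * kern_mass)))"
proof (rule measure_eqI)
  fix A assume "A \<in> sets (distr noise lborel (\<lambda>t. x + e * t))"
  then have [measurable]: "A \<in> sets borel" by simp
  have "emeasure (distr noise lborel (\<lambda>t. x + e * t)) A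
      = (\<integral>\<^sup>+t. indicator A t \<partial>distr noise lborel (\<lambda>t. x + e * t))"
    by simp
  also have "\<dots> = (\<integral>\<^sup>+t. ennreal (kern t / kern_mass) * indicator A (x + e * t) \<partial>lborel)"
    unfolding noise_def by (subst nn_integral_distr) (auto simp: nn_integral_density)
  also have "\<dots> = (\<integral>\<^sup>+t. ennreal (kern (((x + e * t) - x) / e) / kern_mass) * indicator A (x + e * t) \<partial>lborel)"
    using assms by simp
  also have "\<dots> = (\<integral>\<^sup>+t. ennreal e * (ennreal (kern ((t - x) / e) / (e * kern_mass)) * indicator A t) \<partial>distr lborel lborel (\<lambda>t. x + e * t))"
    using assms kern_pos kern_mass_pos 
    by (subst nn_integral_distr) (auto intro!: nn_integral_cong simp: mult.assoc[symmetric] ennreal_mult'[symmetric])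
  also have "\<dots> = (\<integral>\<^sup>+t. (ennreal (kern ((t - x) / e) / (e * kern_mass)) * indicator A t) \<partial>density (distr lborel lborel (\<lambda>t. x + e * t)) (\<lambda>_. ennreal e))"
    by (subst nn_integral_density) auto
  also have "density (distr lborel lborel (\<lambda>t. x + e * t)) (\<lambda>_. ennreal e) = lborel"
    using lborel_real_affine[of e x] assms by (simp add: abs_of_pos cong: distr_cong)
  also have "(\<integral>\<^sup>+t. (ennreal (kern ((t - x) / e) / (e * kern_mass)) * indicator A t) \<partial>lborel)
     = emeasure (density lborel (\<lambda>t. ennreal (kern ((t - x) / e) / (e * kern_mass)))) A"
    by (subst emeasure_density) auto
  finally show "emeasure (distr noise lborel (\<lambda>t. x + e * t)) A = \<dots>" .
qed simp

section \<open>Local C^1 functions with bounded partial derivatives\<close>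

text \<open>The partial derivatives are an argument, so that a C^2 function is expressed by one
  instance for \<open>F\<close> and one for each \<open>F1 i\<close>. They are indexed by the whole
  type; those outside \<open>N\<close> vanish.\<close>

definition C1b :: "'i set \<Rightarrow> (('i \<Rightarrow> real) \<Rightarrow> real) \<Rightarrow> ('i \<Rightarrow> ('i \<Rightarrow> real) \<Rightarrow> real) \<Rightarrow> bool" where
  "C1b N F F1 \<longleftrightarrow> (\<forall>w w'. (\<forall>i\<in>N. w i = w' i) \<longrightarrow> F w = F w') \<and> continuous_on UNIV F \<and> bounded (range F)
    \<and> (\<forall>i. (\<forall>w. ((\<lambda>t. F (w(i := t))) has_real_derivative F1 i w) (at (w i)))
        \<and> continuous_on UNIV (F1 i) \<and> bounded (range (F1 i)))"

lemma C1bD: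
  assumes "C1b N F F1"
  shows C1b_local: "(\<And>i. i \<in> N \<Longrightarrow> w i = w' i) \<Longrightarrow> F w = F w'"
    and C1b_cont: "continuous_on UNIV F" and C1b_bounded: "\<exists>B. \<forall>w. \<bar>F w\<bar> \<le> B"
    and C1b_deriv: "((\<lambda>t. F (w(i := t))) has_real_derivative F1 i w) (at (w i))"
    and C1b_cont1: "continuous_on UNIV (F1 i)" and C1b_bounded1: "\<exists>B. \<forall>w. \<bar>F1 i w\<bar> \<le> B"
  using assms unfolding C1b_def bounded_iff by (blast, blast, force, blast, blast, force)

lemma C1b_deriv_at:
  assumes "C1b N F F1"
  shows "((\<lambda>t. F (w(i := t))) has_real_derivative F1 i (w(i := s))) (at s)"
  using C1b_deriv[OF assms, of "w(i := s)" i] by simp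

lemma C1bI:
  assumes "\<And>w w'. (\<And>i. i \<in> N \<Longrightarrow> w i = w' i) \<Longrightarrow> F w = F w'" "continuous_on UNIV F" "\<And>w. \<bar>F w\<bar> \<le> B"
    "\<And>i w. ((\<lambda>t. F (w(i := t))) has_real_derivative F1 i w) (at (w i))"
    "\<And>i. continuous_on UNIV (F1 i)" "\<And>i w. \<bar>F1 i w\<bar> \<le> C i"
  shows "C1b N F F1"
  unfolding C1b_def
proof (intro conjI allI impI)
  show "bounded (range F)" using assms(3) by (auto simp: bounded_iff)
  show "bounded (range (F1 i))" for i using assms(6)[of i] by (auto simp: bounded_iff)
  show "F w = F w'" if "\<forall>i\<in>N. w i = w' i" for w w' using assms(1)[of w w'] that by blast
qed (rule assms)+

lemma C1b_off: "C1b N F F1 \<Longrightarrow> i \<notin> N \<Longrightarrow> F1 i w = 0"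
proof -
  assume F: "C1b N F F1" and i: "i \<notin> N"
  have "(\<lambda>t. F (w(i := t))) = (\<lambda>t. F w)" using i by (intro ext C1b_local[OF F]) auto
  then show "F1 i w = 0" using C1b_deriv[OF F, of w i] DERIV_unique[OF _ DERIV_const] by simp
qed

lemma C1b_local1:
  assumes F: "C1b N F F1" and eq: "\<And>i. i \<in> N \<Longrightarrow> w i = w' i"
  shows "F1 i w = F1 i w'"
proof (cases "i \<in> N")
  case True
  have "(\<lambda>t. F (w(i := t))) = (\<lambda>t. F (w'(i := t)))" using eq by (intro ext C1b_local[OF F]) auto
  then show ?thesis
    using DERIV_unique[OF C1b_deriv[OF F, of w i, unfolded eq[OF True]]] C1b_deriv[OF F, of w' i] by simp
qed (simp add: C1b_off[OF F])

lemma C1b_mono: "C1b N F F1 \<Longrightarrow> N \<subseteq> N' \<Longrightarrow> C1b N' F F1"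
proof -
  assume F: "C1b N F F1" and N: "N \<subseteq> N'"
  have "\<forall>w w'. (\<forall>i\<in>N'. w i = w' i) \<longrightarrow> F w = F w'"
    using N by (intro allI impI C1b_local[OF F]) auto
  with F show ?thesis unfolding C1b_def by (elim conjE) (intro conjI; assumption)
qed

lemma C1b_zero: "C1b N (\<lambda>_. 0) (\<lambda>_ _. 0)"
  by (rule C1bI[where B=0 and C="\<lambda>_. 0"]) auto

lemma C1b_add:
  assumes F: "C1b N F F1" and G: "C1b N G G1"
  shows "C1b N (\<lambda>w. F w + G w) (\<lambda>i w. F1 i w + G1 i w)"
proof -
  obtain B where B: "\<And>w. \<bar>F w\<bar> \<le> B" using C1b_bounded[OF F] by blast
  obtain C where C: "\<And>w. \<bar>G w\<bar> \<le> C" using C1b_bounded[OF G] by blast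
  have "\<forall>i. \<exists>B. \<forall>w. \<bar>F1 i w\<bar> \<le> B" using C1b_bounded1[OF F] by blast
  then obtain B1 where B1: "\<And>i w. \<bar>F1 i w\<bar> \<le> B1 i" by metis
  have "\<forall>i. \<exists>B. \<forall>w. \<bar>G1 i w\<bar> \<le> B" using C1b_bounded1[OF G] by blast
  then obtain C1 where C1: "\<And>i w. \<bar>G1 i w\<bar> \<le> C1 i" by metis
  show ?thesis
  proof (rule C1bI[where B="B + C" and C="\<lambda>i. B1 i + C1 i"])
    show "F w + G w = F w' + G w'" if "\<And>i. i \<in> N \<Longrightarrow> w i = w' i" for w w'
      using C1b_local[OF F, of w w'] C1b_local[OF G, of w w'] that by auto
    show "\<bar>F w + G w\<bar> \<le> B + C" for w using B[of w] C[of w] by linarith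
    show "\<bar>F1 i w + G1 i w\<bar> \<le> B1 i + C1 i" for i w using B1[of i w] C1[of i w] by linarith
    show "((\<lambda>t. F (w(i := t)) + G (w(i := t))) has_real_derivative F1 i w + G1 i w) (at (w i))" for i w
      by (intro DERIV_add C1b_deriv[OF F] C1b_deriv[OF G])
  qed (intro continuous_intros C1b_cont[OF F] C1b_cont[OF G] C1b_cont1[OF F] C1b_cont1[OF G])+
qed

lemma C1b_mult:
  assumes F: "C1b N F F1" and G: "C1b N G G1"
  shows "C1b N (\<lambda>w. F w * G w) (\<lambda>i w. F1 i w * G w + F w * G1 i w)"
proof -
  obtain B where B: "\<And>w. \<bar>F w\<bar> \<le> B" using C1b_bounded[OF F] by blast
  obtain C where C: "\<And>w. \<bar>G w\<bar> \<le> C" using C1b_bounded[OF G] by blast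
  have "\<forall>i. \<exists>B. \<forall>w. \<bar>F1 i w\<bar> \<le> B" using C1b_bounded1[OF F] by blast
  then obtain B1 where B1: "\<And>i w. \<bar>F1 i w\<bar> \<le> B1 i" by metis
  have "\<forall>i. \<exists>B. \<forall>w. \<bar>G1 i w\<bar> \<le> B" using C1b_bounded1[OF G] by blast
  then obtain C1 where C1: "\<And>i w. \<bar>G1 i w\<bar> \<le> C1 i" by metis
  have BC: "0 \<le> B" "0 \<le> C" "\<And>i. 0 \<le> B1 i" "\<And>i. 0 \<le> C1 i"
    using B C B1 C1 abs_ge_zero order_trans by blast+
  show ?thesis
  proof (rule C1bI[where B="B * C" and C="\<lambda>i. B1 i * C + B * C1 i"])
    show "F w * G w = F w' * G w'" if "\<And>i. i \<in> N \<Longrightarrow> w i = w' i" for w w'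
      using C1b_local[OF F, of w w'] C1b_local[OF G, of w w'] that by auto
    show "\<bar>F w * G w\<bar> \<le> B * C" for w using B[of w] C[of w] BC by (simp add: abs_mult mult_mono)
    show "\<bar>F1 i w * G w + F w * G1 i w\<bar> \<le> B1 i * C + B * C1 i" for i w
    proof -
      have "\<bar>F1 i w * G w\<bar> \<le> B1 i * C" "\<bar>F w * G1 i w\<bar> \<le> B * C1 i"
        using B[of w] C[of w] B1[of i w] C1[of i w] BC by (simp_all add: abs_mult mult_mono)
      then show ?thesis by linarith
    qed
    show "((\<lambda>t. F (w(i := t)) * G (w(i := t))) has_real_derivative F1 i w * G w + F w * G1 i w) (at (w i))" for i w
      using DERIV_mult[OF C1b_deriv[OF F, of w i] C1b_deriv[OF G, of w i]] by (simp add: mult.commute)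
  qed (intro continuous_intros C1b_cont[OF F] C1b_cont[OF G] C1b_cont1[OF F] C1b_cont1[OF G])+
qed

text \<open>The bounds come from compactness of \<open>S\<close>, so \<open>\<phi>\<close> may be
  singular elsewhere: it is applied to \<open>ln\<close> and to the reciprocal, both shifted by
  \<delta>, on an interval containing the values of the density.\<close>

lemma C1b_compose:
  assumes F: "C1b N F F1" and S: "\<And>w. F w \<in> S" "compact S"
    and d: "\<And>s. s \<in> S \<Longrightarrow> (\<phi> has_real_derivative \<phi>' s) (at s)" and c: "continuous_on S \<phi>'"
  shows "C1b N (\<lambda>w. \<phi> (F w)) (\<lambda>i w. \<phi>' (F w) * F1 i w)"
proof -
  have "\<forall>i. \<exists>B. \<forall>w. \<bar>F1 i w\<bar> \<le> B" using C1b_bounded1[OF F] by blast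
  then obtain B1 where B1: "\<And>i w. \<bar>F1 i w\<bar> \<le> B1 i" by metis
  have c0: "continuous_on S \<phi>" using d by (meson DERIV_continuous_on has_field_derivative_at_within)
  obtain B where B: "\<And>s. s \<in> S \<Longrightarrow> \<bar>\<phi> s\<bar> \<le> B"
    using compact_imp_bounded[OF compact_continuous_image[OF c0 S(2)]] unfolding bounded_iff by auto
  obtain C where C: "\<And>s. s \<in> S \<Longrightarrow> \<bar>\<phi>' s\<bar> \<le> C"
    using compact_imp_bounded[OF compact_continuous_image[OF c S(2)]] unfolding bounded_iff by auto
  have C0: "0 \<le> C" using C S(1) abs_ge_zero order_trans by blast
  show ?thesis
  proof (rule C1bI[where B=B and C="\<lambda>i. C * B1 i"])
    show "\<phi> (F w) = \<phi> (F w')" if "\<And>i. i \<in> N \<Longrightarrow> w i = w' i" for w w'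
      using C1b_local[OF F, of w w'] that by auto
    show "\<bar>\<phi>' (F w) * F1 i w\<bar> \<le> C * B1 i" for i w
      using C[OF S(1)[of w]] B1[of i w] C0 by (simp add: abs_mult mult_mono)
    show "((\<lambda>t. \<phi> (F (w(i := t)))) has_real_derivative \<phi>' (F w) * F1 i w) (at (w i))" for i w
      by (rule DERIV_chain2[OF _ C1b_deriv[OF F]]) (use d[OF S(1)[of w]] in simp)
    show "continuous_on UNIV (\<lambda>w. \<phi>' (F w) * F1 i w)" for i
      by (intro continuous_on_mult continuous_on_compose2[OF c C1b_cont[OF F]] C1b_cont1[OF F]) (use S in auto)
  qed (use B S in \<open>auto intro!: continuous_on_compose2[OF c0 C1b_cont[OF F]]\<close>)
qed

lemma continuous_on_fun_shift: "continuous_on UNIV (\<lambda>w i. w i + c i :: real)"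
  by (intro continuous_on_coordinatewise_then_product continuous_intros continuous_on_product_coordinates)

text \<open>A fixed value of the noise acts on test functions as such a translation, which keeps
  them admissible for stationarity.\<close>

lemma C1b_translate:
  assumes F: "C1b N F F1"
  shows "C1b N (\<lambda>w. F (\<lambda>i. w i + c i)) (\<lambda>i w. F1 i (\<lambda>i. w i + c i))"
proof -
  obtain B where B: "\<And>w. \<bar>F w\<bar> \<le> B" using C1b_bounded[OF F] by blast
  have "\<forall>i. \<exists>B. \<forall>w. \<bar>F1 i w\<bar> \<le> B" using C1b_bounded1[OF F] by blast
  then obtain B1 where B1: "\<And>i w. \<bar>F1 i w\<bar> \<le> B1 i" by metis
  show ?thesis
  proof (rule C1bI[where B=B and C=B1])
    show "F (\<lambda>i. w i + c i) = F (\<lambda>i. w' i + c i)" if "\<And>i. i \<in> N \<Longrightarrow> w i = w' i" for w w'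
      using that by (intro C1b_local[OF F]) auto
    show "((\<lambda>t. F (\<lambda>j. (w(i := t)) j + c j)) has_real_derivative F1 i (\<lambda>i. w i + c i)) (at (w i))" for i w
    proof -
      have eq: "(\<lambda>j. (w(i := t)) j + c j) = (\<lambda>i. w i + c i)(i := t + c i)" for t by auto
      have "((\<lambda>t. F ((\<lambda>i. w i + c i)(i := t + c i))) has_real_derivative F1 i (\<lambda>i. w i + c i) * 1) (at (w i))"
      proof (rule DERIV_chain2[where g="\<lambda>t. t + c i"])
        show "((\<lambda>t. F ((\<lambda>i. w i + c i)(i := t))) has_real_derivative F1 i (\<lambda>i. w i + c i)) (at (w i + c i))"
          by (rule C1b_deriv[OF F, of "\<lambda>i. w i + c i" i])
      qed (auto intro!: derivative_eq_intros)
      then show ?thesis unfolding eq by simp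
    qed
    show "continuous_on UNIV (\<lambda>w. F (\<lambda>i. w i + c i))"
      by (rule continuous_on_compose2[OF C1b_cont[OF F] continuous_on_fun_shift]) auto
    show "continuous_on UNIV (\<lambda>w. F1 i (\<lambda>i. w i + c i))" for i
      by (rule continuous_on_compose2[OF C1b_cont1[OF F] continuous_on_fun_shift]) auto
  qed (use B B1 in auto)
qed

lemma continuous_on_UNIV_sequentiallyI:
  fixes f :: "'a::{first_countable_topology,t2_space} \<Rightarrow> 'b::topological_space"
  assumes "\<And>u a. u \<longlonglongrightarrow> a \<Longrightarrow> (\<lambda>n. f (u n)) \<longlonglongrightarrow> f a"
  shows "continuous_on UNIV f"
  using assms by (intro continuous_on_sequentiallyI) auto

lemma borel_fun_measurableI:
  fixes f :: "'a \<Rightarrow> 'i::countable \<Rightarrow> real"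
  assumes "\<And>i. (\<lambda>x. f x i) \<in> borel_measurable M"
  shows "f \<in> borel_measurable M"
  using assms by (rule measurable_coordinatewise_then_product)

text \<open>Links the product sigma-algebra over \<open>N\<close> with the Borel sets of all
  functions: coordinates outside \<open>N\<close> are the constant \<open>undefined\<close>, and
  countability of the index type reduces the claim to single coordinates.\<close>

lemma measurable_PiM_borel:
  fixes M :: "'i::countable \<Rightarrow> real measure"
  assumes "\<And>i. sets (M i) = sets borel"
  shows "(\<lambda>w. w) \<in> borel_measurable (PiM N M)"
proof (rule borel_fun_measurableI)
  fix i
  show "(\<lambda>w. w i) \<in> borel_measurable (PiM N M)"
  proof (cases "i \<in> N")
    case True
    then show ?thesis using measurable_component_singleton[OF True, of M] measurable_cong_sets[OF refl assms] by blast
  next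
    case False
    then have "w \<in> space (PiM N M) \<Longrightarrow> w i = undefined" for w by (auto simp: space_PiM PiE_iff extensional_def)
    then show ?thesis by (subst measurable_cong[where g="\<lambda>_. undefined"]) auto
  qed
qed

lemma integrable_boundedI:
  fixes f :: "'a \<Rightarrow> real"
  assumes "finite_measure M" "f \<in> borel_measurable M" "\<And>x. x \<in> space M \<Longrightarrow> \<bar>f x\<bar> \<le> B"
  shows "integrable M f"
  using assms by (intro finite_measure.integrable_const_bound[where B=B]) (auto intro!: AE_I2)

section \<open>The smeared field and its density\<close>

locale noisy = prob_space M for M :: "'w measure" +
  fixes N :: "'i::countable set" and X :: "'w \<Rightarrow> 'i \<Rightarrow> real" and e :: real
  assumes fin: "finite N" and X_meas [measurable]: "\<And>i. i \<in> N \<Longrightarrow> (\<lambda>\<omega>. X \<omega> i) \<in> borel_measurable M"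
    and e_pos: "e > 0"
begin

definition Q :: "('i \<Rightarrow> real) measure" where "Q = PiM N (\<lambda>_. noise)"
definition P :: "('w \<times> ('i \<Rightarrow> real)) measure" where "P = M \<Otimes>\<^sub>M Q"
definition L :: "('i \<Rightarrow> real) measure" where "L = PiM N (\<lambda>_. lborel)"
definition W :: "'w \<times> ('i \<Rightarrow> real) \<Rightarrow> 'i \<Rightarrow> real" where
  "W p = (\<lambda>i\<in>N. X (fst p) i + e * snd p i)"
definition k :: "real \<Rightarrow> real" where "k t = kern (t / e) / (e * kern_mass)"
definition k1 :: "real \<Rightarrow> real" where "k1 t = kern1 (t / e) / (e\<^sup>2 * kern_mass)"
definition k2 :: "real \<Rightarrow> real" where "k2 t = kern2 (t / e) / (e ^ 3 * kern_mass)"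
text \<open>With \<open>k\<close> in every factor this is the density of the smeared field. One
  kernel per coordinate is allowed because differentiation in \<open>w i\<close> just replaces the
  factor \<open>\<kappa> i\<close> by its derivative.\<close>

definition avg :: "('i \<Rightarrow> real \<Rightarrow> real) \<Rightarrow> ('i \<Rightarrow> real) \<Rightarrow> real" where
  "avg \<kappa> w = (\<integral>\<omega>. (\<Prod>i\<in>N. \<kappa> i (w i - X \<omega> i)) \<partial>M)"
definition rho :: "('i \<Rightarrow> real) \<Rightarrow> real" where "rho = avg (\<lambda>_. k)"
definition rho1 :: "'i \<Rightarrow> ('i \<Rightarrow> real) \<Rightarrow> real" where
  "rho1 i w = (if i \<in> N then avg ((\<lambda>_. k)(i := k1)) w else 0)"
text \<open>The update at \<open>i\<close> comes last and overrides that at \<open>j\<close> when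
  \<open>i = j\<close>, so the diagonal gets one factor \<open>k2\<close> and the other entries two
  factors \<open>k1\<close>.\<close>

definition rho2 :: "'i \<Rightarrow> 'i \<Rightarrow> ('i \<Rightarrow> real) \<Rightarrow> real" where
  "rho2 j i w = (if i \<in> N \<and> j \<in> N then avg ((\<lambda>_. k)(j := k1, i := if i = j then k2 else k1)) w else 0)"

lemma k_pos: "k t > 0" using e_pos kern_mass_pos kern_pos by (simp add: k_def)

lemma k_deriv: "(k has_real_derivative k1 t) (at t)"
proof -
  have "((\<lambda>t. kern (t / e) / (e * kern_mass)) has_real_derivative kern1 (t / e) * (1 / e) / (e * kern_mass)) (at t)"
    by (intro DERIV_cdivide DERIV_chain2[OF kern_deriv] DERIV_ident)
  then show ?thesis by (simp add: k_def[abs_def] k1_def power2_eq_square mult_ac)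
qed

lemma k1_deriv: "(k1 has_real_derivative k2 t) (at t)"
proof -
  have "((\<lambda>t. kern1 (t / e) / (e\<^sup>2 * kern_mass)) has_real_derivative kern2 (t / e) * (1 / e) / (e\<^sup>2 * kern_mass)) (at t)"
    by (intro DERIV_cdivide DERIV_chain2[OF kern1_deriv] DERIV_ident)
  then show ?thesis by (simp add: k1_def[abs_def] k2_def power_numeral_reduce mult_ac)
qed

lemma k_cont: "continuous_on UNIV k" "continuous_on UNIV k1" "continuous_on UNIV k2"
  unfolding k_def[abs_def] k1_def[abs_def] k2_def[abs_def] using e_pos kern_mass_pos
  by (auto intro!: continuous_intros)

lemma k1_le: "\<bar>k1 t\<bar> \<le> 4 / e * k t"
proof -
  have "\<bar>k1 t\<bar> = \<bar>kern1 (t / e)\<bar> / (e\<^sup>2 * kern_mass)" using kern_mass_pos by (simp add: k1_def abs_mult)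
  also have "\<dots> \<le> 4 * kern (t / e) / (e\<^sup>2 * kern_mass)"
    using kern_mass_pos by (intro divide_right_mono kern1_le) auto
  also have "\<dots> = 4 / e * k t" by (simp add: k_def power2_eq_square)
  finally show ?thesis .
qed

lemma k2_le: "\<bar>k2 t\<bar> \<le> 28 / e\<^sup>2 * k t"
proof -
  have "\<bar>k2 t\<bar> = \<bar>kern2 (t / e)\<bar> / (e ^ 3 * kern_mass)" using kern_mass_pos e_pos by (simp add: k2_def abs_mult)
  also have "\<dots> \<le> 28 * kern (t / e) / (e ^ 3 * kern_mass)"
    using kern_mass_pos e_pos by (intro divide_right_mono kern2_le) auto
  also have "\<dots> = 28 / e\<^sup>2 * k t" by (simp add: k_def power_numeral_reduce mult_ac)
  finally show ?thesis .
qed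

text \<open>One bound for the three kernels: \<open>1 / (e * kern_mass)\<close> bounds
  \<open>k\<close>, and the other two summands carry the factors of \<open>k1_le\<close> and
  \<open>k2_le\<close>.\<close>

definition kb :: real where "kb = (1 + 4 / e + 28 / e\<^sup>2) / (e * kern_mass)"

lemma k_le_kb: "\<bar>k t\<bar> \<le> kb" "\<bar>k1 t\<bar> \<le> kb" "\<bar>k2 t\<bar> \<le> kb"
proof -
  have kt: "k t \<le> 1 / (e * kern_mass)" unfolding k_def
    using kern_le_1 e_pos kern_mass_pos by (intro divide_right_mono) auto
  have k0: "0 \<le> k t" using k_pos[of t] by simp
  have c: "1 / (e * kern_mass) \<le> kb" "4 / e * (1 / (e * kern_mass)) \<le> kb" "28 / e\<^sup>2 * (1 / (e * kern_mass)) \<le> kb"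
    unfolding kb_def add_divide_distrib using e_pos kern_mass_pos by (simp_all add: add_nonneg_nonneg)
  show "\<bar>k t\<bar> \<le> kb" using kt k0 c(1) by linarith
  have "4 / e * k t \<le> 4 / e * (1 / (e * kern_mass))" using kt e_pos by (intro mult_left_mono) auto
  then show "\<bar>k1 t\<bar> \<le> kb" using k1_le[of t] c(2) by linarith
  have "28 / e\<^sup>2 * k t \<le> 28 / e\<^sup>2 * (1 / (e * kern_mass))" using kt e_pos by (intro mult_left_mono) auto
  then show "\<bar>k2 t\<bar> \<le> kb" using k2_le[of t] c(3) by linarith
qed

lemma k_measurable [measurable]: "k \<in> borel_measurable borel" "k1 \<in> borel_measurable borel" "k2 \<in> borel_measurable borel"
  using k_cont by (auto intro!: borel_measurable_continuous_onI)

lemma Q_prob: "prob_space Q"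
  unfolding Q_def by (intro prob_space_PiM prob_space_noise)

lemma P_prob: "prob_space P"
  unfolding P_def using Q_prob by (intro prob_space_pair) (simp add: prob_space_axioms)

sublocale Q: prob_space Q by (rule Q_prob)
sublocale P: prob_space P by (rule P_prob)

lemma L_sf: "sigma_finite_measure L"
  unfolding L_def by (intro product_sigma_finite.sigma_finite fin) (unfold_locales)

sublocale L: sigma_finite_measure L by (rule L_sf)
sublocale pairQ: pair_sigma_finite M Q by unfold_locales
sublocale pairL: pair_sigma_finite M L by unfold_locales

lemma Q_id: "(\<lambda>z. z) \<in> borel_measurable Q" and L_id: "(\<lambda>z. z) \<in> borel_measurable L"
  unfolding Q_def L_def by (auto intro!: measurable_PiM_borel)

lemma Q_component: "(\<lambda>z. z i) \<in> borel_measurable Q"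
  by (rule measurable_product_then_coordinatewise[OF Q_id])
lemma L_component: "(\<lambda>z. z i) \<in> borel_measurable L"
  by (rule measurable_product_then_coordinatewise[OF L_id])

lemma fst_meas [measurable]: "fst \<in> measurable P M" and snd_meas [measurable]: "snd \<in> measurable P Q"
  unfolding P_def by auto

lemma W_measL: "W \<in> measurable P L"
proof -
  note Q_component [measurable]
  have "(\<lambda>p. X (fst p) i + e * snd p i) \<in> borel_measurable P" if [measurable]: "i \<in> N" for i
    by measurable
  then show ?thesis unfolding W_def[abs_def] L_def by (auto intro!: measurable_restrict)
qed

lemma W_meas [measurable]: "W \<in> borel_measurable P"
  by (rule measurable_compose[OF W_measL L_id])

lemma X_meas': "(\<lambda>\<omega>. \<lambda>i\<in>N. X \<omega> i) \<in> borel_measurable M"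
  by (rule measurable_compose[OF measurable_restrict[where M="\<lambda>_. borel"] measurable_PiM_borel]) auto

lemma kernel_meas: "(\<lambda>p. \<Prod>i\<in>N. k (snd p i - X (fst p) i)) \<in> borel_measurable (M \<Otimes>\<^sub>M L)"
proof (rule borel_measurable_prod)
  note L_component [measurable]
  fix i assume [measurable]: "i \<in> N"
  show "(\<lambda>p. k (snd p i - X (fst p) i)) \<in> borel_measurable (M \<Otimes>\<^sub>M L)" by measurable
qed

text \<open>For a fixed field the smeared coordinates are independent, each an affine image of the
  noise.\<close>

lemma distr_Q: 
  "distr Q L (\<lambda>z. \<lambda>i\<in>N. x i + e * z i) = density L (\<lambda>w. ennreal (\<Prod>i\<in>N. k (w i - x i)))"
proof -
  define D where "D i = density lborel (\<lambda>t. ennreal (k (t - x i)))" for i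
  have D: "D i = distr noise lborel (\<lambda>t. x i + e * t)" for i
    unfolding D_def k_def using emeasure_density_affine_kern[OF e_pos, of "x i"] by simp
  have pD: "prob_space (D i)" for i
    unfolding D by (rule prob_space.prob_space_distr[OF prob_space_noise]) measurable
  have psD: "product_sigma_finite D" by (simp add: product_sigma_finite_def pD prob_space_imp_sigma_finite)
  have psn: "product_sigma_finite (\<lambda>_::'i. noise)"
    by (simp add: product_sigma_finite_def prob_space_noise prob_space_imp_sigma_finite)
  have psl: "product_sigma_finite (\<lambda>_::'i. lborel :: real measure)" by unfold_locales
  have sD: "sets (D i) = sets borel" for i by (simp add: D_def)
  have "distr Q L (\<lambda>z. \<lambda>i\<in>N. x i + e * z i) = distr (PiM N (\<lambda>_. noise)) (PiM N D) (\<lambda>z. \<lambda>i\<in>N. x i + e * z i)"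
    unfolding Q_def L_def by (intro distr_cong sets_PiM_cong) (auto simp: sD)
  also have "\<dots> = PiM N D"
  proof (rule distr_PiM_map[OF psn psD fin])
    fix i
    show "(\<lambda>t. x i + e * t) \<in> measurable noise (D i)"
      
    proof -
      have "(\<lambda>t. x i + e * t) \<in> borel_measurable borel" by measurable
      then show ?thesis using measurable_cong_sets[OF sets_noise sD[of i]] by blast
    qed
    have "distr noise (D i) (\<lambda>t. x i + e * t) = distr noise lborel (\<lambda>t. x i + e * t)"
      by (rule distr_cong) (auto simp: sD)
    also have "\<dots> = D i" by (rule D[symmetric])
    finally show "distr noise (D i) (\<lambda>t. x i + e * t) = D i" .
  qed
  also have "\<dots> = density L (\<lambda>w. \<Prod>i\<in>N. ennreal (k (w i - x i)))"
    unfolding L_def D_def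
    by (rule density_PiM[symmetric, OF psl _ fin]) (use psD in \<open>auto simp: D_def[abs_def]\<close>)
  also have "\<dots> = density L (\<lambda>w. ennreal (\<Prod>i\<in>N. k (w i - x i)))"
    using k_pos by (simp add: prod_ennreal less_imp_le)
  finally show ?thesis .
qed

text \<open>Keeping the sample point next to \<open>W\<close> allows the noise to be recovered as
  \<open>(W - X) / e\<close>, on which \<open>expect_score\<close> relies.\<close>

lemma distr_P:
  "distr P (M \<Otimes>\<^sub>M L) (\<lambda>p. (fst p, W p)) = density (M \<Otimes>\<^sub>M L) (\<lambda>p. ennreal (\<Prod>i\<in>N. k (snd p i - X (fst p) i)))"
proof (rule measure_eqI)
  note W_measL [measurable] kernel_meas [measurable] L_component [measurable] Q_component [measurable]
  fix A assume "A \<in> sets (distr P (M \<Otimes>\<^sub>M L) (\<lambda>p. (fst p, W p)))"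
  then have A [measurable]: "A \<in> sets (M \<Otimes>\<^sub>M L)" by simp
  have "emeasure (distr P (M \<Otimes>\<^sub>M L) (\<lambda>p. (fst p, W p))) A = (\<integral>\<^sup>+p. indicator A p \<partial>distr P (M \<Otimes>\<^sub>M L) (\<lambda>p. (fst p, W p)))"
    by simp
  also have "\<dots> = (\<integral>\<^sup>+p. indicator A (fst p, W p) \<partial>P)"
    by (subst nn_integral_distr) auto
  also have "\<dots> = (\<integral>\<^sup>+\<omega>. \<integral>\<^sup>+z. indicator A (\<omega>, W (\<omega>, z)) \<partial>Q \<partial>M)"
    unfolding P_def by (subst Q.nn_integral_fst[symmetric]) (auto simp flip: P_def)
  also have "\<dots> = (\<integral>\<^sup>+\<omega>. \<integral>\<^sup>+w. ennreal (\<Prod>i\<in>N. k (w i - X \<omega> i)) * indicator A (\<omega>, w) \<partial>L \<partial>M)"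
  proof (intro nn_integral_cong)
    fix \<omega> assume [measurable]: "\<omega> \<in> space M"
    have m: "(\<lambda>z. \<lambda>i\<in>N. X \<omega> i + e * z i) \<in> measurable Q L"
      unfolding L_def by (intro measurable_restrict) measurable
    have km: "(\<lambda>w. \<Prod>i\<in>N. k (w i - X \<omega> i)) \<in> borel_measurable L"
      by (intro borel_measurable_prod) measurable
    have "(\<integral>\<^sup>+z. indicator A (\<omega>, W (\<omega>, z)) \<partial>Q) = (\<integral>\<^sup>+w. indicator A (\<omega>, w) \<partial>distr Q L (\<lambda>z. \<lambda>i\<in>N. X \<omega> i + e * z i))"
      by (subst nn_integral_distr[OF m]) (auto simp: W_def)
    also have "\<dots> = (\<integral>\<^sup>+w. ennreal (\<Prod>i\<in>N. k (w i - X \<omega> i)) * indicator A (\<omega>, w) \<partial>L)"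
      unfolding distr_Q using km by (subst nn_integral_density) auto
    finally show "(\<integral>\<^sup>+z. indicator A (\<omega>, W (\<omega>, z)) \<partial>Q) = \<dots>" .
  qed
  also have "\<dots> = (\<integral>\<^sup>+p. ennreal (\<Prod>i\<in>N. k (snd p i - X (fst p) i)) * indicator A p \<partial>(M \<Otimes>\<^sub>M L))"
    by (subst L.nn_integral_fst[symmetric]) auto
  also have "\<dots> = emeasure (density (M \<Otimes>\<^sub>M L) (\<lambda>p. ennreal (\<Prod>i\<in>N. k (snd p i - X (fst p) i)))) A"
    by (subst emeasure_density) auto
  finally show "emeasure (distr P (M \<Otimes>\<^sub>M L) (\<lambda>p. (fst p, W p))) A = \<dots>" .
qed simp

lemma expect_W:
  assumes f: "f \<in> borel_measurable (M \<Otimes>\<^sub>M L)" and bd: "\<And>p. \<bar>f p\<bar> \<le> (B::real)"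
  shows "(\<integral>p. f (fst p, W p) \<partial>P) = (\<integral>w. \<integral>\<omega>. f (\<omega>, w) * (\<Prod>i\<in>N. k (w i - X \<omega> i)) \<partial>M \<partial>L)"
proof -
  note W_measL [measurable]
  let ?K = "\<lambda>p. \<Prod>i\<in>N. k (snd p i - X (fst p) i)"
  have K0: "?K p \<ge> 0" for p using k_pos by (intro prod_nonneg) (auto simp: less_imp_le)
  have "integrable (distr P (M \<Otimes>\<^sub>M L) (\<lambda>p. (fst p, W p))) f"
    using f bd by (intro integrable_boundedI[where B=B] prob_space.finite_measure P.prob_space_distr) auto
  then have "integrable (M \<Otimes>\<^sub>M L) (\<lambda>p. ?K p * f p)"
    unfolding distr_P using f K0 kernel_meas by (subst (asm) integrable_density) auto
  then have i: "integrable (M \<Otimes>\<^sub>M L) (\<lambda>(\<omega>, w). f (\<omega>, w) * (\<Prod>i\<in>N. k (w i - X \<omega> i)))"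
    by (simp add: case_prod_beta' mult.commute)
  have "(\<integral>p. f (fst p, W p) \<partial>P) = (\<integral>p. f p \<partial>distr P (M \<Otimes>\<^sub>M L) (\<lambda>p. (fst p, W p)))"
    by (rule integral_distr[symmetric]) (use f in auto)
  also have "\<dots> = (\<integral>p. ?K p * f p \<partial>(M \<Otimes>\<^sub>M L))"
    unfolding distr_P using f K0 kernel_meas by (subst integral_density) auto
  also have "\<dots> = (\<integral>(\<omega>, w). f (\<omega>, w) * (\<Prod>i\<in>N. k (w i - X \<omega> i)) \<partial>(M \<Otimes>\<^sub>M L))"
    by (simp add: case_prod_beta' mult.commute)
  also have "\<dots> = (\<integral>w. \<integral>\<omega>. f (\<omega>, w) * (\<Prod>i\<in>N. k (w i - X \<omega> i)) \<partial>M \<partial>L)"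
    by (rule pairL.integral_snd[symmetric, OF i])
  finally show ?thesis .
qed

end

section \<open>Integration by parts against the noise, and the score\<close>

lemma tendsto_coordinateD:
  fixes x :: "'a \<Rightarrow> 'i \<Rightarrow> 'b::topological_space"
  assumes "(x \<longlongrightarrow> l) F"
  shows "((\<lambda>n. x n i) \<longlongrightarrow> l i) F"
  by (rule continuous_on_tendsto_compose[OF continuous_on_product_coordinates[of i] assms]) auto

text \<open>The bounded quotient \<open>kern1 / kern\<close> is the score of the noise. The boundary
  terms vanish because \<open>g\<close> is bounded and the kernel tends to zero.\<close>

lemma ibp_kern:
  fixes g g' :: "real \<Rightarrow> real"
  assumes e: "e > 0" and d: "\<And>t. (g has_real_derivative g' t) (at t)" and c: "continuous_on UNIV g'"
    and b: "\<And>t. \<bar>g t\<bar> \<le> B" and b': "\<And>t. \<bar>g' t\<bar> \<le> B'"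
  shows "(\<integral>t. e * g' (x + e * t) \<partial>noise) = - (\<integral>t. g (x + e * t) * (kern1 t / kern t) \<partial>noise)"
proof -
  have cg: "continuous_on UNIV g" using d by (meson DERIV_continuous_on has_field_derivative_at_within)
  have [measurable]: "g \<in> borel_measurable borel" "g' \<in> borel_measurable borel"
    using cg c by (auto intro: borel_measurable_continuous_onI)
  have B0: "0 \<le> B" "0 \<le> B'" using b[of 0] b'[of 0] by linarith+
  define u where "u t = e * g' (x + e * t) * kern t + g (x + e * t) * kern1 t" for t
  have i1: "integrable lborel (\<lambda>t. e * g' (x + e * t) * kern t)"
  proof (rule Bochner_Integration.integrable_bound[OF integrable_mult_right[OF integrable_kern, of "e * B'"]])
    show "AE t in lborel. norm (e * g' (x + e * t) * kern t) \<le> norm (e * B' * kern t)"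
      using e b' kern_pos B0 by (intro AE_I2) (auto simp: abs_mult less_imp_le intro!: mult_mono)
  qed auto
  have i2: "integrable lborel (\<lambda>t. g (x + e * t) * kern1 t)"
  proof (rule Bochner_Integration.integrable_bound[OF integrable_mult_right[OF integrable_kern, of "4 * B"]])
    show "AE t in lborel. norm (g (x + e * t) * kern1 t) \<le> norm (4 * B * kern t)"
    proof (rule AE_I2)
      fix t
      have "\<bar>g (x + e * t)\<bar> * \<bar>kern1 t\<bar> \<le> B * (4 * kern t)"
        using b kern1_le B0 by (intro mult_mono) auto
      then show "norm (g (x + e * t) * kern1 t) \<le> norm (4 * B * kern t)"
        using B0 kern_pos[of t] by (simp add: abs_mult)
    qed
  qed auto
  have iu: "integrable lborel u" unfolding u_def by (rule Bochner_Integration.integrable_add[OF i1 i2])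
  define U where "U t = g (x + e * t) * kern t" for t
  have dU: "(U has_real_derivative u t) (at t)" for t
    unfolding U_def u_def
    by (rule derivative_eq_intros refl kern_deriv DERIV_chain2[OF d] | simp)+
  have lim: "(U \<longlongrightarrow> 0) at_top" "(U \<longlongrightarrow> 0) at_bot"
  proof -
    have bd: "norm (U t) \<le> B * cauchy t" for t
      unfolding U_def using b kern_le_cauchy kern_pos[of t] B0 by (auto simp: abs_mult intro!: mult_mono)
    have q: "\<bar>t\<bar> \<le> 1 + t\<^sup>2" for t :: real
      using cauchy_abs[of t] by (simp add: cauchy_def field_simps)
    have f1: "filterlim (\<lambda>t::real. 1 + t\<^sup>2) at_top at_top"
      by (rule filterlim_at_top_mono[OF filterlim_ident always_eventually]) (use q abs_ge_self order_trans in blast)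
    have f2: "filterlim (\<lambda>t::real. 1 + t\<^sup>2) at_top at_bot"
      by (rule filterlim_at_top_mono[OF filterlim_uminus_at_top_at_bot always_eventually]) (use q abs_ge_minus_self order_trans in blast)
    have "((\<lambda>t. B * cauchy t) \<longlongrightarrow> B * 0) at_top" "((\<lambda>t. B * cauchy t) \<longlongrightarrow> B * 0) at_bot"
      unfolding cauchy_def
      by (rule tendsto_mult[OF tendsto_const tendsto_inverse_0_at_top[OF f1]],
          rule tendsto_mult[OF tendsto_const tendsto_inverse_0_at_top[OF f2]])
    then show "(U \<longlongrightarrow> 0) at_top" "(U \<longlongrightarrow> 0) at_bot"
      using bd by (auto intro!: Lim_null_comparison[where g="\<lambda>t. B * cauchy t"] always_eventually)
  qed
  have "(LBINT t=-\<infinity>..\<infinity>. u t) = 0 - 0"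
  proof (rule interval_integral_FTC_integrable[where F=U])
    show "(U has_vector_derivative u t) (at t)" for t
      using dU by (simp add: has_real_derivative_iff_has_vector_derivative)
    show "isCont u t" for t
    proof -
      have "continuous_on UNIV u" unfolding u_def
        by (intro continuous_intros continuous_on_compose2[OF c] continuous_on_compose2[OF cg]) auto
      then show ?thesis by (simp add: continuous_on_eq_continuous_at)
    qed
    show "set_integrable lborel (einterval (- \<infinity>) \<infinity>) u" using iu by (simp add: set_integrable_def)
    show "((U \<circ> real_of_ereal) \<longlongrightarrow> 0) (at_right (- \<infinity>))" "((U \<circ> real_of_ereal) \<longlongrightarrow> 0) (at_left \<infinity>)"
      using lim by (auto simp: ereal_tendsto_simps)
  qed auto
  then have "(\<integral>t. u t \<partial>lborel) = 0"
    by (simp add: interval_lebesgue_integral_def set_lebesgue_integral_def)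
  then have s: "(\<integral>t. e * g' (x + e * t) * kern t \<partial>lborel) = - (\<integral>t. g (x + e * t) * kern1 t \<partial>lborel)"
    unfolding u_def by (subst (asm) Bochner_Integration.integral_add[OF i1 i2]) linarith
  have "(\<integral>t. e * g' (x + e * t) \<partial>noise) = (\<integral>t. (e * g' (x + e * t) * kern t) / kern_mass \<partial>lborel)"
    unfolding noise_def using kern_pos kern_mass_pos
    by (subst integral_density) (auto simp: less_imp_le intro!: Bochner_Integration.integral_cong)
  also have "\<dots> = - ((\<integral>t. g (x + e * t) * kern1 t \<partial>lborel) / kern_mass)"
    by (simp only: integral_divide_zero s minus_divide_left)
  also have "\<dots> = - (\<integral>t. (kern t / kern_mass) * (g (x + e * t) * (kern1 t / kern t)) \<partial>lborel)"
    using kern_pos by (subst integral_divide_zero[symmetric]) (auto intro!: Bochner_Integration.integral_cong simp: less_imp_neq[symmetric])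
  also have "\<dots> = - (\<integral>t. g (x + e * t) * (kern1 t / kern t) \<partial>noise)"
    unfolding noise_def using kern_pos kern_mass_pos
    by (subst integral_density) (auto simp: less_imp_le)
  finally show ?thesis .
qed

context noisy begin

lemma prod_bound:
  fixes f :: "'i \<Rightarrow> real"
  assumes "\<And>i. i \<in> N \<Longrightarrow> \<bar>f i\<bar> \<le> B"
  shows "\<bar>\<Prod>i\<in>N. f i\<bar> \<le> B ^ card N"
proof -
  have "\<bar>\<Prod>i\<in>N. f i\<bar> = (\<Prod>i\<in>N. \<bar>f i\<bar>)" by (rule abs_prod)
  also have "\<dots> \<le> (\<Prod>i\<in>N. B)" using assms by (intro prod_mono) auto
  finally show ?thesis by simp
qed

lemma avg_measurable:
  fixes \<kappa> :: "'i \<Rightarrow> real \<Rightarrow> real"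
  assumes "\<And>i. i \<in> N \<Longrightarrow> continuous_on UNIV (\<kappa> i)"
  shows "(\<lambda>\<omega>. \<Prod>i\<in>N. \<kappa> i (w i - X \<omega> i)) \<in> borel_measurable M"
proof (rule borel_measurable_prod)
  fix i assume i [measurable]: "i \<in> N"
  have [measurable]: "\<kappa> i \<in> borel_measurable borel" using assms[OF i] by (rule borel_measurable_continuous_onI)
  show "(\<lambda>\<omega>. \<kappa> i (w i - X \<omega> i)) \<in> borel_measurable M" by measurable
qed

lemma avg_integrable:
  fixes \<kappa> :: "'i \<Rightarrow> real \<Rightarrow> real"
  assumes "\<And>i. i \<in> N \<Longrightarrow> continuous_on UNIV (\<kappa> i)" "\<And>i t. i \<in> N \<Longrightarrow> \<bar>\<kappa> i t\<bar> \<le> B"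
  shows "integrable M (\<lambda>\<omega>. \<Prod>i\<in>N. \<kappa> i (w i - X \<omega> i))"
  using assms by (intro integrable_boundedI[where B="B ^ card N"] avg_measurable prod_bound finite_measure_axioms) auto

lemma avg_bounded:
  fixes \<kappa> :: "'i \<Rightarrow> real \<Rightarrow> real"
  assumes "\<And>i. i \<in> N \<Longrightarrow> continuous_on UNIV (\<kappa> i)" "\<And>i t. i \<in> N \<Longrightarrow> \<bar>\<kappa> i t\<bar> \<le> B"
  shows "\<bar>avg \<kappa> w\<bar> \<le> B ^ card N"
proof -
  have "\<bar>avg \<kappa> w\<bar> \<le> (\<integral>\<omega>. \<bar>\<Prod>i\<in>N. \<kappa> i (w i - X \<omega> i)\<bar> \<partial>M)" unfolding avg_def by (rule integral_abs_bound)
  also have "\<dots> \<le> (\<integral>\<omega>. B ^ card N \<partial>M)"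
    using assms by (intro integral_mono integrable_abs avg_integrable[where B=B] prod_bound) auto
  finally show ?thesis by (simp add: prob_space)
qed

lemma avg_cont:
  fixes \<kappa> :: "'i \<Rightarrow> real \<Rightarrow> real"
  assumes c: "\<And>i. i \<in> N \<Longrightarrow> continuous_on UNIV (\<kappa> i)" and b: "\<And>i t. i \<in> N \<Longrightarrow> \<bar>\<kappa> i t\<bar> \<le> B"
  shows "continuous_on UNIV (avg \<kappa>)"
proof (rule continuous_on_UNIV_sequentiallyI)
  fix u :: "nat \<Rightarrow> 'i \<Rightarrow> real" and a assume u: "u \<longlonglongrightarrow> a"
  show "(\<lambda>n. avg \<kappa> (u n)) \<longlonglongrightarrow> avg \<kappa> a"
    unfolding avg_def
  proof (rule integral_dominated_convergence[where w="\<lambda>_. B ^ card N"])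
    show "AE \<omega> in M. (\<lambda>n. \<Prod>i\<in>N. \<kappa> i (u n i - X \<omega> i)) \<longlonglongrightarrow> (\<Prod>i\<in>N. \<kappa> i (a i - X \<omega> i))"
    proof (intro AE_I2 tendsto_prod)
      fix \<omega> i assume "i \<in> N"
      then show "(\<lambda>n. \<kappa> i (u n i - X \<omega> i)) \<longlonglongrightarrow> \<kappa> i (a i - X \<omega> i)"
        by (intro continuous_on_tendsto_compose[OF c] tendsto_diff tendsto_const tendsto_coordinateD[OF u]) auto
    qed
    show "AE \<omega> in M. norm (\<Prod>i\<in>N. \<kappa> i (u n i - X \<omega> i)) \<le> B ^ card N" for n
      using b by (intro AE_I2) (auto intro!: prod_bound)
  qed (use c avg_measurable in auto)
qed

lemma avg_deriv:
  fixes \<kappa> :: "'i \<Rightarrow> real \<Rightarrow> real"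
  assumes c: "\<And>i. i \<in> N \<Longrightarrow> continuous_on UNIV (\<kappa> i)" and b: "\<And>i t. i \<in> N \<Longrightarrow> \<bar>\<kappa> i t\<bar> \<le> B"
    and j: "j \<in> N" and d: "\<And>t. (\<kappa> j has_real_derivative \<kappa>' t) (at t)"
    and c': "continuous_on UNIV \<kappa>'" and b': "\<And>t. \<bar>\<kappa>' t\<bar> \<le> B"
  shows "((\<lambda>t. avg \<kappa> (w(j := t))) has_real_derivative avg (\<kappa>(j := \<kappa>')) w) (at (w j))"
proof -
  let ?f = "\<lambda>s \<omega>. \<Prod>i\<in>N. \<kappa> i ((w(j := s)) i - X \<omega> i)"
  let ?f' = "\<lambda>s \<omega>. \<Prod>i\<in>N. (\<kappa>(j := \<kappa>')) i ((w(j := s)) i - X \<omega> i)"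
  have "((\<lambda>s. \<integral>\<omega>. ?f s \<omega> \<partial>M) has_real_derivative (\<integral>\<omega>. ?f' (w j) \<omega> \<partial>M)) (at (w j))"
  proof (rule has_real_derivative_integral[where r=1 and g="\<lambda>_. B ^ card N"])
    fix s \<omega>
    have eq: "?f s \<omega> = \<kappa> j (s - X \<omega> j) * (\<Prod>i\<in>N - {j}. \<kappa> i (w i - X \<omega> i))" for s
      using fin j by (subst prod.remove[OF fin j]) (auto intro!: prod.cong)
    have eq': "?f' s \<omega> = \<kappa>' (s - X \<omega> j) * (\<Prod>i\<in>N - {j}. \<kappa> i (w i - X \<omega> i))"
      using fin j by (subst prod.remove[OF fin j]) (auto intro!: prod.cong)
    have "((\<lambda>s. \<kappa> j (s - X \<omega> j)) has_real_derivative \<kappa>' (s - X \<omega> j) * 1) (at s)"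
      by (rule DERIV_chain2[OF d]) (auto intro!: derivative_eq_intros)
    then show "((\<lambda>s. ?f s \<omega>) has_real_derivative ?f' s \<omega>) (at s)"
      unfolding eq eq' using DERIV_cmult_right by fastforce
    show "\<bar>?f' s \<omega>\<bar> \<le> B ^ card N" using b b' by (intro prod_bound) auto
  next
    show "integrable M (?f s)" for s
      by (rule avg_integrable[OF c b])
    show "?f' (w j) \<in> borel_measurable M" using c c' by (intro avg_measurable) auto
  qed auto
  then show ?thesis unfolding avg_def by simp
qed

lemma avg_C1b:
  fixes \<kappa> :: "'i \<Rightarrow> real \<Rightarrow> real"
  assumes c: "\<And>i. i \<in> N \<Longrightarrow> continuous_on UNIV (\<kappa> i)" and b: "\<And>i t. i \<in> N \<Longrightarrow> \<bar>\<kappa> i t\<bar> \<le> B"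
    and d: "\<And>i t. i \<in> N \<Longrightarrow> (\<kappa> i has_real_derivative \<kappa>' i t) (at t)"
    and c': "\<And>i. i \<in> N \<Longrightarrow> continuous_on UNIV (\<kappa>' i)" and b': "\<And>i t. i \<in> N \<Longrightarrow> \<bar>\<kappa>' i t\<bar> \<le> B"
  shows "C1b N (avg \<kappa>) (\<lambda>i w. if i \<in> N then avg (\<kappa>(i := \<kappa>' i)) w else 0)"
proof (rule C1bI[where B="B ^ card N" and C="\<lambda>_. \<bar>B ^ card N\<bar>"])
  show loc: "avg \<kappa> w = avg \<kappa> w'" if "\<And>i. i \<in> N \<Longrightarrow> w i = w' i" for w w'
    unfolding avg_def using that by (intro Bochner_Integration.integral_cong prod.cong) auto
  show "continuous_on UNIV (avg \<kappa>)" by (rule avg_cont[OF c b])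
  show "\<bar>avg \<kappa> w\<bar> \<le> B ^ card N" for w by (rule avg_bounded[OF c b])
  show "((\<lambda>t. avg \<kappa> (w(i := t))) has_real_derivative (if i \<in> N then avg (\<kappa>(i := \<kappa>' i)) w else 0)) (at (w i))" for i w
  proof (cases "i \<in> N")
    case True
    then show ?thesis using avg_deriv[OF c b True d c' b'] by simp
  next
    case False
    then have "(\<lambda>t. avg \<kappa> (w(i := t))) = (\<lambda>t. avg \<kappa> w)" by (intro ext loc) auto
    then show ?thesis using False by simp
  qed
  have ci: "i \<in> N \<Longrightarrow> l \<in> N \<Longrightarrow> continuous_on UNIV ((\<kappa>(i := \<kappa>' i)) l)" for i l using c c' by auto
  have bi: "i \<in> N \<Longrightarrow> l \<in> N \<Longrightarrow> \<bar>(\<kappa>(i := \<kappa>' i)) l t\<bar> \<le> B" for i l t using b b' by auto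
  show "continuous_on UNIV (\<lambda>w. if i \<in> N then avg (\<kappa>(i := \<kappa>' i)) w else 0)" for i
    using avg_cont[of "\<kappa>(i := \<kappa>' i)" B] ci[of i] bi[of i] by (cases "i \<in> N") auto
  show "\<bar>if i \<in> N then avg (\<kappa>(i := \<kappa>' i)) w else 0\<bar> \<le> \<bar>B ^ card N\<bar>" for i w
    using avg_bounded[of "\<kappa>(i := \<kappa>' i)" B w] ci[of i] bi[of i] by (cases "i \<in> N") force+
qed

lemma rho_C1b: "C1b N rho rho1"
  unfolding rho_def rho1_def[abs_def]
  by (rule avg_C1b[where B=kb]) (use k_cont k_le_kb k_deriv in auto)

lemma rho1_C1b: "C1b N (rho1 j) (rho2 j)"
proof (cases "j \<in> N")
  case True
  have "C1b N (avg ((\<lambda>_. k)(j := k1)))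
    (\<lambda>i w. if i \<in> N then avg (((\<lambda>_. k)(j := k1))(i := if i = j then k2 else k1)) w else 0)"
    by (rule avg_C1b[where B=kb]) (use k_cont k_le_kb k_deriv k1_deriv in auto)
  then show ?thesis using True unfolding rho1_def[abs_def] rho2_def[abs_def] by simp
next
  case False
  then show ?thesis using C1b_zero[of N] unfolding rho1_def[abs_def] rho2_def[abs_def] by simp
qed

lemma kprod_pos: "(\<Prod>i\<in>N. k (w i - X \<omega> i)) > 0"
  using k_pos by (intro prod_pos) auto

lemma kprod_integrable: "integrable M (\<lambda>\<omega>. \<Prod>i\<in>N. k (w i - X \<omega> i))"
  by (rule avg_integrable[where B=kb]) (use k_cont k_le_kb in auto)

lemma rho_pos: "rho w > 0"
proof -
  have "rho w \<noteq> 0"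
  proof
    assume "rho w = 0"
    then have "AE \<omega> in M. (\<Prod>i\<in>N. k (w i - X \<omega> i)) = 0"
      unfolding rho_def avg_def using kprod_integrable kprod_pos
      by (subst (asm) integral_nonneg_eq_0_iff_AE) (auto simp: less_imp_le)
    then have "AE \<omega> in M. False"
      by eventually_elim (use kprod_pos in \<open>auto simp: less_imp_neq[symmetric]\<close>)
    then show False by simp
  qed
  moreover have "rho w \<ge> 0" unfolding rho_def avg_def using kprod_pos by (auto simp: less_imp_le)
  ultimately show ?thesis by simp
qed

text \<open>The bound passes from the kernel to the mixture: a single factor is differentiated and
  the remaining ones are positive. It makes the score bounded, whatever the law of
  \<open>X\<close>.\<close>

lemma rho1_le: "\<bar>rho1 i w\<bar> \<le> 4 / e * rho w"
proof (cases "i \<in> N")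
  case True
  have "\<bar>rho1 i w\<bar> \<le> (\<integral>\<omega>. \<bar>\<Prod>l\<in>N. ((\<lambda>_. k)(i := k1)) l (w l - X \<omega> l)\<bar> \<partial>M)"
    using True unfolding rho1_def avg_def by (auto intro: integral_abs_bound)
  also have "\<dots> \<le> (\<integral>\<omega>. 4 / e * (\<Prod>l\<in>N. k (w l - X \<omega> l)) \<partial>M)"
  proof (intro integral_mono integrable_abs integrable_mult_right kprod_integrable)
    show "integrable M (\<lambda>\<omega>. \<Prod>l\<in>N. ((\<lambda>_. k)(i := k1)) l (w l - X \<omega> l))"
      by (rule avg_integrable[where B=kb]) (use k_cont k_le_kb in auto)
    fix \<omega>
    have p0: "0 \<le> (\<Prod>l\<in>N - {i}. k (w l - X \<omega> l))" using k_pos by (intro prod_nonneg) (auto simp: less_imp_le)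
    have "(\<Prod>l\<in>N. ((\<lambda>_. k)(i := k1)) l (w l - X \<omega> l)) = k1 (w i - X \<omega> i) * (\<Prod>l\<in>N - {i}. k (w l - X \<omega> l))"
      using fin True by (subst prod.remove[OF fin True]) (auto intro!: prod.cong)
    also have "\<bar>\<dots>\<bar> \<le> (4 / e * k (w i - X \<omega> i)) * (\<Prod>l\<in>N - {i}. k (w l - X \<omega> l))"
      using k1_le[of "w i - X \<omega> i"] p0 by (simp only: abs_mult abs_of_nonneg[OF p0]) (intro mult_right_mono)
    also have "\<dots> = 4 / e * (\<Prod>l\<in>N. k (w l - X \<omega> l))"
      by (subst prod.remove[OF fin True]) simp
    finally show "\<bar>\<Prod>l\<in>N. ((\<lambda>_. k)(i := k1)) l (w l - X \<omega> l)\<bar> \<le> \<dots>" .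
  qed
  also have "\<dots> = 4 / e * rho w" unfolding rho_def avg_def by simp
  finally show ?thesis .
next
  case False
  then show ?thesis using rho_pos[of w] e_pos by (simp add: rho1_def)
qed

definition score :: "'i \<Rightarrow> ('i \<Rightarrow> real) \<Rightarrow> real" where "score i w = rho1 i w / rho w"

lemma score_le: "\<bar>score i w\<bar> \<le> 4 / e"
  using rho1_le[of i w] rho_pos[of w] by (simp add: score_def field_simps)

lemma rho_meas [measurable]: "rho \<in> borel_measurable borel" "rho1 i \<in> borel_measurable borel"
  using C1b_cont[OF rho_C1b] C1b_cont1[OF rho_C1b] by (auto intro!: borel_measurable_continuous_onI)

lemma score_meas [measurable]: "score i \<in> borel_measurable borel"
  unfolding score_def[abs_def] by measurable

lemma kern_quot_le: "\<bar>kern1 t / kern t\<bar> \<le> 4"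
  using kern1_le[of t] kern_pos[of t] by (simp add: field_simps)

text \<open>Up to the factor \<open>e\<close>, the score at \<open>W\<close> is the conditional
  expectation of the noise score given \<open>W\<close>: multiplied by the joint density, the
  quotient turns one factor \<open>k\<close> into \<open>e * k1\<close>, and averaging over
  \<open>M\<close> leaves \<open>e * rho1 = e * score * rho\<close>.\<close>

lemma expect_score:
  assumes G [measurable]: "G \<in> borel_measurable borel" and bd: "\<And>w. \<bar>G w\<bar> \<le> B" and i: "i \<in> N"
  shows "(\<integral>p. G (W p) * (kern1 (snd p i) / kern (snd p i)) \<partial>P) = e * (\<integral>p. G (W p) * score i (W p) \<partial>P)"
proof -
  have B0: "0 \<le> B" using bd[of undefined] by linarith
  note [measurable] = i L_component L_id
  have Wi: "(W p i - X (fst p) i) / e = snd p i" for p using i e_pos by (simp add: W_def)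
  define f where "f p = G (snd p) * (kern1 ((snd p i - X (fst p) i) / e) / kern ((snd p i - X (fst p) i) / e))" for p
  have fm: "f \<in> borel_measurable (M \<Otimes>\<^sub>M L)" unfolding f_def by measurable
  have fb: "\<bar>f p\<bar> \<le> B * 4" for p unfolding f_def abs_mult using bd kern_quot_le B0 by (intro mult_mono) auto
  have "(\<integral>p. G (W p) * (kern1 (snd p i) / kern (snd p i)) \<partial>P) = (\<integral>p. f (fst p, W p) \<partial>P)"
    unfolding f_def by (simp add: Wi)
  also have "\<dots> = (\<integral>w. \<integral>\<omega>. f (\<omega>, w) * (\<Prod>i\<in>N. k (w i - X \<omega> i)) \<partial>M \<partial>L)"
    by (rule expect_W[OF fm fb])
  also have "\<dots> = (\<integral>w. \<integral>\<omega>. (e * G w * score i w) * (\<Prod>i\<in>N. k (w i - X \<omega> i)) \<partial>M \<partial>L)"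
  proof (rule Bochner_Integration.integral_cong[OF refl])
    fix w
    have q: "kern1 (t / e) / kern (t / e) * k t = e * k1 t" for t
      using e_pos kern_pos[of "t / e"] kern_mass_pos by (simp add: k_def k1_def power2_eq_square field_simps)
    have "f (\<omega>, w) * (\<Prod>i\<in>N. k (w i - X \<omega> i)) = e * G w * (\<Prod>l\<in>N. ((\<lambda>_. k)(i := k1)) l (w l - X \<omega> l))" for \<omega>
    proof -
      have "f (\<omega>, w) * (\<Prod>i\<in>N. k (w i - X \<omega> i)) = G w * (kern1 ((w i - X \<omega> i) / e) / kern ((w i - X \<omega> i) / e) * k (w i - X \<omega> i)) * (\<Prod>l\<in>N - {i}. k (w l - X \<omega> l))"
        unfolding f_def by (subst prod.remove[OF fin i]) (simp add: mult_ac)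
      also have "\<dots> = e * G w * (k1 (w i - X \<omega> i) * (\<Prod>l\<in>N - {i}. k (w l - X \<omega> l)))"
        unfolding q by simp
      also have "k1 (w i - X \<omega> i) * (\<Prod>l\<in>N - {i}. k (w l - X \<omega> l)) = (\<Prod>l\<in>N. ((\<lambda>_. k)(i := k1)) l (w l - X \<omega> l))"
        using fin i by (subst prod.remove[OF fin i]) (auto intro!: prod.cong)
      finally show ?thesis .
    qed
    then have "(\<integral>\<omega>. f (\<omega>, w) * (\<Prod>i\<in>N. k (w i - X \<omega> i)) \<partial>M) = e * G w * rho1 i w"
      using i by (simp add: rho1_def avg_def)
    also have "\<dots> = (e * G w * score i w) * rho w"
      using rho_pos[of w] by (simp add: score_def)
    also have "\<dots> = (\<integral>\<omega>. (e * G w * score i w) * (\<Prod>i\<in>N. k (w i - X \<omega> i)) \<partial>M)"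
      by (simp add: rho_def avg_def)
    finally show "(\<integral>\<omega>. f (\<omega>, w) * (\<Prod>i\<in>N. k (w i - X \<omega> i)) \<partial>M) = \<dots>" .
  qed
  also have "\<dots> = (\<integral>p. e * G (W p) * score i (W p) \<partial>P)"
  proof -
    have m: "(\<lambda>p. e * G (snd p) * score i (snd p)) \<in> borel_measurable (M \<Otimes>\<^sub>M L)" by measurable
    have b: "\<bar>e * G (snd p) * score i (snd p)\<bar> \<le> e * B * (4 / e)" for p
      unfolding abs_mult using bd score_le B0 e_pos by (intro mult_mono) auto
    show ?thesis using expect_W[OF m b] by simp
  qed
  finally show ?thesis by (simp add: mult.assoc)
qed

text \<open>With the sample point and the other noise coordinates fixed, the noise at
  \<open>i\<close> moves only the coordinate \<open>i\<close> of \<open>W\<close>, affinely with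
  slope \<open>e\<close>, so that \<open>ibp_kern\<close> applies; Fubini does the rest.\<close>

lemma ibp_noise:
  assumes G: "C1b N G G1" and i: "i \<in> N"
  shows "e * (\<integral>p. G1 i (W p) \<partial>P) = - (\<integral>p. G (W p) * (kern1 (snd p i) / kern (snd p i)) \<partial>P)"
proof -
  obtain B where B: "\<And>w. \<bar>G w\<bar> \<le> B" using C1b_bounded[OF G] by blast
  obtain B1 where B1: "\<And>w. \<bar>G1 i w\<bar> \<le> B1" using C1b_bounded1[OF G] by blast
  have B0: "0 \<le> B" using B[of undefined] by linarith
  have [measurable]: "G \<in> borel_measurable borel" "G1 i \<in> borel_measurable borel"
    using C1b_cont[OF G] C1b_cont1[OF G] by (auto intro!: borel_measurable_continuous_onI)
  have Gb: "\<bar>G w * (kern1 t / kern t)\<bar> \<le> B * 4" for w t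
    unfolding abs_mult using B kern_quot_le B0 by (intro mult_mono) auto
  have psn: "product_sigma_finite (\<lambda>_::'i. noise)"
    by (simp add: product_sigma_finite_def prob_space_noise prob_space_imp_sigma_finite)
  note [measurable] = Q_component
  have I1: "integrable P (\<lambda>p. G1 i (W p))"
    using B1 by (intro integrable_boundedI[where B=B1] P.finite_measure_axioms) auto
  have I2: "integrable P (\<lambda>p. G (W p) * (kern1 (snd p i) / kern (snd p i)))"
    using Gb by (intro integrable_boundedI[where B="B*4"] P.finite_measure_axioms) auto
  have "(\<integral>z. e * G1 i (W (\<omega>, z)) \<partial>Q) = - (\<integral>z. G (W (\<omega>, z)) * (kern1 (z i) / kern (z i)) \<partial>Q)" if [measurable]: "\<omega> \<in> space M" for \<omega>
  proof -
    have Wm [measurable]: "(\<lambda>z. W (\<omega>, z)) \<in> borel_measurable Q"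
      using measurable_compose[OF measurable_Pair1'[OF that, of Q], of W borel] W_meas unfolding P_def by simp
    define N' where "N' = N - {i}"
    have N: "N = insert i N'" "finite N'" "i \<notin> N'" using i fin by (auto simp: N'_def)
    have Q: "Q = PiM (insert i N') (\<lambda>_. noise)" unfolding Q_def using N by simp
    have J1: "integrable Q (\<lambda>z. e * G1 i (W (\<omega>, z)))"
      using B1 by (intro integrable_mult_right integrable_boundedI[where B=B1] Q.finite_measure_axioms) auto
    have J2: "integrable Q (\<lambda>z. G (W (\<omega>, z)) * (kern1 (z i) / kern (z i)))"
      using Gb by (intro integrable_boundedI[where B="B*4"] Q.finite_measure_axioms) auto
    have Wu: "W (\<omega>, z(i := y)) = (W (\<omega>, z))(i := X \<omega> i + e * y)" for z y
      using i by (auto simp: W_def fun_eq_iff)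
    have "(\<integral>z. e * G1 i (W (\<omega>, z)) \<partial>Q) = (\<integral>z. \<integral>y. e * G1 i (W (\<omega>, z(i := y))) \<partial>noise \<partial>PiM N' (\<lambda>_. noise))"
      using product_sigma_finite.product_integral_insert[OF psn N(2,3) J1[unfolded Q]] unfolding Q .
    also have "\<dots> = (\<integral>z. - (\<integral>y. G (W (\<omega>, z(i := y))) * (kern1 y / kern y) \<partial>noise) \<partial>PiM N' (\<lambda>_. noise))"
      unfolding Wu
    proof (intro Bochner_Integration.integral_cong refl)
      fix z
      have c: "continuous_on UNIV (\<lambda>t. G1 i ((W (\<omega>, z))(i := t)))"
      proof (rule continuous_on_compose2[OF C1b_cont1[OF G]])
        show "continuous_on UNIV (\<lambda>t. (W (\<omega>, z))(i := t))"
        proof (rule continuous_on_coordinatewise_then_product)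
          show "continuous_on UNIV (\<lambda>t. ((W (\<omega>, z))(i := t)) l)" for l by (cases "l = i") (auto intro: continuous_intros)
        qed
      qed auto
      show "(\<integral>y. e * G1 i ((W (\<omega>, z))(i := X \<omega> i + e * y)) \<partial>noise) = - (\<integral>y. G ((W (\<omega>, z))(i := X \<omega> i + e * y)) * (kern1 y / kern y) \<partial>noise)"
        by (rule ibp_kern[OF e_pos C1b_deriv_at[OF G] c B B1])
    qed
    also have "\<dots> = - (\<integral>z. G (W (\<omega>, z)) * (kern1 (z i) / kern (z i)) \<partial>Q)"
      using product_sigma_finite.product_integral_insert[OF psn N(2,3) J2[unfolded Q]] unfolding Q by simp
    finally show ?thesis .
  qed
  then have "(\<integral>\<omega>. \<integral>z. e * G1 i (W (\<omega>, z)) \<partial>Q \<partial>M) = (\<integral>\<omega>. - (\<integral>z. G (W (\<omega>, z)) * (kern1 (z i) / kern (z i)) \<partial>Q) \<partial>M)"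
    by (intro Bochner_Integration.integral_cong) auto
  then show ?thesis
    using pairQ.integral_fst'[OF I1[unfolded P_def]] pairQ.integral_fst'[OF I2[unfolded P_def]]
    unfolding P_def by simp
qed

text \<open>Integration by parts against \<open>rho\<close>, carried out through the noise, so that
  boundary terms occur in one dimension only.\<close>

lemma ibp_W:
  assumes G: "C1b N G G1" and i: "i \<in> N"
  shows "(\<integral>p. G1 i (W p) \<partial>P) = - (\<integral>p. G (W p) * score i (W p) \<partial>P)"
proof -
  obtain B where B: "\<And>w. \<bar>G w\<bar> \<le> B" using C1b_bounded[OF G] by blast
  have m: "G \<in> borel_measurable borel" using C1b_cont[OF G] by (rule borel_measurable_continuous_onI)
  have "e * (\<integral>p. G1 i (W p) \<partial>P) = e * - (\<integral>p. G (W p) * score i (W p) \<partial>P)"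
    using ibp_noise[OF G i] expect_score[OF m B i] by simp
  then show ?thesis using e_pos unfolding mult_cancel_left by simp
qed

end

lemma integral_power2_le:
  fixes f :: "'a \<Rightarrow> real"
  assumes "prob_space M" "f \<in> borel_measurable M" and f2: "integrable M (\<lambda>x. (f x)\<^sup>2)"
  shows "(\<integral>x. f x \<partial>M)\<^sup>2 \<le> (\<integral>x. (f x)\<^sup>2 \<partial>M)"
proof -
  interpret prob_space M by fact
  have "integrable M f" by (rule square_integrable_imp_integrable) fact+
  then have "0 \<le> expectation (\<lambda>x. (f x)\<^sup>2) - (expectation f)\<^sup>2"
    using variance_positive[of f] variance_eq[of f] f2 by simp
  then show ?thesis by simp
qed

lemma C1b_sum_bounded:
  assumes "finite A" "\<And>i. i \<in> A \<Longrightarrow> \<exists>B. \<forall>w. \<bar>f i w :: real\<bar> \<le> B"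
  shows "\<exists>B. \<forall>w. \<bar>\<Sum>i\<in>A. c i * f i w\<bar> \<le> B"
  using assms
proof (induction A)
  case (insert x A)
  then obtain B C where "\<And>w. \<bar>\<Sum>i\<in>A. c i * f i w\<bar> \<le> B" "\<And>w. \<bar>f x w\<bar> \<le> C" by (metis insertI1 insertI2)
  note B = this(1) and C = this(2)
  have "\<bar>\<Sum>i\<in>insert x A. c i * f i w\<bar> \<le> \<bar>c x\<bar> * C + B" for w
  proof -
    have "\<bar>c x * f x w\<bar> \<le> \<bar>c x\<bar> * C" using C[of w] by (simp add: abs_mult mult_left_mono)
    then show ?thesis using B[of w] insert.hyps by simp
  qed
  then show ?case by blast
next
  case empty
  have "\<forall>w. \<bar>\<Sum>i\<in>{}. c i * f i w\<bar> \<le> 0" by simp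
  then show ?case by blast
qed

section \<open>The energy estimate for smeared stationary fields\<close>

text \<open>The lattice in abstract form: \<open>J\<close> stands for sites, \<open>N\<close> for
  edges, and \<open>a j\<close> for the change of the edge variables when the height at
  \<open>j\<close> is raised. The force \<open>U j\<close> is a function on the sample space, not of
  the coordinates in \<open>N\<close>, since at the rim of a box it involves further edges.\<close>

locale smoothed = noisy M N X e for M :: "'w measure" and N :: "'i::countable set" and X e +
  fixes J :: "'j set" and a :: "'j \<Rightarrow> 'i \<Rightarrow> real" and U :: "'j \<Rightarrow> 'w \<Rightarrow> real"
  assumes finJ: "finite J" and U_meas [measurable]: "\<And>j. j \<in> J \<Longrightarrow> U j \<in> borel_measurable M"
    and U2: "\<And>j. j \<in> J \<Longrightarrow> integrable M (\<lambda>\<omega>. (U j \<omega>)\<^sup>2)"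
    and stat: "\<And>F F1 F2. C1b N F F1 \<Longrightarrow> (\<And>i. C1b N (F1 i) (F2 i)) \<Longrightarrow>
      (\<Sum>j\<in>J. \<integral>\<omega>. (\<Sum>i\<in>N. \<Sum>k\<in>N. a j i * a j k * F2 i k (X \<omega>)) - U j \<omega> * (\<Sum>i\<in>N. a j i * F1 i (X \<omega>)) \<partial>M) = 0"
begin

definition D :: "'j \<Rightarrow> ('i \<Rightarrow> ('i \<Rightarrow> real) \<Rightarrow> real) \<Rightarrow> ('i \<Rightarrow> real) \<Rightarrow> real" where
  "D j G w = (\<Sum>i\<in>N. a j i * G i w)"

lemma D_meas: "(\<And>i. G i \<in> borel_measurable borel) \<Longrightarrow> D j G \<in> borel_measurable borel"
  unfolding D_def[abs_def] by (intro borel_measurable_sum borel_measurable_times borel_measurable_const) auto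

lemma D_score_meas [measurable]: "D j score \<in> borel_measurable borel"
  by (intro D_meas) measurable

lemma C1b_meas1: "C1b N F F1 \<Longrightarrow> F1 i \<in> borel_measurable borel"
  by (rule borel_measurable_continuous_onI[OF C1b_cont1])

lemma C1b_meas: "C1b N F F1 \<Longrightarrow> F \<in> borel_measurable borel"
  by (rule borel_measurable_continuous_onI[OF C1b_cont])

lemma D_C1b_bounded: "C1b N F F1 \<Longrightarrow> \<exists>B. \<forall>w. \<bar>D j F1 w\<bar> \<le> B"
  unfolding D_def by (rule C1b_sum_bounded[OF fin]) (rule C1b_bounded1)

lemma D_score_bounded: "\<exists>B. \<forall>w. \<bar>D j score w\<bar> \<le> B"
proof -
  have "\<exists>B. \<forall>w. \<bar>score i w\<bar> \<le> B" for i using score_le[of i] by (intro exI[of _ "4 / e"]) simp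
  then show ?thesis unfolding D_def by (rule C1b_sum_bounded[OF fin])
qed

lemma U1: "j \<in> J \<Longrightarrow> integrable M (U j)"
  by (rule square_integrable_imp_integrable[OF U_meas U2])

lemma U_P: "j \<in> J \<Longrightarrow> integrable P (\<lambda>p. U j (fst p))" "j \<in> J \<Longrightarrow> integrable P (\<lambda>p. (U j (fst p))\<^sup>2)"
proof -
  have d: "distr P M fst = M"
    unfolding P_def by (rule prob_space.distr_pair_fst[OF Q_prob])
  show "j \<in> J \<Longrightarrow> integrable P (\<lambda>p. U j (fst p))"
    by (rule integrable_distr[OF fst_meas, where f="U j"], unfold d, rule U1)
  show "j \<in> J \<Longrightarrow> integrable P (\<lambda>p. (U j (fst p))\<^sup>2)"
    by (rule integrable_distr[OF fst_meas, where f="\<lambda>\<omega>. (U j \<omega>)\<^sup>2"], unfold d, rule U2)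
qed

lemma bounded_P:
  assumes [measurable]: "f \<in> borel_measurable borel" and "\<exists>B. \<forall>w. \<bar>f w\<bar> \<le> (B::real)"
  shows "integrable P (\<lambda>p. f (W p))" "j \<in> J \<Longrightarrow> integrable P (\<lambda>p. U j (fst p) * f (W p))"
proof -
  obtain B where B: "\<And>w. \<bar>f w\<bar> \<le> B" using assms by blast
  have B0: "0 \<le> B" using B[of undefined] by linarith
  show "integrable P (\<lambda>p. f (W p))"
    by (rule integrable_boundedI[OF P.finite_measure_axioms measurable_compose[OF W_meas assms(1)] B])
  show "integrable P (\<lambda>p. U j (fst p) * f (W p))" if j: "j \<in> J"
  proof (rule Bochner_Integration.integrable_bound[OF integrable_mult_left[OF U_P(1)[OF j], of B]])
    show "(\<lambda>p. U j (fst p) * f (W p)) \<in> borel_measurable P"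
      by (intro borel_measurable_times measurable_compose[OF W_meas] measurable_compose[OF fst_meas] U_meas j assms(1))
    show "AE p in P. norm (U j (fst p) * f (W p)) \<le> norm (U j (fst p) * B)"
      using B B0 by (intro AE_I2) (simp add: abs_mult mult_left_mono)
  qed
qed

lemma integral_double_sum:
  fixes g :: "'i \<Rightarrow> 'i \<Rightarrow> _ \<Rightarrow> real"
  assumes g: "\<And>i k. integrable P (g i k)"
  shows "(\<integral>p. (\<Sum>i\<in>N. \<Sum>k\<in>N. c i k * g i k p) \<partial>P) = (\<Sum>i\<in>N. \<Sum>k\<in>N. c i k * (\<integral>p. g i k p \<partial>P))"
proof -
  have "(\<integral>p. (\<Sum>i\<in>N. \<Sum>k\<in>N. c i k * g i k p) \<partial>P) = (\<Sum>i\<in>N. \<integral>p. (\<Sum>k\<in>N. c i k * g i k p) \<partial>P)"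
    by (intro Bochner_Integration.integral_sum Bochner_Integration.integrable_sum integrable_mult_right g)
  also have "\<dots> = (\<Sum>i\<in>N. \<Sum>k\<in>N. c i k * (\<integral>p. g i k p \<partial>P))"
  proof (rule sum.cong[OF refl])
    fix i
    have "(\<integral>p. (\<Sum>k\<in>N. c i k * g i k p) \<partial>P) = (\<Sum>k\<in>N. \<integral>p. c i k * g i k p \<partial>P)"
      by (intro Bochner_Integration.integral_sum integrable_mult_right g)
    then show "(\<integral>p. (\<Sum>k\<in>N. c i k * g i k p) \<partial>P) = (\<Sum>k\<in>N. c i k * (\<integral>p. g i k p \<partial>P))" by simp
  qed
  finally show ?thesis .
qed

text \<open>Only one of the two derivatives is moved onto the density, so no second derivative of
  \<open>rho\<close> appears.\<close>

lemma integral_D_score: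
  assumes F: "C1b N F F1" and F1: "\<And>i. C1b N (F1 i) (F2 i)"
  shows "(\<integral>p. (\<Sum>i\<in>N. \<Sum>k\<in>N. a j i * a j k * F2 i k (W p)) \<partial>P) = - (\<integral>p. D j F1 (W p) * D j score (W p) \<partial>P)"
proof -
  have m: "F2 i k \<in> borel_measurable borel" "F1 i \<in> borel_measurable borel" for i k
    using C1b_meas1[OF F1] C1b_meas1[OF F] by auto
  note [measurable] = m
  have b2: "\<exists>B. \<forall>w. \<bar>F2 i k w\<bar> \<le> B" for i k using C1b_bounded1[OF F1] by blast
  have b1: "\<exists>B. \<forall>w. \<bar>F1 i w * score k w\<bar> \<le> B" for i k
  proof -
    obtain B where B: "\<And>w. \<bar>F1 i w\<bar> \<le> B" using C1b_bounded1[OF F] by blast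
    have "0 \<le> B" using B[of undefined] by linarith
    then have "\<bar>F1 i w * score k w\<bar> \<le> B * (4 / e)" for w
      unfolding abs_mult using B score_le by (intro mult_mono) auto
    then show ?thesis by blast
  qed
  have I2: "integrable P (\<lambda>p. F2 i k (W p))" for i k by (rule bounded_P(1)[OF _ b2]) measurable
  have I1: "integrable P (\<lambda>p. F1 i (W p) * score k (W p))" for i k
    using bounded_P(1)[of "\<lambda>w. F1 i w * score k w", OF _ b1] by measurable
  have "(\<integral>p. (\<Sum>i\<in>N. \<Sum>k\<in>N. a j i * a j k * F2 i k (W p)) \<partial>P) = (\<Sum>i\<in>N. \<Sum>k\<in>N. a j i * a j k * (\<integral>p. F2 i k (W p) \<partial>P))"
    by (rule integral_double_sum[OF I2])
  also have "\<dots> = (\<Sum>i\<in>N. \<Sum>k\<in>N. - (a j i * a j k * (\<integral>p. F1 i (W p) * score k (W p) \<partial>P)))"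
    by (intro sum.cong refl) (simp add: ibp_W[OF F1])
  also have "\<dots> = - (\<Sum>i\<in>N. \<Sum>k\<in>N. a j i * a j k * (\<integral>p. F1 i (W p) * score k (W p) \<partial>P))"
    by (simp add: sum_negf)
  also have "(\<Sum>i\<in>N. \<Sum>k\<in>N. a j i * a j k * (\<integral>p. F1 i (W p) * score k (W p) \<partial>P))
     = (\<integral>p. (\<Sum>i\<in>N. \<Sum>k\<in>N. a j i * a j k * (F1 i (W p) * score k (W p))) \<partial>P)"
    by (rule integral_double_sum[OF I1, symmetric])
  also have "\<dots> = (\<integral>p. D j F1 (W p) * D j score (W p) \<partial>P)"
    unfolding D_def sum_product by (intro Bochner_Integration.integral_cong[OF refl] sum.cong refl) (simp only: mult_ac)
  finally show ?thesis .
qed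

text \<open>For each value \<open>z\<close> of the noise, \<open>F\<close> at \<open>W\<close> is
  the translate of \<open>F\<close> by \<open>e * z\<close> evaluated at \<open>X\<close>, so
  stationarity holds without error. After averaging over \<open>z\<close>, the second-order part is
  integrated by parts.\<close>

lemma stat_smoothed:
  assumes F: "C1b N F F1" and F1: "\<And>i. C1b N (F1 i) (F2 i)"
  shows "(\<Sum>j\<in>J. \<integral>p. D j F1 (W p) * (D j score (W p) + U j (fst p)) \<partial>P) = 0"
proof -
  have m: "F2 i k \<in> borel_measurable borel" "F1 i \<in> borel_measurable borel" for i k
    using C1b_meas1[OF F1] C1b_meas1[OF F] by auto
  note [measurable] = m D_meas[OF m(2)]
  define DD where "DD j w = (\<Sum>i\<in>N. \<Sum>k\<in>N. a j i * a j k * F2 i k w)" for j w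
  have DDm [measurable]: "DD j \<in> borel_measurable borel" for j unfolding DD_def[abs_def] by measurable
  have DDb: "\<exists>B. \<forall>w. \<bar>DD j w\<bar> \<le> B" for j
  proof -
    have eq: "DD j w = (\<Sum>i\<in>N. a j i * (\<Sum>k\<in>N. a j k * F2 i k w))" for w
      by (simp add: DD_def sum_distrib_left mult.assoc)
    show ?thesis unfolding eq using C1b_bounded1[OF F1] by (intro C1b_sum_bounded fin) blast
  qed
  define g where "g j p = DD j (W p) - U j (fst p) * D j F1 (W p)" for j p
  have ig: "integrable P (g j)" if "j \<in> J" for j
    unfolding g_def using that D_C1b_bounded[OF F] DDb by (intro Bochner_Integration.integrable_diff bounded_P) auto
  have "(\<Sum>j\<in>J. \<integral>p. g j p \<partial>P) = (\<integral>p. (\<Sum>j\<in>J. g j p) \<partial>P)"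
    using ig by (intro Bochner_Integration.integral_sum[symmetric]) auto
  also have "\<dots> = (\<integral>z. \<integral>\<omega>. (\<Sum>j\<in>J. g j (\<omega>, z)) \<partial>M \<partial>Q)"
    unfolding P_def
    by (subst pairQ.integral_snd) (use ig in \<open>auto simp: P_def case_prod_beta'\<close>)
  also have "\<dots> = (\<integral>z. 0 \<partial>Q)"
  proof (rule Bochner_Integration.integral_cong[OF refl])
    fix z assume z: "z \<in> space Q"
    have Wm: "(\<lambda>\<omega>. W (\<omega>, z)) \<in> borel_measurable M"
      using measurable_compose[OF measurable_Pair2'[OF z, of M], of W borel] W_meas unfolding P_def by simp
    have igz: "integrable M (\<lambda>\<omega>. g j (\<omega>, z))" if j [measurable]: "j \<in> J" for j
    proof -
      obtain B where B: "\<And>w. \<bar>DD j w\<bar> \<le> B" using DDb by blast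
      obtain C where C: "\<And>w. \<bar>D j F1 w\<bar> \<le> C" using D_C1b_bounded[OF F] by blast
      have C0: "0 \<le> C" using C[of undefined] by linarith
      have m1: "(\<lambda>\<omega>. DD j (W (\<omega>, z))) \<in> borel_measurable M" by (rule measurable_compose[OF Wm DDm])
      have m2: "(\<lambda>\<omega>. D j F1 (W (\<omega>, z))) \<in> borel_measurable M" by (rule measurable_compose[OF Wm D_meas[OF m(2)]])
      have i1: "integrable M (\<lambda>\<omega>. DD j (W (\<omega>, z)))"
        using B m1 by (intro integrable_boundedI[where B=B] finite_measure_axioms)
      have i2: "integrable M (\<lambda>\<omega>. U j \<omega> * D j F1 (W (\<omega>, z)))"
      proof (rule Bochner_Integration.integrable_bound[OF integrable_mult_left[OF U1[OF j], of C]])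
        show "(\<lambda>\<omega>. U j \<omega> * D j F1 (W (\<omega>, z))) \<in> borel_measurable M"
          by (intro borel_measurable_times m2 U_meas j)
        show "AE \<omega> in M. norm (U j \<omega> * D j F1 (W (\<omega>, z))) \<le> norm (U j \<omega> * C)"
          using C C0 by (intro AE_I2) (simp add: abs_mult mult_left_mono)
      qed
      show ?thesis unfolding g_def fst_conv using i1 i2 by (rule Bochner_Integration.integrable_diff)
    qed
    let ?T = "\<lambda>w. (\<lambda>i. w i + e * z i)"
    \<comment> \<open>\<open>W\<close> and the translated field may differ off \<open>N\<close>, on
      which these functions do not depend.\<close>
    have W: "F1 i (W (\<omega>, z)) = F1 i (?T (X \<omega>))" "F2 i k (W (\<omega>, z)) = F2 i k (?T (X \<omega>))" for i k \<omega>
      by (rule C1b_local[OF F1] C1b_local1[OF F1], simp add: W_def)+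
    have "(\<integral>\<omega>. (\<Sum>j\<in>J. g j (\<omega>, z)) \<partial>M) = (\<Sum>j\<in>J. \<integral>\<omega>. g j (\<omega>, z) \<partial>M)"
      using igz by (intro Bochner_Integration.integral_sum) auto
    also have "\<dots> = 0"
      using stat[OF C1b_translate[OF F, where c="\<lambda>i. e * z i"] C1b_translate[OF F1, where c="\<lambda>i. e * z i"]]
      unfolding g_def DD_def D_def fst_conv W .
    finally show "(\<integral>\<omega>. (\<Sum>j\<in>J. g j (\<omega>, z)) \<partial>M) = 0" .
  qed
  finally have 0: "(\<Sum>j\<in>J. \<integral>p. g j p \<partial>P) = 0" by simp
  have "(\<integral>p. g j p \<partial>P) = - (\<integral>p. D j F1 (W p) * (D j score (W p) + U j (fst p)) \<partial>P)" if j: "j \<in> J" for j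
  proof -
    have b: "\<exists>B. \<forall>w. \<bar>D j F1 w * D j score w\<bar> \<le> B"
    proof -
      obtain B where B: "\<And>w. \<bar>D j F1 w\<bar> \<le> B" using D_C1b_bounded[OF F] by blast
      obtain C where C: "\<And>w. \<bar>D j score w\<bar> \<le> C" using D_score_bounded by blast
      have "0 \<le> B" using B[of undefined] by linarith
      then have "\<bar>D j F1 w * D j score w\<bar> \<le> B * C" for w
        unfolding abs_mult using B C by (intro mult_mono) auto
      then show ?thesis by blast
    qed
    have I1: "integrable P (\<lambda>p. D j F1 (W p) * D j score (W p))"
      using bounded_P(1)[OF _ b] by simp
    have I2: "integrable P (\<lambda>p. U j (fst p) * D j F1 (W p))"
      using bounded_P(2)[OF _ D_C1b_bounded[OF F] j] by simp
    have "(\<integral>p. g j p \<partial>P) = (\<integral>p. DD j (W p) \<partial>P) - (\<integral>p. U j (fst p) * D j F1 (W p) \<partial>P)"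
      unfolding g_def using bounded_P(1)[OF DDm DDb] I2 by (rule Bochner_Integration.integral_diff)
    also have "\<dots> = - ((\<integral>p. D j F1 (W p) * D j score (W p) \<partial>P) + (\<integral>p. U j (fst p) * D j F1 (W p) \<partial>P))"
      unfolding DD_def integral_D_score[OF F F1] by simp
    also have "\<dots> = - (\<integral>p. D j F1 (W p) * D j score (W p) + U j (fst p) * D j F1 (W p) \<partial>P)"
      using I1 I2 by (subst Bochner_Integration.integral_add) auto
    finally show ?thesis by (simp add: algebra_simps)
  qed
  then have "(\<Sum>j\<in>J. \<integral>p. g j p \<partial>P) = - (\<Sum>j\<in>J. \<integral>p. D j F1 (W p) * (D j score (W p) + U j (fst p)) \<partial>P)"
    by (simp add: sum_negf)
  with 0 show ?thesis by simp
qed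

text \<open>For \<open>ln rho\<close> itself the derivatives could be unbounded, since
  \<open>rho\<close> may come arbitrarily close to zero. Adding \<open>\<delta>\<close> removes this
  and multiplies the score by \<open>rho / (rho + \<delta>) \<le> 1\<close>, which tends to one, so
  dominated convergence applies.\<close>

lemma score_identity:
  assumes H: "C1b N H H1" and H1: "\<And>i. C1b N (H1 i) (H2 i)"
  shows "(\<Sum>j\<in>J. \<integral>p. (D j score (W p) + D j H1 (W p)) * (D j score (W p) + U j (fst p)) \<partial>P) = 0"
proof -
  define \<delta> where "\<delta> n = inverse (real (Suc n))" for n
  have \<delta>: "\<delta> n > 0" for n by (simp add: \<delta>_def)
  have \<delta>0: "\<delta> \<longlonglongrightarrow> 0" unfolding \<delta>_def[abs_def] by (rule LIMSEQ_inverse_real_of_nat)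
  obtain R where R: "\<And>w. \<bar>rho w\<bar> \<le> R" using C1b_bounded[OF rho_C1b] by blast
  have rR: "rho w \<in> {0..R}" for w using R[of w] rho_pos[of w] by auto
  note [measurable] = D_meas[OF C1b_meas1[OF H]]
  have 1: "(\<Sum>j\<in>J. \<integral>p. (rho (W p) / (rho (W p) + \<delta> n) * D j score (W p) + D j H1 (W p)) * (D j score (W p) + U j (fst p)) \<partial>P) = 0" for n
  proof -
    have l: "C1b N (\<lambda>w. ln (rho w + \<delta> n)) (\<lambda>i w. inverse (rho w + \<delta> n) * rho1 i w)"
      by (rule C1b_compose[where S="{0..R}" and \<phi>="\<lambda>s. ln (s + \<delta> n)" and \<phi>'="\<lambda>s. inverse (s + \<delta> n)", OF rho_C1b rR])
         (use \<delta>[of n] in \<open>auto intro!: derivative_eq_intros continuous_intros simp: field_simps\<close>)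
    define q where "q i w = - (inverse (rho w + \<delta> n))\<^sup>2 * rho1 i w" for i w
    have iv: "C1b N (\<lambda>w. inverse (rho w + \<delta> n)) q"
      unfolding q_def
      by (rule C1b_compose[where S="{0..R}" and \<phi>="\<lambda>s. inverse (s + \<delta> n)" and \<phi>'="\<lambda>s. - (inverse (s + \<delta> n))\<^sup>2", OF rho_C1b rR])
         (use \<delta>[of n] in \<open>auto intro!: derivative_eq_intros continuous_intros simp: power2_eq_square\<close>)
    \<comment> \<open>Second derivatives of the logarithm, by the product rule for the reciprocal
      and \<open>rho1\<close>.\<close>
    note l' = C1b_mult[OF iv rho1_C1b]
    have D: "D j (\<lambda>i w. inverse (rho w + \<delta> n) * rho1 i w + H1 i w) w
      = rho w / (rho w + \<delta> n) * D j score w + D j H1 w" for j w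
    proof -
      have "inverse (rho w + \<delta> n) * rho1 i w = rho w / (rho w + \<delta> n) * score i w" for i
        using rho_pos[of w] by (simp add: score_def divide_inverse mult_ac)
      then show ?thesis
        unfolding D_def sum_distrib_left sum.distrib[symmetric]
        by (intro sum.cong refl) (simp add: distrib_left mult_ac)
    qed
    show ?thesis
      using stat_smoothed[OF C1b_add[OF l H] C1b_add[OF l' H1]] unfolding D .
  qed
  have "(\<lambda>n. \<Sum>j\<in>J. \<integral>p. (rho (W p) / (rho (W p) + \<delta> n) * D j score (W p) + D j H1 (W p)) * (D j score (W p) + U j (fst p)) \<partial>P)
    \<longlonglongrightarrow> (\<Sum>j\<in>J. \<integral>p. (D j score (W p) + D j H1 (W p)) * (D j score (W p) + U j (fst p)) \<partial>P)"
  proof (rule tendsto_sum)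
    fix j assume j [measurable]: "j \<in> J"
    obtain B where B: "\<And>w. \<bar>D j H1 w\<bar> \<le> B" using D_C1b_bounded[OF H] by blast
    obtain C where C: "\<And>w. \<bar>D j score w\<bar> \<le> C" using D_score_bounded by blast
    have BC: "0 \<le> B" "0 \<le> C" using B[of undefined] C[of undefined] by linarith+
    show "(\<lambda>n. \<integral>p. (rho (W p) / (rho (W p) + \<delta> n) * D j score (W p) + D j H1 (W p)) * (D j score (W p) + U j (fst p)) \<partial>P)
      \<longlonglongrightarrow> (\<integral>p. (D j score (W p) + D j H1 (W p)) * (D j score (W p) + U j (fst p)) \<partial>P)"
    proof (rule integral_dominated_convergence[where w="\<lambda>p. (C + B) * (C + \<bar>U j (fst p)\<bar>)"])
      show "integrable P (\<lambda>p. (C + B) * (C + \<bar>U j (fst p)\<bar>))"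
        by (intro integrable_mult_right Bochner_Integration.integrable_add integrable_abs U_P j) auto
      show "AE p in P. (\<lambda>n. (rho (W p) / (rho (W p) + \<delta> n) * D j score (W p) + D j H1 (W p)) * (D j score (W p) + U j (fst p)))
        \<longlonglongrightarrow> (D j score (W p) + D j H1 (W p)) * (D j score (W p) + U j (fst p))"
      proof (rule AE_I2)
        fix p
        have "(\<lambda>n. (rho (W p) / (rho (W p) + \<delta> n) * D j score (W p) + D j H1 (W p)) * (D j score (W p) + U j (fst p)))
        \<longlonglongrightarrow> (rho (W p) / (rho (W p) + 0) * D j score (W p) + D j H1 (W p)) * (D j score (W p) + U j (fst p))"
          by (intro tendsto_intros \<delta>0) (use rho_pos[of "W p"] in auto)
        then show "(\<lambda>n. (rho (W p) / (rho (W p) + \<delta> n) * D j score (W p) + D j H1 (W p)) * (D j score (W p) + U j (fst p)))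
        \<longlonglongrightarrow> (D j score (W p) + D j H1 (W p)) * (D j score (W p) + U j (fst p))"
          using rho_pos[of "W p"] by simp
      qed
      show "AE p in P. norm ((rho (W p) / (rho (W p) + \<delta> n) * D j score (W p) + D j H1 (W p)) * (D j score (W p) + U j (fst p)))
         \<le> (C + B) * (C + \<bar>U j (fst p)\<bar>)" for n
      proof (rule AE_I2)
        fix p
        have "\<bar>rho (W p) / (rho (W p) + \<delta> n)\<bar> \<le> 1" using rho_pos[of "W p"] \<delta>[of n] by simp
        then have "\<bar>rho (W p) / (rho (W p) + \<delta> n) * D j score (W p)\<bar> \<le> 1 * C"
          unfolding abs_mult using C by (intro mult_mono) auto
        then have "\<bar>rho (W p) / (rho (W p) + \<delta> n) * D j score (W p) + D j H1 (W p)\<bar> \<le> C + B"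
          using B[of "W p"] by linarith
        moreover have "\<bar>D j score (W p) + U j (fst p)\<bar> \<le> C + \<bar>U j (fst p)\<bar>"
          using C[of "W p"] by linarith
        ultimately show "norm ((rho (W p) / (rho (W p) + \<delta> n) * D j score (W p) + D j H1 (W p)) * (D j score (W p) + U j (fst p)))
         \<le> (C + B) * (C + \<bar>U j (fst p)\<bar>)"
          unfolding real_norm_def abs_mult using BC by (intro mult_mono) auto
      qed
    qed measurable
  qed
  from LIMSEQ_unique[OF tendsto_const this[unfolded 1]] show ?thesis by (rule sym)
qed

text \<open>Let \<open>S\<close> be the score plus \<open>D j H1\<close> and \<open>R\<close> the
  defect \<open>U - D j H1\<close>. By \<open>score_identity\<close>,
  \<open>\<Sum> E (S (S + R)) = 0\<close>, and
  \<open>S\<^sup>2 - R\<^sup>2 \<le> 2 S (S + R)\<close> bounds the sum of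
  \<open>E S\<^sup>2\<close> by that of \<open>E R\<^sup>2\<close>. Each mean on the left equals
  \<open>- E (f (S + R))\<close>; the 4 arises from
  \<open>(S + R)\<^sup>2 \<le> 2 S\<^sup>2 + 2 R\<^sup>2\<close>.\<close>

lemma fisher_bound:
  assumes H: "C1b N H H1" and H1: "\<And>i. C1b N (H1 i) (H2 i)"
    and f: "\<And>j. j \<in> J \<Longrightarrow> C1b N (f j) (f1 j)" and f_le: "\<And>j w. j \<in> J \<Longrightarrow> \<bar>f j w\<bar> \<le> 1"
  shows "(\<Sum>j\<in>J. (\<integral>p. D j (f1 j) (W p) - U j (fst p) * f j (W p) \<partial>P)\<^sup>2)
    \<le> 4 * (\<Sum>j\<in>J. \<integral>p. (U j (fst p) - D j H1 (W p))\<^sup>2 \<partial>P)"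
proof -
  note [measurable] = D_meas[OF C1b_meas1[OF H]]
  define S where "S j p = D j score (W p) + D j H1 (W p)" for j p
  define R where "R j p = U j (fst p) - D j H1 (W p)" for j p
  have SR: "D j score (W p) + U j (fst p) = S j p + R j p" for j p by (simp add: S_def R_def)
  have Sm [measurable]: "S j \<in> borel_measurable P" for j unfolding S_def by measurable
  have Rm [measurable]: "j \<in> J \<Longrightarrow> R j \<in> borel_measurable P" for j unfolding R_def by measurable
  have I: "integrable P (\<lambda>p. (S j p)\<^sup>2)" "integrable P (\<lambda>p. (R j p)\<^sup>2)" "integrable P (\<lambda>p. S j p * (S j p + R j p))"
    if j [measurable]: "j \<in> J" for j
  proof -
    obtain B where B: "\<And>w. \<bar>D j H1 w\<bar> \<le> B" using D_C1b_bounded[OF H] by blast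
    obtain C where C: "\<And>w. \<bar>D j score w\<bar> \<le> C" using D_score_bounded by blast
    have SC: "\<bar>S j p\<bar> \<le> C + B" for p using B[of "W p"] C[of "W p"] by (simp add: S_def)
    have CB0: "0 \<le> C + B" using SC[of undefined] by linarith
    show I1: "integrable P (\<lambda>p. (S j p)\<^sup>2)"
    proof (rule integrable_boundedI[where B="(C + B)\<^sup>2"])
      show "\<bar>(S j p)\<^sup>2\<bar> \<le> (C + B)\<^sup>2" for p using SC[of p] CB0 by (simp add: abs_le_square_iff[symmetric])
    qed (auto intro: P.finite_measure_axioms)
    show I2: "integrable P (\<lambda>p. (R j p)\<^sup>2)"
    proof (rule Bochner_Integration.integrable_bound[where f="\<lambda>p. 2 * (U j (fst p))\<^sup>2 + 2 * B\<^sup>2"])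
      show "integrable P (\<lambda>p. 2 * (U j (fst p))\<^sup>2 + 2 * B\<^sup>2)"
        by (intro Bochner_Integration.integrable_add integrable_mult_right U_P j) auto
      show "AE p in P. norm ((R j p)\<^sup>2) \<le> norm (2 * (U j (fst p))\<^sup>2 + 2 * B\<^sup>2)"
      proof (rule AE_I2)
        fix p
        have "(D j H1 (W p))\<^sup>2 \<le> B\<^sup>2" using B[of "W p"] by (simp add: abs_le_square_iff[symmetric] abs_of_nonneg order_trans[OF abs_ge_zero B])
        moreover have "(R j p)\<^sup>2 \<le> 2 * (U j (fst p))\<^sup>2 + 2 * (D j H1 (W p))\<^sup>2"
          using zero_le_power2[of "U j (fst p) + D j H1 (W p)"] unfolding R_def by (simp add: power2_eq_square algebra_simps)
        ultimately show "norm ((R j p)\<^sup>2) \<le> norm (2 * (U j (fst p))\<^sup>2 + 2 * B\<^sup>2)" by simp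
      qed
    qed measurable
    show "integrable P (\<lambda>p. S j p * (S j p + R j p))"
    proof (rule Bochner_Integration.integrable_bound[where f="\<lambda>p. 2 * (S j p)\<^sup>2 + (R j p)\<^sup>2"])
      show "integrable P (\<lambda>p. 2 * (S j p)\<^sup>2 + (R j p)\<^sup>2)"
        using I1 I2 by auto
      show "AE p in P. norm (S j p * (S j p + R j p)) \<le> norm (2 * (S j p)\<^sup>2 + (R j p)\<^sup>2)"
      proof (rule AE_I2)
        fix p
        \<comment> \<open>Completing the square, for either sign of the product.\<close>
        have "2 * (S j p)\<^sup>2 + (R j p)\<^sup>2 - S j p * (S j p + R j p) = (S j p - R j p / 2)\<^sup>2 + 3 / 4 * (R j p)\<^sup>2"
          "2 * (S j p)\<^sup>2 + (R j p)\<^sup>2 + S j p * (S j p + R j p) = 2 * (S j p)\<^sup>2 + (S j p + R j p / 2)\<^sup>2 + 3 / 4 * (R j p)\<^sup>2"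
          by (simp_all add: power2_eq_square field_simps)
        moreover have "0 \<le> (S j p - R j p / 2)\<^sup>2 + 3 / 4 * (R j p)\<^sup>2" "0 \<le> 2 * (S j p)\<^sup>2 + (S j p + R j p / 2)\<^sup>2 + 3 / 4 * (R j p)\<^sup>2"
          by simp_all
        ultimately have "\<bar>S j p * (S j p + R j p)\<bar> \<le> 2 * (S j p)\<^sup>2 + (R j p)\<^sup>2"
          unfolding abs_le_iff by linarith
        then show "norm (S j p * (S j p + R j p)) \<le> norm (2 * (S j p)\<^sup>2 + (R j p)\<^sup>2)" by simp
      qed
    qed measurable
  qed
  have 0: "(\<Sum>j\<in>J. \<integral>p. S j p * (S j p + R j p) \<partial>P) = 0"
    using score_identity[OF H H1] unfolding SR by (simp add: S_def)
  have "(\<Sum>j\<in>J. \<integral>p. (S j p)\<^sup>2 \<partial>P) - (\<Sum>j\<in>J. \<integral>p. (R j p)\<^sup>2 \<partial>P) = (\<Sum>j\<in>J. \<integral>p. (S j p)\<^sup>2 - (R j p)\<^sup>2 \<partial>P)"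
    using I by (simp add: sum_subtractf)
  also have "\<dots> \<le> (\<Sum>j\<in>J. \<integral>p. 2 * (S j p * (S j p + R j p)) \<partial>P)"
  proof (intro sum_mono integral_mono)
    fix j p
    show "(S j p)\<^sup>2 - (R j p)\<^sup>2 \<le> 2 * (S j p * (S j p + R j p))"
      using zero_le_power2[of "S j p + R j p"] by (simp add: power2_eq_square algebra_simps)
  qed (use I in auto)
  also have "\<dots> = 2 * (\<Sum>j\<in>J. \<integral>p. S j p * (S j p + R j p) \<partial>P)"
    using I by (simp add: sum_distrib_left)
  finally have le: "(\<Sum>j\<in>J. \<integral>p. (S j p)\<^sup>2 \<partial>P) \<le> (\<Sum>j\<in>J. \<integral>p. (R j p)\<^sup>2 \<partial>P)" using 0 by simp
  have "(\<integral>p. D j (f1 j) (W p) - U j (fst p) * f j (W p) \<partial>P)\<^sup>2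
    \<le> 2 * (\<integral>p. (S j p)\<^sup>2 \<partial>P) + 2 * (\<integral>p. (R j p)\<^sup>2 \<partial>P)" if j [measurable]: "j \<in> J" for j
  proof -
    note [measurable] = C1b_meas[OF f[OF j]] C1b_meas1[OF f[OF j]] D_meas[OF C1b_meas1[OF f[OF j]]]
    have fb: "\<exists>B. \<forall>w. \<bar>f j w\<bar> \<le> B" using f_le[OF j] by blast
    have b: "\<exists>B. \<forall>w. \<bar>f j w * score i w\<bar> \<le> B" for i
    proof -
      have "\<bar>f j w * score i w\<bar> \<le> 1 * (4 / e)" for w
        unfolding abs_mult using f_le[OF j] score_le by (intro mult_mono) auto
      then show ?thesis by blast
    qed
    have Is: "integrable P (\<lambda>p. f j (W p) * score i (W p))" for i
      using bounded_P(1)[OF _ b, of i] by simp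
    have If1: "integrable P (\<lambda>p. f1 j i (W p))" for i
      using bounded_P(1)[OF _ C1b_bounded1[OF f[OF j]]] by simp
    have "(\<integral>p. D j (f1 j) (W p) \<partial>P) = (\<Sum>i\<in>N. a j i * (\<integral>p. f1 j i (W p) \<partial>P))"
      unfolding D_def by (subst Bochner_Integration.integral_sum) (auto intro!: integrable_mult_right If1)
    also have "\<dots> = - (\<Sum>i\<in>N. a j i * (\<integral>p. f j (W p) * score i (W p) \<partial>P))"
      by (simp add: ibp_W[OF f[OF j]] sum_negf)
    also have "(\<Sum>i\<in>N. a j i * (\<integral>p. f j (W p) * score i (W p) \<partial>P)) = (\<integral>p. (\<Sum>i\<in>N. a j i * (f j (W p) * score i (W p))) \<partial>P)"
      by (subst Bochner_Integration.integral_sum) (auto intro!: integrable_mult_right Is)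
    also have "(\<lambda>p. \<Sum>i\<in>N. a j i * (f j (W p) * score i (W p))) = (\<lambda>p. f j (W p) * D j score (W p))"
      unfolding D_def sum_distrib_left by (intro ext sum.cong) auto
    finally have e1: "(\<integral>p. D j (f1 j) (W p) \<partial>P) = - (\<integral>p. f j (W p) * D j score (W p) \<partial>P)" .
    have If: "integrable P (\<lambda>p. f j (W p) * D j score (W p))"
    proof -
      obtain C where C: "\<And>w. \<bar>D j score w\<bar> \<le> C" using D_score_bounded by blast
      have "\<bar>f j w * D j score w\<bar> \<le> 1 * C" for w
        unfolding abs_mult using f_le[OF j] C by (intro mult_mono) auto
      then show ?thesis using bounded_P(1)[of "\<lambda>w. f j w * D j score w"] by auto
    qed
    have IU: "integrable P (\<lambda>p. U j (fst p) * f j (W p))"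
      using bounded_P(2)[OF _ fb j] by simp
    have ID: "integrable P (\<lambda>p. D j (f1 j) (W p))"
      using bounded_P(1)[OF _ D_C1b_bounded[OF f[OF j]]] by simp
    have "(\<integral>p. D j (f1 j) (W p) - U j (fst p) * f j (W p) \<partial>P)
      = - ((\<integral>p. f j (W p) * D j score (W p) \<partial>P) + (\<integral>p. U j (fst p) * f j (W p) \<partial>P))"
      using ID IU e1 by simp
    also have "\<dots> = - (\<integral>p. f j (W p) * D j score (W p) + U j (fst p) * f j (W p) \<partial>P)"
      using If IU by simp
    also have "(\<lambda>p. f j (W p) * D j score (W p) + U j (fst p) * f j (W p)) = (\<lambda>p. f j (W p) * (S j p + R j p))"
      unfolding SR[symmetric] by (simp add: algebra_simps)
    finally have e2: "(\<integral>p. D j (f1 j) (W p) - U j (fst p) * f j (W p) \<partial>P) = - (\<integral>p. f j (W p) * (S j p + R j p) \<partial>P)" .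
    have pw: "(f j (W p) * (S j p + R j p))\<^sup>2 \<le> 2 * (S j p)\<^sup>2 + 2 * (R j p)\<^sup>2" for p
    proof -
      have "(f j (W p))\<^sup>2 \<le> 1" using f_le[OF j, of "W p"] by (simp add: abs_square_le_1)
      then have "(f j (W p) * (S j p + R j p))\<^sup>2 \<le> 1 * (S j p + R j p)\<^sup>2"
        unfolding power_mult_distrib by (intro mult_right_mono) auto
      also have "\<dots> \<le> 2 * (S j p)\<^sup>2 + 2 * (R j p)\<^sup>2"
        using zero_le_power2[of "S j p - R j p"] by (simp add: power2_eq_square algebra_simps)
      finally show ?thesis .
    qed
    have I2: "integrable P (\<lambda>p. (f j (W p) * (S j p + R j p))\<^sup>2)"
      by (rule Bochner_Integration.integrable_bound[where f="\<lambda>p. 2 * (S j p)\<^sup>2 + 2 * (R j p)\<^sup>2"])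
         (use I[OF j] pw in auto)
    have "(\<integral>p. f j (W p) * (S j p + R j p) \<partial>P)\<^sup>2 \<le> (\<integral>p. (f j (W p) * (S j p + R j p))\<^sup>2 \<partial>P)"
      by (rule integral_power2_le[OF P_prob _ I2]) measurable
    also have "\<dots> \<le> (\<integral>p. 2 * (S j p)\<^sup>2 + 2 * (R j p)\<^sup>2 \<partial>P)"
      using I2 I[OF j] pw by (intro integral_mono) auto
    also have "\<dots> = 2 * (\<integral>p. (S j p)\<^sup>2 \<partial>P) + 2 * (\<integral>p. (R j p)\<^sup>2 \<partial>P)"
      using I[OF j] by simp
    finally show ?thesis unfolding e2 by simp
  qed
  then have "(\<Sum>j\<in>J. (\<integral>p. D j (f1 j) (W p) - U j (fst p) * f j (W p) \<partial>P)\<^sup>2)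
    \<le> (\<Sum>j\<in>J. 2 * (\<integral>p. (S j p)\<^sup>2 \<partial>P) + 2 * (\<integral>p. (R j p)\<^sup>2 \<partial>P))" by (rule sum_mono)
  also have "\<dots> = 2 * (\<Sum>j\<in>J. \<integral>p. (S j p)\<^sup>2 \<partial>P) + 2 * (\<Sum>j\<in>J. \<integral>p. (R j p)\<^sup>2 \<partial>P)"
    by (simp add: sum.distrib sum_distrib_left)
  also have "\<dots> \<le> 4 * (\<Sum>j\<in>J. \<integral>p. (R j p)\<^sup>2 \<partial>P)" using le by simp
  finally show ?thesis by (simp add: R_def)
qed

end

section \<open>Auxiliary facts on sums over coordinates and second moments\<close>

lemma C1b_sum:
  assumes "finite A" "\<And>x. x \<in> A \<Longrightarrow> C1b N (F x) (F1 x)"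
  shows "C1b N (\<lambda>w. \<Sum>x\<in>A. F x w) (\<lambda>i w. \<Sum>x\<in>A. F1 x i w)"
  using assms
proof (induction A)
  case empty
  then show ?case using C1b_zero by simp
next
  case (insert x A)
  then show ?case using C1b_add[of N "F x" "F1 x" "\<lambda>w. \<Sum>x\<in>A. F x w" "\<lambda>i w. \<Sum>x\<in>A. F1 x i w"] by simp
qed

lemma C1b_coord:
  assumes l: "l \<in> N" and d: "\<And>t. (h has_real_derivative h' t) (at t)" and c: "continuous_on UNIV h'"
    and b: "\<And>t. \<bar>h t\<bar> \<le> B" and b': "\<And>t. \<bar>h' t\<bar> \<le> B'"
  shows "C1b N (\<lambda>w. h (w l)) (\<lambda>i w. if i = l then h' (w l) else 0)"
proof -
  have ch: "continuous_on UNIV h" using d by (meson DERIV_continuous_on has_field_derivative_at_within)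
  have B0: "0 \<le> B'" using b'[of undefined] by linarith
  show ?thesis
  proof (rule C1bI[where B=B and C="\<lambda>_. B'"])
    show "((\<lambda>t. h ((w(i := t)) l)) has_real_derivative (if i = l then h' (w l) else 0)) (at (w i))" for i w
      using d by (cases "i = l") auto
    show "continuous_on UNIV (\<lambda>w. h (w l))"
      by (rule continuous_on_compose2[OF ch continuous_on_product_coordinates]) auto
    show "continuous_on UNIV (\<lambda>w. if i = l then h' (w l) else 0)" for i
      using continuous_on_compose2[OF c continuous_on_product_coordinates[of l]] by (cases "i = l") auto
    show "\<bar>if i = l then h' (w l) else 0\<bar> \<le> B'" for i w using b'[of "w l"] B0 by simp
    show "h (w l) = h (w' l)" if "\<And>i. i \<in> N \<Longrightarrow> w i = w' i" for w w' using that[OF l] by simp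
  qed (rule b)
qed

lemma C1b_coord_sum:
  assumes N: "finite N" and d: "\<And>t. (h has_real_derivative h' t) (at t)" and c: "continuous_on UNIV h'"
    and b: "\<And>t. \<bar>h t\<bar> \<le> B" and b': "\<And>t. \<bar>h' t\<bar> \<le> B'"
  shows "C1b N (\<lambda>w. \<Sum>l\<in>N. h (w l)) (\<lambda>i w. if i \<in> N then h' (w i) else 0)"
proof -
  have "C1b N (\<lambda>w. \<Sum>l\<in>N. h (w l)) (\<lambda>i w. \<Sum>l\<in>N. if i = l then h' (w l) else 0)"
    by (rule C1b_sum[OF N]) (rule C1b_coord[OF _ d c b b'])
  moreover have "(\<lambda>i w. \<Sum>l\<in>N. if i = l then h' (w l) else 0) = (\<lambda>i w. if i \<in> N then h' (w i) else 0)"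
    using N by (auto simp: fun_eq_iff sum.delta)
  ultimately show ?thesis by simp
qed

lemma square_integrable_add:
  fixes f g :: "'a \<Rightarrow> real"
  assumes [measurable]: "f \<in> borel_measurable M" "g \<in> borel_measurable M"
    and i: "integrable M (\<lambda>x. (f x)\<^sup>2)" "integrable M (\<lambda>x. (g x)\<^sup>2)"
  shows "integrable M (\<lambda>x. (f x + g x)\<^sup>2)"
proof (rule Bochner_Integration.integrable_bound[where f="\<lambda>x. 2 * (f x)\<^sup>2 + 2 * (g x)\<^sup>2"])
  show "integrable M (\<lambda>x. 2 * (f x)\<^sup>2 + 2 * (g x)\<^sup>2)" using i by simp
  show "AE x in M. norm ((f x + g x)\<^sup>2) \<le> norm (2 * (f x)\<^sup>2 + 2 * (g x)\<^sup>2)"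
  proof (rule AE_I2)
    fix x
    have "(f x + g x)\<^sup>2 + (f x - g x)\<^sup>2 = 2 * (f x)\<^sup>2 + 2 * (g x)\<^sup>2" by (simp add: power2_eq_square algebra_simps)
    moreover have "0 \<le> (f x - g x)\<^sup>2" by simp
    ultimately have "(f x + g x)\<^sup>2 \<le> 2 * (f x)\<^sup>2 + 2 * (g x)\<^sup>2" by linarith
    then show "norm ((f x + g x)\<^sup>2) \<le> norm (2 * (f x)\<^sup>2 + 2 * (g x)\<^sup>2)" by simp
  qed
qed measurable

lemma square_integrable_sum:
  fixes f :: "'i \<Rightarrow> 'a \<Rightarrow> real"
  assumes "finite A" "\<And>i. i \<in> A \<Longrightarrow> f i \<in> borel_measurable M" "\<And>i. i \<in> A \<Longrightarrow> integrable M (\<lambda>x. (f i x)\<^sup>2)"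
  shows "integrable M (\<lambda>x. (\<Sum>i\<in>A. f i x)\<^sup>2)"
  using assms
proof (induction A)
  case (insert i A)
  then have "integrable M (\<lambda>x. (f i x + (\<Sum>i\<in>A. f i x))\<^sup>2)"
    by (intro square_integrable_add borel_measurable_sum) auto
  then show ?case using insert.hyps by simp
qed simp

lemma distr_pair_snd:
  assumes M: "prob_space M" and Q: "prob_space Q"
  shows "distr (M \<Otimes>\<^sub>M Q) Q snd = Q"
proof (rule measure_eqI)
  fix A assume "A \<in> sets (distr (M \<Otimes>\<^sub>M Q) Q snd)"
  then have A: "A \<in> sets Q" by simp
  have "snd -` A \<inter> space (M \<Otimes>\<^sub>M Q) = space M \<times> A"
    using sets.sets_into_space[OF A] by (auto simp: space_pair_measure)
  then have "emeasure (distr (M \<Otimes>\<^sub>M Q) Q snd) A = emeasure (M \<Otimes>\<^sub>M Q) (space M \<times> A)"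
    using A by (simp add: emeasure_distr)
  also have "\<dots> = emeasure M (space M) * emeasure Q A"
    using Q A by (intro sigma_finite_measure.emeasure_pair_measure_Times prob_space_imp_sigma_finite) auto
  finally show "emeasure (distr (M \<Otimes>\<^sub>M Q) Q snd) A = emeasure Q A"
    using prob_space.emeasure_space_1[OF M] by simp
qed simp

section \<open>Removing the smearing\<close>

text \<open>A bounded \<open>C\<^sup>2\<close> approximation of the identity, used to truncate the potential.\<close>

definition trunc :: "real \<Rightarrow> real \<Rightarrow> real" where "trunc R t = t * cauchy (t / R)"
definition trunc' :: "real \<Rightarrow> real" where "trunc' s = cauchy s - 2 * s\<^sup>2 * (cauchy s)\<^sup>2"
definition trunc'' :: "real \<Rightarrow> real" where "trunc'' s = 8 * s ^ 3 * cauchy s ^ 3 - 6 * s * (cauchy s)\<^sup>2"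

lemma trunc_deriv: "R > 0 \<Longrightarrow> (trunc R has_real_derivative trunc' (t / R)) (at t)"
  unfolding trunc_def[abs_def] trunc'_def
  by (rule derivative_eq_intros DERIV_chain2[OF cauchy_deriv] refl | simp add: power2_eq_square field_simps)+

lemma trunc'_deriv: "(trunc' has_real_derivative trunc'' s) (at s)"
  unfolding trunc'_def[abs_def] trunc''_def
  by (rule derivative_eq_intros cauchy_deriv refl | simp add: power_numeral_reduce algebra_simps)+

lemma trunc_cont: "continuous_on UNIV (trunc R)" "continuous_on UNIV trunc'" "continuous_on UNIV trunc''"
  unfolding trunc_def[abs_def] trunc'_def[abs_def] trunc''_def[abs_def] cauchy_def
  by (auto simp: divide_inverse intro!: continuous_intros)

lemma trunc_le: "\<bar>trunc R t\<bar> \<le> \<bar>t\<bar>"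
  using mult_left_mono[OF cauchy_le_1, of "\<bar>t\<bar>"] cauchy_pos[of "t / R"] by (simp add: trunc_def abs_mult)

lemma trunc_bounded: "R > 0 \<Longrightarrow> \<bar>trunc R t\<bar> \<le> R"
  using cauchy_abs[of "t / R"] cauchy_pos[of "t / R"] by (simp add: trunc_def abs_mult field_simps)

text \<open>Slope at most one lets the truncated forces inherit the linear bound of
  \<open>V1\<close>, uniformly in \<open>R\<close>. In terms of
  \<open>y = s\<^sup>2 * cauchy s\<close>, which lies between zero and one, the slope is
  \<open>cauchy s * (1 - 2 * y)\<close>.\<close>

lemma trunc'_le: "\<bar>trunc' s\<bar> \<le> 1"
proof -
  define y where "y = s\<^sup>2 * cauchy s"
  have y: "0 \<le> y" "y \<le> 1" using cauchy_square[of s] cauchy_pos[of s] by (auto simp: y_def)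
  have "trunc' s = cauchy s * (1 - 2 * y)" by (simp add: trunc'_def y_def power2_eq_square algebra_simps)
  moreover have "\<bar>cauchy s\<bar> * \<bar>1 - 2 * y\<bar> \<le> 1 * 1"
    using cauchy_pos[of s] cauchy_le_1[of s] y by (intro mult_mono) auto
  ultimately show ?thesis by (simp add: abs_mult)
qed

text \<open>14 = 8 + 6, as \<open>s * cauchy s\<close> and \<open>cauchy s\<close> are at most one
  in modulus.\<close>

lemma trunc''_le: "\<bar>trunc'' s\<bar> \<le> 14"
proof -
  have 1: "\<bar>s * cauchy s\<bar> \<le> 1" using cauchy_abs[of s] cauchy_pos[of s] by (simp add: abs_mult)
  have "trunc'' s = 8 * (s * cauchy s) ^ 3 - 6 * ((s * cauchy s) * cauchy s)"
    by (simp add: trunc''_def power_numeral_reduce algebra_simps)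
  moreover have "\<bar>s * cauchy s\<bar> ^ 3 \<le> 1" using 1 by (intro power_le_one) auto
  then have "\<bar>(s * cauchy s) ^ 3\<bar> \<le> 1" by (simp add: power_abs)
  moreover have "\<bar>s * cauchy s\<bar> * \<bar>cauchy s\<bar> \<le> 1 * 1" 
    using 1 cauchy_pos[of s] cauchy_le_1[of s] by (intro mult_mono) auto
  then have "\<bar>s * cauchy s * cauchy s\<bar> \<le> 1" by (simp add: abs_mult)
  ultimately show ?thesis by linarith
qed

text \<open>The setting of \<open>smoothed\<close> without noise. Second moments of \<open>X\<close>
  are added, to dominate the forces in the limit.\<close>

locale stationary_field = prob_space M for M :: "'w measure" +
  fixes N :: "'i::countable set" and X :: "'w \<Rightarrow> 'i \<Rightarrow> real"
    and J :: "'j set" and a :: "'j \<Rightarrow> 'i \<Rightarrow> real" and U :: "'j \<Rightarrow> 'w \<Rightarrow> real"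
  assumes fin: "finite N" and X_meas: "\<And>i. i \<in> N \<Longrightarrow> (\<lambda>\<omega>. X \<omega> i) \<in> borel_measurable M"
    and X2: "\<And>i. i \<in> N \<Longrightarrow> integrable M (\<lambda>\<omega>. (X \<omega> i)\<^sup>2)"
    and finJ: "finite J" and U_meas: "\<And>j. j \<in> J \<Longrightarrow> U j \<in> borel_measurable M"
    and U2: "\<And>j. j \<in> J \<Longrightarrow> integrable M (\<lambda>\<omega>. (U j \<omega>)\<^sup>2)"
    and stat: "\<And>F F1 F2. C1b N F F1 \<Longrightarrow> (\<And>i. C1b N (F1 i) (F2 i)) \<Longrightarrow>
      (\<Sum>j\<in>J. \<integral>\<omega>. (\<Sum>i\<in>N. \<Sum>k\<in>N. a j i * a j k * F2 i k (X \<omega>)) - U j \<omega> * (\<Sum>i\<in>N. a j i * F1 i (X \<omega>)) \<partial>M) = 0"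
begin

text \<open>Neither side of \<open>fisher_bound\<close> contains the density, so noise and
  truncation can be removed together. The left side converges because \<open>f\<close> and its
  derivatives are bounded; on the right side the linear growth of \<open>V1\<close> yields a square
  integrable majorant.\<close>

theorem dirichlet_bound:
  fixes V V1 V2 :: "real \<Rightarrow> real"
  assumes V: "\<And>t. (V has_real_derivative V1 t) (at t)" and V1: "\<And>t. (V1 has_real_derivative V2 t) (at t)"
    and V2: "continuous_on UNIV V2" and C1: "\<And>t. \<bar>V1 t\<bar> \<le> C * \<bar>t\<bar>" and C2: "\<And>t. \<bar>V2 t\<bar> \<le> C"
    and f: "\<And>j. j \<in> J \<Longrightarrow> C1b N (f j) (f1 j)" and f_le: "\<And>j w. j \<in> J \<Longrightarrow> \<bar>f j w\<bar> \<le> 1"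
  shows "(\<Sum>j\<in>J. (\<integral>\<omega>. (\<Sum>i\<in>N. a j i * f1 j i (X \<omega>)) - U j \<omega> * f j (X \<omega>) \<partial>M)\<^sup>2)
    \<le> 4 * (\<Sum>j\<in>J. \<integral>\<omega>. (U j \<omega> - (\<Sum>i\<in>N. a j i * V1 (X \<omega> i)))\<^sup>2 \<partial>M)"
proof -
  define Q where "Q = PiM N (\<lambda>_. noise)"
  define P where "P = M \<Otimes>\<^sub>M Q"
  define e where "e n = inverse (real (Suc n))" for n
  define R where "R n = real (Suc n)" for n
  define W where "W n p = (\<lambda>i\<in>N. X (fst p) i + e n * snd p i)" for n and p :: "'w \<times> ('i \<Rightarrow> real)"
  have e: "e n > 0" "e n \<le> 1" for n by (auto simp: e_def inverse_le_1_iff)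
  have R: "R n > 0" for n by (simp add: R_def)
  have e0: "e \<longlonglongrightarrow> 0" unfolding e_def[abs_def] by (rule LIMSEQ_inverse_real_of_nat)
  have R0: "(\<lambda>n. inverse (R n)) \<longlonglongrightarrow> 0" unfolding R_def by (rule LIMSEQ_inverse_real_of_nat)
  have C0: "0 \<le> C" using C2[of 0] by linarith
  \<comment> \<open>\<open>h1\<close> and \<open>h2\<close> are the first two derivatives of the
    truncated potential, whose sum over \<open>N\<close> serves as the energy
    \<open>H\<close>.\<close>
  define h1 where "h1 n t = V1 (trunc (R n) t) * trunc' (t / R n)" for n t
  define h2 where "h2 n t = V2 (trunc (R n) t) * (trunc' (t / R n))\<^sup>2 + V1 (trunc (R n) t) * trunc'' (t / R n) / R n" for n t
  define H1 where "H1 n i w = (if i \<in> N then h1 n (w i) else 0)" for n i and w :: "'i \<Rightarrow> real"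
  have cV: "continuous_on UNIV V" using V by (meson DERIV_continuous_on has_field_derivative_at_within)
  have cV1: "continuous_on UNIV V1" using V1 by (meson DERIV_continuous_on has_field_derivative_at_within)
  have h1d: "((\<lambda>t. V (trunc (R n) t)) has_real_derivative h1 n t) (at t)" for n t
    unfolding h1_def by (rule DERIV_chain2[OF V trunc_deriv[OF R]])
  have h2d: "(h1 n has_real_derivative h2 n t) (at t)" for n t
  proof -
    have d1: "((\<lambda>t. V1 (trunc (R n) t)) has_real_derivative V2 (trunc (R n) t) * trunc' (t / R n)) (at t)"
      by (rule DERIV_chain2[OF V1 trunc_deriv[OF R]])
    have d2: "((\<lambda>t. trunc' (t / R n)) has_real_derivative trunc'' (t / R n) * (1 / R n)) (at t)"
      by (intro DERIV_chain2[OF trunc'_deriv] DERIV_cdivide DERIV_ident)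
    show ?thesis unfolding h1_def[abs_def] h2_def
      using DERIV_mult[OF d1 d2] by (simp add: power2_eq_square algebra_simps)
  qed
  have ch1: "continuous_on UNIV (h1 n)" for n using h2d by (meson DERIV_continuous_on has_field_derivative_at_within)
  have div: "continuous_on UNIV (\<lambda>t. t / R n)" for n using R[of n] by (intro continuous_intros) auto
  have ch2: "continuous_on UNIV (h2 n)" for n
    unfolding h2_def[abs_def] using R[of n]
    by (intro continuous_intros continuous_on_compose2[OF V2 trunc_cont(1)] continuous_on_compose2[OF cV1 trunc_cont(1)]
        continuous_on_compose2[OF trunc_cont(2) div] continuous_on_compose2[OF trunc_cont(3) div]) auto
  have h0b: "\<exists>B. \<forall>t. \<bar>V (trunc (R n) t)\<bar> \<le> B" for n
  proof -
    have "compact (V ` {- R n..R n})" by (intro compact_continuous_image continuous_on_subset[OF cV]) auto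
    then have "bounded (V ` {- R n..R n})" by (rule compact_imp_bounded)
    then obtain B where B: "\<forall>x\<in>V ` {- R n..R n}. norm x \<le> B"
      unfolding bounded_iff by (rule exE)
    have B: "\<bar>V t\<bar> \<le> B" if "t \<in> {- R n..R n}" for t
      using bspec[OF B imageI[OF that]] by simp
    have "\<bar>V (trunc (R n) t)\<bar> \<le> B" for t using trunc_bounded[OF R[of n], of t] by (intro B) auto
    then show ?thesis by blast
  qed
  have h1_le: "\<bar>h1 n t\<bar> \<le> C * \<bar>t\<bar>" for n t
  proof -
    have "\<bar>V1 (trunc (R n) t)\<bar> \<le> C * \<bar>t\<bar>"
      using C1[of "trunc (R n) t"] mult_left_mono[OF trunc_le[of "R n" t] C0] by linarith
    then have "\<bar>V1 (trunc (R n) t)\<bar> * \<bar>trunc' (t / R n)\<bar> \<le> (C * \<bar>t\<bar>) * 1"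
      using trunc'_le C0 by (intro mult_mono) auto
    then show ?thesis by (simp add: h1_def abs_mult)
  qed
  have V1b: "\<bar>V1 (trunc (R n) t)\<bar> \<le> C * R n" for n t
    using C1[of "trunc (R n) t"] mult_left_mono[OF trunc_bounded[OF R[of n], of t] C0] by linarith
  have h1b: "\<bar>h1 n t\<bar> \<le> (C * R n) * 1" for n t
    unfolding h1_def abs_mult using V1b trunc'_le C0 R[of n] by (intro mult_mono) auto
  have h2b: "\<bar>h2 n t\<bar> \<le> C * 1 + (C * R n) * 14 / R n" for n t
  proof -
    have "\<bar>V2 (trunc (R n) t)\<bar> * \<bar>(trunc' (t / R n))\<^sup>2\<bar> \<le> C * 1"
      using C2 C0 trunc'_le[of "t / R n"] by (intro mult_mono) (auto simp: abs_square_le_1)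
    then have "\<bar>V2 (trunc (R n) t) * (trunc' (t / R n))\<^sup>2\<bar> \<le> C * 1"
      unfolding abs_mult .
    moreover have "\<bar>V1 (trunc (R n) t)\<bar> * \<bar>trunc'' (t / R n)\<bar> \<le> (C * R n) * 14"
      using V1b trunc''_le C0 R[of n] by (intro mult_mono) auto
    then have "\<bar>V1 (trunc (R n) t) * trunc'' (t / R n) / R n\<bar> \<le> (C * R n) * 14 / R n"
      using R[of n] by (simp add: abs_mult pos_divide_le_eq mult_ac)
    ultimately show ?thesis unfolding h2_def by linarith
  qed
  have H: "\<exists>H. C1b N H (H1 n)" for n
  proof -
    obtain B where B: "\<And>t. \<bar>V (trunc (R n) t)\<bar> \<le> B" using h0b by blast
    show ?thesis unfolding H1_def[abs_def] by (rule exI, rule C1b_coord_sum[OF fin h1d ch1 B h1b])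
  qed
  have H1: "\<exists>H2. \<forall>i. C1b N (H1 n i) (H2 i)" for n
  proof -
    have "\<exists>G. C1b N (H1 n i) G" for i
    proof (cases "i \<in> N")
      case True
      show ?thesis
        using C1b_coord[OF True h2d ch2 h1b h2b, of n] True unfolding H1_def[abs_def] by auto
    next
      case False
      then show ?thesis using C1b_zero unfolding H1_def[abs_def] by auto
    qed
    then show ?thesis by (rule choice[OF allI])
  qed
  have ineq: "(\<Sum>j\<in>J. (\<integral>p. (\<Sum>i\<in>N. a j i * f1 j i (W n p)) - U j (fst p) * f j (W n p) \<partial>P)\<^sup>2)
    \<le> 4 * (\<Sum>j\<in>J. \<integral>p. (U j (fst p) - (\<Sum>i\<in>N. a j i * H1 n i (W n p)))\<^sup>2 \<partial>P)" for n
  proof -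
    interpret s: smoothed M N X "e n" J a U
      by unfold_locales (use fin X_meas e finJ U_meas U2 stat in auto)
    obtain H where a1: "C1b N H (H1 n)" using H by blast
    obtain H2 where a2: "\<And>i. C1b N (H1 n i) (H2 i)" using H1 by blast
    have eqs: "s.P = P" "s.W = W n"
      by (auto simp: s.P_def P_def s.Q_def Q_def s.W_def W_def fun_eq_iff)
    show ?thesis
      by (rule s.fisher_bound[OF a1 a2, where f=f and ?f1.0=f1, unfolded s.D_def eqs])
         (fact f, fact f_le)
  qed
  \<comment> \<open>The width 1 is arbitrary: this instance only supplies facts about
    \<open>P\<close>, which does not depend on the width.\<close>
  interpret s: smoothed M N X 1 J a U
    by unfold_locales (use fin X_meas finJ U_meas U2 stat in auto)
  have sP: "s.P = P" by (simp add: s.P_def P_def s.Q_def Q_def)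
  have dfst: "distr P M fst = M"
    unfolding sP[symmetric] s.P_def by (rule prob_space.distr_pair_fst[OF s.Q_prob])
  have fstm: "fst \<in> measurable P M" using s.fst_meas unfolding sP .
  have sndm: "snd \<in> measurable P Q" unfolding P_def by simp
  have UP: "(\<lambda>p. U j (fst p)) \<in> borel_measurable P" "integrable P (\<lambda>p. U j (fst p))" "integrable P (\<lambda>p. (U j (fst p))\<^sup>2)" if "j \<in> J" for j
    using s.U_P[OF that] measurable_compose[OF fstm U_meas[OF that]] unfolding sP by auto
  have Xm: "(\<lambda>p. X (fst p) i) \<in> borel_measurable P" if "i \<in> N" for i
    by (rule measurable_compose[OF fstm X_meas[OF that]])
  have X2P: "integrable P (\<lambda>p. (X (fst p) i)\<^sup>2)" if "i \<in> N" for i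
    by (rule integrable_distr[OF fstm, where f="\<lambda>\<omega>. (X \<omega> i)\<^sup>2"], unfold dfst, rule X2[OF that])
  have Zm: "(\<lambda>p. snd p i) \<in> borel_measurable P" for i
    using measurable_compose[OF sndm, of "\<lambda>z. z i" borel] s.Q_component unfolding s.Q_def Q_def by simp
  have Z2P: "integrable P (\<lambda>p. (snd p i)\<^sup>2)" if i: "i \<in> N" for i
  proof -
    have "distr Q noise (\<lambda>z. z i) = noise"
      unfolding Q_def by (rule distr_PiM_component[OF prob_space_noise i])
    then have "integrable Q (\<lambda>z. (z i)\<^sup>2)"
      using integrable_distr[of "\<lambda>z. z i" Q noise "\<lambda>t. t\<^sup>2"] noise_second_moment i unfolding Q_def by simp
    moreover have "distr P Q snd = Q"
      unfolding P_def Q_def by (rule distr_pair_snd) (use s.Q_prob prob_space_axioms in \<open>auto simp: s.Q_def\<close>)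
    ultimately show ?thesis
      using integrable_distr[OF sndm, of "\<lambda>z. (z i)\<^sup>2"] by simp
  qed
  have Wm: "W n \<in> borel_measurable P" for n
  proof (rule borel_fun_measurableI)
    fix i
    show "(\<lambda>p. W n p i) \<in> borel_measurable P"
    proof (cases "i \<in> N")
      case True
      have "(\<lambda>p. X (fst p) i + e n * snd p i) \<in> borel_measurable P"
        using Xm[OF True] Zm[of i] by measurable
      then show ?thesis using True by (simp add: W_def)
    qed (simp add: W_def)
  qed
  \<comment> \<open>The limit of \<open>W n\<close>. Off \<open>N\<close> both are
    \<open>undefined\<close>, so convergence holds in every coordinate.\<close>
  define X' where "X' p = (\<lambda>i\<in>N. X (fst p) i)" for p :: "'w \<times> ('i \<Rightarrow> real)"
  have lim: "(\<lambda>n. W n p) \<longlonglongrightarrow> X' p" for p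
  proof (rule tendsto_coordinatewiseI)
    fix i
    have "(\<lambda>n. X (fst p) i + e n * snd p i) \<longlonglongrightarrow> X (fst p) i + 0 * snd p i"
      by (intro tendsto_intros e0)
    then show "(\<lambda>n. W n p i) \<longlonglongrightarrow> X' p i" by (cases "i \<in> N") (simp_all add: W_def X'_def)
  qed
  have L: "(\<lambda>n. \<Sum>j\<in>J. (\<integral>p. (\<Sum>i\<in>N. a j i * f1 j i (W n p)) - U j (fst p) * f j (W n p) \<partial>P)\<^sup>2)
    \<longlonglongrightarrow> (\<Sum>j\<in>J. (\<integral>p. (\<Sum>i\<in>N. a j i * f1 j i (X' p)) - U j (fst p) * f j (X' p) \<partial>P)\<^sup>2)"
  proof (intro tendsto_sum tendsto_power)
    fix j assume j: "j \<in> J"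
    have m0: "f j \<in> borel_measurable borel" "f1 j i \<in> borel_measurable borel" for i
      using C1b_cont[OF f[OF j]] C1b_cont1[OF f[OF j]] by (auto intro: borel_measurable_continuous_onI)
    have m: "(\<lambda>p. (\<Sum>i\<in>N. a j i * f1 j i (w p)) - U j (fst p) * f j (w p)) \<in> borel_measurable P"
      if "w \<in> borel_measurable P" for w
      by (intro borel_measurable_diff borel_measurable_sum borel_measurable_times borel_measurable_const
          measurable_compose[OF that m0(1)] measurable_compose[OF that m0(2)] UP(1)[OF j])
    obtain B where B: "\<And>w. \<bar>\<Sum>i\<in>N. a j i * f1 j i w\<bar> \<le> B"
      using C1b_sum_bounded[OF fin, of "f1 j" "a j"] C1b_bounded1[OF f[OF j]] by blast
    show "(\<lambda>n. \<integral>p. (\<Sum>i\<in>N. a j i * f1 j i (W n p)) - U j (fst p) * f j (W n p) \<partial>P)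
      \<longlonglongrightarrow> (\<integral>p. (\<Sum>i\<in>N. a j i * f1 j i (X' p)) - U j (fst p) * f j (X' p) \<partial>P)"
    proof (rule integral_dominated_convergence[where w="\<lambda>p. B + \<bar>U j (fst p)\<bar>"])
      show "integrable P (\<lambda>p. B + \<bar>U j (fst p)\<bar>)"
        using UP(2)[OF j] s.P.finite_measure_axioms unfolding sP by (auto intro!: finite_measure.integrable_const)
      show "AE p in P. (\<lambda>n. (\<Sum>i\<in>N. a j i * f1 j i (W n p)) - U j (fst p) * f j (W n p))
        \<longlonglongrightarrow> (\<Sum>i\<in>N. a j i * f1 j i (X' p)) - U j (fst p) * f j (X' p)"
        by (intro AE_I2 tendsto_intros continuous_on_tendsto_compose[OF C1b_cont1[OF f[OF j]] lim]
            continuous_on_tendsto_compose[OF C1b_cont[OF f[OF j]] lim]) auto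
      show "AE p in P. norm ((\<Sum>i\<in>N. a j i * f1 j i (W n p)) - U j (fst p) * f j (W n p)) \<le> B + \<bar>U j (fst p)\<bar>" for n
      proof (rule AE_I2)
        fix p
        have "\<bar>U j (fst p) * f j (W n p)\<bar> \<le> \<bar>U j (fst p)\<bar>"
          using mult_left_mono[OF f_le[OF j, of "W n p"], of "\<bar>U j (fst p)\<bar>"] by (simp add: abs_mult)
        then show "norm ((\<Sum>i\<in>N. a j i * f1 j i (W n p)) - U j (fst p) * f j (W n p)) \<le> B + \<bar>U j (fst p)\<bar>"
          using B[of "W n p"] unfolding real_norm_def by linarith
      qed
      show "(\<lambda>p. (\<Sum>i\<in>N. a j i * f1 j i (W n p)) - U j (fst p) * f j (W n p)) \<in> borel_measurable P" for n
        by (rule m[OF Wm])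
      show "(\<lambda>p. (\<Sum>i\<in>N. a j i * f1 j i (X' p)) - U j (fst p) * f j (X' p)) \<in> borel_measurable P"
        unfolding X'_def by (rule m) (rule measurable_compose[OF fstm s.X_meas'])
    qed
  qed
  have L': "(\<integral>p. (\<Sum>i\<in>N. a j i * f1 j i (X' p)) - U j (fst p) * f j (X' p) \<partial>P)
     = (\<integral>\<omega>. (\<Sum>i\<in>N. a j i * f1 j i (X \<omega>)) - U j \<omega> * f j (X \<omega>) \<partial>M)" if j: "j \<in> J" for j
  proof -
    have eq: "f1 j i (X' p) = f1 j i (\<lambda>i\<in>N. X (fst p) i)" "f j (X' p) = f j (\<lambda>i\<in>N. X (fst p) i)" 
      "f1 j i (X \<omega>) = f1 j i (\<lambda>i\<in>N. X \<omega> i)" "f j (X \<omega>) = f j (\<lambda>i\<in>N. X \<omega> i)" for i p \<omega>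
      by (simp_all only: X'_def) (rule C1b_local1[OF f[OF j]] C1b_local[OF f[OF j]], simp)+
    have m0: "f j \<in> borel_measurable borel" "f1 j i \<in> borel_measurable borel" for i
      using C1b_cont[OF f[OF j]] C1b_cont1[OF f[OF j]] by (auto intro: borel_measurable_continuous_onI)
    have xm: "(\<lambda>\<omega>. \<lambda>i\<in>N. X \<omega> i) \<in> borel_measurable M" by (rule s.X_meas')
    have m: "(\<lambda>\<omega>. (\<Sum>i\<in>N. a j i * f1 j i (\<lambda>i\<in>N. X \<omega> i)) - U j \<omega> * f j (\<lambda>i\<in>N. X \<omega> i)) \<in> borel_measurable M"
      by (intro borel_measurable_diff borel_measurable_sum borel_measurable_times borel_measurable_const
          measurable_compose[OF xm m0(1)] measurable_compose[OF xm m0(2)] U_meas[OF j])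
    show ?thesis unfolding eq using integral_distr[OF fstm m] unfolding dfst by simp
  qed
  have r: "(\<lambda>n. \<Sum>j\<in>J. \<integral>p. (U j (fst p) - (\<Sum>i\<in>N. a j i * H1 n i (W n p)))\<^sup>2 \<partial>P)
    \<longlonglongrightarrow> (\<Sum>j\<in>J. \<integral>p. (U j (fst p) - (\<Sum>i\<in>N. a j i * V1 (X (fst p) i)))\<^sup>2 \<partial>P)"
  proof (rule tendsto_sum)
    fix j assume j: "j \<in> J"
    have V1m: "V1 \<in> borel_measurable borel" using cV1 by (rule borel_measurable_continuous_onI)
    \<comment> \<open>A majorant independent of \<open>n\<close>: the width \<open>e n\<close> is at
      most one, and \<open>h1_le\<close> bounds the truncated force.\<close>
    define G where "G p = \<bar>U j (fst p)\<bar> + (\<Sum>i\<in>N. \<bar>a j i\<bar> * C * (\<bar>X (fst p) i\<bar> + \<bar>snd p i\<bar>))" for p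
    have Gm: "(\<lambda>p. \<bar>a j i\<bar> * C * (\<bar>X (fst p) i\<bar> + \<bar>snd p i\<bar>)) \<in> borel_measurable P" if "i \<in> N" for i
      by (intro borel_measurable_times borel_measurable_const borel_measurable_add borel_measurable_abs Xm[OF that] Zm)
    have G2: "integrable P (\<lambda>p. (G p)\<^sup>2)"
      unfolding G_def
    proof (intro square_integrable_add square_integrable_sum fin)
      fix i assume i: "i \<in> N"
      have "integrable P (\<lambda>p. (\<bar>X (fst p) i\<bar> + \<bar>snd p i\<bar>)\<^sup>2)"
        by (intro square_integrable_add borel_measurable_abs Xm[OF i] Zm) (use X2P[OF i] Z2P[OF i] in auto)
      then show "integrable P (\<lambda>p. (\<bar>a j i\<bar> * C * (\<bar>X (fst p) i\<bar> + \<bar>snd p i\<bar>))\<^sup>2)"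
        unfolding power_mult_distrib by (intro integrable_mult_right)
    qed (use Gm UP[OF j] in \<open>auto intro!: borel_measurable_sum\<close>)
    show "(\<lambda>n. \<integral>p. (U j (fst p) - (\<Sum>i\<in>N. a j i * H1 n i (W n p)))\<^sup>2 \<partial>P)
      \<longlonglongrightarrow> (\<integral>p. (U j (fst p) - (\<Sum>i\<in>N. a j i * V1 (X (fst p) i)))\<^sup>2 \<partial>P)"
    proof (rule integral_dominated_convergence[OF _ _ G2])
      show "(\<lambda>p. (U j (fst p) - (\<Sum>i\<in>N. a j i * V1 (X (fst p) i)))\<^sup>2) \<in> borel_measurable P"
        by (intro borel_measurable_power borel_measurable_diff UP(1)[OF j] borel_measurable_sum borel_measurable_times
            borel_measurable_const measurable_compose[OF Xm V1m])
      have H1m: "H1 n i \<in> borel_measurable borel" for n i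
      proof -
        obtain H2 where "\<And>i. C1b N (H1 n i) (H2 i)" using H1 by blast
        then show ?thesis by (rule borel_measurable_continuous_onI[OF C1b_cont])
      qed
      show "(\<lambda>p. (U j (fst p) - (\<Sum>i\<in>N. a j i * H1 n i (W n p)))\<^sup>2) \<in> borel_measurable P" for n
        by (intro borel_measurable_power borel_measurable_diff UP(1)[OF j] borel_measurable_sum borel_measurable_times
            borel_measurable_const measurable_compose[OF Wm H1m])
      show "AE p in P. (\<lambda>n. (U j (fst p) - (\<Sum>i\<in>N. a j i * H1 n i (W n p)))\<^sup>2) \<longlonglongrightarrow> (U j (fst p) - (\<Sum>i\<in>N. a j i * V1 (X (fst p) i)))\<^sup>2"
      proof (intro AE_I2 tendsto_intros)
        fix p i assume i: "i \<in> N"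
        have w: "(\<lambda>n. W n p i) \<longlonglongrightarrow> X (fst p) i" using tendsto_coordinateD[OF lim, of p i] i by (simp add: X'_def)
        have s: "(\<lambda>n. W n p i / R n) \<longlonglongrightarrow> 0" using tendsto_mult[OF w R0] by (simp add: divide_inverse)
        have cc: "continuous_on UNIV cauchy" using cauchy_cont[OF continuous_on_id] .
        have "(\<lambda>n. cauchy (W n p i / R n)) \<longlonglongrightarrow> cauchy 0" by (rule continuous_on_tendsto_compose[OF cc s]) auto
        then have t: "(\<lambda>n. trunc (R n) (W n p i)) \<longlonglongrightarrow> X (fst p) i"
          unfolding trunc_def using tendsto_mult[OF w, of "\<lambda>n. cauchy (W n p i / R n)" "cauchy 0"] by (simp add: cauchy_def)
        have "(\<lambda>n. trunc' (W n p i / R n)) \<longlonglongrightarrow> trunc' 0" by (rule continuous_on_tendsto_compose[OF trunc_cont(2) s]) auto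
        then have "(\<lambda>n. h1 n (W n p i)) \<longlonglongrightarrow> V1 (X (fst p) i) * trunc' 0"
          unfolding h1_def by (intro tendsto_mult continuous_on_tendsto_compose[OF cV1 t]) auto
        then show "(\<lambda>n. H1 n i (W n p)) \<longlonglongrightarrow> V1 (X (fst p) i)"
          using i by (simp add: H1_def trunc'_def cauchy_def)
      qed
      show "AE p in P. norm ((U j (fst p) - (\<Sum>i\<in>N. a j i * H1 n i (W n p)))\<^sup>2) \<le> (G p)\<^sup>2" for n
      proof (rule AE_I2)
        fix p
        have "\<bar>\<Sum>i\<in>N. a j i * H1 n i (W n p)\<bar> \<le> (\<Sum>i\<in>N. \<bar>a j i * H1 n i (W n p)\<bar>)" by (rule sum_abs)
        also have "\<dots> \<le> (\<Sum>i\<in>N. \<bar>a j i\<bar> * C * (\<bar>X (fst p) i\<bar> + \<bar>snd p i\<bar>))"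
        proof (rule sum_mono)
          fix i assume i: "i \<in> N"
          have "\<bar>e n * snd p i\<bar> \<le> \<bar>snd p i\<bar>"
            using e[of n] mult_right_mono[of "e n" 1 "\<bar>snd p i\<bar>"] by (simp add: abs_mult)
          then have "\<bar>W n p i\<bar> \<le> \<bar>X (fst p) i\<bar> + \<bar>snd p i\<bar>" using i unfolding W_def by simp
          then have "C * \<bar>W n p i\<bar> \<le> C * (\<bar>X (fst p) i\<bar> + \<bar>snd p i\<bar>)" using C0 by (rule mult_left_mono)
          then have "\<bar>H1 n i (W n p)\<bar> \<le> C * (\<bar>X (fst p) i\<bar> + \<bar>snd p i\<bar>)"
            using h1_le[of n "W n p i"] i by (simp add: H1_def)
          then have "\<bar>a j i\<bar> * \<bar>H1 n i (W n p)\<bar> \<le> \<bar>a j i\<bar> * (C * (\<bar>X (fst p) i\<bar> + \<bar>snd p i\<bar>))"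
            by (rule mult_left_mono) simp
          then show "\<bar>a j i * H1 n i (W n p)\<bar> \<le> \<bar>a j i\<bar> * C * (\<bar>X (fst p) i\<bar> + \<bar>snd p i\<bar>)"
            by (simp add: abs_mult mult.assoc)
        qed
        finally have "\<bar>U j (fst p) - (\<Sum>i\<in>N. a j i * H1 n i (W n p))\<bar> \<le> \<bar>G p\<bar>"
          unfolding G_def by linarith
        then show "norm ((U j (fst p) - (\<Sum>i\<in>N. a j i * H1 n i (W n p)))\<^sup>2) \<le> (G p)\<^sup>2"
          by (simp add: abs_le_square_iff)
      qed
    qed
  qed
  have r': "(\<integral>p. (U j (fst p) - (\<Sum>i\<in>N. a j i * V1 (X (fst p) i)))\<^sup>2 \<partial>P)
    = (\<integral>\<omega>. (U j \<omega> - (\<Sum>i\<in>N. a j i * V1 (X \<omega> i)))\<^sup>2 \<partial>M)" if j: "j \<in> J" for j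
  proof -
    have V1m: "V1 \<in> borel_measurable borel" using cV1 by (rule borel_measurable_continuous_onI)
    have "(\<lambda>\<omega>. (U j \<omega> - (\<Sum>i\<in>N. a j i * V1 (X \<omega> i)))\<^sup>2) \<in> borel_measurable M"
      by (intro borel_measurable_power borel_measurable_diff U_meas[OF j] borel_measurable_sum borel_measurable_times
            borel_measurable_const measurable_compose[OF X_meas V1m])
    from integral_distr[OF fstm this] show ?thesis unfolding dfst by simp
  qed
  have "(\<Sum>j\<in>J. (\<integral>p. (\<Sum>i\<in>N. a j i * f1 j i (X' p)) - U j (fst p) * f j (X' p) \<partial>P)\<^sup>2)
    \<le> 4 * (\<Sum>j\<in>J. \<integral>p. (U j (fst p) - (\<Sum>i\<in>N. a j i * V1 (X (fst p) i)))\<^sup>2 \<partial>P)"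
    by (rule LIMSEQ_le[OF L tendsto_mult[OF tendsto_const r]]) (use ineq in auto)
  then show ?thesis by (simp add: L' r')
qed

end

section \<open>Lattice edges and divergence\<close>

text \<open>Every unoriented edge is represented once, by its lower end and its axis; this gives one
  free real variable per edge in place of two opposite ones.\<close>

definition pb :: "('d::finite) site \<times> 'd \<Rightarrow> 'd bond" where
  "pb p = (fst p, fst p + axis (snd p) 1)"

abbreviation rb :: "('d::finite) site \<times> 'd \<Rightarrow> 'd bond" where "rb p \<equiv> rev_bond (pb p)"

lemma axis_square_sum: "(\<Sum>j\<in>UNIV. ((axis i (1::int) :: int ^ 'd::finite) $ j)\<^sup>2) = 1"
proof -
  have "(\<Sum>j\<in>UNIV. ((axis i (1::int) :: int ^ 'd) $ j)\<^sup>2) = (\<Sum>j\<in>UNIV. if j = i then 1 else 0)"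
    by (intro sum.cong) (auto simp: axis_def)
  then show ?thesis by simp
qed

lemma pb_bonds [simp]:
  fixes p :: "('d::finite) site \<times> 'd"
  shows "pb p \<in> bonds" "rb p \<in> bonds"
proof -
  show "rb p \<in> bonds" using axis_square_sum[of "snd p"] by (simp add: bonds_def pb_def)
  have "(\<Sum>j\<in>UNIV. (- ((axis (snd p) (1::int) :: int ^ 'd) $ j))\<^sup>2) = 1"
    using axis_square_sum[of "snd p"] by simp
  then show "pb p \<in> bonds" by (simp add: bonds_def pb_def)
qed

text \<open>A sum of integer squares that equals one has a single non-zero term.\<close>

lemma unit_vector_cases:
  fixes d :: "int ^ 'd::finite"
  assumes "(\<Sum>i\<in>UNIV. (d $ i)\<^sup>2) = 1"
  obtains i where "d = axis i 1" | i where "d = - axis i 1"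
proof -
  have "\<exists>i. d $ i \<noteq> 0"
  proof (rule ccontr)
    assume "\<nexists>i. d $ i \<noteq> 0"
    then have "(\<Sum>i\<in>UNIV. (d $ i)\<^sup>2) = 0" by simp
    with assms show False by simp
  qed
  then obtain i where i: "d $ i \<noteq> 0" by blast
  have s: "(\<Sum>i\<in>UNIV. (d $ i)\<^sup>2) = (d $ i)\<^sup>2 + (\<Sum>j\<in>UNIV - {i}. (d $ j)\<^sup>2)"
    by (rule sum.remove) auto
  have r0: "0 \<le> (\<Sum>j\<in>UNIV - {i}. (d $ j)\<^sup>2)" by (intro sum_nonneg) auto
  have "(d $ i)\<^sup>2 > 0" using i by simp
  then have 1: "(d $ i)\<^sup>2 = 1" "(\<Sum>j\<in>UNIV - {i}. (d $ j)\<^sup>2) = 0" using s r0 assms by linarith+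
  have z: "d $ j = 0" if "j \<noteq> i" for j
    using 1(2) that by (subst (asm) sum_nonneg_eq_0_iff) auto
  from 1(1) have "d $ i = 1 \<or> d $ i = -1" by (simp add: power2_eq_1_iff)
  then show ?thesis
  proof
    assume "d $ i = 1"
    then have "d = axis i 1" using z by (auto simp: vec_eq_iff axis_def)
    then show ?thesis by (rule that(1))
  next
    assume "d $ i = -1"
    then have "d = - axis i 1" using z by (auto simp: vec_eq_iff axis_def)
    then show ?thesis by (rule that(2))
  qed
qed

lemma bond_cases:
  assumes "b \<in> bonds"
  obtains p where "b = pb p" | p where "b = rb p"
proof -
  obtain x y where b: "b = (x, y)" by (cases b)
  have "(\<Sum>i\<in>UNIV. ((x - y) $ i)\<^sup>2) = 1" using assms by (simp add: bonds_def b)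
  then show ?thesis
  proof (cases rule: unit_vector_cases)
    case (1 i)
    then have "x = y + axis i 1" by (metis add.commute diff_add_cancel)
    then have "b = rb (y, i)" by (simp add: b pb_def)
    then show ?thesis by (rule that(2))
  next
    case (2 i)
    then have "y = x + axis i 1" by (metis add.commute diff_add_cancel diff_minus_eq_add minus_diff_eq)
    then have "b = pb (x, i)" by (simp add: b pb_def)
    then show ?thesis by (rule that(1))
  qed
qed

lemma axis_1_inj: "(axis i 1 :: int ^ 'd::finite) = axis j 1 \<longleftrightarrow> i = j"
  by (simp add: axis_eq_axis)

lemma pb_inj: "pb p = pb q \<longleftrightarrow> p = q"
  by (cases p, cases q) (auto simp: pb_def axis_1_inj)

lemma pb_neq_rb:
  fixes p :: "('d::finite) site \<times> 'd"
  shows "pb p \<noteq> rb q"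
proof
  assume "pb p = rb q"
  then have "axis (snd p) 1 + axis (snd q) 1 = (0 :: int ^ 'd)"
    by (auto simp: pb_def add.commute)
  then have "(axis (snd p) 1 + axis (snd q) 1 :: int ^ 'd) $ snd p = 0" by simp
  then show False by (auto simp: axis_def split: if_splits)
qed

lemma rb_neq_pb: "rb p \<noteq> pb q"
  using pb_neq_rb by metis

lemma rb_inj: "rb p = rb q \<longleftrightarrow> p = q"
  using pb_inj[of p q] by (metis prod.collapse prod.inject)

lemma rev_bond_bonds: "b \<in> bonds \<Longrightarrow> rev_bond b \<in> bonds"
  by (erule bond_cases) simp_all

lemma star_sum:
  fixes g :: "('d::finite) bond \<Rightarrow> real"
  shows "(\<Sum>b\<in>{b \<in> bonds. fst b = x}. g b) = (\<Sum>i\<in>UNIV. g (pb (x, i)) + g (rb (x - axis i 1, i)))"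
proof -
  let ?A = "(\<lambda>i. pb (x, i)) ` UNIV" and ?B = "(\<lambda>i. rb (x - axis i 1, i)) ` UNIV"
  have "{b \<in> bonds. fst b = x} = ?A \<union> ?B"
  proof (intro equalityI subsetI)
    fix b assume "b \<in> {b \<in> bonds. fst b = x}"
    then have b: "b \<in> bonds" "fst b = x" by auto
    from b(1) show "b \<in> ?A \<union> ?B"
    proof (cases rule: bond_cases)
      case (1 p)
      then have "b = pb (x, snd p)" using b(2) by (simp add: pb_def)
      then show ?thesis by blast
    next
      case (2 p)
      then have "fst p = x - axis (snd p) 1" using b(2) by (auto simp: pb_def)
      then have "b = rb (x - axis (snd p) 1, snd p)" using 2 by (cases p) simp
      then show ?thesis by blast
    qed
  next
    fix b assume "b \<in> ?A \<union> ?B"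
    then consider i where "b = pb (x, i)" | i where "b = rb (x - axis i 1, i)" by blast
    then show "b \<in> {b \<in> bonds. fst b = x}"
    proof cases
      case (1 i)
      then have "b \<in> bonds" by (simp only: pb_bonds)
      moreover have "fst b = x" by (simp add: 1 pb_def)
      ultimately show ?thesis by simp
    next
      case (2 i)
      then have "b \<in> bonds" by (simp only: pb_bonds)
      moreover have "fst b = x" by (simp add: 2 pb_def)
      ultimately show ?thesis by simp
    qed
  qed
  moreover have "?A \<inter> ?B = {}" using pb_neq_rb by blast
  ultimately have "(\<Sum>b\<in>{b \<in> bonds. fst b = x}. g b) = sum g ?A + sum g ?B"
    by (simp add: sum.union_disjoint)
  also have "sum g ?A = (\<Sum>i\<in>UNIV. g (pb (x, i)))"
    by (subst sum.reindex) (auto simp: inj_on_def pb_inj)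
  also have "sum g ?B = (\<Sum>i\<in>UNIV. g (rb (x - axis i 1, i)))"
    by (subst sum.reindex) (auto simp: inj_on_def rb_inj simp del: prod.inject)
  finally show ?thesis by (simp add: sum.distrib)
qed

text \<open>The lattice divergence. By the chain rule, the derivative in the height at
  \<open>x\<close> of a function of the edge gradients is the divergence of its partial derivatives:
  edges starting at \<open>x\<close> count positively, those ending there negatively.\<close>

definition dvg :: "('d::finite) site \<Rightarrow> ('d site \<times> 'd \<Rightarrow> real) \<Rightarrow> real" where
  "dvg x g = (\<Sum>i\<in>UNIV. g (x, i) - g (x - axis i 1, i))"

text \<open>The derivative of the gradient on the edge \<open>p\<close> in the height at
  \<open>x\<close>. These numbers are substituted for the coefficients \<open>a\<close>.\<close>

definition inc :: "('d::finite) site \<Rightarrow> 'd site \<times> 'd \<Rightarrow> real" where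
  "inc x p = (if fst p = x then 1 else 0) - (if fst p + axis (snd p) 1 = x then 1 else 0)"

lemma dvg_eq_sum:
  assumes N: "finite N" and g: "\<And>p. p \<notin> N \<Longrightarrow> g p = 0"
  shows "(\<Sum>p\<in>N. inc x p * g p) = dvg x g"
proof -
  let ?A = "(\<lambda>i. (x, i)) ` UNIV" and ?B = "(\<lambda>i. (x - axis i 1, i)) ` UNIV"
  have "(\<Sum>p\<in>N. inc x p * g p) = (\<Sum>p\<in>N. if fst p = x then g p else 0) - (\<Sum>p\<in>N. if fst p + axis (snd p) 1 = x then g p else 0)"
    unfolding sum_subtractf[symmetric] inc_def by (intro sum.cong) auto
  also have "(\<Sum>p\<in>N. if fst p = x then g p else 0) = (\<Sum>p\<in>?A. g p)"
    using N g by (intro sum.mono_neutral_cong) auto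
  also have "\<dots> = (\<Sum>i\<in>UNIV. g (x, i))" by (subst sum.reindex) (auto simp: inj_on_def)
  also have "(\<Sum>p\<in>N. if fst p + axis (snd p) 1 = x then g p else 0) = (\<Sum>p\<in>?B. g p)"
  proof (intro sum.mono_neutral_cong)
    fix p assume "p \<in> N - ?B"
    moreover have "p = (x - axis (snd p) 1, snd p)" if "fst p + axis (snd p) 1 = x"
      using that by (cases p) auto
    ultimately show "(if fst p + axis (snd p) 1 = x then g p else 0) = 0" by auto
  qed (use N g in auto)
  also have "\<dots> = (\<Sum>i\<in>UNIV. g (x - axis i 1, i))" by (subst sum.reindex) (auto simp: inj_on_def)
  finally show ?thesis by (simp add: dvg_def sum_subtractf)
qed

section \<open>Test functions of the odd part, and the generator\<close>

definition coords :: "(('d::finite) bond \<Rightarrow> real) \<Rightarrow> 'd site \<times> 'd \<Rightarrow> real" where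
  "coords \<eta> p = \<eta> (pb p)"

text \<open>Dividing by two enforces the odd convention and has no effect on gradient fields.\<close>

definition oddpart :: "(('d::finite) bond \<Rightarrow> real) \<Rightarrow> 'd site \<times> 'd \<Rightarrow> real" where
  "oddpart \<eta> p = (\<eta> (pb p) - \<eta> (rb p)) / 2"

lemma grad_odd: "\<eta> \<in> gradient_fields \<Longrightarrow> b \<in> bonds \<Longrightarrow> \<eta> (rev_bond b) = - \<eta> b"
  using rev_bond_bonds[of b] by (auto simp: gradient_fields_def grad_def)

lemma oddpart_grad: "\<eta> \<in> gradient_fields \<Longrightarrow> oddpart \<eta> = coords \<eta>"
  using grad_odd[of \<eta> "pb _"] by (auto simp: oddpart_def coords_def fun_eq_iff)

lemma oddpart_upd_pb: "oddpart (\<eta>(pb p := t)) = (oddpart \<eta>)(p := (t - \<eta> (rb p)) / 2)"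
  by (auto simp: oddpart_def fun_eq_iff pb_inj rb_neq_pb simp del: prod.inject split_paired_All)

lemma oddpart_upd_rb: "oddpart (\<eta>(rb p := t)) = (oddpart \<eta>)(p := (\<eta> (pb p) - t) / 2)"
proof -
  have "rb q = rb p \<longleftrightarrow> q = p" "pb q \<noteq> rb p" for q by (rule rb_inj, rule pb_neq_rb)
  then show ?thesis by (intro ext) (simp only: oddpart_def fun_upd_apply, auto)
qed

lemma oddpart_cont: "continuous_on UNIV oddpart"
  unfolding oddpart_def[abs_def]
  by (intro continuous_on_coordinatewise_then_product continuous_intros continuous_on_product_coordinates) auto

lemma oddpart_deriv_pb:
  assumes F: "C1b N F F1"
  shows "((\<lambda>t. F (oddpart (\<eta>(pb p := t)))) has_real_derivative F1 p (oddpart \<eta>) / 2) (at (\<eta> (pb p)))"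
proof -
  have "((\<lambda>t. F ((oddpart \<eta>)(p := (t - \<eta> (rb p)) / 2))) has_real_derivative F1 p (oddpart \<eta>) * (1 / 2)) (at (\<eta> (pb p)))"
  proof (rule DERIV_chain2[where g="\<lambda>t. (t - \<eta> (rb p)) / 2"])
    show "((\<lambda>t. F ((oddpart \<eta>)(p := t))) has_real_derivative F1 p (oddpart \<eta>)) (at ((\<eta> (pb p) - \<eta> (rb p)) / 2))"
      using C1b_deriv[OF F, of "oddpart \<eta>" p] by (simp add: oddpart_def)
  qed (auto intro!: derivative_eq_intros)
  then show ?thesis unfolding oddpart_upd_pb by simp
qed

lemma oddpart_deriv_rb:
  assumes F: "C1b N F F1"
  shows "((\<lambda>t. F (oddpart (\<eta>(rb p := t)))) has_real_derivative - (F1 p (oddpart \<eta>) / 2)) (at (\<eta> (rb p)))"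
proof -
  have "((\<lambda>t. F ((oddpart \<eta>)(p := (\<eta> (pb p) - t) / 2))) has_real_derivative F1 p (oddpart \<eta>) * (- 1 / 2)) (at (\<eta> (rb p)))"
  proof (rule DERIV_chain2[where g="\<lambda>t. (\<eta> (pb p) - t) / 2"])
    show "((\<lambda>t. F ((oddpart \<eta>)(p := t))) has_real_derivative F1 p (oddpart \<eta>)) (at ((\<eta> (pb p) - \<eta> (rb p)) / 2))"
      using C1b_deriv[OF F, of "oddpart \<eta>" p] by (simp add: oddpart_def)
  qed (auto intro!: derivative_eq_intros)
  then show ?thesis unfolding oddpart_upd_rb by simp
qed

lemma pd_oddpart:
  assumes F: "C1b N F F1"
  shows "pd (pb p) (\<lambda>\<eta>. F (oddpart \<eta>)) = (\<lambda>\<eta>. F1 p (oddpart \<eta>) / 2)"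
    and "pd (rb p) (\<lambda>\<eta>. F (oddpart \<eta>)) = (\<lambda>\<eta>. - (F1 p (oddpart \<eta>) / 2))"
proof -
  show "pd (pb p) (\<lambda>\<eta>. F (oddpart \<eta>)) = (\<lambda>\<eta>. F1 p (oddpart \<eta>) / 2)"
  proof (rule ext)
    show "pd (pb p) (\<lambda>\<eta>. F (oddpart \<eta>)) \<eta> = F1 p (oddpart \<eta>) / 2" for \<eta>
      unfolding pd_def by (rule DERIV_imp_deriv) (use oddpart_deriv_pb[OF F] in simp)
  qed
  show "pd (rb p) (\<lambda>\<eta>. F (oddpart \<eta>)) = (\<lambda>\<eta>. - (F1 p (oddpart \<eta>) / 2))"
  proof (rule ext)
    show "pd (rb p) (\<lambda>\<eta>. F (oddpart \<eta>)) \<eta> = - (F1 p (oddpart \<eta>) / 2)" for \<eta>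
      unfolding pd_def by (rule DERIV_imp_deriv) (use oddpart_deriv_rb[OF F] in simp)
  qed
qed

lemma pd_cmult_oddpart:
  assumes F: "C1b N F F1"
  shows "pd (pb p) (\<lambda>\<eta>. F (oddpart \<eta>) / 2) = (\<lambda>\<eta>. F1 p (oddpart \<eta>) / 4)"
    and "pd (rb p) (\<lambda>\<eta>. F (oddpart \<eta>) / 2) = (\<lambda>\<eta>. - (F1 p (oddpart \<eta>) / 4))"
    and "pd (pb p) (\<lambda>\<eta>. - (F (oddpart \<eta>) / 2)) = (\<lambda>\<eta>. - (F1 p (oddpart \<eta>) / 4))"
    and "pd (rb p) (\<lambda>\<eta>. - (F (oddpart \<eta>) / 2)) = (\<lambda>\<eta>. F1 p (oddpart \<eta>) / 4)"
proof -
  show "pd (pb p) (\<lambda>\<eta>. F (oddpart \<eta>) / 2) = (\<lambda>\<eta>. F1 p (oddpart \<eta>) / 4)"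
  proof (rule ext)
    show "pd (pb p) (\<lambda>\<eta>. F (oddpart \<eta>) / 2) \<eta> = F1 p (oddpart \<eta>) / 4" for \<eta>
      unfolding pd_def by (rule DERIV_imp_deriv) (use DERIV_cdivide[OF oddpart_deriv_pb[OF F], of \<eta> p 2] in simp)
  qed
  show "pd (rb p) (\<lambda>\<eta>. F (oddpart \<eta>) / 2) = (\<lambda>\<eta>. - (F1 p (oddpart \<eta>) / 4))"
  proof (rule ext)
    show "pd (rb p) (\<lambda>\<eta>. F (oddpart \<eta>) / 2) \<eta> = - (F1 p (oddpart \<eta>) / 4)" for \<eta>
      unfolding pd_def by (rule DERIV_imp_deriv) (use DERIV_cdivide[OF oddpart_deriv_rb[OF F], of \<eta> p 2] in simp)
  qed
  show "pd (pb p) (\<lambda>\<eta>. - (F (oddpart \<eta>) / 2)) = (\<lambda>\<eta>. - (F1 p (oddpart \<eta>) / 4))"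
  proof (rule ext)
    show "pd (pb p) (\<lambda>\<eta>. - (F (oddpart \<eta>) / 2)) \<eta> = - (F1 p (oddpart \<eta>) / 4)" for \<eta>
      unfolding pd_def by (rule DERIV_imp_deriv) (use DERIV_minus[OF DERIV_cdivide[OF oddpart_deriv_pb[OF F], of \<eta> p 2]] in simp)
  qed
  show "pd (rb p) (\<lambda>\<eta>. - (F (oddpart \<eta>) / 2)) = (\<lambda>\<eta>. F1 p (oddpart \<eta>) / 4)"
  proof (rule ext)
    show "pd (rb p) (\<lambda>\<eta>. - (F (oddpart \<eta>) / 2)) \<eta> = F1 p (oddpart \<eta>) / 4" for \<eta>
      unfolding pd_def by (rule DERIV_imp_deriv) (use DERIV_minus[OF DERIV_cdivide[OF oddpart_deriv_rb[OF F], of \<eta> p 2]] in simp)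
  qed
qed

lemma pdiff_oddpart:
  assumes F: "C1b N F F1" and b: "b \<in> bonds"
  shows "pdiff b (\<lambda>\<eta>. F (oddpart \<eta>))" "pdiff b (\<lambda>\<eta>. F (oddpart \<eta>) / 2)" "pdiff b (\<lambda>\<eta>. - (F (oddpart \<eta>) / 2))"
proof -
  have *: "\<exists>D. ((\<lambda>t. F (oddpart (\<eta>(b := t)))) has_real_derivative D) (at (\<eta> b))" for \<eta>
    using b
  proof (cases rule: bond_cases)
    case (1 p)
    show ?thesis unfolding 1 by (rule exI, rule oddpart_deriv_pb[OF F])
  next
    case (2 p)
    show ?thesis unfolding 2 by (rule exI, rule oddpart_deriv_rb[OF F])
  qed
  show "pdiff b (\<lambda>\<eta>. F (oddpart \<eta>))" "pdiff b (\<lambda>\<eta>. F (oddpart \<eta>) / 2)" "pdiff b (\<lambda>\<eta>. - (F (oddpart \<eta>) / 2))"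
    unfolding pdiff_def real_differentiable_def
    using * DERIV_cdivide[OF someI_ex[OF *], of _ 2] DERIV_minus[OF DERIV_cdivide[OF someI_ex[OF *], of _ 2]] by blast+
qed

lemma oddpart_continuous_bounded:
  assumes "continuous_on UNIV f" "\<exists>B. \<forall>w. \<bar>f w\<bar> \<le> (B::real)"
  shows "continuous_on UNIV (\<lambda>\<eta>. c * f (oddpart \<eta>))" "bounded (range (\<lambda>\<eta>. c * f (oddpart \<eta>)))"
proof -
  show "continuous_on UNIV (\<lambda>\<eta>. c * f (oddpart \<eta>))"
    by (intro continuous_intros continuous_on_compose2[OF assms(1) oddpart_cont]) auto
  obtain B where "\<And>w. \<bar>f w\<bar> \<le> B" using assms(2) by blast
  then have "norm (c * f (oddpart \<eta>)) \<le> \<bar>c\<bar> * B" for \<eta> by (simp add: abs_mult mult_left_mono)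
  then show "bounded (range (\<lambda>\<eta>. c * f (oddpart \<eta>)))" unfolding bounded_iff by blast
qed

text \<open>Supplies the test functions: every bounded C^2 function of finitely many edges enters
  the stationarity condition through its composition with \<open>oddpart\<close>.\<close>

lemma C2_loc_oddpart:
  assumes N: "finite N" and F: "C1b N F F1" and F1: "\<And>i. C1b N (F1 i) (F2 i)"
  shows "(\<lambda>\<eta>. F (oddpart \<eta>)) \<in> C2_loc" and "odd_convention (\<lambda>\<eta>. F (oddpart \<eta>))"
proof -
  note cb0 = oddpart_continuous_bounded[OF C1b_cont[OF F] C1b_bounded[OF F], of 1, simplified]
  have cb1: "continuous_on UNIV (\<lambda>\<eta>. F1 p (oddpart \<eta>) / 2)" "continuous_on UNIV (\<lambda>\<eta>. - (F1 p (oddpart \<eta>) / 2))"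
    "bounded (range (\<lambda>\<eta>. F1 p (oddpart \<eta>) / 2))" "bounded (range (\<lambda>\<eta>. - (F1 p (oddpart \<eta>) / 2)))" for p
    using oddpart_continuous_bounded[OF C1b_cont1[OF F] C1b_bounded1[OF F], of "1/2" p]
      oddpart_continuous_bounded[OF C1b_cont1[OF F] C1b_bounded1[OF F], of "-1/2" p] by simp_all
  have cb2: "continuous_on UNIV (\<lambda>\<eta>. F2 q p (oddpart \<eta>) / 4)" "continuous_on UNIV (\<lambda>\<eta>. - (F2 q p (oddpart \<eta>) / 4))"
    "bounded (range (\<lambda>\<eta>. F2 q p (oddpart \<eta>) / 4))" "bounded (range (\<lambda>\<eta>. - (F2 q p (oddpart \<eta>) / 4)))" for p q
    using oddpart_continuous_bounded[OF C1b_cont1[OF F1] C1b_bounded1[OF F1], of "1/4" q p]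
      oddpart_continuous_bounded[OF C1b_cont1[OF F1] C1b_bounded1[OF F1], of "-1/4" q p] by simp_all
  have 1: "pdiff b (\<lambda>\<eta>. F (oddpart \<eta>)) \<and> continuous_on UNIV (pd b (\<lambda>\<eta>. F (oddpart \<eta>))) \<and> bounded (range (pd b (\<lambda>\<eta>. F (oddpart \<eta>))))"
    if b: "b \<in> bonds" for b
    using b by (cases rule: bond_cases) (simp_all add: pdiff_oddpart[OF F] pd_oddpart[OF F] cb1)
  have 2: "pdiff b (pd b' (\<lambda>\<eta>. F (oddpart \<eta>))) \<and> continuous_on UNIV (pd b (pd b' (\<lambda>\<eta>. F (oddpart \<eta>)))) \<and> bounded (range (pd b (pd b' (\<lambda>\<eta>. F (oddpart \<eta>)))))"
    if b: "b \<in> bonds" and b': "b' \<in> bonds" for b b'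
    using b'
  proof (cases rule: bond_cases)
    case (1 q)
    show ?thesis unfolding 1 pd_oddpart[OF F]
      using b by (cases rule: bond_cases) (simp_all add: pdiff_oddpart[OF F1] pd_cmult_oddpart[OF F1] cb2)
  next
    case (2 q)
    show ?thesis unfolding 2 pd_oddpart[OF F]
      using b by (cases rule: bond_cases) (simp_all add: pdiff_oddpart[OF F1] pd_cmult_oddpart[OF F1] cb2)
  qed
  have "finite (pb ` N \<union> rb ` N) \<and> pb ` N \<union> rb ` N \<subseteq> bonds \<and>
    (\<forall>\<eta> \<eta>'. (\<forall>b\<in>pb ` N \<union> rb ` N. \<eta> b = (\<eta>' b :: real)) \<longrightarrow> F (oddpart \<eta>) = F (oddpart \<eta>'))"
  proof (intro conjI allI impI)
    fix \<eta> \<eta>' assume eq: "\<forall>b\<in>pb ` N \<union> rb ` N. \<eta> b = (\<eta>' b :: real)"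
    show "F (oddpart \<eta>) = F (oddpart \<eta>')"
    proof (rule C1b_local[OF F])
      fix p assume "p \<in> N"
      then have "\<eta> (pb p) = \<eta>' (pb p)" "\<eta> (rb p) = \<eta>' (rb p)" using eq by blast+
      then show "oddpart \<eta> p = oddpart \<eta>' p" by (simp add: oddpart_def)
    qed
  qed (use N in \<open>auto simp del: prod.inject\<close>)
  then have "\<exists>B. finite B \<and> B \<subseteq> bonds \<and> (\<forall>\<eta> \<eta>'. (\<forall>b\<in>B. \<eta> b = (\<eta>' b :: real)) \<longrightarrow> F (oddpart \<eta>) = F (oddpart \<eta>'))"
    by (rule exI)
  moreover have "\<forall>b\<in>bonds. pdiff b (\<lambda>\<eta>. F (oddpart \<eta>)) \<and> continuous_on UNIV (pd b (\<lambda>\<eta>. F (oddpart \<eta>))) \<and> bounded (range (pd b (\<lambda>\<eta>. F (oddpart \<eta>))))"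
    using 1 by (intro ballI)
  moreover have "\<forall>b\<in>bonds. \<forall>b'\<in>bonds. pdiff b (pd b' (\<lambda>\<eta>. F (oddpart \<eta>))) \<and> continuous_on UNIV (pd b (pd b' (\<lambda>\<eta>. F (oddpart \<eta>)))) \<and> bounded (range (pd b (pd b' (\<lambda>\<eta>. F (oddpart \<eta>)))))"
    using 2 by (intro ballI)
  ultimately show "(\<lambda>\<eta>. F (oddpart \<eta>)) \<in> C2_loc"
    unfolding C2_loc_def mem_Collect_eq using cb0 by (intro conjI)
  show "odd_convention (\<lambda>\<eta>. F (oddpart \<eta>))"
    unfolding odd_convention_def
  proof (intro ballI allI)
    fix b :: "'a bond" and \<eta> :: "'a bond \<Rightarrow> real" assume "b \<in> bonds"
    then show "pd (rev_bond b) (\<lambda>\<eta>. F (oddpart \<eta>)) \<eta> = - pd b (\<lambda>\<eta>. F (oddpart \<eta>)) \<eta>"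
      by (cases rule: bond_cases) (simp_all add: pd_oddpart[OF F])
  qed
qed

text \<open>Through \<open>oddpart\<close> each partial derivative carries 1/2 with the sign of the
  orientation, so a sum of derivatives over the bonds leaving \<open>x\<close> is half a divergence.
  The coefficients 4 and 2 of the generator remove these halves.\<close>

lemma generator_at_oddpart:
  assumes F: "C1b N F F1" and F1: "\<And>i. C1b N (F1 i) (F2 i)"
    and V: "\<And>t. deriv V (- t) = - deriv V t" and \<eta>: "\<eta> \<in> gradient_fields"
  shows "generator_at V x (\<lambda>\<eta>. F (oddpart \<eta>)) \<eta>
    = dvg x (\<lambda>q. dvg x (\<lambda>p. F2 q p (coords \<eta>))) - dvg x (\<lambda>p. deriv V (coords \<eta> p)) * dvg x (\<lambda>p. F1 p (coords \<eta>))"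
proof -
  let ?S = "{b \<in> bonds. fst b = x}" and ?G = "\<lambda>\<eta>. F (oddpart \<eta>)"
  note \<eta>' = oddpart_grad[OF \<eta>]
  have s1: "(\<Sum>b\<in>?S. deriv V (\<eta> b)) = dvg x (\<lambda>p. deriv V (coords \<eta> p))"
    unfolding star_sum dvg_def using grad_odd[OF \<eta> pb_bonds(1)]
    by (intro sum.cong refl) (simp add: V coords_def)
  have s2: "(\<Sum>b\<in>?S. 2 * pd b ?G \<eta>) = dvg x (\<lambda>p. F1 p (coords \<eta>))"
    unfolding star_sum dvg_def by (intro sum.cong refl) (simp add: pd_oddpart[OF F] \<eta>')
  have s3: "(\<Sum>b\<in>?S. 4 * pd b (pd (pb q) ?G) \<eta>) = dvg x (\<lambda>p. F2 q p (coords \<eta>))"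
    "(\<Sum>b\<in>?S. 4 * pd b (pd (rb q) ?G) \<eta>) = - dvg x (\<lambda>p. F2 q p (coords \<eta>))" for q
    unfolding star_sum dvg_def pd_oddpart[OF F] sum_negf[symmetric]
    by (intro sum.cong refl; simp add: pd_cmult_oddpart[OF F1] \<eta>')+
  have s4: "(\<Sum>b'\<in>?S. \<Sum>b\<in>?S. 4 * pd b (pd b' ?G) \<eta>) = dvg x (\<lambda>q. dvg x (\<lambda>p. F2 q p (coords \<eta>)))"
    by (subst star_sum, unfold s3, subst (3) dvg_def) simp
  have "generator_at V x ?G \<eta> = (\<Sum>b\<in>?S. \<Sum>b'\<in>?S. 4 * pd b (pd b' ?G) \<eta>) - (\<Sum>b\<in>?S. \<Sum>b'\<in>?S. deriv V (\<eta> b) * (2 * pd b' ?G \<eta>))"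
    unfolding generator_at_def sum_subtractf[symmetric] by (intro sum.cong refl) simp
  also have "(\<Sum>b\<in>?S. \<Sum>b'\<in>?S. 4 * pd b (pd b' ?G) \<eta>) = (\<Sum>b'\<in>?S. \<Sum>b\<in>?S. 4 * pd b (pd b' ?G) \<eta>)"
    by (rule sum.swap)
  also have "(\<Sum>b\<in>?S. \<Sum>b'\<in>?S. deriv V (\<eta> b) * (2 * pd b' ?G \<eta>)) = (\<Sum>b\<in>?S. deriv V (\<eta> b)) * (\<Sum>b\<in>?S. 2 * pd b ?G \<eta>)"
    by (rule sum_product[symmetric])
  finally show ?thesis unfolding s1 s2 s4 .
qed

text \<open>\<open>J\<close> contains both ends of every edge in \<open>N\<close>, so no other site
  contributes to the infinite sum.\<close>

lemma generator_oddpart: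
  assumes N: "finite N" and F: "C1b N F F1" and F1: "\<And>i. C1b N (F1 i) (F2 i)"
    and V: "\<And>t. deriv V (- t) = - deriv V t" and \<eta>: "\<eta> \<in> gradient_fields"
    and J: "finite J" "\<And>p. p \<in> N \<Longrightarrow> fst p \<in> J \<and> fst p + axis (snd p) 1 \<in> J"
  shows "generator V (\<lambda>\<eta>. F (oddpart \<eta>)) \<eta> = (\<Sum>x\<in>J. (\<Sum>i\<in>N. \<Sum>k\<in>N. inc x i * inc x k * F2 i k (coords \<eta>))
    - dvg x (\<lambda>p. deriv V (coords \<eta> p)) * (\<Sum>i\<in>N. inc x i * F1 i (coords \<eta>)))"
proof -
  have z1: "p \<notin> N \<Longrightarrow> F1 p w = 0" for p w by (rule C1b_off[OF F])
  have z2: "p \<notin> N \<Longrightarrow> F2 q p w = 0" for p q w by (rule C1b_off[OF F1])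
  \<comment> \<open>Vanishing in the other index: there \<open>F1 q\<close> is identically
    zero.\<close>
  have z3: "q \<notin> N \<Longrightarrow> F2 q p w = 0" for p q w
  proof -
    assume "q \<notin> N"
    then have "(\<lambda>t. F1 q (w(p := t))) = (\<lambda>t. 0)" using z1 by simp
    then show "F2 q p w = 0" using C1b_deriv[OF F1, of q w p] DERIV_unique[OF _ DERIV_const] by simp
  qed
  have eq: "generator_at V x (\<lambda>\<eta>. F (oddpart \<eta>)) \<eta> = (\<Sum>i\<in>N. \<Sum>k\<in>N. inc x i * inc x k * F2 i k (coords \<eta>))
    - dvg x (\<lambda>p. deriv V (coords \<eta> p)) * (\<Sum>i\<in>N. inc x i * F1 i (coords \<eta>))" for x
  proof -
    have "dvg x (\<lambda>q. dvg x (\<lambda>p. F2 q p (coords \<eta>))) = (\<Sum>i\<in>N. inc x i * dvg x (\<lambda>p. F2 i p (coords \<eta>)))"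
      by (rule dvg_eq_sum[symmetric, OF N]) (simp add: z3 dvg_def)
    also have "\<dots> = (\<Sum>i\<in>N. inc x i * (\<Sum>k\<in>N. inc x k * F2 i k (coords \<eta>)))"
      by (intro sum.cong refl) (simp add: dvg_eq_sum[OF N] z2)
    also have "\<dots> = (\<Sum>i\<in>N. \<Sum>k\<in>N. inc x i * inc x k * F2 i k (coords \<eta>))"
      by (simp add: sum_distrib_left mult.assoc)
    finally show ?thesis
      unfolding generator_at_oddpart[OF F F1 V \<eta>] by (simp add: dvg_eq_sum[OF N] z1)
  qed
  have "inc x p = 0" if "x \<notin> J" "p \<in> N" for x p
    using J(2)[OF that(2)] that(1) unfolding inc_def by (auto split: if_splits)
  then have z: "generator_at V x (\<lambda>\<eta>. F (oddpart \<eta>)) \<eta> = 0" if "x \<notin> J" for x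
    unfolding eq using that by simp
  have "generator V (\<lambda>\<eta>. F (oddpart \<eta>)) \<eta> = (\<Sum>\<^sub>\<infinity>x\<in>J. generator_at V x (\<lambda>\<eta>. F (oddpart \<eta>)) \<eta>)"
    unfolding generator_def by (rule infsum_cong_neutral) (use z in auto)
  also have "\<dots> = (\<Sum>x\<in>J. generator_at V x (\<lambda>\<eta>. F (oddpart \<eta>)) \<eta>)" using J(1) by simp
  finally show ?thesis unfolding eq .
qed

section \<open>Boxes, shifts and measurability of gradient fields\<close>

definition box_sites :: "nat \<Rightarrow> ('d::finite) site set" where
  "box_sites n = {y. \<forall>i. \<bar>y $ i\<bar> \<le> int n}"

lemma card_box_sites: "finite (box_sites n :: ('d::finite) site set)" "card (box_sites n :: 'd site set) = (2 * n + 1) ^ CARD('d)"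
proof -
  let ?A = "{- int n..int n}"
  have bij: "bij_betw (\<lambda>f. vec_lambda f :: int ^ 'd) (PiE UNIV (\<lambda>_. ?A)) (box_sites n)"
  proof -
    have "box_sites n = {y :: int ^ 'd. \<forall>i. y $ i \<in> ?A}"
      unfolding box_sites_def by (simp add: abs_le_iff minus_le_iff conj_commute)
    then show ?thesis
      by (intro bij_betw_byWitness[where f'="vec_nth"]) (auto simp: PiE_def Pi_def vec_lambda_inverse)
  qed
  have "finite (PiE (UNIV :: 'd set) (\<lambda>_. ?A))" by (intro finite_PiE) auto
  then show "finite (box_sites n :: 'd site set)" using bij_betw_finite[OF bij] by simp
  have "card (box_sites n :: 'd site set) = card (PiE (UNIV :: 'd set) (\<lambda>_. ?A))"
    using bij_betw_same_card[OF bij] by simp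
  also have "\<dots> = (2 * n + 1) ^ CARD('d)" by (subst card_PiE) (simp_all add: nat_add_distrib nat_mult_distrib)
  finally show "card (box_sites n :: 'd site set) = (2 * n + 1) ^ CARD('d)" .
qed

lemma finite_subset_box:
  assumes "finite (S :: ('d::finite) site set)"
  obtains m where "S \<subseteq> box_sites m"
proof
  show "S \<subseteq> box_sites (nat (\<Sum>y\<in>S. \<Sum>i\<in>UNIV. \<bar>y $ i\<bar>))"
  proof
    fix y assume y: "y \<in> S"
    have "\<bar>y $ i\<bar> \<le> (\<Sum>y\<in>S. \<Sum>i\<in>UNIV. \<bar>y $ i\<bar>)" for i
    proof -
      have "\<bar>y $ i\<bar> \<le> (\<Sum>i\<in>UNIV. \<bar>y $ i\<bar>)" by (rule member_le_sum) auto
      also have "\<dots> \<le> (\<Sum>y\<in>S. \<Sum>i\<in>UNIV. \<bar>y $ i\<bar>)"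
        by (rule member_le_sum[OF y]) (auto intro: sum_nonneg assms)
      finally show ?thesis .
    qed
    moreover have "0 \<le> (\<Sum>y\<in>S. \<Sum>i\<in>UNIV. \<bar>y $ i\<bar>)" by (intro sum_nonneg) auto
    ultimately show "y \<in> box_sites (nat (\<Sum>y\<in>S. \<Sum>i\<in>UNIV. \<bar>y $ i\<bar>))" by (simp add: box_sites_def)
  qed
qed

lemma box_sites_add: "y \<in> box_sites n \<Longrightarrow> z \<in> box_sites m \<Longrightarrow> y + z \<in> box_sites (n + m)"
proof -
  assume a: "y \<in> box_sites n" "z \<in> box_sites m"
  have "\<bar>y $ i + z $ i\<bar> \<le> int n + int m" for i
  proof -
    have "\<bar>y $ i\<bar> \<le> int n" "\<bar>z $ i\<bar> \<le> int m" using a by (auto simp: box_sites_def)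
    then show ?thesis by linarith
  qed
  then show "y + z \<in> box_sites (n + m)" by (simp add: box_sites_def)
qed

lemma box_sites_mono: "n \<le> m \<Longrightarrow> box_sites n \<subseteq> box_sites m"
  unfolding box_sites_def by (auto intro: order_trans)

text \<open>Both ends must lie in the box, so that stationarity has to be summed over the sites of
  the box only.\<close>

definition inner_bonds :: "nat \<Rightarrow> (('d::finite) site \<times> 'd) set" where
  "inner_bonds n = {p. fst p \<in> box_sites n \<and> fst p + axis (snd p) 1 \<in> box_sites n}"

lemma finite_inner_bonds: "finite (inner_bonds n)"
  by (rule finite_subset[of _ "box_sites n \<times> UNIV"]) (auto simp: inner_bonds_def card_box_sites(1))

text \<open>Used with a lattice shift of the edges, to move a test function from one site to
  another.\<close>

lemma C1b_reindex:
  assumes F: "C1b N F F1" and s: "\<And>p. s' (s p) = p" "\<And>q. s (s' q) = q"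
  shows "C1b (s ` N) (\<lambda>w. F (\<lambda>p. w (s p))) (\<lambda>q w. F1 (s' q) (\<lambda>p. w (s p)))"
proof -
  obtain B where B: "\<And>w. \<bar>F w\<bar> \<le> B" using C1b_bounded[OF F] by blast
  have "\<forall>i. \<exists>B. \<forall>w. \<bar>F1 i w\<bar> \<le> B" using C1b_bounded1[OF F] by blast
  then obtain B1 where B1: "\<And>i w. \<bar>F1 i w\<bar> \<le> B1 i" by metis
  have c: "continuous_on UNIV (\<lambda>w p. w (s p) :: real)"
    by (intro continuous_on_coordinatewise_then_product continuous_on_product_coordinates)
  show ?thesis
  proof (rule C1bI[where B=B and C="\<lambda>q. B1 (s' q)"])
    show "F (\<lambda>p. w (s p)) = F (\<lambda>p. w' (s p))" if "\<And>i. i \<in> s ` N \<Longrightarrow> w i = w' i" for w w'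
      by (rule C1b_local[OF F]) (use that in auto)
    show "continuous_on UNIV (\<lambda>w. F (\<lambda>p. w (s p)))"
      by (rule continuous_on_compose2[OF C1b_cont[OF F] c]) auto
    show "continuous_on UNIV (\<lambda>w. F1 (s' q) (\<lambda>p. w (s p)))" for q
      by (rule continuous_on_compose2[OF C1b_cont1[OF F] c]) auto
    show "((\<lambda>t. F (\<lambda>p. (w(q := t)) (s p))) has_real_derivative F1 (s' q) (\<lambda>p. w (s p))) (at (w q))" for q w
    proof -
      have "(\<lambda>p. (w(q := t)) (s p)) = (\<lambda>p. w (s p))(s' q := t)" for t
        using s by (auto simp: fun_eq_iff)
      then show ?thesis using C1b_deriv[OF F, of "\<lambda>p. w (s p)" "s' q"] by (simp add: s)
    qed
  qed (rule B B1)+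
qed

lemma space_gradient_space [simp]: "space gradient_space = gradient_fields"
  by (auto simp: gradient_space_def space_restrict_space space_PiM gradient_fields_def grad_def)

lemma gradient_space_component: "b \<in> bonds \<Longrightarrow> (\<lambda>\<eta>. \<eta> b) \<in> borel_measurable gradient_space"
  unfolding gradient_space_def by (intro measurable_restrict_space1 measurable_component_singleton)

lemma measurable_gradient_spaceI:
  assumes "\<And>x. x \<in> space M \<Longrightarrow> f x \<in> gradient_fields" and "\<And>b. b \<in> bonds \<Longrightarrow> (\<lambda>x. f x b) \<in> borel_measurable M"
  shows "f \<in> measurable M gradient_space"
  unfolding gradient_space_def
proof (rule measurable_restrict_space2)
  have ext: "f x b = undefined" if "x \<in> space M" "b \<notin> bonds" for x b
    using assms(1)[OF that(1)] that(2) by (auto simp: gradient_fields_def grad_def)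
  show "f \<in> measurable M (PiM bonds (\<lambda>_. borel))"
  proof (rule measurable_PiM_single')
    show "f \<in> space M \<rightarrow> (\<Pi>\<^sub>E i\<in>bonds. space borel)" using ext by (auto simp: PiE_iff extensional_def)
  qed (use assms(2) in auto)
qed (use assms(1) in auto)

lemma shift_grad: "\<eta> \<in> gradient_fields \<Longrightarrow> shift z \<eta> \<in> gradient_fields"
proof -
  assume "\<eta> \<in> gradient_fields"
  then obtain \<phi> where \<phi>: "\<eta> = grad \<phi>" by (auto simp: gradient_fields_def)
  have "(x + z, y + z) \<in> bonds \<longleftrightarrow> (x, y) \<in> bonds" for x y :: "'a site" by (simp add: bonds_def)
  then have "shift z \<eta> = grad (\<lambda>x. \<phi> (x + z))"
    by (auto simp: \<phi> shift_def grad_def fun_eq_iff restrict_def)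
  then show ?thesis by (auto simp: gradient_fields_def)
qed

lemma shift_bond: "b \<in> bonds \<Longrightarrow> (fst b + z, snd b + z) \<in> bonds"
  by (auto simp: bonds_def)

lemma shift_measurable: "shift z \<in> measurable gradient_space gradient_space"
proof (rule measurable_gradient_spaceI)
  show "(\<lambda>\<eta>. shift z \<eta> b) \<in> borel_measurable gradient_space" if "b \<in> bonds" for b
    using that by (simp add: shift_def gradient_space_component shift_bond)
qed (simp add: shift_grad)

definition tr :: "('d::finite) site \<Rightarrow> 'd site \<times> 'd \<Rightarrow> 'd site \<times> 'd" where
  "tr z p = (fst p + z, snd p)"

lemma tr_tr [simp]: "tr (- z) (tr z p) = p" "tr z (tr (- z) p) = p"
  by (auto simp: tr_def)

lemma coords_shift: "coords (shift z \<eta>) p = coords \<eta> (tr z p)"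
proof -
  have "(fst (pb p) + z, snd (pb p) + z) = pb (tr z p)" by (simp add: pb_def tr_def)
  then show ?thesis by (simp add: coords_def shift_def)
qed

lemma dvg_tr: "dvg y (\<lambda>q. g (tr (- (y - x)) q)) = dvg x g"
proof -
  have "tr (- (y - x)) (y, i) = (x, i)" "tr (- (y - x)) (y - axis i 1, i) = (x - axis i 1, i)" for i
    by (simp_all add: tr_def)
  then show ?thesis by (simp add: dvg_def)
qed

section \<open>Shift invariance and integration by parts at a single site\<close>

locale stationary_gradient =
  fixes V V1 V2 :: "real \<Rightarrow> real" and C :: real and \<mu> :: "(('d::finite) bond \<Rightarrow> real) measure"
  assumes V_even: "V (- t) = V t" and V_deriv: "(V has_real_derivative V1 t) (at t)"
    and V1_deriv: "(V1 has_real_derivative V2 t) (at t)" and V2_cont: "continuous_on UNIV V2"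
    and V2_bound: "\<bar>V2 t\<bar> \<le> C"
    and P2: "\<mu> \<in> P2" and shift: "shift_invariant \<mu>" and stat: "stationary V \<mu>"
begin

lemma V1_odd: "V1 (- t) = - V1 t"
proof -
  have "((\<lambda>t. V (- t)) has_real_derivative V1 (- t) * - 1) (at t)"
    by (rule DERIV_chain2[OF V_deriv]) (auto intro!: derivative_eq_intros)
  then show ?thesis using DERIV_unique[OF _ V_deriv] by (fastforce simp: V_even)
qed

text \<open>Evenness of the potential gives \<open>V1 0 = 0\<close>; the bound on the second
  derivative does the rest. With this linear growth, second moments of the field make the forces
  square integrable.\<close>

lemma V1_bound: "\<bar>V1 t\<bar> \<le> C * \<bar>t\<bar>"
proof -
  have "V1 0 = 0" using V1_odd[of 0] by simp
  moreover have "norm (V1 t - V1 0) \<le> C * norm (t - 0)"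
    by (rule field_differentiable_bound[of UNIV]) (use V1_deriv V2_bound in \<open>auto\<close>)
  ultimately show ?thesis by simp
qed

lemma V_cont: "continuous_on UNIV V" and V1_cont: "continuous_on UNIV V1"
  using V_deriv V1_deriv by (meson DERIV_continuous_on has_field_derivative_at_within)+

lemma deriv_V: "deriv V = V1" using V_deriv by (intro ext DERIV_imp_deriv)

lemma prob_mu: "prob_space \<mu>" and sets_mu: "sets \<mu> = sets gradient_space"
  and square_integrable_mu: "b \<in> bonds \<Longrightarrow> integrable \<mu> (\<lambda>\<eta>. (\<eta> b)\<^sup>2)"
  using P2 by (auto simp: P2_def)

sublocale prob_space \<mu> by (rule prob_mu)

lemma space_mu: "space \<mu> = gradient_fields"
  using sets_eq_imp_space_eq[OF sets_mu] by simp

lemma meas_mu: "measurable \<mu> A = measurable gradient_space A"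
  by (rule measurable_cong_sets[OF sets_mu refl])

lemma coords_meas: "(\<lambda>\<eta>. coords \<eta> p) \<in> borel_measurable \<mu>" and coords_meas': "coords \<in> borel_measurable \<mu>"
proof -
  show *: "(\<lambda>\<eta>. coords \<eta> p) \<in> borel_measurable \<mu>" for p
    unfolding coords_def meas_mu by (rule gradient_space_component) simp
  show "coords \<in> borel_measurable \<mu>" by (rule borel_fun_measurableI[OF *])
qed

text \<open>On \<open>grad \<phi>\<close> this is the sum of \<open>V1 (\<phi> x - \<phi> y)\<close>
  over the neighbours \<open>y\<close> of \<open>x\<close>, the \<open>U\<^sub>x\<close> of the
  generator: oddness of \<open>V1\<close> takes care of the edges that end at
  \<open>x\<close>.\<close>

definition force :: "'d site \<Rightarrow> ('d bond \<Rightarrow> real) \<Rightarrow> real" where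
  "force x \<eta> = dvg x (\<lambda>p. V1 (coords \<eta> p))"

lemma V1_coords_meas: "(\<lambda>\<eta>. V1 (coords \<eta> p)) \<in> borel_measurable \<mu>"
  by (rule measurable_compose[OF coords_meas borel_measurable_continuous_onI[OF V1_cont]])

lemma coords_square: "integrable \<mu> (\<lambda>\<eta>. (coords \<eta> p)\<^sup>2)"
  unfolding coords_def by (rule square_integrable_mu) simp

lemma V1_square: "integrable \<mu> (\<lambda>\<eta>. (V1 (coords \<eta> p))\<^sup>2)"
proof (rule Bochner_Integration.integrable_bound[OF integrable_mult_right[OF coords_square, of "C\<^sup>2" p]])
  show "(\<lambda>\<eta>. (V1 (coords \<eta> p))\<^sup>2) \<in> borel_measurable \<mu>"
    by (intro borel_measurable_power V1_coords_meas)
  show "AE \<eta> in \<mu>. norm ((V1 (coords \<eta> p))\<^sup>2) \<le> norm (C\<^sup>2 * (coords \<eta> p)\<^sup>2)"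
  proof (rule AE_I2)
    fix \<eta>
    have "\<bar>V1 (coords \<eta> p)\<bar>\<^sup>2 \<le> (C * \<bar>coords \<eta> p\<bar>)\<^sup>2" by (intro power_mono V1_bound) auto
    then show "norm ((V1 (coords \<eta> p))\<^sup>2) \<le> norm (C\<^sup>2 * (coords \<eta> p)\<^sup>2)"
      by (simp add: power_mult_distrib)
  qed
qed

lemma force_meas: "force x \<in> borel_measurable \<mu>"
  unfolding force_def[abs_def] dvg_def by (intro borel_measurable_sum borel_measurable_diff V1_coords_meas)

lemma force_square: "integrable \<mu> (\<lambda>\<eta>. (force x \<eta>)\<^sup>2)"
  unfolding force_def dvg_def diff_conv_add_uminus
  by (intro square_integrable_sum square_integrable_add borel_measurable_add borel_measurable_uminus V1_coords_meas)
     (use V1_square in auto)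

lemma force_integrable: "integrable \<mu> (force x)"
  by (rule square_integrable_imp_integrable[OF force_meas force_square])

lemma bounded_coords:
  assumes "f \<in> borel_measurable borel" and b: "\<And>w. \<bar>f w\<bar> \<le> (B::real)"
  shows "integrable \<mu> (\<lambda>\<eta>. f (coords \<eta>))" "integrable \<mu> (\<lambda>\<eta>. force x \<eta> * f (coords \<eta>))"
proof -
  have m: "(\<lambda>\<eta>. f (coords \<eta>)) \<in> borel_measurable \<mu>" by (rule measurable_compose[OF coords_meas' assms(1)])
  show "integrable \<mu> (\<lambda>\<eta>. f (coords \<eta>))"
    by (rule integrable_boundedI[OF finite_measure_axioms m b])
  have B0: "0 \<le> B" using b[of undefined] by linarith
  show "integrable \<mu> (\<lambda>\<eta>. force x \<eta> * f (coords \<eta>))"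
  proof (rule Bochner_Integration.integrable_bound[OF integrable_mult_left[OF force_integrable[of x], of B]])
    show "AE \<eta> in \<mu>. norm (force x \<eta> * f (coords \<eta>)) \<le> norm (force x \<eta> * B)"
      using b B0 by (intro AE_I2) (simp add: abs_mult mult_left_mono)
  qed (intro borel_measurable_times force_meas m)
qed

text \<open>Provides the assumption \<open>stat\<close> of \<open>stationary_field\<close>, with
  \<open>inc\<close> for the coefficients and \<open>force\<close> for \<open>U\<close>.\<close>

lemma stationary_sum:
  assumes N: "finite N" and J: "finite J" "\<And>p. p \<in> N \<Longrightarrow> fst p \<in> J \<and> fst p + axis (snd p) 1 \<in> J"
    and F: "C1b N F F1" and F1: "\<And>i. C1b N (F1 i) (F2 i)"
  shows "(\<Sum>x\<in>J. \<integral>\<eta>. (\<Sum>i\<in>N. \<Sum>k\<in>N. inc x i * inc x k * F2 i k (coords \<eta>))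
    - force x \<eta> * (\<Sum>i\<in>N. inc x i * F1 i (coords \<eta>)) \<partial>\<mu>) = 0"
proof -
  define g where "g x \<eta> = (\<Sum>i\<in>N. \<Sum>k\<in>N. inc x i * inc x k * F2 i k (coords \<eta>))
    - force x \<eta> * (\<Sum>i\<in>N. inc x i * F1 i (coords \<eta>))" for x \<eta>
  have m1: "F1 i \<in> borel_measurable borel" "F2 i k \<in> borel_measurable borel" for i k
    by (rule borel_measurable_continuous_onI[OF C1b_cont1[OF F]], rule borel_measurable_continuous_onI[OF C1b_cont1[OF F1]])
  have i: "integrable \<mu> (g x)" for x
    unfolding g_def
  proof (rule Bochner_Integration.integrable_diff)
    show "integrable \<mu> (\<lambda>\<eta>. \<Sum>i\<in>N. \<Sum>k\<in>N. inc x i * inc x k * F2 i k (coords \<eta>))"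
    proof (intro Bochner_Integration.integrable_sum integrable_mult_right)
      fix i k
      obtain B where "\<And>w. \<bar>F2 i k w\<bar> \<le> B" using C1b_bounded1[OF F1] by blast
      then show "integrable \<mu> (\<lambda>\<eta>. F2 i k (coords \<eta>))" by (rule bounded_coords(1)[OF m1(2)])
    qed
    obtain B where B: "\<And>w. \<bar>\<Sum>i\<in>N. inc x i * F1 i w\<bar> \<le> B"
      using C1b_sum_bounded[OF N, of F1 "inc x"] C1b_bounded1[OF F] by blast
    show "integrable \<mu> (\<lambda>\<eta>. force x \<eta> * (\<Sum>i\<in>N. inc x i * F1 i (coords \<eta>)))"
      by (rule bounded_coords(2)[OF _ B]) (intro borel_measurable_sum borel_measurable_times borel_measurable_const m1)
  qed
  have "(\<integral>\<eta>. generator V (\<lambda>\<eta>. F (oddpart \<eta>)) \<eta> \<partial>\<mu>) = 0"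
    using stat C2_loc_oddpart[OF N F F1] unfolding stationary_def by blast
  also have "(\<integral>\<eta>. generator V (\<lambda>\<eta>. F (oddpart \<eta>)) \<eta> \<partial>\<mu>) = (\<integral>\<eta>. (\<Sum>x\<in>J. g x \<eta>) \<partial>\<mu>)"
  proof (rule Bochner_Integration.integral_cong[OF refl])
    fix \<eta> assume "\<eta> \<in> space \<mu>"
    then have \<eta>: "\<eta> \<in> gradient_fields" by (simp add: space_mu)
    have vo: "deriv V (- t) = - deriv V t" for t by (simp add: deriv_V V1_odd)
    show "generator V (\<lambda>\<eta>. F (oddpart \<eta>)) \<eta> = (\<Sum>x\<in>J. g x \<eta>)"
      using generator_oddpart[OF N F F1 vo \<eta> J] unfolding g_def force_def deriv_V .
  qed
  also have "\<dots> = (\<Sum>x\<in>J. \<integral>\<eta>. g x \<eta> \<partial>\<mu>)" using i by (intro Bochner_Integration.integral_sum)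
  finally show ?thesis unfolding g_def by simp
qed

lemma integral_shift:
  assumes "G \<in> borel_measurable \<mu>"
  shows "(\<integral>\<eta>. G (shift z \<eta>) \<partial>\<mu>) = (\<integral>\<eta>. (G \<eta> :: real) \<partial>\<mu>)"
proof -
  have s: "shift z \<in> measurable \<mu> gradient_space" unfolding meas_mu by (rule shift_measurable)
  have "(\<integral>\<eta>. G \<eta> \<partial>distr \<mu> gradient_space (shift z)) = (\<integral>\<eta>. G (shift z \<eta>) \<partial>\<mu>)"
    using assms unfolding meas_mu by (rule integral_distr[OF s])
  moreover have "distr \<mu> gradient_space (shift z) = \<mu>" using shift by (simp add: shift_invariant_def)
  ultimately show ?thesis by simp
qed

text \<open>Integration by parts at the site \<open>x\<close> is the statement that the mean of this
  function vanishes.\<close>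

definition drift :: "'d site \<Rightarrow> (('d site \<times> 'd \<Rightarrow> real) \<Rightarrow> real) \<Rightarrow> ('d site \<times> 'd \<Rightarrow> ('d site \<times> 'd \<Rightarrow> real) \<Rightarrow> real) \<Rightarrow> ('d bond \<Rightarrow> real) \<Rightarrow> real" where
  "drift x f f1 \<eta> = dvg x (\<lambda>p. f1 p (coords \<eta>)) - force x \<eta> * f (coords \<eta>)"

lemma drift_meas: "C1b N f f1 \<Longrightarrow> drift x f f1 \<in> borel_measurable \<mu>"
  unfolding drift_def[abs_def] dvg_def
  by (intro borel_measurable_sum borel_measurable_diff borel_measurable_times force_meas measurable_compose[OF coords_meas']
      borel_measurable_continuous_onI C1b_cont1 C1b_cont)

text \<open>\<open>dirichlet_bound\<close> is applied to the box of radius \<open>n + m\<close>,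
  with a translate of \<open>f\<close> at each site of the concentric box of radius
  \<open>n\<close>. Shift invariance makes the terms of the inner sites equal, and at those sites
  the energy of the outer box reproduces the whole force. Hence only the shell between the boxes
  contributes on the right.\<close>

lemma drift_average:
  assumes f: "C1b N0 f f1" and N0: "finite N0" and f_le: "\<And>w. \<bar>f w\<bar> \<le> 1"
  shows "\<exists>K m. \<forall>n. real ((2 * n + 1) ^ CARD('d)) * (\<integral>\<eta>. drift x f f1 \<eta> \<partial>\<mu>)\<^sup>2
    \<le> K * (real ((2 * (n + m) + 1) ^ CARD('d)) - real ((2 * n + 1) ^ CARD('d)))"
proof -
  let ?star = "range (\<lambda>i. (x, i)) \<union> range (\<lambda>i. (x - axis i 1, i))"
  have "finite ((\<lambda>p. fst p - x) ` (N0 \<union> ?star) \<union> (\<lambda>p. fst p + axis (snd p) 1 - x) ` (N0 \<union> ?star))" using N0 by simp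
  \<comment> \<open>The margin \<open>m\<close> is chosen so that the edges on which
    \<open>f\<close> depends and the star of \<open>x\<close>, moved to any inner site, stay in the
    outer box.\<close>
  then obtain m where m: "(\<lambda>p. fst p - x) ` (N0 \<union> ?star) \<union> (\<lambda>p. fst p + axis (snd p) 1 - x) ` (N0 \<union> ?star) \<subseteq> box_sites m"
    by (rule finite_subset_box)
  have in_inner: "tr (y - x) p \<in> inner_bonds (n + m)" if "y \<in> box_sites n" "p \<in> N0 \<union> ?star" for y n p
  proof -
    have "fst p - x \<in> box_sites m" "fst p + axis (snd p) 1 - x \<in> box_sites m" using m that(2) by blast+
    from this[THEN box_sites_add[OF that(1)]] show ?thesis
      by (simp add: inner_bonds_def tr_def algebra_simps)
  qed
  define A where "A i = (\<integral>\<eta>. (V1 (coords \<eta> (0, i)))\<^sup>2 \<partial>\<mu>)" for i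
  have A: "(\<integral>\<eta>. (V1 (coords \<eta> (y, i)))\<^sup>2 \<partial>\<mu>) = A i" for y i
  proof -
    have "(\<lambda>\<eta>. (V1 (coords \<eta> (0, i)))\<^sup>2) \<in> borel_measurable \<mu>" by (intro borel_measurable_power V1_coords_meas)
    from integral_shift[OF this, of y] show ?thesis by (simp add: A_def coords_shift tr_def)
  qed
  \<comment> \<open>Cauchy-Schwarz over the axes costs the factor \<open>CARD('d)\<close>; each axis
    contributes two squares, each doubled, with the common mean \<open>A i\<close>.\<close>
  define K where "K = real CARD('d) * (\<Sum>i\<in>UNIV. 4 * A i)"
  have "real ((2 * n + 1) ^ CARD('d)) * (\<integral>\<eta>. drift x f f1 \<eta> \<partial>\<mu>)\<^sup>2
    \<le> 4 * K * (real ((2 * (n + m) + 1) ^ CARD('d)) - real ((2 * n + 1) ^ CARD('d)))" for n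
  proof -
    define N where "N = (inner_bonds (n + m) :: ('d site \<times> 'd) set)"
    define J where "J = (box_sites (n + m) :: 'd site set)"
    define B where "B = (box_sites n :: 'd site set)"
    have N: "finite N" by (simp add: N_def finite_inner_bonds)
    have J: "finite J" "finite B" "B \<subseteq> J" by (auto simp: J_def B_def card_box_sites(1) intro: box_sites_mono[THEN subsetD, rotated])
    have NJ: "p \<in> N \<Longrightarrow> fst p \<in> J \<and> fst p + axis (snd p) 1 \<in> J" for p by (simp add: N_def J_def inner_bonds_def)
    interpret S: stationary_field \<mu> N coords J inc force
      by unfold_locales
         (rule N, rule coords_meas, rule coords_square, rule J(1), rule force_meas, rule force_square, rule stationary_sum[OF N J(1) NJ])
    \<comment> \<open>Sites of the shell only need some admissible test function, and zero will
      do.\<close>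
    define g where "g y = (if y \<in> B then (\<lambda>w. f (\<lambda>p. w (tr (y - x) p))) else (\<lambda>_. 0))" for y
    define g1 where "g1 y = (if y \<in> B then (\<lambda>q w. f1 (tr (- (y - x)) q) (\<lambda>p. w (tr (y - x) p))) else (\<lambda>_ _. 0))" for y
    have gC: "C1b N (g y) (g1 y)" for y
    proof (cases "y \<in> B")
      case True
      have "C1b (tr (y - x) ` N0) (g y) (g1 y)"
        unfolding g_def g1_def if_P[OF True] by (rule C1b_reindex[OF f tr_tr])
      moreover have "tr (y - x) ` N0 \<subseteq> N" using in_inner True unfolding B_def N_def by blast
      ultimately show ?thesis by (rule C1b_mono)
    qed (simp add: g_def g1_def C1b_zero)
    have gle: "\<bar>g y w\<bar> \<le> 1" for y w using f_le by (simp add: g_def)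
    \<comment> \<open>The defect of the force at \<open>y\<close>, made up of the edges at
      \<open>y\<close> that are not in \<open>N\<close>.\<close>
    define r where "r y \<eta> = force y \<eta> - (\<Sum>i\<in>N. inc y i * V1 (coords \<eta> i))" for y \<eta>
    have r: "r y \<eta> = dvg y (\<lambda>p. V1 (coords \<eta> p)) - dvg y (\<lambda>p. if p \<in> N then V1 (coords \<eta> p) else 0)" for y \<eta>
      unfolding r_def force_def
      by (subst dvg_eq_sum[OF N, symmetric]) (auto intro!: sum.cong)
    have bound: "(\<Sum>y\<in>J. (\<integral>\<eta>. (\<Sum>i\<in>N. inc y i * g1 y i (coords \<eta>)) - force y \<eta> * g y (coords \<eta>) \<partial>\<mu>)\<^sup>2)
      \<le> 4 * (\<Sum>y\<in>J. \<integral>\<eta>. (r y \<eta>)\<^sup>2 \<partial>\<mu>)"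
      unfolding r_def by (rule S.dirichlet_bound[OF V_deriv V1_deriv V2_cont V1_bound V2_bound gC gle])
    have eq: "(\<integral>\<eta>. (\<Sum>i\<in>N. inc y i * g1 y i (coords \<eta>)) - force y \<eta> * g y (coords \<eta>) \<partial>\<mu>) = (\<integral>\<eta>. drift x f f1 \<eta> \<partial>\<mu>)"
      if y: "y \<in> B" for y
    proof -
      have "(\<Sum>i\<in>N. inc y i * g1 y i (coords \<eta>)) - force y \<eta> * g y (coords \<eta>) = drift x f f1 (shift (y - x) \<eta>)" for \<eta>
      proof -
        have "(\<Sum>i\<in>N. inc y i * g1 y i (coords \<eta>)) = dvg y (\<lambda>q. g1 y q (coords \<eta>))"
          by (rule dvg_eq_sum[OF N]) (rule C1b_off[OF gC])
        also have "\<dots> = dvg x (\<lambda>p. f1 p (\<lambda>p. coords \<eta> (tr (y - x) p)))"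
          unfolding g1_def using y dvg_tr[of y "\<lambda>q. f1 q (\<lambda>p. coords \<eta> (tr (y - x) p))" x] by simp
        finally have 1: "(\<Sum>i\<in>N. inc y i * g1 y i (coords \<eta>)) = dvg x (\<lambda>p. f1 p (coords (shift (y - x) \<eta>)))"
          by (simp add: coords_shift[abs_def])
        have 2: "force y \<eta> = force x (shift (y - x) \<eta>)"
          unfolding force_def coords_shift using dvg_tr[of y "\<lambda>q. V1 (coords \<eta> (tr (y - x) q))" x] by (simp only: tr_tr)
        show ?thesis unfolding drift_def 1 2 using y by (simp add: g_def coords_shift[abs_def])
      qed
      then show ?thesis using integral_shift[OF drift_meas[OF f], of x "y - x"] by simp
    qed
    have r0: "r y \<eta> = 0" if y: "y \<in> B" for y \<eta>
    proof -
      have "(y, i) = tr (y - x) (x, i)" "(y - axis i 1, i) = tr (y - x) (x - axis i 1, i)" for i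
        by (simp_all add: tr_def)
      then have "(y, i) \<in> N" "(y - axis i 1, i) \<in> N" for i
        using in_inner[of y n "(x, i)"] in_inner[of y n "(x - axis i 1, i)"] y unfolding N_def B_def by auto
      then show ?thesis unfolding r dvg_def by simp
    qed
    have rK: "(\<integral>\<eta>. (r y \<eta>)\<^sup>2 \<partial>\<mu>) \<le> K" for y
    proof -
      let ?v = "\<lambda>\<eta> p. if p \<in> N then 0 else V1 (coords \<eta> p)"
      have le: "(r y \<eta>)\<^sup>2 \<le> real CARD('d) * (\<Sum>i\<in>UNIV. 2 * (V1 (coords \<eta> (y, i)))\<^sup>2 + 2 * (V1 (coords \<eta> (y - axis i 1, i)))\<^sup>2)" for \<eta>
      proof -
        have "r y \<eta> = (\<Sum>i\<in>UNIV. ?v \<eta> (y, i) - ?v \<eta> (y - axis i 1, i))"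
          unfolding r dvg_def sum_subtractf[symmetric] by (intro sum.cong) auto
        then have "(r y \<eta>)\<^sup>2 \<le> (\<Sum>i\<in>UNIV. (?v \<eta> (y, i) - ?v \<eta> (y - axis i 1, i))\<^sup>2) * real CARD('d)"
          using sum_squared_le_sum_of_squares[of "\<lambda>i. ?v \<eta> (y, i) - ?v \<eta> (y - axis i 1, i)" UNIV] by simp
        also have "\<dots> \<le> (\<Sum>i\<in>UNIV. 2 * (V1 (coords \<eta> (y, i)))\<^sup>2 + 2 * (V1 (coords \<eta> (y - axis i 1, i)))\<^sup>2) * real CARD('d)"
        proof (intro mult_right_mono sum_mono)
          fix i
          have "(s - t)\<^sup>2 \<le> 2 * s\<^sup>2 + 2 * t\<^sup>2" for s t :: real
          proof -
            have "(s - t)\<^sup>2 + (s + t)\<^sup>2 = 2 * s\<^sup>2 + 2 * t\<^sup>2" by (simp add: power2_eq_square algebra_simps)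
            moreover have "0 \<le> (s + t)\<^sup>2" by simp
            ultimately show ?thesis by linarith
          qed
          from this[of "?v \<eta> (y, i)" "?v \<eta> (y - axis i 1, i)"]
          have "(?v \<eta> (y, i) - ?v \<eta> (y - axis i 1, i))\<^sup>2 \<le> 2 * (?v \<eta> (y, i))\<^sup>2 + 2 * (?v \<eta> (y - axis i 1, i))\<^sup>2" .
          also have "\<dots> \<le> 2 * (V1 (coords \<eta> (y, i)))\<^sup>2 + 2 * (V1 (coords \<eta> (y - axis i 1, i)))\<^sup>2"
            by (intro add_mono mult_left_mono) auto
          finally show "(?v \<eta> (y, i) - ?v \<eta> (y - axis i 1, i))\<^sup>2 \<le> \<dots>" .
        qed simp
        finally show ?thesis by (simp add: mult.commute)
      qed
      have i: "integrable \<mu> (\<lambda>\<eta>. real CARD('d) * (\<Sum>i\<in>UNIV. 2 * (V1 (coords \<eta> (y, i)))\<^sup>2 + 2 * (V1 (coords \<eta> (y - axis i 1, i)))\<^sup>2))"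
        by (intro integrable_mult_right Bochner_Integration.integrable_sum Bochner_Integration.integrable_add V1_square)
      have "(\<integral>\<eta>. (r y \<eta>)\<^sup>2 \<partial>\<mu>) \<le> (\<integral>\<eta>. real CARD('d) * (\<Sum>i\<in>UNIV. 2 * (V1 (coords \<eta> (y, i)))\<^sup>2 + 2 * (V1 (coords \<eta> (y - axis i 1, i)))\<^sup>2) \<partial>\<mu>)"
        by (rule integral_mono'[OF i le]) (intro mult_nonneg_nonneg sum_nonneg add_nonneg_nonneg, simp_all)
      also have "\<dots> = real CARD('d) * (\<Sum>i\<in>UNIV. \<integral>\<eta>. 2 * (V1 (coords \<eta> (y, i)))\<^sup>2 + 2 * (V1 (coords \<eta> (y - axis i 1, i)))\<^sup>2 \<partial>\<mu>)"
        by (subst integral_mult_right_zero, subst Bochner_Integration.integral_sum)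
           (intro Bochner_Integration.integrable_add integrable_mult_right V1_square, rule refl)
      also have "\<dots> = K"
        unfolding K_def
        by (intro arg_cong2[where f="(*)"] sum.cong refl)
           (simp add: V1_square A)
      finally show ?thesis .
    qed
    have "real (card B) * (\<integral>\<eta>. drift x f f1 \<eta> \<partial>\<mu>)\<^sup>2 = (\<Sum>y\<in>B. (\<integral>\<eta>. drift x f f1 \<eta> \<partial>\<mu>)\<^sup>2)" by simp
    also have "\<dots> = (\<Sum>y\<in>B. (\<integral>\<eta>. (\<Sum>i\<in>N. inc y i * g1 y i (coords \<eta>)) - force y \<eta> * g y (coords \<eta>) \<partial>\<mu>)\<^sup>2)"
      by (intro sum.cong refl) (simp add: eq)
    also have "\<dots> \<le> (\<Sum>y\<in>J. (\<integral>\<eta>. (\<Sum>i\<in>N. inc y i * g1 y i (coords \<eta>)) - force y \<eta> * g y (coords \<eta>) \<partial>\<mu>)\<^sup>2)"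
      by (rule sum_mono2[OF J(1,3)]) simp
    also have "\<dots> \<le> 4 * (\<Sum>y\<in>J. \<integral>\<eta>. (r y \<eta>)\<^sup>2 \<partial>\<mu>)" by (rule bound)
    also have "(\<Sum>y\<in>J. \<integral>\<eta>. (r y \<eta>)\<^sup>2 \<partial>\<mu>) = (\<Sum>y\<in>J - B. \<integral>\<eta>. (r y \<eta>)\<^sup>2 \<partial>\<mu>)"
      by (rule sum.mono_neutral_right[OF J(1)]) (auto simp: r0)
    also have "4 * \<dots> \<le> 4 * (\<Sum>y\<in>J - B. K)" by (intro mult_left_mono sum_mono rK) simp
    also have "\<dots> = 4 * K * (real (card J) - real (card B))"
      using J card_mono[OF J(1,3)] by (simp add: card_Diff_subset of_nat_diff)
    finally show ?thesis unfolding J_def B_def card_box_sites(2) .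
  qed
  then show ?thesis by blast
qed

theorem drift_integral_zero:
  assumes f: "C1b N0 f f1" and N0: "finite N0" and f_le: "\<And>w. \<bar>f w\<bar> \<le> 1"
  shows "(\<integral>\<eta>. drift x f f1 \<eta> \<partial>\<mu>) = 0"
proof -
  let ?d = "CARD('d)"
  obtain K m where K: "\<And>n. real ((2 * n + 1) ^ ?d) * (\<integral>\<eta>. drift x f f1 \<eta> \<partial>\<mu>)\<^sup>2
    \<le> K * (real ((2 * (n + m) + 1) ^ ?d) - real ((2 * n + 1) ^ ?d))"
    using drift_average[OF assms] by blast
  \<comment> \<open>The ratio of the side lengths of the two boxes; its limit is one, so the shell
    is negligible against the volume.\<close>
  define q where "q n = 1 + (2 * real m) * inverse (real (Suc (2 * n)))" for n
  have le: "(\<integral>\<eta>. drift x f f1 \<eta> \<partial>\<mu>)\<^sup>2 \<le> K * (q n ^ ?d - 1)" for n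
  proof -
    define a where "a = real (2 * n + 1)"
    have a: "a > 0" by (simp add: a_def)
    have q: "q n = real (2 * (n + m) + 1) / a" using a by (simp add: q_def a_def field_simps)
    have "a ^ ?d * (\<integral>\<eta>. drift x f f1 \<eta> \<partial>\<mu>)\<^sup>2 \<le> K * (real (2 * (n + m) + 1) ^ ?d - a ^ ?d)"
      using K[of n] by (simp add: a_def)
    also have "\<dots> = a ^ ?d * (K * (q n ^ ?d - 1))"
      unfolding q power_divide using a by (simp add: field_simps)
    finally show ?thesis using a by simp
  qed
  have "q \<longlonglongrightarrow> 1 + (2 * real m) * 0"
    unfolding q_def
    by (intro tendsto_intros LIMSEQ_subseq_LIMSEQ[OF LIMSEQ_inverse_real_of_nat, of "\<lambda>n. 2 * n", unfolded o_def])
       (simp add: strict_mono_def)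
  then have "(\<lambda>n. K * (q n ^ ?d - 1)) \<longlonglongrightarrow> K * (1 ^ ?d - 1)"
    by (intro tendsto_intros) simp
  then have "(\<integral>\<eta>. drift x f f1 \<eta> \<partial>\<mu>)\<^sup>2 \<le> K * (1 ^ ?d - 1)"
    by (rule LIMSEQ_le_const) (use le in blast)
  then show ?thesis by simp
qed

end

section \<open>Finitely supported heights of directions in dimension at least two\<close>

lemma int_constant:
  fixes f :: "int \<Rightarrow> 'a"
  assumes "\<And>t. f t = f (t + 1)"
  shows "f s = f t"
proof -
  have "f t = f 0" for t
  proof (induction t rule: int_induct[of _ 0])
    case (step1 i) then show ?case using assms[of i] by simp
  next
    case (step2 i) then show ?case using assms[of "i - 1"] by simp
  qed simp
  then show ?thesis by metis
qed

definition upd_site :: "('d::finite) site \<Rightarrow> 'd \<Rightarrow> int \<Rightarrow> 'd site" where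
  "upd_site x j t = (\<chi> k. if k = j then t else x $ k)"

text \<open>While one coordinate exceeds \<open>n\<close> in modulus, the others can move freely
  without entering the box. First some axis \<open>j\<close> other than the offending one is moved
  to \<open>n + 1\<close>; with \<open>j\<close> keeping the site outside, all remaining coordinates
  follow one at a time.\<close>

lemma outside_box_constant:
  fixes \<psi> :: "('d::finite) site \<Rightarrow> real"
  assumes d: "CARD('d) \<ge> 2" and \<psi>: "\<And>b. b \<in> bonds \<Longrightarrow> fst b \<notin> box_sites n \<Longrightarrow> snd b \<notin> box_sites n \<Longrightarrow> \<psi> (fst b) = \<psi> (snd b)"
    and x: "x \<notin> box_sites n"
  shows "\<psi> x = \<psi> (\<chi> k. int n + 1)"
proof -
  have move: "\<psi> y = \<psi> (upd_site y j t)" if i: "\<bar>y $ i\<bar> > int n" "j \<noteq> i" for y i j t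
  proof -
    have "\<psi> (upd_site y j s) = \<psi> (upd_site y j (s + 1))" for s
    proof -
      have out: "upd_site y j s \<notin> box_sites n" for s
        using i by (auto simp: box_sites_def upd_site_def not_le intro!: exI[of _ i])
      have "upd_site y j s + axis j 1 = upd_site y j (s + 1)"
        by (auto simp: upd_site_def vec_eq_iff axis_def)
      then have "pb (upd_site y j s, j) = (upd_site y j s, upd_site y j (s + 1))" by (simp add: pb_def)
      moreover from this have "(upd_site y j s, upd_site y j (s + 1)) \<in> bonds" by (metis pb_bonds(1))
      ultimately show ?thesis using \<psi>[of "(upd_site y j s, upd_site y j (s + 1))"] out by simp
    qed
    from int_constant[of "\<lambda>s. \<psi> (upd_site y j s)", OF this, of "y $ j" t]
    moreover have "upd_site y j (y $ j) = y" by (auto simp: upd_site_def vec_eq_iff)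
    ultimately show ?thesis by simp
  qed
  obtain i where i: "\<bar>x $ i\<bar> > int n" using x by (auto simp: box_sites_def not_le)
  have "\<exists>j::'d. j \<noteq> i"
  proof (rule ccontr)
    assume "\<nexists>j. j \<noteq> i"
    then have "(UNIV :: 'd set) = {i}" by auto
    then have "CARD('d) = card {i}" by (rule arg_cong)
    with d show False by simp
  qed
  then obtain j where j: "j \<noteq> i" by blast
  define y where "y = upd_site x j (int n + 1)"
  have yj: "y $ j = int n + 1" by (simp add: y_def upd_site_def)
  have "\<psi> y = \<psi> (\<chi> k. if k \<in> S then int n + 1 else y $ k)" if "finite S" "j \<notin> S" for S
    using that
  proof (induction S)
    case (insert k S)
    let ?z = "\<chi> k. if k \<in> S then int n + 1 else y $ k"
    have "\<bar>?z $ j\<bar> > int n" using insert yj by simp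
    from move[OF this, of k "int n + 1"] insert
    have "\<psi> ?z = \<psi> (upd_site ?z k (int n + 1))" by auto
    also have "upd_site ?z k (int n + 1) = (\<chi> k'. if k' \<in> insert k S then int n + 1 else y $ k')"
      by (auto simp: upd_site_def vec_eq_iff)
    finally show ?case using insert by simp
  qed simp
  from this[of "UNIV - {j}"] have "\<psi> y = \<psi> (\<chi> k. if k \<in> UNIV - {j} then int n + 1 else y $ k)" by simp
  also have "(\<chi> k. if k \<in> UNIV - {j} then int n + 1 else y $ k) = (\<chi> k. int n + 1)"
    using yj by (auto simp: vec_eq_iff)
  finally show ?thesis using move[OF i j, of "int n + 1"] by (simp add: y_def)
qed

lemma grad_pb: "grad \<psi> (pb p) = \<psi> (fst p) - \<psi> (fst p + axis (snd p) 1)"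
  by (simp add: grad_def) (simp add: pb_def)

text \<open>This is where \<open>d \<ge> 2\<close> enters: a direction may lift a whole component of the complement of
  \<open>\<Lambda>\<close>, and only the unbounded component, which is unique, can be normalised to height zero.\<close>

lemma direction_finite_support:
  fixes \<Lambda> :: "('d::finite) site set"
  assumes d: "CARD('d) \<ge> 2" and \<Lambda>: "finite \<Lambda>" and u: "u \<in> fields_bc \<Lambda> (\<lambda>_. 0)"
  obtains \<psi> A where "u = grad \<psi>" "finite A" "\<And>x. x \<notin> A \<Longrightarrow> \<psi> x = 0"
proof -
  obtain \<phi> where \<phi>: "u = grad \<phi>" using u by (auto simp: fields_bc_def gradient_fields_def)
  obtain n where n: "\<Lambda> \<subseteq> box_sites n" using finite_subset_box[OF \<Lambda>] .
  define c where "c = \<phi> (\<chi> k. int n + 1)"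
  have const: "\<phi> x = c" if "x \<notin> box_sites n" for x
    unfolding c_def
  proof (rule outside_box_constant[OF d _ that])
    fix b :: "'d bond" assume b: "b \<in> bonds" "fst b \<notin> box_sites n" "snd b \<notin> box_sites n"
    then have "b \<in> bonds - bond_closure \<Lambda>" using n by (auto simp: bond_closure_def)
    then have "u b = 0" using u by (simp add: fields_bc_def)
    then show "\<phi> (fst b) = \<phi> (snd b)" using b by (simp add: \<phi> grad_def)
  qed
  have "u = grad (\<lambda>x. \<phi> x - c)" by (auto simp: \<phi> grad_def fun_eq_iff)
  then show ?thesis by (rule that[OF _ card_box_sites(1)[of n]]) (use const in auto)
qed

section \<open>Translation invariance under the energy weight, for smooth products\<close>

lemma C1b_prod:
  assumes B: "finite B" and d: "\<And>p t. p \<in> B \<Longrightarrow> (h p has_real_derivative h' p t) (at t)"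
    and c: "\<And>p. p \<in> B \<Longrightarrow> continuous_on UNIV (h' p)"
    and b: "\<And>p t. p \<in> B \<Longrightarrow> \<bar>h p t\<bar> \<le> K" and b': "\<And>p t. p \<in> B \<Longrightarrow> \<bar>h' p t\<bar> \<le> K"
  shows "C1b B (\<lambda>w. \<Prod>p\<in>B. h p (w p)) (\<lambda>q w. if q \<in> B then h' q (w q) * (\<Prod>p\<in>B - {q}. h p (w p)) else 0)"
proof -
  have ch: "continuous_on UNIV (h p)" if "p \<in> B" for p
    using d[OF that] by (meson DERIV_continuous_on has_field_derivative_at_within)
  have prod_le: "\<bar>\<Prod>p\<in>B'. h p (w p)\<bar> \<le> K ^ card B'" if "B' \<subseteq> B" for B' w
  proof -
    have "\<bar>\<Prod>p\<in>B'. h p (w p)\<bar> = (\<Prod>p\<in>B'. \<bar>h p (w p)\<bar>)" by (rule abs_prod)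
    also have "\<dots> \<le> (\<Prod>p\<in>B'. K)" using that b by (intro prod_mono) auto
    finally show ?thesis by simp
  qed
  show ?thesis
  proof (rule C1bI[where B="K ^ card B" and C="\<lambda>q. \<bar>K * K ^ card (B - {q})\<bar>"])
    show "(\<Prod>p\<in>B. h p (w p)) = (\<Prod>p\<in>B. h p (w' p))" if "\<And>i. i \<in> B \<Longrightarrow> w i = w' i" for w w'
      using that by (intro prod.cong) auto
    show "continuous_on UNIV (\<lambda>w. \<Prod>p\<in>B. h p (w p))"
      by (intro continuous_on_prod continuous_on_compose2[OF ch continuous_on_product_coordinates]) auto
    show "\<bar>\<Prod>p\<in>B. h p (w p)\<bar> \<le> K ^ card B" for w by (rule prod_le) simp
    show "((\<lambda>t. \<Prod>p\<in>B. h p ((w(q := t)) p)) has_real_derivative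
        (if q \<in> B then h' q (w q) * (\<Prod>p\<in>B - {q}. h p (w p)) else 0)) (at (w q))" for q w
    proof (cases "q \<in> B")
      case True
      have eq: "(\<Prod>p\<in>B. h p ((w(q := t)) p)) = h q t * (\<Prod>p\<in>B - {q}. h p (w p))" for t
        by (subst prod.remove[OF B True]) (auto intro!: prod.cong)
      show ?thesis unfolding eq using True DERIV_cmult_right[OF d[OF True, of "w q"]] by simp
    next
      case False
      then have "(\<Prod>p\<in>B. h p ((w(q := t)) p)) = (\<Prod>p\<in>B. h p (w p))" for t by (intro prod.cong) auto
      then show ?thesis using False by simp
    qed
    show "continuous_on UNIV (\<lambda>w. if q \<in> B then h' q (w q) * (\<Prod>p\<in>B - {q}. h p (w p)) else 0)" for q
    proof (cases "q \<in> B")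
      case True
      have "continuous_on UNIV (\<lambda>w. h' q (w q) * (\<Prod>p\<in>B - {q}. h p (w p)))"
        by (intro continuous_on_mult continuous_on_prod continuous_on_compose2[OF c[OF True] continuous_on_product_coordinates]
            continuous_on_compose2[OF ch continuous_on_product_coordinates]) auto
      then show ?thesis using True by simp
    qed simp
    show "\<bar>if q \<in> B then h' q (w q) * (\<Prod>p\<in>B - {q}. h p (w p)) else 0\<bar> \<le> \<bar>K * K ^ card (B - {q})\<bar>" for q w
    proof (cases "q \<in> B")
      case True
      have "0 \<le> K" using b[OF True, of 0] by linarith
      then have "\<bar>h' q (w q)\<bar> * \<bar>\<Prod>p\<in>B - {q}. h p (w p)\<bar> \<le> K * K ^ card (B - {q})"
        using b'[OF True] prod_le[of "B - {q}"] by (intro mult_mono) auto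
      also have "\<dots> \<le> \<bar>K * K ^ card (B - {q})\<bar>" by (rule abs_ge_self)
      finally show ?thesis using True by (simp only: if_True abs_mult)
    qed simp
  qed
qed

locale gibbs_volume = stationary_gradient V V1 V2 C \<mu>
  for V V1 V2 C and \<mu> :: "(('d::finite) bond \<Rightarrow> real) measure" +
  fixes \<Lambda> :: "'d site set"
  assumes dim: "CARD('d) \<ge> 2" and finite_volume: "finite \<Lambda>"
begin

definition S :: "('d site \<times> 'd) set" where "S = {p. pb p \<in> bond_closure \<Lambda>}"

text \<open>Each unoriented edge counts once; the factor 1/2 in the Boltzmann weight offsets the two
  orientations that are summed there.\<close>

definition energy :: "('d site \<times> 'd \<Rightarrow> real) \<Rightarrow> real" where "energy w = (\<Sum>p\<in>S. V (w p))"

lemma finite_S: "finite S"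
proof -
  have "p \<in> (\<Lambda> \<times> UNIV) \<union> (\<lambda>(y, i). (y - axis i 1, i)) ` (\<Lambda> \<times> UNIV)" if "p \<in> S" for p
  proof -
    obtain x i where p: "p = (x, i)" by (cases p)
    have "x \<in> \<Lambda> \<or> x + axis i 1 \<in> \<Lambda>" using that by (auto simp: S_def bond_closure_def pb_def p)
    moreover have "p = (\<lambda>(y, i). (y - axis i 1, i)) (x + axis i 1, i)" by (simp add: p)
    ultimately show ?thesis using p by (metis (no_types, lifting) SigmaI UNIV_I UnI1 UnI2 imageI)
  qed
  then have "S \<subseteq> (\<Lambda> \<times> UNIV) \<union> (\<lambda>(y, i). (y - axis i 1, i)) ` (\<Lambda> \<times> UNIV)" by blast
  then show ?thesis by (rule finite_subset) (use finite_volume in simp)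
qed

lemma drift_integrable: "C1b N f f1 \<Longrightarrow> integrable \<mu> (drift x f f1)"
proof -
  assume f: "C1b N f f1"
  have m: "f \<in> borel_measurable borel" "f1 p \<in> borel_measurable borel" for p
    by (rule borel_measurable_continuous_onI[OF C1b_cont[OF f]], rule borel_measurable_continuous_onI[OF C1b_cont1[OF f]])
  obtain B where B: "\<And>w. \<bar>f w\<bar> \<le> B" using C1b_bounded[OF f] by blast
  have i: "integrable \<mu> (\<lambda>\<eta>. f1 p (coords \<eta>))" for p
  proof -
    obtain B where "\<And>w. \<bar>f1 p w\<bar> \<le> B" using C1b_bounded1[OF f] by blast
    then show ?thesis by (rule bounded_coords(1)[OF m(2)])
  qed
  show ?thesis unfolding drift_def[abs_def] dvg_def
    by (intro Bochner_Integration.integrable_diff Bochner_Integration.integrable_sum i bounded_coords(2)[OF m(1) B])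
qed

text \<open>\<open>drift\<close> is linear in the test function, so scaling removes the restriction
  to functions bounded by one. Dividing by \<open>B + 1\<close> covers the case
  \<open>B = 0\<close>.\<close>

lemma drift_zero:
  assumes f: "C1b N f f1" and N: "finite N"
  shows "(\<integral>\<eta>. drift x f f1 \<eta> \<partial>\<mu>) = 0"
proof -
  obtain B where B: "\<And>w. \<bar>f w\<bar> \<le> B" using C1b_bounded[OF f] by blast
  have B0: "0 \<le> B" using B[of undefined] by linarith
  define c where "c = inverse (B + 1)"
  have c: "c > 0" using B0 by (simp add: c_def)
  have const: "C1b N (\<lambda>_. c) (\<lambda>_ _. 0)" by (rule C1bI[where B="\<bar>c\<bar>" and C="\<lambda>_. 0"]) auto
  have cf: "C1b N (\<lambda>w. c * f w) (\<lambda>i w. c * f1 i w)" using C1b_mult[OF const f] by simp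
  have "\<bar>c * f w\<bar> \<le> 1" for w using B[of w] B0 by (simp add: c_def abs_mult field_simps)
  then have "(\<integral>\<eta>. drift x (\<lambda>w. c * f w) (\<lambda>i w. c * f1 i w) \<eta> \<partial>\<mu>) = 0"
    by (rule drift_integral_zero[OF cf N])
  also have "drift x (\<lambda>w. c * f w) (\<lambda>i w. c * f1 i w) = (\<lambda>\<eta>. c * drift x f f1 \<eta>)"
    by (simp add: fun_eq_iff drift_def dvg_def sum_distrib_left algebra_simps)
  finally show ?thesis using c by simp
qed

lemma direction_off_S: "u \<in> fields_bc \<Lambda> (\<lambda>_. 0) \<Longrightarrow> p \<notin> S \<Longrightarrow> u (pb p) = 0"
  by (simp add: fields_bc_def S_def)

text \<open>The single-site formulas are added with the heights \<open>\<psi>\<close> as weights.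
  Summation by parts, a finite sum because \<open>\<psi>\<close> has finite support, turns the
  divergences into a pairing of \<open>grad \<psi> = u\<close> with the partial derivatives. As
  \<open>u\<close> vanishes off \<open>S\<close>, every finite \<open>B\<close> containing
  \<open>S\<close> may index the result.\<close>

lemma direction_ibp:
  assumes u: "u \<in> fields_bc \<Lambda> (\<lambda>_. 0)" and f: "C1b N f f1" and N: "finite N" and B: "finite B" "S \<subseteq> B"
  shows "(\<integral>\<eta>. (\<Sum>p\<in>B. u (pb p) * (f1 p (coords \<eta>) - V1 (coords \<eta> p) * f (coords \<eta>))) \<partial>\<mu>) = 0"
proof -
  obtain \<psi> A where \<psi>: "u = grad \<psi>" and A: "finite A" "\<And>x. x \<notin> A \<Longrightarrow> \<psi> x = 0"
    using direction_finite_support[OF dim finite_volume u] by blast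
  define T where "T = {p. fst p \<in> A \<or> fst p + axis (snd p) 1 \<in> A}"
  have "T \<subseteq> (A \<times> UNIV) \<union> (\<lambda>(y, i). (y - axis i 1, i)) ` (A \<times> UNIV)"
  proof
    fix p assume "p \<in> T"
    moreover have "p = (\<lambda>(y, i). (y - axis i 1, i)) (fst p + axis (snd p) 1, snd p)" by simp
    ultimately show "p \<in> (A \<times> UNIV) \<union> (\<lambda>(y, i). (y - axis i 1, i)) ` (A \<times> UNIV)"
      unfolding T_def by (metis (mono_tags, lifting) SigmaI UNIV_I UnI1 UnI2 imageI mem_Collect_eq prod.collapse)
  qed
  then have T: "finite T" by (rule finite_subset) (use A in simp)
  have parts: "(\<Sum>x\<in>A. \<psi> x * dvg x g) = (\<Sum>p\<in>B. u (pb p) * g p)" for g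
  proof -
    have d: "dvg x g = (\<Sum>p\<in>T. inc x p * g p)" if x: "x \<in> A" for x
    proof -
      have "(\<Sum>p\<in>T. inc x p * (if p \<in> T then g p else 0)) = dvg x (\<lambda>p. if p \<in> T then g p else 0)"
        by (rule dvg_eq_sum[OF T]) simp
      also have "\<dots> = dvg x g" using x by (auto simp: dvg_def T_def intro!: sum.cong)
      finally show ?thesis by (simp cong: sum.cong)
    qed
    have i: "(\<Sum>x\<in>A. \<psi> x * inc x p) = u (pb p)" for p
    proof -
      have "(\<Sum>x\<in>A. \<psi> x * inc x p) = (\<Sum>x\<in>A. if x = fst p then \<psi> x else 0) - (\<Sum>x\<in>A. if x = fst p + axis (snd p) 1 then \<psi> x else 0)"
        unfolding sum_subtractf[symmetric] by (intro sum.cong refl) (auto simp: inc_def)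
      also have "\<dots> = \<psi> (fst p) - \<psi> (fst p + axis (snd p) 1)"
        using A by (simp add: sum.delta')
      finally show ?thesis by (simp add: \<psi> grad_pb)
    qed
    have "(\<Sum>x\<in>A. \<psi> x * dvg x g) = (\<Sum>x\<in>A. \<Sum>p\<in>T. \<psi> x * inc x p * g p)"
      by (intro sum.cong refl) (simp add: d sum_distrib_left mult.assoc)
    also have "\<dots> = (\<Sum>p\<in>T. \<Sum>x\<in>A. \<psi> x * inc x p * g p)" by (rule sum.swap)
    also have "\<dots> = (\<Sum>p\<in>T. u (pb p) * g p)" by (simp add: i flip: sum_distrib_right)
    also have "\<dots> = (\<Sum>p\<in>B. u (pb p) * g p)"
    proof (rule sum.mono_neutral_cong[OF B(1) T])
      fix p assume "p \<in> T - B"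
      then have "p \<notin> S" using B(2) by blast
      from direction_off_S[OF u this] show "u (pb p) * g p = 0" by simp
    next
      fix p assume "p \<in> B - T"
      then show "u (pb p) * g p = 0" using A(2) by (auto simp: \<psi> grad_pb T_def)
    qed simp
    finally show ?thesis .
  qed
  have "0 = (\<Sum>x\<in>A. \<psi> x * (\<integral>\<eta>. drift x f f1 \<eta> \<partial>\<mu>))" by (simp add: drift_zero[OF f N])
  also have "\<dots> = (\<integral>\<eta>. (\<Sum>x\<in>A. \<psi> x * drift x f f1 \<eta>) \<partial>\<mu>)"
    by (subst Bochner_Integration.integral_sum) (auto intro!: integrable_mult_right drift_integrable[OF f])
  also have "(\<lambda>\<eta>. \<Sum>x\<in>A. \<psi> x * drift x f f1 \<eta>) =
      (\<lambda>\<eta>. \<Sum>p\<in>B. u (pb p) * (f1 p (coords \<eta>) - V1 (coords \<eta> p) * f (coords \<eta>)))"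
  proof (rule ext)
    fix \<eta>
    have "drift x f f1 \<eta> = dvg x (\<lambda>p. f1 p (coords \<eta>) - V1 (coords \<eta> p) * f (coords \<eta>))" for x
      unfolding drift_def force_def dvg_def sum_distrib_right sum_subtractf[symmetric]
      by (intro sum.cong refl) (simp add: algebra_simps)
    then show "(\<Sum>x\<in>A. \<psi> x * drift x f f1 \<eta>) = (\<Sum>p\<in>B. u (pb p) * (f1 p (coords \<eta>) - V1 (coords \<eta> p) * f (coords \<eta>)))"
      using parts by simp
  qed
  finally show ?thesis by simp
qed

text \<open>The product is moved along \<open>t * u\<close>. Its derivative in \<open>t\<close> is
  the integrand of \<open>direction_ibp\<close> for the full test function, the energy factor
  included: differentiating that factor in the field produces terms that cancel the force. So the
  integral does not depend on \<open>t\<close>. The compact supports keep the exponential of the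
  energy bounded.\<close>

lemma translation_invariance_smooth:
  fixes \<theta> \<theta>' :: "'d site \<times> 'd \<Rightarrow> real \<Rightarrow> real"
  assumes u: "u \<in> fields_bc \<Lambda> (\<lambda>_. 0)" and B: "finite B" "S \<subseteq> B"
    and d: "\<And>p s. (\<theta> p has_real_derivative \<theta>' p s) (at s)" and c: "\<And>p. continuous_on UNIV (\<theta>' p)"
    and supp: "\<And>p s. p \<in> B \<Longrightarrow> \<bar>s\<bar> > R \<Longrightarrow> \<theta> p s = 0" "\<And>p s. p \<in> B \<Longrightarrow> \<bar>s\<bar> > R \<Longrightarrow> \<theta>' p s = 0"
  shows "(\<integral>\<eta>. (\<Prod>p\<in>B. \<theta> p (coords \<eta> p + u (pb p))) * exp (energy (coords \<eta>)) \<partial>\<mu>)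
    = (\<integral>\<eta>. (\<Prod>p\<in>B. \<theta> p (coords \<eta> p)) * exp (energy (coords \<eta>)) \<partial>\<mu>)"
proof -
  define U where "U p = u (pb p)" for p
  \<comment> \<open>The energy is a sum over edges, so its exponential splits into one-edge factors
    and \<open>C1b_prod\<close> applies; edges outside \<open>S\<close> get the factor one.\<close>
  define W where "W p s = (if p \<in> S then V s else 0)" for p s
  define W1 where "W1 p s = (if p \<in> S then V1 s else 0)" for p s
  define h where "h t p s = \<theta> p (s + t * U p) * exp (W p s)" for t p s
  define g where "g t p s = \<theta>' p (s + t * U p) * exp (W p s)" for t p s
  define h' where "h' t p s = g t p s + h t p s * W1 p s" for t p s
  have c0: "continuous_on UNIV (\<theta> p)" for p using d by (meson DERIV_continuous_on has_field_derivative_at_within)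
  have cW: "continuous_on UNIV (W p)" "continuous_on UNIV (W1 p)" for p
    unfolding W_def W1_def using V_cont V1_cont by (cases "p \<in> S"; simp)+
  have dW: "(W p has_real_derivative W1 p s) (at s)" for p s
    unfolding W_def W1_def using V_deriv by auto
  have ch: "continuous_on UNIV (h t p)" "continuous_on UNIV (g t p)" for t p
    unfolding h_def g_def
    by (intro continuous_intros continuous_on_compose2[OF c0] continuous_on_compose2[OF c] cW; simp)+
  have ch': "continuous_on UNIV (h' t p)" for t p
    unfolding h'_def by (intro continuous_intros ch cW)
  have dh: "(h t p has_real_derivative h' t p s) (at s)" for t p s
  proof -
    have "((\<lambda>s. s + t * U p) has_real_derivative 1) (at s)" by (auto intro!: derivative_eq_intros)
    from DERIV_chain2[OF d this] have 1: "((\<lambda>s. \<theta> p (s + t * U p)) has_real_derivative \<theta>' p (s + t * U p)) (at s)"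
      by simp
    have 2: "((\<lambda>s. exp (W p s)) has_real_derivative exp (W p s) * W1 p s) (at s)"
      by (rule DERIV_chain2[OF DERIV_exp dW])
    show ?thesis
      unfolding h'_def h_def[abs_def] g_def using DERIV_mult[OF 1 2] by (simp add: algebra_simps)
  qed
  have bound: "\<exists>K. \<forall>t p s. \<bar>t\<bar> \<le> t0 \<longrightarrow> p \<in> B \<longrightarrow> \<bar>h t p s\<bar> \<le> K \<and> \<bar>g t p s\<bar> \<le> K \<and> \<bar>h' t p s\<bar> \<le> K" for t0
  proof -
    \<comment> \<open>For all \<open>t\<close> up to \<open>t0\<close> in modulus, the supports of
      the shifted factors lie within this radius.\<close>
    define R' where "R' = R + \<bar>t0\<bar> * (\<Sum>p\<in>B. \<bar>U p\<bar>)"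
    have comp: "\<exists>K. \<forall>s\<in>{- r..r}. \<bar>f s\<bar> \<le> K" if "continuous_on UNIV f" for f :: "real \<Rightarrow> real" and r
    proof -
      have "bounded (f ` {- r..r})"
        by (intro compact_imp_bounded compact_continuous_image continuous_on_subset[OF that]) auto
      then show ?thesis unfolding bounded_iff by (metis imageI real_norm_def)
    qed
    have fin: "\<exists>K. \<forall>p\<in>B. \<forall>s\<in>{- r..r}. \<bar>f p s\<bar> \<le> K" if "\<And>p. continuous_on UNIV (f p)" for f :: "'d site \<times> 'd \<Rightarrow> real \<Rightarrow> real" and r
    proof -
      have "\<forall>p. \<exists>K. \<forall>s\<in>{- r..r}. \<bar>f p s\<bar> \<le> K" using comp[OF that] by blast
      then obtain K where K: "\<And>p s. s \<in> {- r..r} \<Longrightarrow> \<bar>f p s\<bar> \<le> K p" by metis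
      have "\<bar>f p s\<bar> \<le> (\<Sum>p\<in>B. \<bar>K p\<bar>)" if "p \<in> B" "s \<in> {- r..r}" for p s
      proof -
        have "\<bar>K p\<bar> \<le> (\<Sum>p\<in>B. \<bar>K p\<bar>)" by (rule member_le_sum[OF that(1) _ B(1)]) auto
        then show ?thesis using K[OF that(2), of p] by linarith
      qed
      then show ?thesis by blast
    qed
    obtain K1 where K1: "\<And>p s. p \<in> B \<Longrightarrow> s \<in> {- R..R} \<Longrightarrow> \<bar>\<theta> p s\<bar> \<le> K1" using fin[of "\<theta>" "R", OF c0] by blast
    obtain K2 where K2: "\<And>p s. p \<in> B \<Longrightarrow> s \<in> {- R..R} \<Longrightarrow> \<bar>\<theta>' p s\<bar> \<le> K2" using fin[of "\<theta>'" "R", OF c] by blast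
    obtain K3 where K3: "\<And>p s. p \<in> B \<Longrightarrow> s \<in> {- R'..R'} \<Longrightarrow> \<bar>W p s\<bar> \<le> K3" using fin[of "W" "R'", OF cW(1)] by blast
    obtain K4 where K4: "\<And>p s. p \<in> B \<Longrightarrow> s \<in> {- R'..R'} \<Longrightarrow> \<bar>W1 p s\<bar> \<le> K4" using fin[of "W1" "R'", OF cW(2)] by blast
    define k where "k = (\<bar>K1\<bar> + \<bar>K2\<bar>) * exp \<bar>K3\<bar>"
    have k0: "0 \<le> k" by (simp add: k_def)
    have "\<bar>h t p s\<bar> \<le> k * (1 + \<bar>K4\<bar>) \<and> \<bar>g t p s\<bar> \<le> k * (1 + \<bar>K4\<bar>) \<and> \<bar>h' t p s\<bar> \<le> k * (1 + \<bar>K4\<bar>)" if t: "\<bar>t\<bar> \<le> t0" and p: "p \<in> B" for t p s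
    proof (cases "\<bar>s + t * U p\<bar> > R")
      case True
      then have "h t p s = 0" "g t p s = 0" "h' t p s = 0" using supp[OF p True] by (simp_all add: h_def g_def h'_def)
      then show ?thesis using k0 by simp
    next
      case False
      then have r: "s + t * U p \<in> {- R..R}" by auto
      have "\<bar>U p\<bar> \<le> (\<Sum>p\<in>B. \<bar>U p\<bar>)" by (rule member_le_sum[OF p _ B(1)]) auto
      then have "\<bar>t\<bar> * \<bar>U p\<bar> \<le> \<bar>t0\<bar> * (\<Sum>p\<in>B. \<bar>U p\<bar>)" using t by (intro mult_mono) auto
      then have "\<bar>t * U p\<bar> \<le> \<bar>t0\<bar> * (\<Sum>p\<in>B. \<bar>U p\<bar>)" by (simp add: abs_mult)
      then have r': "s \<in> {- R'..R'}" using False unfolding R'_def by auto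
      have e: "exp (W p s) \<le> exp \<bar>K3\<bar>" using K3[OF p r'] by simp
      have "\<bar>\<theta> p (s + t * U p)\<bar> * exp (W p s) \<le> (\<bar>K1\<bar> + \<bar>K2\<bar>) * exp \<bar>K3\<bar>"
        using K1[OF p r] e by (intro mult_mono) auto
      then have h: "\<bar>h t p s\<bar> \<le> k" by (simp add: h_def k_def abs_mult)
      have "\<bar>\<theta>' p (s + t * U p)\<bar> * exp (W p s) \<le> (\<bar>K1\<bar> + \<bar>K2\<bar>) * exp \<bar>K3\<bar>"
        using K2[OF p r] e by (intro mult_mono) auto
      then have g: "\<bar>g t p s\<bar> \<le> k" by (simp add: g_def k_def abs_mult)
      have "\<bar>h t p s\<bar> * \<bar>W1 p s\<bar> \<le> k * \<bar>K4\<bar>" using h K4[OF p r'] k0 by (intro mult_mono) auto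
      then have "\<bar>h t p s * W1 p s\<bar> \<le> k * \<bar>K4\<bar>" by (simp add: abs_mult)
      then have "\<bar>h' t p s\<bar> \<le> k + k * \<bar>K4\<bar>" using g unfolding h'_def by linarith
      moreover have "0 \<le> k * \<bar>K4\<bar>" using k0 by simp
      ultimately show ?thesis using h g unfolding distrib_left mult_1_right by (intro conjI; linarith)
    qed
    then show ?thesis by blast
  qed
  define F where "F t w = (\<Prod>p\<in>B. h t p (w p))" for t w
  define F1 where "F1 t q w = (if q \<in> B then h' t q (w q) * (\<Prod>p\<in>B - {q}. h t p (w p)) else 0)" for t q w
  define D where "D t w = (\<Sum>q\<in>B. U q * (g t q (w q) * (\<Prod>p\<in>B - {q}. h t p (w p))))" for t w
  have FC: "C1b B (F t) (F1 t)" for t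
  proof -
    obtain K where K: "\<And>p s. p \<in> B \<Longrightarrow> \<bar>h t p s\<bar> \<le> K \<and> \<bar>h' t p s\<bar> \<le> K" using bound[of "\<bar>t\<bar>"] by fastforce
    show ?thesis unfolding F_def[abs_def] F1_def[abs_def]
      by (rule C1b_prod[OF B(1) dh ch', where K=K]) (use K in auto)
  qed
  have Fm: "(\<lambda>\<eta>. F t (coords \<eta>)) \<in> borel_measurable \<mu>" for t
    by (rule measurable_compose[OF coords_meas' borel_measurable_continuous_onI[OF C1b_cont[OF FC]]])
  have Dcont: "continuous_on UNIV (D t)" for t
    unfolding D_def[abs_def]
    by (intro continuous_intros continuous_on_prod continuous_on_compose2[OF ch(1) continuous_on_product_coordinates]
        continuous_on_compose2[OF ch(2) continuous_on_product_coordinates]) auto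
  have Dm: "(\<lambda>\<eta>. D t (coords \<eta>)) \<in> borel_measurable \<mu>" for t
    by (rule measurable_compose[OF coords_meas' borel_measurable_continuous_onI[OF Dcont]])
  have D0: "(\<integral>\<eta>. D t (coords \<eta>) \<partial>\<mu>) = 0" for t
  proof -
    \<comment> \<open>On \<open>S\<close> the derivative of the exponential cancels the term with
      \<open>V1\<close>; off \<open>S\<close> the direction is zero.\<close>
    have e: "U q * (F1 t q w - V1 (w q) * F t w) = U q * (g t q (w q) * (\<Prod>p\<in>B - {q}. h t p (w p)))" if q: "q \<in> B" for q w
    proof (cases "q \<in> S")
      case True
      have "F t w = h t q (w q) * (\<Prod>p\<in>B - {q}. h t p (w p))"
        unfolding F_def by (rule prod.remove[OF B(1) q])
      then show ?thesis using True q by (simp add: F1_def h'_def W1_def algebra_simps)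
    next
      case False
      then have "U q = 0" unfolding U_def by (rule direction_off_S[OF u])
      then show ?thesis by simp
    qed
    have "D t w = (\<Sum>q\<in>B. U q * (F1 t q w - V1 (w q) * F t w))" for w
      unfolding D_def by (rule sum.cong[OF refl]) (rule e[symmetric])
    then show ?thesis using direction_ibp[OF u FC B(1) B] unfolding U_def by simp
  qed
  have "((\<lambda>t. \<integral>\<eta>. F t (coords \<eta>) \<partial>\<mu>) has_real_derivative (\<integral>\<eta>. D t (coords \<eta>) \<partial>\<mu>)) (at t)" for t
  proof -
    obtain K where K: "\<And>s p y. \<bar>s\<bar> \<le> \<bar>t\<bar> + 1 \<Longrightarrow> p \<in> B \<Longrightarrow> \<bar>h s p y\<bar> \<le> K \<and> \<bar>g s p y\<bar> \<le> K"
      using bound[of "\<bar>t\<bar> + 1"] by fastforce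
    \<comment> \<open>The maximum only ensures that the bound is nonnegative, also when
      \<open>B\<close> is empty.\<close>
    define K' where "K' = max K 1"
    have K': "\<bar>h s p y\<bar> \<le> K'" "\<bar>g s p y\<bar> \<le> K'" if "\<bar>s - t\<bar> < 1" "p \<in> B" for s p y
    proof -
      have "\<bar>s\<bar> \<le> \<bar>t\<bar> + 1" using that(1) by linarith
      from K[OF this that(2), of y] show "\<bar>h s p y\<bar> \<le> K'" "\<bar>g s p y\<bar> \<le> K'" by (auto simp: K'_def)
    qed
    have prod_le: "\<bar>\<Prod>p\<in>B'. h s p (w p)\<bar> \<le> K' ^ card B'" if "B' \<subseteq> B" "\<bar>s - t\<bar> < 1" for B' s w
    proof -
      have "\<bar>\<Prod>p\<in>B'. h s p (w p)\<bar> = (\<Prod>p\<in>B'. \<bar>h s p (w p)\<bar>)" by (rule abs_prod)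
      also have "\<dots> \<le> (\<Prod>p\<in>B'. K')" using that K' by (intro prod_mono) auto
      finally show ?thesis by simp
    qed
    show ?thesis
    proof (rule has_real_derivative_integral[where r=1 and g="\<lambda>_. \<Sum>q\<in>B. \<bar>U q\<bar> * (K' * K' ^ card (B - {q}))"])
      fix s \<eta>
      assume s: "\<bar>s - t\<bar> < 1"
      have dt: "((\<lambda>s. h s p y) has_real_derivative U p * g s p y) (at s)" for p y
      proof -
        have "((\<lambda>s. \<theta> p (y + s * U p)) has_real_derivative \<theta>' p (y + s * U p) * U p) (at s)"
          by (rule DERIV_chain2[OF d]) (auto intro!: derivative_eq_intros)
        from DERIV_cmult_right[OF this, of "exp (W p y)"] show ?thesis unfolding h_def g_def by (simp add: mult_ac)
      qed
      have "((\<lambda>s. F s (coords \<eta>)) has_real_derivative (\<Sum>q\<in>B. U q * g s q (coords \<eta> q) * (\<Prod>p\<in>B - {q}. h s p (coords \<eta> p)))) (at s)"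
        unfolding F_def by (rule has_field_derivative_prod) (rule dt)
      then show "((\<lambda>s. F s (coords \<eta>)) has_real_derivative D s (coords \<eta>)) (at s)"
        unfolding D_def by (simp add: mult.assoc)
      have "\<bar>D s (coords \<eta>)\<bar> \<le> (\<Sum>q\<in>B. \<bar>U q * (g s q (coords \<eta> q) * (\<Prod>p\<in>B - {q}. h s p (coords \<eta> p)))\<bar>)"
        unfolding D_def by (rule sum_abs)
      also have "\<dots> \<le> (\<Sum>q\<in>B. \<bar>U q\<bar> * (K' * K' ^ card (B - {q})))"
        unfolding abs_mult by (intro sum_mono mult_left_mono mult_mono K'(2)[OF s] prod_le[OF _ s]) (auto simp: K'_def)
      finally show "\<bar>D s (coords \<eta>)\<bar> \<le> (\<Sum>q\<in>B. \<bar>U q\<bar> * (K' * K' ^ card (B - {q})))" .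
    next
      fix s assume "\<bar>s - t\<bar> < 1"
      show "integrable \<mu> (\<lambda>\<eta>. F s (coords \<eta>))"
      proof -
        obtain B' where "\<And>w. \<bar>F s w\<bar> \<le> B'" using C1b_bounded[OF FC] by blast
        then show ?thesis by (rule bounded_coords(1)[OF borel_measurable_continuous_onI[OF C1b_cont[OF FC]]])
      qed
    qed (use Dm in auto)
  qed
  then have "(\<integral>\<eta>. F 1 (coords \<eta>) \<partial>\<mu>) = (\<integral>\<eta>. F 0 (coords \<eta>) \<partial>\<mu>)"
    unfolding D0 by (rule DERIV_isconst_all[rule_format])
  moreover have "(\<Prod>p\<in>B. exp (W p (w p))) = exp (energy w)" for w
  proof -
    have "(\<Sum>p\<in>B. W p (w p)) = energy w"
      unfolding energy_def W_def using B by (subst sum.If_cases) (auto simp: Int_absorb1)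
    then show ?thesis by (metis exp_sum B(1))
  qed
  then have "F t w = (\<Prod>p\<in>B. \<theta> p (w p + t * U p)) * exp (energy w)" for t w
    unfolding F_def h_def prod.distrib by simp
  ultimately show ?thesis unfolding U_def by simp
qed

end

section \<open>Approximation of interval indicators\<close>

text \<open>The square makes the positive part C^1, which is the regularity that the integration by
  parts formula asks of its test functions.\<close>

definition possq :: "real \<Rightarrow> real" where "possq x = (max 0 x)\<^sup>2"

lemma possq_deriv: "(possq has_real_derivative 2 * max 0 x) (at x)"
proof (cases "x = 0")
  case True
  have "((\<lambda>h. (possq (0 + h) - possq 0) / h) \<longlongrightarrow> 0) (at 0)"
  proof (rule Lim_null_comparison[where g="\<lambda>h. \<bar>h\<bar>"])
    show "\<forall>\<^sub>F h in at 0. norm ((possq (0 + h) - possq 0) / h) \<le> \<bar>h\<bar>"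
      by (rule always_eventually) (auto simp: possq_def max_def power2_eq_square)
    show "((\<lambda>h::real. \<bar>h\<bar>) \<longlongrightarrow> 0) (at 0)" by (rule tendsto_rabs_zero[OF tendsto_ident_at])
  qed
  then show ?thesis using True by (simp add: DERIV_def)
next
  case False
  then consider "x > 0" | "x < 0" by linarith
  then show ?thesis
  proof cases
    case 1
    have "((\<lambda>x. x\<^sup>2) has_real_derivative 2 * x) (at x)" by (auto intro!: derivative_eq_intros)
    moreover have "\<forall>\<^sub>F y in nhds x. possq y = y\<^sup>2"
      using eventually_nhds_in_open[of "{0<..}" x] 1 by (auto simp: possq_def elim!: eventually_mono)
    ultimately show ?thesis using 1 DERIV_cong_ev[of x x possq "\<lambda>x. x\<^sup>2" "2 * x" "2 * x"] by simp
  next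
    case 2
    have "\<forall>\<^sub>F y in nhds x. possq y = 0"
      using eventually_nhds_in_open[of "{..<0}" x] 2 by (auto simp: possq_def elim!: eventually_mono)
    then show ?thesis using 2 DERIV_cong_ev[of x x possq "\<lambda>_. 0" 0 0] by simp
  qed
qed

lemma possq_cont: "continuous_on UNIV possq"
  unfolding possq_def[abs_def] by (intro continuous_intros)

text \<open>\<open>C\<^sup>1\<close> functions increasing to the indicator of an open interval.\<close>

definition bump :: "real \<Rightarrow> real \<Rightarrow> real \<Rightarrow> real \<Rightarrow> real" where
  "bump m l r s = m * (possq (s - l) * possq (r - s)) / (1 + m * (possq (s - l) * possq (r - s)))"
definition bump' :: "real \<Rightarrow> real \<Rightarrow> real \<Rightarrow> real \<Rightarrow> real" where
  "bump' m l r s = m * (2 * max 0 (s - l) * possq (r - s) - possq (s - l) * (2 * max 0 (r - s)))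
    / (1 + m * (possq (s - l) * possq (r - s)))\<^sup>2"

lemma bump_denominator: "m \<ge> 0 \<Longrightarrow> 1 + m * (possq (s - l) * possq (r - s)) > 0"
  by (simp add: possq_def add_pos_nonneg)

lemma bump_deriv:
  assumes m: "m \<ge> 0"
  shows "(bump m l r has_real_derivative bump' m l r s) (at s)"
proof -
  let ?y = "\<lambda>s. possq (s - l) * possq (r - s)"
  let ?y' = "2 * max 0 (s - l) * possq (r - s) - possq (s - l) * (2 * max 0 (r - s))"
  have 1: "((\<lambda>s. possq (s - l)) has_real_derivative 2 * max 0 (s - l) * 1) (at s)"
    by (rule DERIV_chain2[OF possq_deriv]) (auto intro!: derivative_eq_intros)
  have 2: "((\<lambda>s. possq (r - s)) has_real_derivative 2 * max 0 (r - s) * - 1) (at s)"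
    by (rule DERIV_chain2[OF possq_deriv]) (auto intro!: derivative_eq_intros)
  have y: "(?y has_real_derivative ?y') (at s)"
    using DERIV_mult[OF 1 2] by (simp add: algebra_simps)
  have n: "1 + m * ?y s \<noteq> 0" using bump_denominator[OF m, of s l r] by linarith
  have a: "((\<lambda>s. m * ?y s) has_real_derivative m * ?y') (at s)" by (rule DERIV_cmult[OF y])
  have b: "((\<lambda>s. 1 + m * ?y s) has_real_derivative m * ?y') (at s)" using DERIV_add[OF DERIV_const a] by simp
  have "((\<lambda>s. m * ?y s / (1 + m * ?y s)) has_real_derivative
      (m * ?y' * (1 + m * ?y s) - m * ?y s * (m * ?y')) / ((1 + m * ?y s) * (1 + m * ?y s))) (at s)"
    by (rule DERIV_divide[OF a b n])
  moreover have "m * ?y' * (1 + m * ?y s) - m * ?y s * (m * ?y') = m * ?y'" by (simp add: algebra_simps)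
  ultimately show ?thesis unfolding bump_def[abs_def] bump'_def power2_eq_square[of "1 + _"] by (simp only:)
qed

lemma bump_cont: "m \<ge> 0 \<Longrightarrow> continuous_on UNIV (bump m l r)" "m \<ge> 0 \<Longrightarrow> continuous_on UNIV (bump' m l r)"
proof -
  assume m: "m \<ge> 0"
  have p: "continuous_on UNIV (\<lambda>s. possq (s - l))" "continuous_on UNIV (\<lambda>s. possq (r - s))"
    by (rule continuous_on_compose2[OF possq_cont]; auto intro!: continuous_intros)+
  have n: "1 + m * (possq (s - l) * possq (r - s)) \<noteq> 0" for s using bump_denominator[OF m, of s l r] by linarith
  show "continuous_on UNIV (bump m l r)" unfolding bump_def[abs_def]
    by (intro continuous_intros p) (use n in auto)
  show "continuous_on UNIV (bump' m l r)" unfolding bump'_def[abs_def]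
    by (intro continuous_intros p) (use n in auto)
qed

lemma bump_range: "m \<ge> 0 \<Longrightarrow> 0 \<le> bump m l r s" "m \<ge> 0 \<Longrightarrow> bump m l r s \<le> 1"
  using bump_denominator[of m s l r] unfolding bump_def by (auto simp: possq_def)

lemma bump_zero: "\<not> (l < s \<and> s < r) \<Longrightarrow> bump m l r s = 0" "\<not> (l < s \<and> s < r) \<Longrightarrow> bump' m l r s = 0"
  by (auto simp: bump_def bump'_def possq_def max_def)

lemma bump_tendsto: "(\<lambda>n. bump (real n) l r s) \<longlonglongrightarrow> (if l < s \<and> s < r then 1 else 0)"
proof (cases "l < s \<and> s < r")
  case True
  define y where "y = possq (s - l) * possq (r - s)"
  have y: "y > 0" using True by (simp add: y_def possq_def)
  have d: "1 + real n * y > 0" for n using y by (simp add: add_pos_nonneg)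
  have "filterlim (\<lambda>n. 1 + real n * y) at_top sequentially"
    by (intro filterlim_tendsto_add_at_top[OF tendsto_const] filterlim_at_top_mult_tendsto_pos[OF tendsto_const y] filterlim_real_sequentially)
  then have "(\<lambda>n. 1 - inverse (1 + real n * y)) \<longlonglongrightarrow> 1 - 0"
    by (intro tendsto_diff tendsto_const tendsto_inverse_0_at_top)
  moreover have "bump (real n) l r s = 1 - inverse (1 + real n * y)" for n
  proof -
    have "bump (real n) l r s = real n * y / (1 + real n * y)" by (simp only: bump_def y_def)
    also have "\<dots> = 1 - inverse (1 + real n * y)" using d[of n] by (simp add: field_simps)
    finally show ?thesis .
  qed
  ultimately show ?thesis using True by simp
next
  case False
  have "(\<lambda>n. bump (real n) l r s) = (\<lambda>n. 0)" using bump_zero(1)[OF False] by (intro ext)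
  then show ?thesis using False by auto
qed

section \<open>Invariance of the weighted measure under directions\<close>

definition translate :: "(('d::finite) bond \<Rightarrow> real) \<Rightarrow> ('d bond \<Rightarrow> real) \<Rightarrow> 'd bond \<Rightarrow> real" where
  "translate u \<eta> = (\<lambda>b\<in>bonds. \<eta> b + u b)"

lemma translate_grad: "\<eta> \<in> gradient_fields \<Longrightarrow> u \<in> gradient_fields \<Longrightarrow> translate u \<eta> \<in> gradient_fields"
proof -
  assume "\<eta> \<in> gradient_fields" "u \<in> gradient_fields"
  then obtain \<phi> \<psi> where "\<eta> = grad \<phi>" "u = grad \<psi>" by (auto simp: gradient_fields_def)
  then have "translate u \<eta> = grad (\<lambda>x. \<phi> x + \<psi> x)" by (auto simp: translate_def grad_def fun_eq_iff)
  then show ?thesis by (auto simp: gradient_fields_def)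
qed

lemma translate_measurable: "u \<in> gradient_fields \<Longrightarrow> translate u \<in> measurable gradient_space gradient_space"
proof (rule measurable_gradient_spaceI)
  show "(\<lambda>\<eta>. translate u \<eta> b) \<in> borel_measurable gradient_space" if "b \<in> bonds" for b
    using that gradient_space_component[OF that] by (simp add: translate_def)
qed (simp add: translate_grad)

lemma coords_translate: "coords (translate u \<eta>) p = coords \<eta> p + u (pb p)"
  by (simp add: coords_def translate_def)

context gibbs_volume begin

lemma energy_meas: "(\<lambda>\<eta>. energy (coords \<eta>)) \<in> borel_measurable gradient_space"
  unfolding energy_def meas_mu[symmetric]
  by (intro borel_measurable_sum measurable_compose[OF coords_meas borel_measurable_continuous_onI[OF V_cont]])

lemma exp_energy_bounded:
  "\<exists>K. \<forall>x. (\<forall>p\<in>S. \<bar>x p + w p\<bar> \<le> R) \<longrightarrow> exp (energy x) \<le> K"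
proof -
  define R' where "R' = R + (\<Sum>p\<in>S. \<bar>w p\<bar>)"
  have "bounded (V ` {- R'..R'})"
    by (intro compact_imp_bounded compact_continuous_image continuous_on_subset[OF V_cont]) auto
  then obtain K where K: "\<forall>x\<in>V ` {- R'..R'}. norm x \<le> K" unfolding bounded_iff by (rule exE)
  have "exp (energy x) \<le> exp (\<Sum>p\<in>S. K)" if x: "\<forall>p\<in>S. \<bar>x p + w p\<bar> \<le> R" for x
    unfolding energy_def exp_le_cancel_iff
  proof (rule sum_mono)
    fix p assume p: "p \<in> S"
    have "\<bar>w p\<bar> \<le> (\<Sum>p\<in>S. \<bar>w p\<bar>)" by (rule member_le_sum[OF p _ finite_S]) auto
    then have "x p \<in> {- R'..R'}" using bspec[OF x p] unfolding R'_def by auto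
    from bspec[OF K imageI[OF this]] show "V (x p) \<le> K" by simp
  qed
  then show ?thesis by blast
qed

definition box_event :: "('d site \<times> 'd) set \<Rightarrow> ('d site \<times> 'd \<Rightarrow> real) \<Rightarrow> ('d site \<times> 'd \<Rightarrow> real) \<Rightarrow> ('d bond \<Rightarrow> real) set" where
  "box_event B l r = {\<eta> \<in> gradient_fields. \<forall>p\<in>B. l p < coords \<eta> p \<and> coords \<eta> p < r p}"

lemma box_event_sets: "finite B \<Longrightarrow> box_event B l r \<in> sets gradient_space"
proof -
  assume B: "finite B"
  have [measurable]: "(\<lambda>\<eta>. coords \<eta> p) \<in> borel_measurable gradient_space" for p :: "'d site \<times> 'd"
    using coords_meas unfolding meas_mu .
  have "{\<eta> \<in> space gradient_space. \<forall>p\<in>B. l p < coords \<eta> p \<and> coords \<eta> p < r p} \<in> sets gradient_space"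
    using B by (intro sets.sets_Collect_finite_All) measurable
  then show ?thesis by (simp add: box_event_def)
qed

text \<open>The limit of the smooth case along bumps. As the box constrains every edge of
  \<open>S\<close>, the energy is bounded on it, and this gives a constant majorant.\<close>

lemma translation_invariance_box:
  assumes u: "u \<in> fields_bc \<Lambda> (\<lambda>_. 0)" and B: "finite B" "S \<subseteq> B"
  shows "(\<integral>\<eta>. (\<Prod>p\<in>B. if l p < coords \<eta> p + u (pb p) \<and> coords \<eta> p + u (pb p) < r p then 1 else 0) * exp (energy (coords \<eta>)) \<partial>\<mu>)
    = (\<integral>\<eta>. (\<Prod>p\<in>B. if l p < coords \<eta> p \<and> coords \<eta> p < r p then 1 else 0) * exp (energy (coords \<eta>)) \<partial>\<mu>)" (is "?L = ?R")
    and "\<And>w. integrable \<mu> (\<lambda>\<eta>. (\<Prod>p\<in>B. if l p < coords \<eta> p + w p \<and> coords \<eta> p + w p < r p then 1 else 0) * exp (energy (coords \<eta>)))"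
proof -
  define R where "R = (\<Sum>p\<in>B. \<bar>l p\<bar> + \<bar>r p\<bar>)"
  have in_R: "\<bar>s\<bar> \<le> R" if "p \<in> B" "l p < s \<and> s < r p" for p s
  proof -
    have "\<bar>l p\<bar> + \<bar>r p\<bar> \<le> R" unfolding R_def by (rule member_le_sum[OF that(1) _ B(1)]) auto
    then show ?thesis using that(2) by linarith
  qed
  define f where "f n w \<eta> = (\<Prod>p\<in>B. bump (real n) (l p) (r p) (coords \<eta> p + w p)) * exp (energy (coords \<eta>))" for n w \<eta>
  define f0 where "f0 w \<eta> = (\<Prod>p\<in>B. if l p < coords \<eta> p + w p \<and> coords \<eta> p + w p < r p then 1 else 0) * exp (energy (coords \<eta>))" for w \<eta>
  have fm: "f n w \<in> borel_measurable \<mu>" for n w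
    unfolding f_def[abs_def]
  proof (intro borel_measurable_times borel_measurable_prod)
    show "(\<lambda>\<eta>. exp (energy (coords \<eta>))) \<in> borel_measurable \<mu>"
      unfolding meas_mu by (rule measurable_compose[OF energy_meas]) simp
    fix p
    have "(\<lambda>\<eta>. coords \<eta> p + w p) \<in> borel_measurable \<mu>" by (intro borel_measurable_add coords_meas borel_measurable_const)
    then show "(\<lambda>\<eta>. bump (real n) (l p) (r p) (coords \<eta> p + w p)) \<in> borel_measurable \<mu>"
      by (rule measurable_compose) (rule borel_measurable_continuous_onI[OF bump_cont(1)], simp)
  qed
  have f0l: "(\<lambda>n. f n w \<eta>) \<longlonglongrightarrow> f0 w \<eta>" for w \<eta>
    unfolding f_def f0_def by (intro tendsto_mult tendsto_prod bump_tendsto tendsto_const)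
  have f0m: "f0 w \<in> borel_measurable \<mu>" for w
    by (rule borel_measurable_LIMSEQ_real[OF f0l fm])
  have fb: "\<exists>K. \<forall>n \<eta>. \<bar>f n w \<eta>\<bar> \<le> K" for w
  proof -
    obtain K where K: "\<And>x. (\<forall>p\<in>S. \<bar>x p + w p\<bar> \<le> R) \<Longrightarrow> exp (energy x) \<le> K"
      using exp_energy_bounded[of w R] by blast
    have "\<bar>f n w \<eta>\<bar> \<le> \<bar>K\<bar>" for n \<eta>
    proof (cases "\<forall>p\<in>B. l p < coords \<eta> p + w p \<and> coords \<eta> p + w p < r p")
      case True
      then have "\<forall>p\<in>S. \<bar>coords \<eta> p + w p\<bar> \<le> R" using in_R B(2) by blast
      then have e: "exp (energy (coords \<eta>)) \<le> \<bar>K\<bar>" using K[of "coords \<eta>"] by linarith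
      have p1: "0 \<le> (\<Prod>p\<in>B. bump (real n) (l p) (r p) (coords \<eta> p + w p))" by (intro prod_nonneg) (simp add: bump_range)
      have "(\<Prod>p\<in>B. bump (real n) (l p) (r p) (coords \<eta> p + w p)) \<le> 1" by (intro prod_le_1) (simp add: bump_range)
      then have "(\<Prod>p\<in>B. bump (real n) (l p) (r p) (coords \<eta> p + w p)) * exp (energy (coords \<eta>)) \<le> 1 * \<bar>K\<bar>"
        using e p1 by (intro mult_mono) auto
      then show ?thesis using p1 by (simp add: f_def abs_mult)
    next
      case False
      then obtain p where "p \<in> B" "\<not> (l p < coords \<eta> p + w p \<and> coords \<eta> p + w p < r p)" by blast
      then have "\<exists>p\<in>B. bump (real n) (l p) (r p) (coords \<eta> p + w p) = 0" using bump_zero(1) by blast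
      then have "f n w \<eta> = 0" using prod_zero[OF B(1)] by (simp add: f_def)
      then show ?thesis by simp
    qed
    then show ?thesis by blast
  qed
  have lim: "(\<lambda>n. \<integral>\<eta>. f n w \<eta> \<partial>\<mu>) \<longlonglongrightarrow> (\<integral>\<eta>. f0 w \<eta> \<partial>\<mu>)" and int: "integrable \<mu> (f0 w)" for w
  proof -
    obtain K where K: "\<And>n \<eta>. \<bar>f n w \<eta>\<bar> \<le> K" using fb by blast
    show "(\<lambda>n. \<integral>\<eta>. f n w \<eta> \<partial>\<mu>) \<longlonglongrightarrow> (\<integral>\<eta>. f0 w \<eta> \<partial>\<mu>)"
      by (rule integral_dominated_convergence[where w="\<lambda>_. K"]) (use f0m fm f0l K in auto)
    show "integrable \<mu> (f0 w)"
      by (rule integrable_dominated_convergence[where w="\<lambda>_. K" and s="\<lambda>n. f n w"]) (use f0m fm f0l K in auto)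
  qed
  have "(\<integral>\<eta>. f n (\<lambda>p. u (pb p)) \<eta> \<partial>\<mu>) = (\<integral>\<eta>. f n (\<lambda>_. 0) \<eta> \<partial>\<mu>)" for n
  proof -
    have "(\<integral>\<eta>. (\<Prod>p\<in>B. bump (real n) (l p) (r p) (coords \<eta> p + u (pb p))) * exp (energy (coords \<eta>)) \<partial>\<mu>)
      = (\<integral>\<eta>. (\<Prod>p\<in>B. bump (real n) (l p) (r p) (coords \<eta> p)) * exp (energy (coords \<eta>)) \<partial>\<mu>)"
      by (rule translation_invariance_smooth[where \<theta>'="\<lambda>p. bump' (real n) (l p) (r p)" and R=R, OF u B])
         (use in_R in \<open>auto intro!: bump_deriv bump_cont bump_zero simp: not_le[symmetric]\<close>)
    then show ?thesis by (simp add: f_def)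
  qed
  with lim[of "\<lambda>p. u (pb p)"] lim[of "\<lambda>_. 0"] have "(\<integral>\<eta>. f0 (\<lambda>p. u (pb p)) \<eta> \<partial>\<mu>) = (\<integral>\<eta>. f0 (\<lambda>_. 0) \<eta> \<partial>\<mu>)"
    using LIMSEQ_unique by simp
  then show "?L = ?R" by (simp add: f0_def)
  show "\<And>w. integrable \<mu> (\<lambda>\<eta>. (\<Prod>p\<in>B. if l p < coords \<eta> p + w p \<and> coords \<eta> p + w p < r p then 1 else 0) * exp (energy (coords \<eta>)))"
    using int unfolding f0_def .
qed

text \<open>The law with the Gibbs factor of \<open>\<Lambda>\<close> divided out. Its total mass
  may be infinite; finiteness on boxes and sigma-finiteness take the place of a finite mass.\<close>

definition lam :: "('d bond \<Rightarrow> real) measure" where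
  "lam = density \<mu> (\<lambda>\<eta>. ennreal (exp (energy (coords \<eta>))))"

lemma sets_lam: "sets lam = sets gradient_space" by (simp add: lam_def sets_mu)
lemma space_lam: "space lam = gradient_fields" by (simp add: lam_def space_mu)
lemma meas_lam: "measurable lam A = measurable gradient_space A"
  by (rule measurable_cong_sets[OF sets_lam refl])

lemma exp_energy_meas: "(\<lambda>\<eta>. ennreal (exp (energy (coords \<eta>)))) \<in> borel_measurable \<mu>"
  unfolding meas_mu by (intro measurable_compose[OF energy_meas]) simp

lemma directions_grad: "u \<in> fields_bc \<Lambda> (\<lambda>_. 0) \<Longrightarrow> u \<in> gradient_fields"
  by (simp add: fields_bc_def)

lemma zero_direction: "grad (\<lambda>_. 0) \<in> fields_bc \<Lambda> (\<lambda>_. 0)"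
proof -
  have "grad (\<lambda>_. 0) \<in> gradient_fields" by (simp add: gradient_fields_def)
  moreover have "\<forall>b\<in>bonds - bond_closure \<Lambda>. grad (\<lambda>_. 0) b = 0" by (simp add: grad_def)
  ultimately show ?thesis by (simp add: fields_bc_def)
qed

lemma emeasure_lam_box:
  assumes B: "finite B" "S \<subseteq> B" and u: "u \<in> gradient_fields"
  shows "emeasure (distr lam gradient_space (translate u)) (box_event B l r)
    = ennreal (\<integral>\<eta>. (\<Prod>p\<in>B. if l p < coords \<eta> p + u (pb p) \<and> coords \<eta> p + u (pb p) < r p then 1 else 0) * exp (energy (coords \<eta>)) \<partial>\<mu>)"
proof -
  let ?f = "\<lambda>\<eta>. \<Prod>p\<in>B. if l p < coords \<eta> p + u (pb p) \<and> coords \<eta> p + u (pb p) < r p then 1 else 0 :: real"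
  let ?A = "translate u -` box_event B l r \<inter> gradient_fields"
  have tm: "translate u \<in> measurable lam gradient_space" unfolding meas_lam by (rule translate_measurable[OF u])
  have A: "?A \<in> sets \<mu>"
    using measurable_sets[OF translate_measurable[OF u] box_event_sets[OF B(1), of l r]] by (simp add: sets_mu)
  have "emeasure (distr lam gradient_space (translate u)) (box_event B l r) = emeasure lam ?A"
    using emeasure_distr[OF tm box_event_sets[OF B(1)]] by (simp add: space_lam)
  also have "\<dots> = (\<integral>\<^sup>+\<eta>. ennreal (exp (energy (coords \<eta>))) * indicator ?A \<eta> \<partial>\<mu>)"
    unfolding lam_def by (rule emeasure_density[OF exp_energy_meas A])
  also have "\<dots> = (\<integral>\<^sup>+\<eta>. ennreal (?f \<eta> * exp (energy (coords \<eta>))) \<partial>\<mu>)"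
  proof (rule nn_integral_cong)
    fix \<eta> assume "\<eta> \<in> space \<mu>"
    then have g: "\<eta> \<in> gradient_fields" by (simp add: space_mu)
    have "?f \<eta> = (if \<eta> \<in> ?A then 1 else 0)"
    proof (cases "\<forall>p\<in>B. l p < coords \<eta> p + u (pb p) \<and> coords \<eta> p + u (pb p) < r p")
      case True
      then have "\<eta> \<in> ?A" using g u by (auto simp: box_event_def coords_translate translate_grad)
      moreover have "?f \<eta> = 1" using True by (intro prod.neutral) auto
      ultimately show ?thesis by simp
    next
      case False
      then have "\<eta> \<notin> ?A" by (auto simp: box_event_def coords_translate)
      moreover have "?f \<eta> = 0" using False B(1) by (intro prod_zero) auto
      ultimately show ?thesis by simp
    qed
    then show "ennreal (exp (energy (coords \<eta>))) * indicator ?A \<eta> = ennreal (?f \<eta> * exp (energy (coords \<eta>)))"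
      by (auto simp: indicator_def)
  qed
  also have "\<dots> = ennreal (\<integral>\<eta>. ?f \<eta> * exp (energy (coords \<eta>)) \<partial>\<mu>)"
  proof (rule nn_integral_eq_integral)
    show "integrable \<mu> (\<lambda>\<eta>. ?f \<eta> * exp (energy (coords \<eta>)))"
      by (rule translation_invariance_box(2)[OF zero_direction B, where w="\<lambda>p. u (pb p)"])
    show "AE \<eta> in \<mu>. 0 \<le> ?f \<eta> * exp (energy (coords \<eta>))"
      by (intro AE_I2 mult_nonneg_nonneg prod_nonneg) auto
  qed
  finally show ?thesis .
qed


text \<open>Constraining all of \<open>S\<close> makes the energy bounded on every box and hence
  \<open>lam\<close> finite there.\<close>

definition boxes :: "('d bond \<Rightarrow> real) set set" where
  "boxes = {box_event B l r | B l r. finite B \<and> S \<subseteq> B}"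

text \<open>A half-line condition on one edge is a countable union of boxes: the \<open>n\<close>-th
  one confines the remaining edges of \<open>S\<close> to \<open>(- n, n)\<close> and cuts off the
  half-line at \<open>n\<close>.\<close>

lemma sigma_boxes: "sets gradient_space = sigma_sets gradient_fields boxes"
proof
  have sub: "boxes \<subseteq> sets gradient_space" by (auto simp: boxes_def intro: box_event_sets)
  then show "sigma_sets gradient_fields boxes \<subseteq> sets gradient_space"
    using sets.sigma_sets_subset[OF sub] by simp
  define G where "G = sigma gradient_fields boxes"
  have pow: "boxes \<subseteq> Pow gradient_fields" by (auto simp: boxes_def box_event_def)
  have sG: "sets G = sigma_sets gradient_fields boxes" "space G = gradient_fields"
    using pow by (simp_all add: G_def)
  have pm: "(\<lambda>\<eta>. \<eta> (pb p)) \<in> borel_measurable G" for p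
    unfolding borel_measurable_iff_greater
  proof
    fix a :: real
    define l where "l n q = (if q = p then a else - real n)" for n q
    have "{\<eta> \<in> space G. a < \<eta> (pb p)} = (\<Union>n. box_event (insert p S) (l n) (\<lambda>_. real n))"
    proof (intro equalityI subsetI)
      fix \<eta> assume \<eta>: "\<eta> \<in> {\<eta> \<in> space G. a < \<eta> (pb p)}"
      obtain n where n: "(\<Sum>q\<in>insert p S. \<bar>coords \<eta> q\<bar>) < real n" using reals_Archimedean2 by blast
      have "\<bar>coords \<eta> q\<bar> < real n" if "q \<in> insert p S" for q
        using member_le_sum[OF that, of "\<lambda>q. \<bar>coords \<eta> q\<bar>"] finite_S n by simp
      then have "\<forall>q\<in>insert p S. l n q < coords \<eta> q \<and> coords \<eta> q < real n"
        using \<eta> by (auto simp: l_def coords_def abs_less_iff) fastforce+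
      then show "\<eta> \<in> (\<Union>n. box_event (insert p S) (l n) (\<lambda>_. real n))"
        using \<eta> sG by (auto simp: box_event_def)
    qed (auto simp: box_event_def sG l_def coords_def)
    moreover have "box_event (insert p S) (l n) (\<lambda>_. real n) \<in> sets G" for n
      unfolding sG by (rule sigma_sets.Basic) (use finite_S in \<open>auto simp: boxes_def\<close>)
    ultimately show "{\<eta> \<in> space G. a < \<eta> (pb p)} \<in> sets G" by auto
  qed
  have "(\<lambda>\<eta>. \<eta>) \<in> measurable G gradient_space"
  proof (rule measurable_gradient_spaceI)
    fix b :: "'d bond" assume "b \<in> bonds"
    then show "(\<lambda>\<eta>. \<eta> b) \<in> borel_measurable G"
    proof (cases rule: bond_cases)
      case (2 p)
      have "(\<lambda>\<eta>. - \<eta> (pb p)) \<in> borel_measurable G" by (intro borel_measurable_uminus pm)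
      moreover have "\<eta> b = - \<eta> (pb p)" if "\<eta> \<in> space G" for \<eta>
        using grad_odd[of \<eta> "pb p"] that 2 sG by simp
      ultimately show ?thesis using measurable_cong[of G "\<lambda>\<eta>. \<eta> b" "\<lambda>\<eta>. - \<eta> (pb p)"] by blast
    qed (simp add: pm)
  qed (simp add: sG)
  from measurable_sets[OF this] show "sets gradient_space \<subseteq> sigma_sets gradient_fields boxes"
  proof -
    assume m: "\<And>A. A \<in> sets gradient_space \<Longrightarrow> (\<lambda>\<eta>. \<eta>) -` A \<inter> space G \<in> sets G"
    have "A \<in> sets G" if "A \<in> sets gradient_space" for A :: "('d bond \<Rightarrow> real) set"
      using m[OF that] sets.sets_into_space[OF that] by (simp add: sG(2) Int_absorb2 vimage_ident)
    then show ?thesis by (auto simp: sG)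
  qed
qed

lemma Int_stable_boxes: "Int_stable boxes"
proof (rule Int_stableI)
  fix X Y assume "X \<in> boxes" "Y \<in> boxes"
  then obtain B l r B' l' r' where X: "X = box_event B l r" "finite B" "S \<subseteq> B"
    and Y: "Y = box_event B' l' r'" "finite B'" "S \<subseteq> B'" by (auto simp: boxes_def)
  define l2 where "l2 p = (if p \<in> B then if p \<in> B' then max (l p) (l' p) else l p else l' p)" for p
  define r2 where "r2 p = (if p \<in> B then if p \<in> B' then min (r p) (r' p) else r p else r' p)" for p
  have "X \<inter> Y = box_event (B \<union> B') l2 r2"
    unfolding X Y box_event_def l2_def r2_def by (auto split: if_splits)
  then show "X \<inter> Y \<in> boxes" unfolding boxes_def using X Y by blast
qed

lemma translate_zero: "\<eta> \<in> gradient_fields \<Longrightarrow> translate (grad (\<lambda>_. 0)) \<eta> = \<eta>"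
  by (auto simp: translate_def grad_def gradient_fields_def fun_eq_iff)

lemma lam_invariant:
  assumes u: "u \<in> fields_bc \<Lambda> (\<lambda>_. 0)"
  shows "distr lam gradient_space (translate u) = lam"
proof -
  \<comment> \<open>The formula for boxes concerns translates; the zero translation makes it cover
    \<open>lam\<close> itself.\<close>
  have z: "distr lam gradient_space (translate (grad (\<lambda>_. 0))) = lam"
  proof -
    have "distr lam gradient_space (translate (grad (\<lambda>_. 0))) = distr lam lam (\<lambda>\<eta>. \<eta>)"
      by (rule distr_cong) (auto simp: sets_lam space_lam translate_zero)
    then show ?thesis by (simp add: distr_id2)
  qed
  have box: "emeasure (distr lam gradient_space (translate u)) X = emeasure lam X" if XB: "X \<in> boxes" for X
  proof -
    obtain B l r where X: "X = box_event B l r" "finite B" "S \<subseteq> B" using XB by (auto simp: boxes_def)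
    have "emeasure lam X = emeasure (distr lam gradient_space (translate (grad (\<lambda>_. 0)))) X" unfolding z ..
    also have "\<dots> = emeasure (distr lam gradient_space (translate u)) X"
      unfolding X(1) emeasure_lam_box[OF X(2,3) directions_grad[OF zero_direction]] emeasure_lam_box[OF X(2,3) directions_grad[OF u]]
      using translation_invariance_box(1)[OF u X(2,3), of l r] by (simp add: grad_def)
    finally show ?thesis ..
  qed
  \<comment> \<open>An exhaustion by boxes of finite mass, as the uniqueness theorem for measures
    requires.\<close>
  define A where "A n = box_event S (\<lambda>_. - real n) (\<lambda>_. real n)" for n
  have A: "A n \<in> boxes" for n using finite_S by (auto simp: A_def boxes_def)
  show ?thesis
  proof (rule measure_eqI_generator_eq[OF Int_stable_boxes, where \<Omega>=gradient_fields and A=A])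
    show "boxes \<subseteq> Pow gradient_fields" by (auto simp: boxes_def box_event_def)
    show "range A \<subseteq> boxes" using A by blast
    show "(\<Union>n. A n) = gradient_fields"
    proof (intro equalityI subsetI)
      fix \<eta> :: "'d bond \<Rightarrow> real" assume \<eta>: "\<eta> \<in> gradient_fields"
      obtain n where n: "(\<Sum>q\<in>S. \<bar>coords \<eta> q\<bar>) < real n" using reals_Archimedean2 by blast
      have "\<bar>coords \<eta> q\<bar> < real n" if "q \<in> S" for q
        using member_le_sum[OF that, of "\<lambda>q. \<bar>coords \<eta> q\<bar>"] finite_S n by simp
      then have "\<eta> \<in> A n" using \<eta> by (auto simp: A_def box_event_def abs_less_iff) fastforce
      then show "\<eta> \<in> (\<Union>n. A n)" by blast
    qed (auto simp: A_def box_event_def)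
    show "emeasure (distr lam gradient_space (translate u)) (A n) \<noteq> \<infinity>" for n
      unfolding A_def by (subst emeasure_lam_box[OF finite_S _ directions_grad[OF u]]) auto
  qed (use box in \<open>auto simp: sets_lam sigma_boxes\<close>)
qed

lemma nn_integral_lam_translate:
  assumes u: "u \<in> fields_bc \<Lambda> (\<lambda>_. 0)" and f: "f \<in> borel_measurable gradient_space"
  shows "(\<integral>\<^sup>+\<eta>. f (translate u \<eta>) \<partial>lam) = (\<integral>\<^sup>+\<eta>. f \<eta> \<partial>lam)"
proof -
  have t: "translate u \<in> measurable lam gradient_space"
    unfolding meas_lam by (rule translate_measurable[OF directions_grad[OF u]])
  have "(\<integral>\<^sup>+\<eta>. f \<eta> \<partial>distr lam gradient_space (translate u)) = (\<integral>\<^sup>+\<eta>. f (translate u \<eta>) \<partial>lam)"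
    by (rule nn_integral_distr[OF t]) (simp add: f)
  then show ?thesis unfolding lam_invariant[OF u] by simp
qed

end

section \<open>Linear algebra of directions and product Lebesgue measure\<close>

text \<open>Elimination by induction on the support: if some member of \<open>W\<close> is non-zero
  at \<open>x\<close>, a normalised one \<open>u\<close> extends a basis of the subspace vanishing
  at \<open>x\<close>, because \<open>f - f x * u\<close> lies in that subspace.\<close>

lemma finite_support_basis:
  fixes W :: "('b \<Rightarrow> real) set"
  assumes B: "finite B"
  shows "(\<And>f g. f \<in> W \<Longrightarrow> g \<in> W \<Longrightarrow> (\<lambda>b. f b + g b) \<in> W) \<Longrightarrow> (\<And>f a. f \<in> W \<Longrightarrow> (\<lambda>b. a * f b) \<in> W)
    \<Longrightarrow> (\<lambda>_. 0) \<in> W \<Longrightarrow> (\<And>f b. f \<in> W \<Longrightarrow> b \<notin> B \<Longrightarrow> f b = 0)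
    \<Longrightarrow> \<exists>(n::nat) v. (\<forall>i<n. v i \<in> W) \<and> (\<forall>f\<in>W. \<exists>c. \<forall>b. f b = (\<Sum>i<n. c i * v i b))
        \<and> (\<forall>c. (\<forall>b. (\<Sum>i<n. c i * v i b) = 0) \<longrightarrow> (\<forall>i<n. c i = (0::real)))"
  using B
proof (induction B arbitrary: W)
  case empty
  have "\<forall>f\<in>W. \<forall>b. f b = 0" using empty(4) by auto
  then show ?case by (intro exI[of _ "0::nat"] exI[of _ "\<lambda>_ _. 0"]) auto
next
  case (insert x B)
  show ?case
  proof (cases "\<forall>f\<in>W. f x = 0")
    case True
    have supp: "f b = 0" if "f \<in> W" "b \<notin> B" for f b
      using insert(7)[OF that(1), of b] True that by (cases "b = x") auto
    show ?thesis
    proof (rule insert(3))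
      show "(\<lambda>b. f b + g b) \<in> W" if "f \<in> W" "g \<in> W" for f g by (rule insert(4)[OF that])
      show "(\<lambda>b. a * f b) \<in> W" if "f \<in> W" for f a by (rule insert(5)[OF that])
      show "f b = 0" if "f \<in> W" "b \<notin> B" for f b by (rule supp[OF that])
    qed (rule insert(6))
  next
    case False
    then obtain u0 where u0: "u0 \<in> W" "u0 x \<noteq> 0" by blast
    define u where "u b = inverse (u0 x) * u0 b" for b
    have u: "u \<in> W" "u x = 1" using insert(5)[OF u0(1), of "inverse (u0 x)"] u0(2) by (simp_all add: u_def[abs_def])
    define W0 where "W0 = {f \<in> W. f x = 0}"
    have W0: "f \<in> W0 \<longleftrightarrow> f \<in> W \<and> f x = 0" for f by (simp add: W0_def)
    have "\<exists>(n::nat) v. (\<forall>i<n. v i \<in> W0) \<and> (\<forall>f\<in>W0. \<exists>c. \<forall>b. f b = (\<Sum>i<n. c i * v i b))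
        \<and> (\<forall>c. (\<forall>b. (\<Sum>i<n. c i * v i b) = 0) \<longrightarrow> (\<forall>i<n. c i = 0))"
    proof (rule insert(3))
      show "f b = 0" if "f \<in> W0" "b \<notin> B" for f b
        using insert(7)[of f b] that by (cases "b = x") (auto simp: W0)
    qed (auto simp: W0 intro: insert(4) insert(5) insert(6))
    then obtain n :: nat and v where v: "\<And>i. i < n \<Longrightarrow> v i \<in> W0" "\<And>f. f \<in> W0 \<Longrightarrow> \<exists>c. \<forall>b. f b = (\<Sum>i<n. c i * v i b)"
      "\<And>c i. (\<And>b. (\<Sum>i<n. c i * v i b) = 0) \<Longrightarrow> i < n \<Longrightarrow> c i = (0::real)" by blast
    define v' where "v' = v(n := u)"
    have s: "(\<Sum>i<Suc n. c i * v' i b) = (\<Sum>i<n. c i * v i b) + c n * u b" for c b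
      by (simp add: v'_def)
    have "\<forall>i<Suc n. v' i \<in> W" using v(1) u(1) by (auto simp: v'_def less_Suc_eq W0)
    moreover have "\<exists>c. \<forall>b. f b = (\<Sum>i<Suc n. c i * v' i b)" if f: "f \<in> W" for f
    proof -
      have "(\<lambda>b. f b + (- f x) * u b) \<in> W0"
        using insert(4)[OF f insert(5)[OF u(1), of "- f x"]] u(2) by (simp add: W0)
      from v(2)[OF this] obtain c where c: "\<And>b. f b + (- f x) * u b = (\<Sum>i<n. c i * v i b)" by blast
      have "f b = (\<Sum>i<Suc n. (c(n := f x)) i * v' i b)" for b
      proof -
        have "(\<Sum>i<n. (c(n := f x)) i * v i b) = (\<Sum>i<n. c i * v i b)" by (intro sum.cong) auto
        then show ?thesis unfolding s using c[of b] by simp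
      qed
      then show ?thesis by blast
    qed
    moreover have "\<forall>i<Suc n. c i = 0" if c: "\<forall>b. (\<Sum>i<Suc n. c i * v' i b) = 0" for c
    proof -
      have "(\<Sum>i<n. c i * v i x) = 0" using v(1) by (intro sum.neutral) (auto simp: W0)
      then have n: "c n = 0" using c[rule_format, of x] u(2) unfolding s by simp
      then have "(\<Sum>i<n. c i * v i b) = 0" for b using c[rule_format, of b] unfolding s by simp
      from v(3)[OF this] n show ?thesis by (auto simp: less_Suc_eq)
    qed
    ultimately show ?thesis by (intro exI[of _ "Suc n"] exI[of _ v']) blast
  qed
qed

text \<open>Yields linear functionals of a field that read off the coefficients of a direction;
  \<open>local_mass_finite\<close> builds a test density from them. The induction eliminates
  \<open>v n\<close> from the other vectors by means of an entry \<open>b0\<close> at which it is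
  non-zero.\<close>

lemma dual_functionals:
  fixes v :: "nat \<Rightarrow> 'b \<Rightarrow> real"
  assumes B: "finite B"
  shows "(\<And>c. (\<And>b. b \<in> B \<Longrightarrow> (\<Sum>j<n. c j * v j b) = 0) \<Longrightarrow> (\<forall>j<n. c j = (0::real)))
    \<Longrightarrow> \<exists>dl. \<forall>i<n. \<forall>j<n. (\<Sum>b\<in>B. dl i b * v j b) = (if i = j then 1 else (0::real))"
proof (induction n arbitrary: v)
  case (Suc n)
  have "\<exists>b0\<in>B. v n b0 \<noteq> 0"
  proof (rule ccontr)
    assume "\<not> (\<exists>b0\<in>B. v n b0 \<noteq> 0)"
    then have "(\<Sum>j<Suc n. (if j = n then 1 else 0) * v j b) = 0" if "b \<in> B" for b
      using that by simp
    from Suc(2)[OF this] show False by (auto dest: spec[of _ n])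
  qed
  then obtain b0 where b0: "b0 \<in> B" "v n b0 \<noteq> 0" by blast
  define q where "q j = v j b0 / v n b0" for j
  define v' where "v' j b = v j b - q j * v n b" for j b
  have v'0: "v' j b0 = 0" for j using b0 by (simp add: v'_def q_def)
  have "\<exists>dl. \<forall>i<n. \<forall>j<n. (\<Sum>b\<in>B. dl i b * v' j b) = (if i = j then 1 else 0)"
  proof (rule Suc(1))
    fix c :: "nat \<Rightarrow> real" assume c: "\<And>b. b \<in> B \<Longrightarrow> (\<Sum>j<n. c j * v' j b) = 0"
    define c' where "c' = c(n := - (\<Sum>j<n. c j * q j))"
    have "(\<Sum>j<Suc n. c' j * v j b) = 0" if "b \<in> B" for b
    proof -
      have "(\<Sum>j<Suc n. c' j * v j b) = (\<Sum>j<n. c j * v j b) - (\<Sum>j<n. c j * q j) * v n b"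
        by (simp add: c'_def)
      also have "\<dots> = (\<Sum>j<n. c j * v' j b)"
        unfolding v'_def sum_distrib_right sum_subtractf[symmetric]
        by (intro sum.cong refl) (simp add: algebra_simps)
      finally show ?thesis using c[OF that] by simp
    qed
    from Suc(2)[OF this] have "\<forall>j<Suc n. c' j = 0" .
    then have "c' j = 0" if "j < n" for j using that by simp
    then show "\<forall>j<n. c j = 0" by (simp add: c'_def)
  qed
  then obtain dl' where l': "\<And>i j. i < n \<Longrightarrow> j < n \<Longrightarrow> (\<Sum>b\<in>B. dl' i b * v' j b) = (if i = j then 1 else 0)" by blast
  define e where "e b = (if b = b0 then inverse (v n b0) else 0)" for b
  have e: "(\<Sum>b\<in>B. e b * f b) = f b0 / v n b0" for f :: "'b \<Rightarrow> real"
  proof -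
    have "(\<Sum>b\<in>B. e b * f b) = (\<Sum>b\<in>B. if b = b0 then f b0 / v n b0 else 0)"
      by (intro sum.cong) (auto simp: e_def divide_inverse)
    then show ?thesis using B b0 by simp
  qed
  \<comment> \<open>Corrected by evaluation at \<open>b0\<close> so as to annihilate
    \<open>v n\<close>. The values on \<open>v'\<close> stay those of \<open>dl'\<close>, because
    \<open>v'\<close> vanishes at \<open>b0\<close>.\<close>
  define k where "k i b = dl' i b - (\<Sum>b\<in>B. dl' i b * v n b) * e b" for i b
  have kv: "(\<Sum>b\<in>B. k i b * f b) = (\<Sum>b\<in>B. dl' i b * f b) - (\<Sum>b\<in>B. dl' i b * v n b) * (f b0 / v n b0)" for i f
  proof -
    have "(\<Sum>b\<in>B. k i b * f b) = (\<Sum>b\<in>B. dl' i b * f b) - (\<Sum>b\<in>B. dl' i b * v n b) * (\<Sum>b\<in>B. e b * f b)"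
      unfolding k_def left_diff_distrib sum_subtractf sum_distrib_left[of _ "\<lambda>b. e b * f b"] by (simp add: mult.assoc)
    then show ?thesis unfolding e .
  qed
  have kn: "(\<Sum>b\<in>B. k i b * v n b) = 0" for i using b0 by (simp add: kv)
  have kj: "(\<Sum>b\<in>B. k i b * v j b) = (if i = j then 1 else 0)" if "i < n" "j < n" for i j
  proof -
    have "(\<Sum>b\<in>B. k i b * v j b) = (\<Sum>b\<in>B. k i b * v' j b) + q j * (\<Sum>b\<in>B. k i b * v n b)"
      unfolding v'_def sum_distrib_left sum.distrib[symmetric] by (intro sum.cong) (auto simp: algebra_simps)
    also have "\<dots> = (\<Sum>b\<in>B. dl' i b * v' j b)" by (simp add: kn kv v'0)
    finally show ?thesis using l'[OF that] by simp
  qed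
  \<comment> \<open>The last functional is normalised evaluation at \<open>b0\<close>, from which
    the values \<open>q i\<close> on the earlier vectors are removed.\<close>
  define dl where "dl i b = (if i < n then k i b else e b - (\<Sum>i<n. q i * k i b))" for i b
  have "(\<Sum>b\<in>B. dl i b * v j b) = (if i = j then 1 else 0)" if ij: "i < Suc n" "j < Suc n" for i j
  proof (cases "i < n")
    case True
    then show ?thesis using ij kj[OF True, of j] kn[of i] by (cases "j = n") (auto simp: dl_def)
  next
    case False
    then have i: "i = n" using ij by simp
    have "(\<Sum>b\<in>B. dl i b * v j b) = (\<Sum>b\<in>B. e b * v j b) - (\<Sum>b\<in>B. \<Sum>i<n. q i * (k i b * v j b))"
      unfolding dl_def using False by (simp add: left_diff_distrib sum_subtractf sum_distrib_right mult.assoc)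
    also have "(\<Sum>b\<in>B. \<Sum>i<n. q i * (k i b * v j b)) = (\<Sum>i<n. q i * (\<Sum>b\<in>B. k i b * v j b))"
      unfolding sum_distrib_left by (rule sum.swap)
    also have "(\<Sum>b\<in>B. e b * v j b) = q j" by (simp add: e q_def)
    finally have eq: "(\<Sum>b\<in>B. dl i b * v j b) = q j - (\<Sum>i<n. q i * (\<Sum>b\<in>B. k i b * v j b))" .
    show ?thesis
    proof (cases "j = n")
      case True
      then show ?thesis unfolding eq using i b0 by (simp add: kn q_def)
    next
      case False
      then have j: "j < n" using ij by simp
      have "(\<Sum>i<n. q i * (\<Sum>b\<in>B. k i b * v j b)) = (\<Sum>i<n. if i = j then q j else 0)"
        using kj[OF _ j] by (intro sum.cong) auto
      then show ?thesis unfolding eq using i j by simp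
    qed
  qed
  then show ?case by blast
qed simp

lemma nn_integral_PiM_lborel_affine:
  fixes n :: nat
  assumes f: "f \<in> borel_measurable (PiM {..<n} (\<lambda>_. lborel :: real measure))"
  shows "(\<integral>\<^sup>+c. f (\<lambda>i\<in>{..<n}. a i + c i) \<partial>PiM {..<n} (\<lambda>_. lborel)) = (\<integral>\<^sup>+c. f c \<partial>PiM {..<n} (\<lambda>_. lborel))"
    and "(\<integral>\<^sup>+c. f (\<lambda>i\<in>{..<n}. - c i) \<partial>PiM {..<n} (\<lambda>_. lborel)) = (\<integral>\<^sup>+c. f c \<partial>PiM {..<n} (\<lambda>_. lborel))"
proof -
  have ps: "product_sigma_finite (\<lambda>_::nat. lborel :: real measure)" by unfold_locales
  have m: "(\<lambda>c. \<lambda>i\<in>{..<n}. g i (c i)) \<in> measurable (PiM {..<n} (\<lambda>_. lborel)) (PiM {..<n} (\<lambda>_. lborel))"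
    if "\<And>i. g i \<in> borel_measurable borel" for g :: "nat \<Rightarrow> real \<Rightarrow> real"
    using that by (intro measurable_restrict) (auto intro!: measurable_compose[OF measurable_component_singleton])
  have lb: "distr lborel lborel g = distr lborel borel g" for g :: "real \<Rightarrow> real"
    by (rule distr_cong) simp_all
  have d1: "distr (PiM {..<n} (\<lambda>_. lborel)) (PiM {..<n} (\<lambda>_. lborel)) (\<lambda>c. \<lambda>i\<in>{..<n}. a i + c i) = PiM {..<n} (\<lambda>_. lborel)"
    by (rule distr_PiM_map[OF ps ps, where f="\<lambda>i t. a i + t"]) (simp_all add: lb lborel_distr_plus)
  have d2: "distr (PiM {..<n} (\<lambda>_. lborel :: real measure)) (PiM {..<n} (\<lambda>_. lborel)) (\<lambda>c. \<lambda>i\<in>{..<n}. - c i) = PiM {..<n} (\<lambda>_. lborel)"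
    by (rule distr_PiM_map[OF ps ps, where f="\<lambda>i t. - t"]) (simp_all add: lb lborel_distr_uminus)
  show "(\<integral>\<^sup>+c. f (\<lambda>i\<in>{..<n}. a i + c i) \<partial>PiM {..<n} (\<lambda>_. lborel)) = (\<integral>\<^sup>+c. f c \<partial>PiM {..<n} (\<lambda>_. lborel))"
    using nn_integral_distr[OF m[of "\<lambda>i t. a i + t"], of f] f unfolding d1 by simp
  show "(\<integral>\<^sup>+c. f (\<lambda>i\<in>{..<n}. - c i) \<partial>PiM {..<n} (\<lambda>_. lborel)) = (\<integral>\<^sup>+c. f c \<partial>PiM {..<n} (\<lambda>_. lborel))"
    using nn_integral_distr[OF m[of "\<lambda>i t. - t"], of f] f unfolding d2 by simp
qed

text \<open>The noise density is even, so reflected translates have mass one as well.\<close>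

lemma nn_integral_kern_reflect: "(\<integral>\<^sup>+t. ennreal (kern (a - t) / kern_mass) \<partial>lborel) = 1"
proof -
  have k: "kern (a - t) = kern (t - a)" for t by (simp add: kern_def cauchy_def power2_commute)
  have "prob_space (distr noise lborel (\<lambda>t. a + 1 * t))"
    by (rule prob_space.prob_space_distr[OF prob_space_noise]) measurable
  then have "emeasure (density lborel (\<lambda>t. ennreal (kern ((t - a) / 1) / (1 * kern_mass)))) UNIV = 1"
    using prob_space.emeasure_space_1 unfolding emeasure_density_affine_kern[OF zero_less_one] by fastforce
  then show ?thesis by (simp add: emeasure_density k)
qed

section \<open>Existence of a basis of the directions\<close>

context gibbs_volume begin

lemma closure_eq: "bond_closure \<Lambda> = pb ` S \<union> rb ` S"
proof (intro equalityI subsetI)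
  fix b assume b: "b \<in> bond_closure \<Lambda>"
  then have "b \<in> bonds" by (simp add: bond_closure_def)
  then show "b \<in> pb ` S \<union> rb ` S"
  proof (cases rule: bond_cases)
    case (1 p)
    then show ?thesis using b by (auto simp: S_def)
  next
    case (2 p)
    have "pb p \<in> bond_closure \<Lambda>" using b 2 by (auto simp: bond_closure_def)
    then have "p \<in> S" by (simp add: S_def)
    then show ?thesis using 2 by blast
  qed
next
  fix b assume "b \<in> pb ` S \<union> rb ` S"
  then obtain p where p: "p \<in> S" "b = pb p \<or> b = rb p" by blast
  then have "pb p \<in> bond_closure \<Lambda>" by (simp add: S_def)
  then have "rb p \<in> bond_closure \<Lambda>" using rev_bond_bonds[of "pb p"] by (auto simp: bond_closure_def)
  with \<open>pb p \<in> bond_closure \<Lambda>\<close> p show "b \<in> bond_closure \<Lambda>" by blast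
qed

lemma finite_closure: "finite (bond_closure \<Lambda>)" unfolding closure_eq using finite_S by simp

text \<open>\<open>affine_lebesgue\<close> picks its basis with \<open>SOME\<close>, so existence
  has to be known before anything can be said about that measure.\<close>

lemma direction_basis_exists: "\<exists>n v. direction_basis \<Lambda> n v"
proof -
  \<comment> \<open>Fields take the value \<open>undefined\<close> off the bonds, which pointwise
    addition does not respect. Replacing it by zero turns the directions into a genuine space of
    functions with finite support.\<close>
  define Z where "Z f b = (if b \<in> bonds then f b else 0)" for f :: "'d bond \<Rightarrow> real" and b
  define W where "W = Z ` fields_bc \<Lambda> (\<lambda>_. 0)"
  have D: "f \<in> fields_bc \<Lambda> (\<lambda>_. 0) \<longleftrightarrow> (\<exists>\<phi>. f = grad \<phi> \<and> (\<forall>b\<in>bonds - bond_closure \<Lambda>. grad \<phi> b = 0))" for f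
    by (auto simp: fields_bc_def gradient_fields_def)
  have "\<exists>(n::nat) v. (\<forall>i<n. v i \<in> W) \<and> (\<forall>f\<in>W. \<exists>c. \<forall>b. f b = (\<Sum>i<n. c i * v i b))
        \<and> (\<forall>c. (\<forall>b. (\<Sum>i<n. c i * v i b) = 0) \<longrightarrow> (\<forall>i<n. c i = (0::real)))"
  proof (rule finite_support_basis[OF finite_closure])
    fix f g assume "f \<in> W" "g \<in> W"
    then obtain \<phi> \<psi> where f: "f = Z (grad \<phi>)" "\<forall>b\<in>bonds - bond_closure \<Lambda>. grad \<phi> b = 0"
      and g: "g = Z (grad \<psi>)" "\<forall>b\<in>bonds - bond_closure \<Lambda>. grad \<psi> b = 0"
      by (auto simp: W_def D)
    have "(\<lambda>b. f b + g b) = Z (grad (\<lambda>x. \<phi> x + \<psi> x))" by (auto simp: f g Z_def grad_def)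
    moreover have "\<forall>b\<in>bonds - bond_closure \<Lambda>. grad (\<lambda>x. \<phi> x + \<psi> x) b = 0"
    proof
      fix b assume b: "b \<in> bonds - bond_closure \<Lambda>"
      then have "grad (\<lambda>x. \<phi> x + \<psi> x) b = grad \<phi> b + grad \<psi> b" by (simp add: grad_def)
      then show "grad (\<lambda>x. \<phi> x + \<psi> x) b = 0" using f g b by simp
    qed
    ultimately show "(\<lambda>b. f b + g b) \<in> W" unfolding W_def using D by blast
  next
    fix f and a :: real assume "f \<in> W"
    then obtain \<phi> where f: "f = Z (grad \<phi>)" "\<forall>b\<in>bonds - bond_closure \<Lambda>. grad \<phi> b = 0"
      by (auto simp: W_def D)
    have "(\<lambda>b. a * f b) = Z (grad (\<lambda>x. a * \<phi> x))" by (auto simp: f Z_def grad_def algebra_simps)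
    moreover have "\<forall>b\<in>bonds - bond_closure \<Lambda>. grad (\<lambda>x. a * \<phi> x) b = 0"
    proof
      fix b assume b: "b \<in> bonds - bond_closure \<Lambda>"
      then have "grad (\<lambda>x. a * \<phi> x) b = a * grad \<phi> b" by (simp add: grad_def algebra_simps)
      then show "grad (\<lambda>x. a * \<phi> x) b = 0" using f b by simp
    qed
    ultimately show "(\<lambda>b. a * f b) \<in> W" unfolding W_def using D by blast
  next
    have "(\<lambda>_. 0) = Z (grad (\<lambda>_. 0))" by (auto simp: Z_def grad_def)
    then show "(\<lambda>_. 0) \<in> W" unfolding W_def using zero_direction by blast
  next
    fix f b assume "f \<in> W" "b \<notin> bond_closure \<Lambda>"
    then show "f b = 0" by (auto simp: W_def Z_def fields_bc_def)
  qed
  then obtain n :: nat and v where v: "\<And>i. i < n \<Longrightarrow> v i \<in> W" "\<And>f. f \<in> W \<Longrightarrow> \<exists>c. \<forall>b. f b = (\<Sum>i<n. c i * v i b)"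
    "\<And>c i. (\<And>b. (\<Sum>i<n. c i * v i b) = 0) \<Longrightarrow> i < n \<Longrightarrow> c i = (0::real)" by blast
  obtain \<phi> where \<phi>: "\<And>i. i < n \<Longrightarrow> v i = Z (grad (\<phi> i)) \<and> (\<forall>b\<in>bonds - bond_closure \<Lambda>. grad (\<phi> i) b = 0)"
  proof -
    have "\<forall>i. \<exists>\<phi>. i < n \<longrightarrow> v i = Z (grad \<phi>) \<and> (\<forall>b\<in>bonds - bond_closure \<Lambda>. grad \<phi> b = 0)"
    proof
      fix i
      show "\<exists>\<phi>. i < n \<longrightarrow> v i = Z (grad \<phi>) \<and> (\<forall>b\<in>bonds - bond_closure \<Lambda>. grad \<phi> b = 0)"
      proof (cases "i < n")
        case True
        from v(1)[OF True] obtain f where f: "f \<in> fields_bc \<Lambda> (\<lambda>_. 0)" "v i = Z f" unfolding W_def by blast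
        from f(1) obtain \<phi> where "f = grad \<phi>" "\<forall>b\<in>bonds - bond_closure \<Lambda>. grad \<phi> b = 0" unfolding D by blast
        then show ?thesis using f(2) by blast
      qed simp
    qed
    then show ?thesis using that by metis
  qed
  have am: "affine_map (\<lambda>_. 0) n v c b = (if b \<in> bonds then \<Sum>i<n. c i * v i b else undefined)" for c b
    by (simp add: affine_map_def)
  have off: "v i b = 0" if "i < n" "b \<notin> bonds" for i b using \<phi>[OF that(1)] that(2) by (simp add: Z_def)
  have "bij_betw (affine_map (\<lambda>_. 0) n v) ({..<n} \<rightarrow>\<^sub>E UNIV) (fields_bc \<Lambda> (\<lambda>_. 0))"
    unfolding bij_betw_def
  proof
    show "inj_on (affine_map (\<lambda>_. 0) n v) ({..<n} \<rightarrow>\<^sub>E UNIV)"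
    proof (rule inj_onI)
      fix c c' assume c: "c \<in> {..<n} \<rightarrow>\<^sub>E UNIV" "c' \<in> {..<n} \<rightarrow>\<^sub>E UNIV" and eq: "affine_map (\<lambda>_. 0) n v c = affine_map (\<lambda>_. 0) n v c'"
      have "(\<Sum>i<n. (c i - c' i) * v i b) = 0" for b
      proof (cases "b \<in> bonds")
        case True
        then have "(\<Sum>i<n. c i * v i b) = (\<Sum>i<n. c' i * v i b)" using fun_cong[OF eq, of b] by (simp add: am)
        then show ?thesis by (simp add: left_diff_distrib sum_subtractf)
      qed (simp add: off)
      from v(3)[OF this] have "i < n \<Longrightarrow> c i = c' i" for i by simp
      then show "c = c'" using c by (intro PiE_ext) auto
    qed
    show "affine_map (\<lambda>_. 0) n v ` ({..<n} \<rightarrow>\<^sub>E UNIV) = fields_bc \<Lambda> (\<lambda>_. 0)"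
    proof (intro equalityI subsetI)
      fix f assume "f \<in> affine_map (\<lambda>_. 0) n v ` ({..<n} \<rightarrow>\<^sub>E UNIV)"
      then obtain c where f: "f = affine_map (\<lambda>_. 0) n v c" by blast
      have "f b = grad (\<lambda>x. \<Sum>i<n. c i * \<phi> i x) b" for b
      proof (cases "b \<in> bonds")
        case True
        then have "f b = (\<Sum>i<n. c i * (\<phi> i (fst b) - \<phi> i (snd b)))"
          unfolding f am using \<phi> by (auto intro!: sum.cong simp: Z_def grad_def)
        then show ?thesis using True by (simp add: grad_def right_diff_distrib sum_subtractf)
      qed (simp add: f am grad_def)
      then have g: "f = grad (\<lambda>x. \<Sum>i<n. c i * \<phi> i x)" by blast
      have "f b = 0" if b: "b \<in> bonds - bond_closure \<Lambda>" for b
        unfolding f am using b \<phi> by (auto intro!: sum.neutral simp: Z_def)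
      then show "f \<in> fields_bc \<Lambda> (\<lambda>_. 0)" unfolding fields_bc_def using g by (auto simp: gradient_fields_def)
    next
      fix f assume f: "f \<in> fields_bc \<Lambda> (\<lambda>_. 0)"
      then have "Z f \<in> W" by (simp add: W_def)
      from v(2)[OF this] obtain c where c: "\<And>b. Z f b = (\<Sum>i<n. c i * v i b)" by blast
      have "f b = affine_map (\<lambda>_. 0) n v (restrict c {..<n}) b" for b
      proof (cases "b \<in> bonds")
        case True
        then show ?thesis using c[of b] by (simp add: am Z_def)
      next
        case False
        moreover have "f b = undefined" using f False by (auto simp: fields_bc_def gradient_fields_def grad_def)
        ultimately show ?thesis by (simp add: am)
      qed
      then have "f = affine_map (\<lambda>_. 0) n v (restrict c {..<n})" by blast
      moreover have "restrict c {..<n} \<in> {..<n} \<rightarrow>\<^sub>E UNIV" by simp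
      ultimately show "f \<in> affine_map (\<lambda>_. 0) n v ` ({..<n} \<rightarrow>\<^sub>E UNIV)" by blast
    qed
  qed
  then show ?thesis unfolding direction_basis_def by blast
qed

end

section \<open>Parametrisation of the fields with a given exterior\<close>

context gibbs_volume begin

text \<open>\<open>nb\<close> and \<open>vb\<close> name the very basis that
  \<open>affine_lebesgue\<close> selects.\<close>

definition nb :: nat where "nb = fst (SOME (n, v). direction_basis \<Lambda> n v)"
definition vb :: "nat \<Rightarrow> 'd bond \<Rightarrow> real" where "vb = snd (SOME (n, v). direction_basis \<Lambda> n v)"

lemma direction_basis_chosen: "direction_basis \<Lambda> nb vb"
proof -
  obtain n v where "direction_basis \<Lambda> n v" using direction_basis_exists by blast
  then have "case (n, v) of (n, v) \<Rightarrow> direction_basis \<Lambda> n v" by simp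
  from someI[of "\<lambda>(n, v). direction_basis \<Lambda> n v", OF this]
  show ?thesis by (simp add: nb_def vb_def case_prod_beta)
qed

definition dirsum :: "(nat \<Rightarrow> real) \<Rightarrow> 'd bond \<Rightarrow> real" where "dirsum = affine_map (\<lambda>_. 0) nb vb"

definition coef :: "(nat \<Rightarrow> real) measure" where "coef = PiM {..<nb} (\<lambda>_. lborel)"

lemma affine_lebesgue_eq: "affine_lebesgue \<Lambda> \<xi> = distr coef gradient_space (affine_map \<xi> nb vb)"
  by (simp add: affine_lebesgue_def coef_def nb_def vb_def case_prod_beta)

lemma affine_map_eq: "affine_map \<xi> nb vb c = translate (dirsum c) \<xi>"
  by (simp add: affine_map_def dirsum_def translate_def restrict_def fun_eq_iff)

lemma dirsum_restrict: "dirsum (restrict c {..<nb}) = dirsum c"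
  by (auto simp: dirsum_def affine_map_def fun_eq_iff)

lemma dirsum_bij: "bij_betw dirsum ({..<nb} \<rightarrow>\<^sub>E UNIV) (fields_bc \<Lambda> (\<lambda>_. 0))"
  using direction_basis_chosen by (simp add: direction_basis_def dirsum_def)

lemma dirsum_direction: "dirsum c \<in> fields_bc \<Lambda> (\<lambda>_. 0)"
proof -
  have "restrict c {..<nb} \<in> {..<nb} \<rightarrow>\<^sub>E UNIV" by simp
  then have "dirsum (restrict c {..<nb}) \<in> fields_bc \<Lambda> (\<lambda>_. 0)" using dirsum_bij by (auto simp: bij_betw_def)
  then show ?thesis by (simp add: dirsum_restrict)
qed

lemma translate_dirsum_add: "translate (dirsum c) (translate (dirsum c') \<xi>) = translate (dirsum (\<lambda>i. c' i + c i)) \<xi>"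
  by (auto simp: translate_def dirsum_def affine_map_def fun_eq_iff distrib_right sum.distrib)

lemma dirsum_zero: "\<xi> \<in> gradient_fields \<Longrightarrow> translate (dirsum (\<lambda>_. 0)) \<xi> = \<xi>"
  by (auto simp: translate_def dirsum_def affine_map_def fun_eq_iff gradient_fields_def grad_def)

lemma coef_sigma_finite: "sigma_finite_measure coef"
  unfolding coef_def by (intro product_sigma_finite.sigma_finite) (unfold_locales, simp)

lemma lam_sigma_finite: "sigma_finite_measure lam"
  unfolding lam_def by (subst sigma_finite_iff_density_finite[OF exp_energy_meas]) auto

sublocale coef: sigma_finite_measure coef by (rule coef_sigma_finite)
sublocale lam: sigma_finite_measure lam by (rule lam_sigma_finite)
sublocale lam_coef: pair_sigma_finite lam coef by unfold_locales

lemma translate_joint_measurable: "(\<lambda>p. translate (dirsum (snd p)) (fst p)) \<in> measurable (gradient_space \<Otimes>\<^sub>M coef) gradient_space"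
proof (rule measurable_gradient_spaceI)
  fix p :: "('d bond \<Rightarrow> real) \<times> (nat \<Rightarrow> real)" assume "p \<in> space (gradient_space \<Otimes>\<^sub>M coef)"
  then have "fst p \<in> gradient_fields" by (auto simp: space_pair_measure)
  then show "translate (dirsum (snd p)) (fst p) \<in> gradient_fields"
    by (rule translate_grad[OF _ directions_grad[OF dirsum_direction]])
next
  fix b :: "'d bond" assume b: "b \<in> bonds"
  have "(\<lambda>p. fst p b) \<in> borel_measurable (gradient_space \<Otimes>\<^sub>M coef)"
    by (rule measurable_compose[OF measurable_fst gradient_space_component[OF b]])
  moreover have "(\<lambda>p. snd p i) \<in> borel_measurable (gradient_space \<Otimes>\<^sub>M coef)" if "i \<in> {..<nb}" for i
  proof (rule measurable_compose[OF measurable_snd])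
    show "(\<lambda>c. c i) \<in> borel_measurable coef"
      using measurable_component_singleton[OF that, of "\<lambda>_. lborel :: real measure"] unfolding coef_def by simp
  qed
  ultimately have "(\<lambda>p. fst p b + (\<Sum>i<nb. snd p i * vb i b)) \<in> borel_measurable (gradient_space \<Otimes>\<^sub>M coef)"
    by (intro borel_measurable_add borel_measurable_sum borel_measurable_times borel_measurable_const)
  then show "(\<lambda>p. translate (dirsum (snd p)) (fst p) b) \<in> borel_measurable (gradient_space \<Otimes>\<^sub>M coef)"
    using b by (simp add: translate_def dirsum_def affine_map_def)
qed

lemma meas_lam_coef: "measurable (lam \<Otimes>\<^sub>M coef) A = measurable (gradient_space \<Otimes>\<^sub>M coef) A"
  by (intro measurable_cong_sets sets_pair_measure_cong sets_lam refl)

lemma translate_slice: "\<xi> \<in> gradient_fields \<Longrightarrow> (\<lambda>c. translate (dirsum c) \<xi>) \<in> measurable coef gradient_space"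
  using measurable_compose[OF measurable_Pair1' translate_joint_measurable, of \<xi>] by simp

section \<open>The conditional distribution\<close>

text \<open>Since \<open>lam\<close> is invariant under the directions and Lebesgue measure under reflection, the roles of
  a field and its translate can be exchanged.\<close>

lemma exchange:
  assumes F: "case_prod F \<in> borel_measurable (gradient_space \<Otimes>\<^sub>M gradient_space)"
  shows "(\<integral>\<^sup>+\<eta>. \<integral>\<^sup>+c. F \<eta> (translate (dirsum c) \<eta>) \<partial>coef \<partial>lam) = (\<integral>\<^sup>+\<eta>. \<integral>\<^sup>+c. F (translate (dirsum c) \<eta>) \<eta> \<partial>coef \<partial>lam)"
proof -
  have m1: "(\<lambda>p. F (fst p) (translate (dirsum (snd p)) (fst p))) \<in> borel_measurable (gradient_space \<Otimes>\<^sub>M coef)"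
    using measurable_compose[OF measurable_Pair[OF measurable_fst translate_joint_measurable] F] by simp
  have m2: "(\<lambda>p. F (translate (dirsum (snd p)) (fst p)) (fst p)) \<in> borel_measurable (gradient_space \<Otimes>\<^sub>M coef)"
    using measurable_compose[OF measurable_Pair[OF translate_joint_measurable measurable_fst] F] by simp
  have neg: "(\<lambda>c. \<lambda>i\<in>{..<nb}. - c i) \<in> measurable coef coef"
    unfolding coef_def by (intro measurable_restrict borel_measurable_uminus) simp
  have m3: "(\<lambda>p. F (translate (dirsum (\<lambda>i. - snd p i)) (fst p)) (fst p)) \<in> borel_measurable (gradient_space \<Otimes>\<^sub>M coef)"
  proof -
    have "(\<lambda>p. (fst p, \<lambda>i\<in>{..<nb}. - snd p i)) \<in> measurable (gradient_space \<Otimes>\<^sub>M coef) (gradient_space \<Otimes>\<^sub>M coef)"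
      by (intro measurable_Pair measurable_fst measurable_compose[OF measurable_snd neg])
    from measurable_compose[OF this m2] show ?thesis by (simp add: dirsum_restrict)
  qed
  have "(\<integral>\<^sup>+\<eta>. \<integral>\<^sup>+c. F \<eta> (translate (dirsum c) \<eta>) \<partial>coef \<partial>lam) = (\<integral>\<^sup>+c. \<integral>\<^sup>+\<eta>. F \<eta> (translate (dirsum c) \<eta>) \<partial>lam \<partial>coef)"
    by (rule lam_coef.Fubini'[symmetric]) (use m1 in \<open>simp add: meas_lam_coef case_prod_beta'\<close>)
  also have "\<dots> = (\<integral>\<^sup>+c. \<integral>\<^sup>+\<eta>. F (translate (dirsum (\<lambda>i. - c i)) \<eta>) \<eta> \<partial>lam \<partial>coef)"
  proof (rule nn_integral_cong)
    fix c assume c: "c \<in> space coef"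
    have "(\<lambda>\<eta>. F \<eta> (translate (dirsum c) \<eta>)) \<in> borel_measurable gradient_space"
      using measurable_compose[OF measurable_Pair2'[OF c] m1] by simp
    from nn_integral_lam_translate[OF dirsum_direction[of "\<lambda>i. - c i"] this]
    have "(\<integral>\<^sup>+\<eta>. F \<eta> (translate (dirsum c) \<eta>) \<partial>lam)
      = (\<integral>\<^sup>+\<eta>. F (translate (dirsum (\<lambda>i. - c i)) \<eta>) (translate (dirsum c) (translate (dirsum (\<lambda>i. - c i)) \<eta>)) \<partial>lam)"
      by simp
    also have "\<dots> = (\<integral>\<^sup>+\<eta>. F (translate (dirsum (\<lambda>i. - c i)) \<eta>) \<eta> \<partial>lam)"
      by (intro nn_integral_cong) (simp add: translate_dirsum_add dirsum_zero space_lam)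
    finally show "(\<integral>\<^sup>+\<eta>. F \<eta> (translate (dirsum c) \<eta>) \<partial>lam) = \<dots>" .
  qed
  also have "\<dots> = (\<integral>\<^sup>+\<eta>. \<integral>\<^sup>+c. F (translate (dirsum (\<lambda>i. - c i)) \<eta>) \<eta> \<partial>coef \<partial>lam)"
    by (rule lam_coef.Fubini') (use m3 in \<open>simp add: meas_lam_coef case_prod_beta'\<close>)
  also have "\<dots> = (\<integral>\<^sup>+\<eta>. \<integral>\<^sup>+c. F (translate (dirsum c) \<eta>) \<eta> \<partial>coef \<partial>lam)"
  proof (rule nn_integral_cong)
    fix \<eta> assume "\<eta> \<in> space lam"
    then have \<eta>: "\<eta> \<in> space gradient_space" by (simp add: space_lam)
    have "(\<lambda>c. F (translate (dirsum c) \<eta>) \<eta>) \<in> borel_measurable coef"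
      using measurable_compose[OF measurable_Pair1'[OF \<eta>] m2] by simp
    from nn_integral_PiM_lborel_affine(2)[OF this[unfolded coef_def]]
    show "(\<integral>\<^sup>+c. F (translate (dirsum (\<lambda>i. - c i)) \<eta>) \<eta> \<partial>coef) = (\<integral>\<^sup>+c. F (translate (dirsum c) \<eta>) \<eta> \<partial>coef)"
      unfolding coef_def dirsum_restrict .
  qed
  finally show ?thesis .
qed

lemma boltzmann_energy:
  assumes "\<eta> \<in> gradient_fields"
  shows "boltzmann_weight V \<Lambda> \<eta> = exp (- energy (coords \<eta>))"
proof -
  have "(\<Sum>b\<in>bond_closure \<Lambda>. V (\<eta> b)) = (\<Sum>b\<in>pb ` S. V (\<eta> b)) + (\<Sum>b\<in>rb ` S. V (\<eta> b))"
    unfolding closure_eq using finite_S by (intro sum.union_disjoint) (use pb_neq_rb in blast)+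
  also have "(\<Sum>b\<in>pb ` S. V (\<eta> b)) = energy (coords \<eta>)"
    by (subst sum.reindex) (auto simp: inj_on_def pb_inj energy_def coords_def)
  also have "(\<Sum>b\<in>rb ` S. V (\<eta> b)) = (\<Sum>p\<in>S. V (\<eta> (rb p)))"
    by (subst sum.reindex) (auto simp: inj_on_def rb_inj simp del: prod.inject)
  also have "\<dots> = energy (coords \<eta>)"
    using grad_odd[OF assms pb_bonds(1)] by (simp add: energy_def coords_def V_even)
  finally show ?thesis by (simp add: boltzmann_weight_def)
qed

definition wt :: "('d bond \<Rightarrow> real) \<Rightarrow> ennreal" where "wt \<eta> = ennreal (boltzmann_weight V \<Lambda> \<eta>)"

lemma wt_meas: "wt \<in> borel_measurable gradient_space"
proof -
  have "(\<lambda>\<eta>. ennreal (exp (- energy (coords \<eta>)))) \<in> borel_measurable gradient_space"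
    by (intro measurable_compose[OF borel_measurable_uminus[OF energy_meas]]) simp
  then show ?thesis
    by (subst measurable_cong[where g="\<lambda>\<eta>. ennreal (exp (- energy (coords \<eta>)))"]) (simp_all add: wt_def boltzmann_energy)
qed

lemma wt_pos: "0 < wt \<eta>" by (simp add: wt_def boltzmann_weight_def)

text \<open>On gradient fields \<open>wt\<close> is the reciprocal of the density of
  \<open>lam\<close>.\<close>

lemma nn_integral_mu:
  assumes "g \<in> borel_measurable gradient_space"
  shows "(\<integral>\<^sup>+\<eta>. g \<eta> \<partial>\<mu>) = (\<integral>\<^sup>+\<eta>. g \<eta> * wt \<eta> \<partial>lam)"
proof -
  have "(\<integral>\<^sup>+\<eta>. g \<eta> * wt \<eta> \<partial>lam) = (\<integral>\<^sup>+\<eta>. ennreal (exp (energy (coords \<eta>))) * (g \<eta> * wt \<eta>) \<partial>\<mu>)"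
    unfolding lam_def by (rule nn_integral_density[OF exp_energy_meas]) (use assms wt_meas in \<open>simp add: meas_mu\<close>)
  also have "\<dots> = (\<integral>\<^sup>+\<eta>. g \<eta> \<partial>\<mu>)"
  proof (rule nn_integral_cong)
    fix \<eta> assume "\<eta> \<in> space \<mu>"
    then have "ennreal (exp (energy (coords \<eta>))) * wt \<eta> = 1"
      by (simp add: wt_def boltzmann_energy space_mu exp_minus flip: ennreal_mult)
    then show "ennreal (exp (energy (coords \<eta>))) * (g \<eta> * wt \<eta>) = g \<eta>"
      by (metis mult.left_commute mult_1_right)
  qed
  finally show ?thesis ..
qed

text \<open>The unnormalised Gibbs mass of \<open>A\<close>; for \<open>A = gradient_fields\<close>
  it is the partition function.\<close>

definition local_mass :: "('d bond \<Rightarrow> real) set \<Rightarrow> ('d bond \<Rightarrow> real) \<Rightarrow> ennreal" where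
  "local_mass A \<xi> = (\<integral>\<^sup>+c. wt (translate (dirsum c) \<xi>) * indicator A (translate (dirsum c) \<xi>) \<partial>coef)"

lemma wt_indicator_meas: "A \<in> sets gradient_space \<Longrightarrow> (\<lambda>\<eta>. wt \<eta> * indicator A \<eta>) \<in> borel_measurable gradient_space"
  by (intro borel_measurable_times_ennreal wt_meas borel_measurable_indicator)

lemma local_mass_meas: "A \<in> sets gradient_space \<Longrightarrow> local_mass A \<in> borel_measurable gradient_space"
  unfolding local_mass_def[abs_def]
  using measurable_compose[OF translate_joint_measurable wt_indicator_meas]
  by (intro coef.borel_measurable_nn_integral) (simp add: case_prod_beta')

lemma nn_integral_affine_lebesgue:
  assumes "\<xi> \<in> gradient_fields" "f \<in> borel_measurable gradient_space"
  shows "(\<integral>\<^sup>+\<eta>. f \<eta> \<partial>affine_lebesgue \<Lambda> \<xi>) = (\<integral>\<^sup>+c. f (translate (dirsum c) \<xi>) \<partial>coef)"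
  unfolding affine_lebesgue_eq affine_map_eq by (rule nn_integral_distr[OF translate_slice[OF assms(1)]]) (simp add: assms(2))

lemma partition_function_eq: "\<xi> \<in> gradient_fields \<Longrightarrow> partition_function V \<Lambda> \<xi> = local_mass gradient_fields \<xi>"
proof -
  assume \<xi>: "\<xi> \<in> gradient_fields"
  have "partition_function V \<Lambda> \<xi> = (\<integral>\<^sup>+c. wt (translate (dirsum c) \<xi>) \<partial>coef)"
    unfolding partition_function_def wt_def[symmetric] by (rule nn_integral_affine_lebesgue[OF \<xi> wt_meas])
  then show ?thesis
    using translate_grad[OF \<xi> directions_grad[OF dirsum_direction]] by (simp add: local_mass_def)
qed

lemma emeasure_finite_gibbs:
  assumes \<xi>: "\<xi> \<in> gradient_fields" and A: "A \<in> sets gradient_space"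
  shows "emeasure (finite_gibbs V \<Lambda> \<xi>) A = local_mass A \<xi> / local_mass gradient_fields \<xi>"
proof -
  let ?Z = "local_mass gradient_fields \<xi>"
  have s: "sets (affine_lebesgue \<Lambda> \<xi>) = sets gradient_space" by (simp add: affine_lebesgue_eq)
  have m: "measurable (affine_lebesgue \<Lambda> \<xi>) B = measurable gradient_space B" for B
    by (rule measurable_cong_sets[OF s refl])
  have wm: "(\<lambda>\<eta>. wt \<eta> / ?Z) \<in> borel_measurable gradient_space" using wt_meas by measurable
  have "emeasure (finite_gibbs V \<Lambda> \<xi>) A = (\<integral>\<^sup>+\<eta>. wt \<eta> / ?Z * indicator A \<eta> \<partial>affine_lebesgue \<Lambda> \<xi>)"
    unfolding finite_gibbs_def partition_function_eq[OF \<xi>] wt_def[symmetric]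
    by (rule emeasure_density) (use wm A s m in auto)
  also have "\<dots> = (\<integral>\<^sup>+c. wt (translate (dirsum c) \<xi>) / ?Z * indicator A (translate (dirsum c) \<xi>) \<partial>coef)"
    by (rule nn_integral_affine_lebesgue[OF \<xi>]) (use wm A in measurable)
  also have "\<dots> = (\<integral>\<^sup>+c. wt (translate (dirsum c) \<xi>) * indicator A (translate (dirsum c) \<xi>) * inverse ?Z \<partial>coef)"
    by (simp add: divide_ennreal_def mult_ac)
  also have "\<dots> = local_mass A \<xi> * inverse ?Z"
    unfolding local_mass_def
    by (rule nn_integral_multc) (rule measurable_compose[OF translate_slice[OF \<xi>] wt_indicator_meas[OF A]])
  finally show ?thesis by (simp add: divide_ennreal_def)
qed

text \<open>By translation invariance of Lebesgue measure, the mass depends on the orbit of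
  \<open>\<xi>\<close> under the directions only.\<close>

lemma local_mass_translate:
  assumes \<xi>: "\<xi> \<in> gradient_fields" and A: "A \<in> sets gradient_space"
  shows "local_mass A (translate (dirsum c0) \<xi>) = local_mass A \<xi>"
proof -
  have m: "(\<lambda>c. wt (translate (dirsum c) \<xi>) * indicator A (translate (dirsum c) \<xi>)) \<in> borel_measurable coef"
    by (rule measurable_compose[OF translate_slice[OF \<xi>] wt_indicator_meas[OF A]])
  have "local_mass A (translate (dirsum c0) \<xi>) = (\<integral>\<^sup>+c. wt (translate (dirsum (\<lambda>i\<in>{..<nb}. c0 i + c i)) \<xi>) * indicator A (translate (dirsum (\<lambda>i\<in>{..<nb}. c0 i + c i)) \<xi>) \<partial>coef)"
    unfolding local_mass_def translate_dirsum_add dirsum_restrict ..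
  also have "\<dots> = local_mass A \<xi>"
    using nn_integral_PiM_lborel_affine(1)[OF m[unfolded coef_def], of c0] unfolding local_mass_def coef_def .
  finally show ?thesis .
qed

text \<open>The weight is positive and \<open>coef\<close> is not the zero measure, as the unit cube
  shows.\<close>

lemma local_mass_pos:
  assumes \<xi>: "\<xi> \<in> gradient_fields"
  shows "local_mass gradient_fields \<xi> \<noteq> 0"
proof
  assume "local_mass gradient_fields \<xi> = 0"
  then have "(\<integral>\<^sup>+c. wt (translate (dirsum c) \<xi>) \<partial>coef) = 0"
    using translate_grad[OF \<xi> directions_grad[OF dirsum_direction]] by (simp add: local_mass_def)
  moreover have "(\<lambda>c. wt (translate (dirsum c) \<xi>)) \<in> borel_measurable coef"
    by (rule measurable_compose[OF translate_slice[OF \<xi>] wt_meas])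
  ultimately have "AE c in coef. wt (translate (dirsum c) \<xi>) = 0" by (simp add: nn_integral_0_iff_AE)
  then have "AE c in coef. c \<notin> space coef" by eventually_elim (use wt_pos in \<open>auto simp: less_imp_neq[symmetric]\<close>)
  then have "space coef \<in> null_sets coef" by (subst AE_iff_null_sets) auto
  then have "emeasure coef (space coef) = 0" by (simp add: null_sets_def)
  moreover have "emeasure coef (PiE {..<nb} (\<lambda>_. {0..1})) = 1"
    unfolding coef_def by (subst product_sigma_finite.emeasure_PiM) (unfold_locales, auto)
  moreover have "emeasure coef (PiE {..<nb} (\<lambda>_. {0..1})) \<le> emeasure coef (space coef)"
    by (rule emeasure_space)
  ultimately show False by simp
qed

text \<open>Finiteness is inferred from \<mu> being a probability measure. Let \<open>f\<close> be
  positive with integral one along every orbit of the directions. By \<open>exchange\<close>, the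
  integral of \<open>f\<close> times the local mass under \<open>lam\<close> equals that of
  \<open>wt\<close>, which is the total mass of \<mu>. So the product is finite almost everywhere,
  and \<open>f\<close> has no zeros.\<close>

lemma local_mass_finite: "AE \<xi> in \<mu>. local_mass gradient_fields \<xi> \<noteq> \<infinity>"
proof -
  have "\<exists>dl. \<forall>i<nb. \<forall>j<nb. (\<Sum>b\<in>bond_closure \<Lambda>. dl i b * vb j b) = (if i = j then 1 else 0)"
  proof (rule dual_functionals[OF finite_closure])
    fix c assume c: "\<And>b. b \<in> bond_closure \<Lambda> \<Longrightarrow> (\<Sum>j<nb. c j * vb j b) = 0"
    have "dirsum c b = dirsum (\<lambda>_. 0) b" for b
    proof (cases "b \<in> bond_closure \<Lambda>")
      case True
      then have "b \<in> bonds" by (simp add: bond_closure_def)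
      then show ?thesis using c[OF True] by (simp add: dirsum_def affine_map_def)
    next
      case False
      then show ?thesis
        using dirsum_direction[of c] dirsum_direction[of "\<lambda>_. 0"] by (cases "b \<in> bonds") (auto simp: fields_bc_def dirsum_def affine_map_def)
    qed
    then have "dirsum (restrict c {..<nb}) = dirsum (restrict (\<lambda>_. 0) {..<nb})" by (auto simp: dirsum_restrict)
    from inj_onD[where f=dirsum, OF bij_betw_imp_inj_on[OF dirsum_bij] this]
    have eq: "restrict c {..<nb} = restrict (\<lambda>_. 0) {..<nb}" by simp
    show "\<forall>j<nb. c j = 0" using fun_cong[OF eq] by (metis lessThan_iff restrict_apply')
  qed
  then obtain dl where dl: "\<And>i j. i < nb \<Longrightarrow> j < nb \<Longrightarrow> (\<Sum>b\<in>bond_closure \<Lambda>. dl i b * vb j b) = (if i = j then 1 else 0)" by blast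
  \<comment> \<open>Linear coordinates that grow by exactly \<open>c i\<close> when the direction
    \<open>dirsum c\<close> is added.\<close>
  define a where "a i \<eta> = (\<Sum>b\<in>bond_closure \<Lambda>. dl i b * \<eta> b)" for i and \<eta> :: "'d bond \<Rightarrow> real"
  have cb: "b \<in> bond_closure \<Lambda> \<Longrightarrow> b \<in> bonds" for b by (simp add: bond_closure_def)
  have a_translate: "a i (translate (dirsum c) \<eta>) = a i \<eta> + c i" if i: "i < nb" for i c \<eta>
  proof -
    have "a i (translate (dirsum c) \<eta>) = (\<Sum>b\<in>bond_closure \<Lambda>. dl i b * \<eta> b + (\<Sum>j<nb. c j * (dl i b * vb j b)))"
      unfolding a_def by (intro sum.cong refl) (simp add: translate_def dirsum_def affine_map_def cb distrib_left sum_distrib_left mult_ac)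
    also have "\<dots> = a i \<eta> + (\<Sum>b\<in>bond_closure \<Lambda>. \<Sum>j<nb. c j * (dl i b * vb j b))"
      by (simp add: a_def sum.distrib)
    also have "(\<Sum>b\<in>bond_closure \<Lambda>. \<Sum>j<nb. c j * (dl i b * vb j b)) = (\<Sum>j<nb. c j * (\<Sum>b\<in>bond_closure \<Lambda>. dl i b * vb j b))"
      unfolding sum_distrib_left by (rule sum.swap)
    also have "\<dots> = (\<Sum>j<nb. if j = i then c i else 0)" using dl[OF i] by (intro sum.cong) auto
    finally show ?thesis using i by simp
  qed
  \<comment> \<open>The noise density in these coordinates: along an orbit each factor becomes a
    reflected translate of a probability density in \<open>c i\<close>, so every orbit integral is
    one.\<close>
  define f where "f \<eta> = (\<Prod>i<nb. ennreal (kern (- a i \<eta>) / kern_mass))" for \<eta>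
  have fm: "f \<in> borel_measurable gradient_space"
    unfolding f_def[abs_def] a_def
  proof (rule borel_measurable_prod_ennreal)
    fix i
    have "(\<lambda>\<eta>. \<Sum>b\<in>bond_closure \<Lambda>. dl i b * \<eta> b) \<in> borel_measurable gradient_space"
      by (intro borel_measurable_sum borel_measurable_times borel_measurable_const gradient_space_component cb)
    then have [measurable]: "(\<lambda>\<eta>. - (\<Sum>b\<in>bond_closure \<Lambda>. dl i b * \<eta> b)) \<in> borel_measurable gradient_space"
      by (rule borel_measurable_uminus)
    show "(\<lambda>\<eta>. ennreal (kern (- (\<Sum>b\<in>bond_closure \<Lambda>. dl i b * \<eta> b)) / kern_mass)) \<in> borel_measurable gradient_space"
      by measurable
  qed
  have f1: "(\<integral>\<^sup>+c. f (translate (dirsum c) \<eta>) \<partial>coef) = 1" for \<eta>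
  proof -
    have "(\<integral>\<^sup>+c. f (translate (dirsum c) \<eta>) \<partial>coef) = (\<integral>\<^sup>+c. (\<Prod>i<nb. ennreal (kern (- a i \<eta> - c i) / kern_mass)) \<partial>coef)"
      unfolding f_def by (intro nn_integral_cong prod.cong) (simp_all add: a_translate)
    also have "\<dots> = (\<Prod>i<nb. \<integral>\<^sup>+t. ennreal (kern (- a i \<eta> - t) / kern_mass) \<partial>lborel)"
      unfolding coef_def
      by (rule product_sigma_finite.product_nn_integral_prod) (unfold_locales, simp, measurable)
    finally show ?thesis by (simp add: nn_integral_kern_reflect)
  qed
  have "(\<integral>\<^sup>+\<eta>. f \<eta> * local_mass gradient_fields \<eta> \<partial>lam) = (\<integral>\<^sup>+\<eta>. \<integral>\<^sup>+c. f \<eta> * wt (translate (dirsum c) \<eta>) \<partial>coef \<partial>lam)"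
  proof (rule nn_integral_cong)
    fix \<eta> assume "\<eta> \<in> space lam"
    then have \<eta>: "\<eta> \<in> gradient_fields" by (simp add: space_lam)
    have "local_mass gradient_fields \<eta> = (\<integral>\<^sup>+c. wt (translate (dirsum c) \<eta>) \<partial>coef)"
      using translate_grad[OF \<eta> directions_grad[OF dirsum_direction]] by (simp add: local_mass_def)
    then show "f \<eta> * local_mass gradient_fields \<eta> = (\<integral>\<^sup>+c. f \<eta> * wt (translate (dirsum c) \<eta>) \<partial>coef)"
      by (simp add: nn_integral_cmult measurable_compose[OF translate_slice[OF \<eta>] wt_meas])
  qed
  also have "\<dots> = (\<integral>\<^sup>+\<eta>. \<integral>\<^sup>+c. f (translate (dirsum c) \<eta>) * wt \<eta> \<partial>coef \<partial>lam)"
  proof (rule exchange)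
    have "(\<lambda>p. f (fst p) * wt (snd p)) \<in> borel_measurable (gradient_space \<Otimes>\<^sub>M gradient_space)"
      by (intro borel_measurable_times_ennreal measurable_compose[OF measurable_fst fm] measurable_compose[OF measurable_snd wt_meas])
    then show "(\<lambda>(\<eta>, \<eta>'). f \<eta> * wt \<eta>') \<in> borel_measurable (gradient_space \<Otimes>\<^sub>M gradient_space)"
      by (simp add: case_prod_beta')
  qed
  also have "\<dots> = (\<integral>\<^sup>+\<eta>. 1 * wt \<eta> \<partial>lam)"
  proof (rule nn_integral_cong)
    fix \<eta> assume "\<eta> \<in> space lam"
    then have \<eta>: "\<eta> \<in> gradient_fields" by (simp add: space_lam)
    show "(\<integral>\<^sup>+c. f (translate (dirsum c) \<eta>) * wt \<eta> \<partial>coef) = 1 * wt \<eta>"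
      by (subst nn_integral_multc) (simp_all add: f1 measurable_compose[OF translate_slice[OF \<eta>] fm])
  qed
  also have "\<dots> = (\<integral>\<^sup>+\<eta>. 1 \<partial>\<mu>)" by (rule nn_integral_mu[symmetric]) simp
  also have "\<dots> = 1" by (simp add: emeasure_space_1)
  finally have fin: "(\<integral>\<^sup>+\<eta>. f \<eta> * local_mass gradient_fields \<eta> \<partial>lam) = 1" .
  have g: "gradient_fields \<in> sets gradient_space" using sets.top[of gradient_space] by simp
  have "(\<lambda>\<eta>. f \<eta> * local_mass gradient_fields \<eta>) \<in> borel_measurable lam"
    unfolding meas_lam by (intro borel_measurable_times_ennreal fm local_mass_meas[OF g])
  then have "AE \<eta> in lam. f \<eta> * local_mass gradient_fields \<eta> \<noteq> \<infinity>"
    by (rule nn_integral_PInf_AE) (simp add: fin)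
  then have "AE \<eta> in \<mu>. f \<eta> * local_mass gradient_fields \<eta> \<noteq> \<infinity>"
    unfolding lam_def by (subst (asm) AE_density[OF exp_energy_meas]) simp
  then show ?thesis
  proof eventually_elim
    case (elim \<eta>)
    have pos: "0 < kern t / kern_mass" for t
      by (rule divide_pos_pos[OF kern_pos kern_mass_pos])
    have "f \<eta> = ennreal (\<Prod>i<nb. kern (- a i \<eta>) / kern_mass)"
      unfolding f_def by (rule prod_ennreal) (rule less_imp_le[OF pos])
    moreover have "0 < (\<Prod>i<nb. kern (- a i \<eta>) / kern_mass)" by (rule prod_pos) (rule pos)
    ultimately have "f \<eta> \<noteq> 0" by (simp add: ennreal_eq_0_iff not_le)
    with elim show ?case by (auto simp: ennreal_mult_eq_top_iff)
  qed
qed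

end

section \<open>The exterior sigma-algebra and a measurable section\<close>

definition exterior_edges :: "('d::finite) site set \<Rightarrow> ('d site \<times> 'd site) set" where
  "exterior_edges \<Lambda> = {b \<in> bonds. fst b \<notin> \<Lambda> \<and> snd b \<notin> \<Lambda>}"

definition component_rep :: "('d::finite) site set \<Rightarrow> 'd site \<Rightarrow> 'd site" where
  "component_rep \<Lambda> x = (SOME y. (x, y) \<in> (exterior_edges \<Lambda>)\<^sup>*)"

lemma component_rep: "(x, component_rep \<Lambda> x) \<in> (exterior_edges \<Lambda>)\<^sup>*"
  unfolding component_rep_def by (rule someI[of _ x]) simp

text \<open>Exterior edges are symmetric, so the two ends reach the same sites and
  \<open>SOME\<close> selects the same one for both.\<close>

lemma component_rep_eq:
  assumes "(x, y) \<in> exterior_edges \<Lambda>"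
  shows "component_rep \<Lambda> x = component_rep \<Lambda> y"
proof -
  have "(y, x) \<in> exterior_edges \<Lambda>" using assms rev_bond_bonds[of "(x, y)"] by (auto simp: exterior_edges_def)
  then have "(x, z) \<in> (exterior_edges \<Lambda>)\<^sup>* \<longleftrightarrow> (y, z) \<in> (exterior_edges \<Lambda>)\<^sup>*" for z
    using assms by (meson converse_rtrancl_into_rtrancl)
  then show ?thesis by (simp add: component_rep_def)
qed

definition height :: "(('d::finite) bond \<Rightarrow> real) \<Rightarrow> 'd site \<Rightarrow> real" where
  "height \<eta> = (SOME \<phi>. grad \<phi> = \<eta>)"

lemma grad_height: "\<eta> \<in> gradient_fields \<Longrightarrow> grad (height \<eta>) = \<eta>"
  unfolding height_def by (rule someI_ex[of "\<lambda>\<phi>. grad \<phi> = \<eta>"]) (auto simp: gradient_fields_def)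

lemma height_diff: "\<eta> \<in> gradient_fields \<Longrightarrow> (x, y) \<in> bonds \<Longrightarrow> height \<eta> x - height \<eta> y = \<eta> (x, y)"
  using fun_cong[OF grad_height, of \<eta> "(x, y)"] by (simp add: grad_def)

text \<open>Normalising the height to zero on \<open>\<Lambda>\<close> and at one site of each component of its complement
  gives a field that has the same exterior bonds but is a function of them.\<close>

definition exterior_section :: "('d::finite) site set \<Rightarrow> ('d bond \<Rightarrow> real) \<Rightarrow> 'd bond \<Rightarrow> real" where
  "exterior_section \<Lambda> \<eta> = grad (\<lambda>x. if x \<in> \<Lambda> then 0 else height \<eta> x - height \<eta> (component_rep \<Lambda> x))"

lemma exterior_generators_Pow:
  "{{\<eta> \<in> gradient_fields. \<eta> b \<in> A} | b A. b \<in> bonds - bond_closure \<Lambda> \<and> A \<in> sets borel} \<subseteq> Pow gradient_fields"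
  by auto

lemma space_exterior [simp]: "space (exterior_algebra \<Lambda>) = gradient_fields"
  unfolding exterior_algebra_def by (rule space_measure_of[OF exterior_generators_Pow])

lemma sets_exterior: "sets (exterior_algebra \<Lambda>) = sigma_sets gradient_fields
    {{\<eta> \<in> gradient_fields. \<eta> b \<in> A} | b A. b \<in> bonds - bond_closure \<Lambda> \<and> A \<in> sets borel}"
  unfolding exterior_algebra_def by (rule sets_measure_of[OF exterior_generators_Pow])

lemma exterior_component:
  assumes b: "b \<in> bonds - bond_closure \<Lambda>"
  shows "(\<lambda>\<eta>. \<eta> b) \<in> borel_measurable (exterior_algebra \<Lambda>)"
proof (rule measurableI)
  fix A :: "real set" assume "A \<in> sets borel"
  then have "{\<eta> \<in> gradient_fields. \<eta> b \<in> A} \<in> sets (exterior_algebra \<Lambda>)"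
    unfolding sets_exterior using b by (intro sigma_sets.Basic) blast
  moreover have "(\<lambda>\<eta>. \<eta> b) -` A \<inter> space (exterior_algebra \<Lambda>) = {\<eta> \<in> gradient_fields. \<eta> b \<in> A}" by auto
  ultimately show "(\<lambda>\<eta>. \<eta> b) -` A \<inter> space (exterior_algebra \<Lambda>) \<in> sets (exterior_algebra \<Lambda>)" by simp
qed simp

lemma exterior_subset: "sets (exterior_algebra \<Lambda>) \<subseteq> sets gradient_space"
proof -
  have "{\<eta> \<in> gradient_fields. \<eta> b \<in> A} \<in> sets gradient_space" if "b \<in> bonds" "A \<in> sets borel" for b and A :: "real set"
  proof -
    have "(\<lambda>\<eta>. \<eta> b) -` A \<inter> space gradient_space \<in> sets gradient_space"
      by (rule measurable_sets[OF gradient_space_component[OF that(1)] that(2)])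
    moreover have "(\<lambda>\<eta>. \<eta> b) -` A \<inter> space gradient_space = {\<eta> \<in> gradient_fields. \<eta> b \<in> A}" by auto
    ultimately show ?thesis by simp
  qed
  then have "{{\<eta> \<in> gradient_fields. \<eta> b \<in> A} | b A. b \<in> bonds - bond_closure \<Lambda> \<and> A \<in> sets borel} \<subseteq> sets gradient_space"
    by blast
  from sets.sigma_sets_subset[OF this] show ?thesis unfolding sets_exterior by simp
qed

text \<open>\<open>height\<close> is an arbitrary choice and carries no measurability of its own;
  along a path of exterior bonds its differences are sums of exterior bond variables.\<close>

lemma height_diff_measurable:
  assumes "(x, y) \<in> (exterior_edges \<Lambda>)\<^sup>*"
  shows "(\<lambda>\<eta>. height \<eta> x - height \<eta> y) \<in> borel_measurable (exterior_algebra \<Lambda>)"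
  using assms
proof (induction rule: rtrancl_induct)
  case (step y z)
  then have yz: "(y, z) \<in> bonds - bond_closure \<Lambda>" by (auto simp: exterior_edges_def bond_closure_def)
  have "(\<lambda>\<eta>. (height \<eta> x - height \<eta> y) + \<eta> (y, z)) \<in> borel_measurable (exterior_algebra \<Lambda>)"
    by (intro borel_measurable_add step.IH exterior_component yz)
  moreover have "height \<eta> x - height \<eta> z = (height \<eta> x - height \<eta> y) + \<eta> (y, z)" if "\<eta> \<in> space (exterior_algebra \<Lambda>)" for \<eta>
    using height_diff[of \<eta> y z] that yz by simp
  ultimately show ?case by (subst measurable_cong[where g="\<lambda>\<eta>. (height \<eta> x - height \<eta> y) + \<eta> (y, z)"])
qed simp

lemma exterior_section_measurable: "exterior_section \<Lambda> \<in> measurable (exterior_algebra \<Lambda>) gradient_space"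
proof (rule measurable_gradient_spaceI)
  show "exterior_section \<Lambda> \<eta> \<in> gradient_fields" for \<eta> by (simp add: exterior_section_def gradient_fields_def)
  fix b :: "'a bond" assume b: "b \<in> bonds"
  have m: "(\<lambda>\<eta>. if x \<in> \<Lambda> then 0 else height \<eta> x - height \<eta> (component_rep \<Lambda> x)) \<in> borel_measurable (exterior_algebra \<Lambda>)" for x
    using height_diff_measurable[OF component_rep[of x \<Lambda>]] by simp
  show "(\<lambda>\<eta>. exterior_section \<Lambda> \<eta> b) \<in> borel_measurable (exterior_algebra \<Lambda>)"
    unfolding exterior_section_def grad_def using b borel_measurable_diff[OF m[of "fst b"] m[of "snd b"]] by simp
qed

text \<open>What the normalisation subtracts from the height is constant on each component of the
  complement of \<open>\<Lambda>\<close>, so its gradient vanishes on the exterior bonds.\<close>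

lemma exterior_section_direction:
  assumes \<eta>: "\<eta> \<in> gradient_fields"
  obtains u where "u \<in> fields_bc \<Lambda> (\<lambda>_. 0)" "translate u (exterior_section \<Lambda> \<eta>) = \<eta>"
proof
  let ?u = "grad (\<lambda>x. if x \<in> \<Lambda> then height \<eta> x else height \<eta> (component_rep \<Lambda> x))"
  have "?u b = 0" if b: "b \<in> bonds - bond_closure \<Lambda>" for b
  proof -
    have "(fst b, snd b) \<in> exterior_edges \<Lambda>" using b by (auto simp: exterior_edges_def bond_closure_def)
    from component_rep_eq[OF this] show ?thesis using b by (auto simp: grad_def bond_closure_def)
  qed
  moreover have "?u \<in> gradient_fields" by (simp add: gradient_fields_def)
  ultimately show "?u \<in> fields_bc \<Lambda> (\<lambda>_. 0)" unfolding fields_bc_def by blast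
  have "translate ?u (exterior_section \<Lambda> \<eta>) = grad (height \<eta>)"
    by (auto simp: translate_def exterior_section_def grad_def fun_eq_iff)
  then show "translate ?u (exterior_section \<Lambda> \<eta>) = \<eta>" by (simp add: grad_height[OF \<eta>])
qed

section \<open>The DLR equation and the conditional law\<close>

context gibbs_volume begin

lemma exterior_invariant:
  assumes B: "B \<in> sets (exterior_algebra \<Lambda>)" and u: "u \<in> fields_bc \<Lambda> (\<lambda>_. 0)" and \<eta>: "\<eta> \<in> gradient_fields"
  shows "translate u \<eta> \<in> B \<longleftrightarrow> \<eta> \<in> B"
  using B unfolding sets_exterior
proof (induction rule: sigma_sets.induct)
  case (Basic X)
  then obtain b A where "X = {\<eta> \<in> gradient_fields. \<eta> b \<in> A}" "b \<in> bonds - bond_closure \<Lambda>" by blast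
  moreover have "translate u \<eta> b = \<eta> b" if "b \<in> bonds - bond_closure \<Lambda>" for b
    using that u by (simp add: translate_def fields_bc_def)
  ultimately show ?case using \<eta> translate_grad[OF \<eta> directions_grad[OF u]] by simp
next
  case (Compl X)
  then show ?case using \<eta> translate_grad[OF \<eta> directions_grad[OF u]] by simp
qed auto

text \<open>A field and its section differ by a direction. Composition with the section thus
  exhibits the local mass as a measurable function of the exterior bonds.\<close>

lemma local_mass_section:
  assumes \<eta>: "\<eta> \<in> gradient_fields" and A: "A \<in> sets gradient_space"
  shows "local_mass A (exterior_section \<Lambda> \<eta>) = local_mass A \<eta>"
proof -
  obtain u where u: "u \<in> fields_bc \<Lambda> (\<lambda>_. 0)" "translate u (exterior_section \<Lambda> \<eta>) = \<eta>"
    using exterior_section_direction[OF \<eta>] .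
  obtain c where "u = dirsum c" using u(1) bij_betw_imp_surj_on[OF dirsum_bij] by blast
  moreover have "exterior_section \<Lambda> \<eta> \<in> gradient_fields" by (simp add: exterior_section_def gradient_fields_def)
  ultimately show ?thesis using local_mass_translate[OF _ A, of "exterior_section \<Lambda> \<eta>" c] u(2) by simp
qed

lemma gradient_fields_sets: "gradient_fields \<in> sets gradient_space"
  using sets.top[of gradient_space] by simp

lemma local_spec_le_1: "local_mass A \<xi> / local_mass gradient_fields \<xi> \<le> 1" if \<xi>: "\<xi> \<in> gradient_fields"
proof -
  let ?Z = "local_mass gradient_fields \<xi>"
  have "local_mass A \<xi> \<le> ?Z"
    unfolding local_mass_def using translate_grad[OF \<xi> directions_grad[OF dirsum_direction]]
    by (intro nn_integral_mono) (auto simp: indicator_def)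
  then have "local_mass A \<xi> / ?Z \<le> ?Z / ?Z" by (rule divide_right_mono_ennreal)
  \<comment> \<open>In \<open>ennreal\<close> this quotient is zero when \<open>?Z\<close> is
    infinite, and one otherwise.\<close>
  also have "\<dots> \<le> 1"
    using local_mass_pos[OF \<xi>] by (cases "?Z = \<infinity>") (simp_all add: ennreal_divide_self less_top)
  finally show ?thesis .
qed

text \<open>Written with \<open>lam\<close>, the left side is a double integral over fields and
  their translates. \<open>exchange\<close> moves \<open>B\<close>, one weight and the reciprocal of
  the partition function onto the translate. The event \<open>B\<close> and the partition function
  are invariant under directions, so the inner integral reproduces the partition function, and the
  two cancel.\<close>

lemma dlr_equation:
  assumes A: "A \<in> sets gradient_space" and B: "B \<in> sets (exterior_algebra \<Lambda>)"
  shows "(\<integral>\<^sup>+\<xi>. indicator B \<xi> * (local_mass A \<xi> / local_mass gradient_fields \<xi>) \<partial>\<mu>) = emeasure \<mu> (A \<inter> B)"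
proof -
  let ?Z = "local_mass gradient_fields"
  have Bs: "B \<in> sets gradient_space" using B exterior_subset by blast
  have Zm: "?Z \<in> borel_measurable gradient_space" by (rule local_mass_meas[OF gradient_fields_sets])
  have Gm: "(\<lambda>\<eta>. indicator B \<eta> * wt \<eta> * inverse (?Z \<eta>)) \<in> borel_measurable gradient_space"
    by (intro borel_measurable_times_ennreal borel_measurable_indicator Bs wt_meas measurable_compose[OF Zm borel_measurable_inverse_ennreal])
      simp
  have Fm: "(\<lambda>(\<eta>, \<eta>'). (indicator B \<eta> * wt \<eta> * inverse (?Z \<eta>)) * (wt \<eta>' * indicator A \<eta>')) \<in> borel_measurable (gradient_space \<Otimes>\<^sub>M gradient_space)"
    unfolding case_prod_beta'
    by (rule borel_measurable_times_ennreal[OF measurable_compose[OF measurable_fst Gm] measurable_compose[OF measurable_snd wt_indicator_meas[OF A]]])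
  have "(\<integral>\<^sup>+\<xi>. indicator B \<xi> * (local_mass A \<xi> / ?Z \<xi>) \<partial>\<mu>) = (\<integral>\<^sup>+\<xi>. indicator B \<xi> * (local_mass A \<xi> / ?Z \<xi>) * wt \<xi> \<partial>lam)"
    by (intro nn_integral_mu borel_measurable_times_ennreal borel_measurable_indicator Bs borel_measurable_divide_ennreal local_mass_meas A gradient_fields_sets)
  also have "\<dots> = (\<integral>\<^sup>+\<eta>. \<integral>\<^sup>+c. (indicator B \<eta> * wt \<eta> * inverse (?Z \<eta>)) * (wt (translate (dirsum c) \<eta>) * indicator A (translate (dirsum c) \<eta>)) \<partial>coef \<partial>lam)"
  proof (rule nn_integral_cong)
    fix \<eta> assume "\<eta> \<in> space lam"
    then have \<eta>: "\<eta> \<in> gradient_fields" by (simp add: space_lam)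
    show "indicator B \<eta> * (local_mass A \<eta> / ?Z \<eta>) * wt \<eta> =
      (\<integral>\<^sup>+c. (indicator B \<eta> * wt \<eta> * inverse (?Z \<eta>)) * (wt (translate (dirsum c) \<eta>) * indicator A (translate (dirsum c) \<eta>)) \<partial>coef)"
      by (subst nn_integral_cmult[OF measurable_compose[OF translate_slice[OF \<eta>] wt_indicator_meas[OF A]]])
        (simp add: local_mass_def divide_ennreal_def mult_ac)
  qed
  also have "\<dots> = (\<integral>\<^sup>+\<eta>. \<integral>\<^sup>+c. (indicator B (translate (dirsum c) \<eta>) * wt (translate (dirsum c) \<eta>) * inverse (?Z (translate (dirsum c) \<eta>))) * (wt \<eta> * indicator A \<eta>) \<partial>coef \<partial>lam)"
    by (rule exchange[OF Fm])
  also have "\<dots> = (\<integral>\<^sup>+\<eta>. indicator (A \<inter> B) \<eta> * (?Z \<eta> * inverse (?Z \<eta>)) * wt \<eta> \<partial>lam)"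
  proof (rule nn_integral_cong)
    fix \<eta> assume "\<eta> \<in> space lam"
    then have \<eta>: "\<eta> \<in> gradient_fields" by (simp add: space_lam)
    have Z: "?Z \<eta> = (\<integral>\<^sup>+c. wt (translate (dirsum c) \<eta>) \<partial>coef)"
      using translate_grad[OF \<eta> directions_grad[OF dirsum_direction]] by (simp add: local_mass_def)
    have ind: "indicator B (translate (dirsum c) \<eta>) = (indicator B \<eta> :: ennreal)" for c
      using exterior_invariant[OF B dirsum_direction \<eta>] by (simp add: indicator_def)
    have "(\<integral>\<^sup>+c. (indicator B (translate (dirsum c) \<eta>) * wt (translate (dirsum c) \<eta>) * inverse (?Z (translate (dirsum c) \<eta>))) * (wt \<eta> * indicator A \<eta>) \<partial>coef)
      = (\<integral>\<^sup>+c. (indicator B \<eta> * inverse (?Z \<eta>) * wt \<eta> * indicator A \<eta>) * wt (translate (dirsum c) \<eta>) \<partial>coef)"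
      by (intro nn_integral_cong) (simp add: ind local_mass_translate[OF \<eta> gradient_fields_sets] mult_ac)
    also have "\<dots> = (indicator B \<eta> * inverse (?Z \<eta>) * wt \<eta> * indicator A \<eta>) * ?Z \<eta>"
      unfolding Z by (rule nn_integral_cmult) (rule measurable_compose[OF translate_slice[OF \<eta>] wt_meas])
    also have "\<dots> = indicator (A \<inter> B) \<eta> * (?Z \<eta> * inverse (?Z \<eta>)) * wt \<eta>"
      by (simp add: indicator_inter_arith mult_ac)
    finally show "(\<integral>\<^sup>+c. (indicator B (translate (dirsum c) \<eta>) * wt (translate (dirsum c) \<eta>) * inverse (?Z (translate (dirsum c) \<eta>))) * (wt \<eta> * indicator A \<eta>) \<partial>coef) = \<dots>" .
  qed
  also have "\<dots> = (\<integral>\<^sup>+\<eta>. indicator (A \<inter> B) \<eta> * (?Z \<eta> * inverse (?Z \<eta>)) \<partial>\<mu>)"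
    by (intro nn_integral_mu[symmetric] borel_measurable_times_ennreal borel_measurable_indicator sets.Int A Bs Zm
        measurable_compose[OF Zm borel_measurable_inverse_ennreal]) simp
  also have "\<dots> = (\<integral>\<^sup>+\<eta>. indicator (A \<inter> B) \<eta> \<partial>\<mu>)"
  proof (rule nn_integral_cong_AE)
    show "AE \<eta> in \<mu>. indicator (A \<inter> B) \<eta> * (?Z \<eta> * inverse (?Z \<eta>)) = indicator (A \<inter> B) \<eta>"
      using local_mass_finite AE_space[of \<mu>]
    proof eventually_elim
      case (elim \<eta>)
      then have "?Z \<eta> * inverse (?Z \<eta>) = 1"
        using local_mass_pos[of \<eta>] ennreal_divide_self[of "?Z \<eta>"] by (simp add: space_mu divide_ennreal_def less_top)
      then show ?case by simp
    qed
  qed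
  also have "\<dots> = emeasure \<mu> (A \<inter> B)" by (rule nn_integral_indicator) (simp add: sets_mu A Bs sets.Int)
  finally show ?thesis .
qed

theorem conditional_distribution:
  assumes A: "A \<in> sets \<mu>"
  shows "AE \<xi> in \<mu>. real_cond_exp \<mu> (exterior_algebra \<Lambda>) (indicator A) \<xi> = measure (finite_gibbs V \<Lambda> \<xi>) A"
proof -
  have A': "A \<in> sets gradient_space" using A by (simp add: sets_mu)
  have sub: "subalgebra \<mu> (exterior_algebra \<Lambda>)"
    unfolding subalgebra_def using exterior_subset by (simp add: space_mu sets_mu)
  interpret E: finite_measure_subalgebra \<mu> "exterior_algebra \<Lambda>" by unfold_locales (rule sub)
  define r where "r \<xi> = local_mass A \<xi> / local_mass gradient_fields \<xi>" for \<xi>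
  \<comment> \<open>Through the section, \<open>g\<close> is measurable for the exterior algebra by
    construction, while on gradient fields it has the values of \<open>r\<close>.\<close>
  define g where "g \<xi> = enn2real (r (exterior_section \<Lambda> \<xi>))" for \<xi>
  have rm: "r \<in> borel_measurable gradient_space"
    unfolding r_def by (intro borel_measurable_divide_ennreal local_mass_meas A' gradient_fields_sets)
  have gm: "g \<in> borel_measurable (exterior_algebra \<Lambda>)"
    unfolding g_def by (intro borel_measurable_enn2real measurable_compose[OF exterior_section_measurable rm])
  then have gm': "g \<in> borel_measurable \<mu>" using measurable_from_subalg[OF sub] by blast
  have g: "ennreal (g \<xi>) = r \<xi>" "g \<xi> \<le> 1" "g \<xi> = measure (finite_gibbs V \<Lambda> \<xi>) A" if \<xi>: "\<xi> \<in> gradient_fields" for \<xi>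
  proof -
    have e: "r (exterior_section \<Lambda> \<xi>) = r \<xi>"
      by (simp add: r_def local_mass_section[OF \<xi>] A' gradient_fields_sets)
    have r1: "r \<xi> \<le> 1" unfolding r_def by (rule local_spec_le_1[OF \<xi>])
    then have "r \<xi> < \<top>" using le_less_trans[OF _ ennreal_one_less_top] by blast
    then show "ennreal (g \<xi>) = r \<xi>" unfolding g_def e by simp
    show "g \<xi> \<le> 1" unfolding g_def e using enn2real_mono[OF r1] by simp
    show "g \<xi> = measure (finite_gibbs V \<Lambda> \<xi>) A"
      unfolding g_def e unfolding measure_def emeasure_finite_gibbs[OF \<xi> A'] r_def ..
  qed
  have g0: "0 \<le> g \<xi>" for \<xi> by (simp add: g_def)
  have "AE \<xi> in \<mu>. real_cond_exp \<mu> (exterior_algebra \<Lambda>) (indicator A) \<xi> = g \<xi>"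
  proof (rule E.real_cond_exp_charact)
    show "integrable \<mu> (indicator A :: _ \<Rightarrow> real)" using A by (simp add: integrable_indicator_iff less_top[symmetric])
    show "integrable \<mu> g"
      using g(2) g0 by (intro integrable_boundedI[where B=1] finite_measure_axioms gm') (simp add: space_mu)
    show "g \<in> borel_measurable (exterior_algebra \<Lambda>)" by (rule gm)
    fix B assume B: "B \<in> sets (exterior_algebra \<Lambda>)"
    have Bs: "B \<in> sets \<mu>" using B exterior_subset by (auto simp: sets_mu)
    have "(\<integral>\<xi>\<in>B. indicator A \<xi> \<partial>\<mu>) = (\<integral>\<xi>. indicator (A \<inter> B) \<xi> \<partial>\<mu>)"
      unfolding set_lebesgue_integral_def by (intro Bochner_Integration.integral_cong) (auto simp: indicator_def)
    also have "\<dots> = measure \<mu> (A \<inter> B)" using A Bs by simp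
    also have "\<dots> = enn2real (\<integral>\<^sup>+\<xi>. ennreal (indicator B \<xi> * g \<xi>) \<partial>\<mu>)"
    proof -
      have "(\<integral>\<^sup>+\<xi>. ennreal (indicator B \<xi> * g \<xi>) \<partial>\<mu>) = (\<integral>\<^sup>+\<xi>. indicator B \<xi> * (local_mass A \<xi> / local_mass gradient_fields \<xi>) \<partial>\<mu>)"
        by (intro nn_integral_cong) (auto simp: indicator_def g(1) space_mu r_def)
      then show ?thesis unfolding dlr_equation[OF A' B] measure_def by simp
    qed
    also have "\<dots> = (\<integral>\<xi>\<in>B. g \<xi> \<partial>\<mu>)"
      unfolding set_lebesgue_integral_def real_scaleR_def
      by (rule integral_eq_nn_integral[symmetric]) (use gm' Bs g0 in auto)
    finally show "(\<integral>\<xi>\<in>B. indicator A \<xi> \<partial>\<mu>) = (\<integral>\<xi>\<in>B. g \<xi> \<partial>\<mu>)" .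
  qed
  then show ?thesis using AE_space[of \<mu>]
    by eventually_elim (simp add: g(3) space_mu)
qed

end

section \<open>From Assumption (A) to the theorem\<close>

lemma assumption_A_regular:
  assumes "assumption_A V"
  obtains C where "\<And>t. V (- t) = V t" "\<And>t. (V has_real_derivative deriv V t) (at t)"
    "\<And>t. (deriv V has_real_derivative deriv (deriv V) t) (at t)" "continuous_on UNIV (deriv (deriv V))"
    "\<And>t. \<bar>deriv (deriv V) t\<bar> \<le> C"
proof -
  obtain V0 g where V: "V = (\<lambda>x. V0 x + g x)" and C2: "C2 V0" "C2 g" and ev: "\<And>x. V0 (- x) = V0 x" "\<And>x. g (- x) = g x"
    and b: "\<exists>c_minus > 0. \<exists>c_plus > 0. \<forall>x. c_minus \<le> deriv (deriv V0) x \<and> deriv (deriv V0) x \<le> c_plus"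
    and b': "\<exists>C_g > 0. \<forall>x. \<bar>deriv g x\<bar> + \<bar>deriv (deriv g) x\<bar> \<le> C_g"
    using assms unfolding assumption_A_def by blast
  have D: "(f has_real_derivative deriv f t) (at t)" "(deriv f has_real_derivative deriv (deriv f) t) (at t)"
    "continuous_on UNIV (deriv (deriv f))" if "C2 f" for f t
    using that unfolding C2_def by (auto simp: DERIV_deriv_iff_real_differentiable)
  have d1: "deriv V = (\<lambda>t. deriv V0 t + deriv g t)"
    unfolding V by (intro ext DERIV_imp_deriv DERIV_add D C2)
  have d2: "deriv (deriv V) = (\<lambda>t. deriv (deriv V0) t + deriv (deriv g) t)"
    unfolding d1 by (intro ext DERIV_imp_deriv DERIV_add D C2)
  obtain c c' k where c: "c > 0" "\<And>x. c \<le> deriv (deriv V0) x \<and> deriv (deriv V0) x \<le> c'" using b by blast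
  obtain k where k: "\<And>x. \<bar>deriv g x\<bar> + \<bar>deriv (deriv g) x\<bar> \<le> k" using b' by blast
  show ?thesis
  proof (rule that)
    show "V (- t) = V t" for t by (simp add: V ev)
    show "(V has_real_derivative deriv V t) (at t)" for t unfolding d1 unfolding V by (intro DERIV_add D C2)
    show "(deriv V has_real_derivative deriv (deriv V) t) (at t)" for t unfolding d2 unfolding d1 by (intro DERIV_add D C2)
    show "continuous_on UNIV (deriv (deriv V))" unfolding d2 by (intro continuous_on_add D C2)
    \<comment> \<open>The second derivative of \<open>V0\<close> lies between zero and
      \<open>c'\<close>, and that of \<open>g\<close> is at most \<open>k\<close> in
      modulus.\<close>
    show "\<bar>deriv (deriv V) t\<bar> \<le> c' + k" for t
      unfolding d2 using c(1) c(2)[of t] k[of t] abs_ge_zero[of "deriv g t"] by linarith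
  qed
qed

theorem theorem3p1:
  fixes V :: "real \<Rightarrow> real"
    and \<mu> :: "(('d::finite) bond \<Rightarrow> real) measure"
  assumes "CARD('d) \<ge> 2"
    and "assumption_A V"
    and "\<mu> \<in> P2"
    and "shift_invariant \<mu>"
    and "stationary V \<mu>"
  shows "gibbs_measure V \<mu>"
proof -
  obtain C where V: "\<And>t. V (- t) = V t" "\<And>t. (V has_real_derivative deriv V t) (at t)"
    "\<And>t. (deriv V has_real_derivative deriv (deriv V) t) (at t)" "continuous_on UNIV (deriv (deriv V))"
    "\<And>t. \<bar>deriv (deriv V) t\<bar> \<le> C"
    using assumption_A_regular[OF assms(2)] by blast
  have "AE \<xi> in \<mu>. real_cond_exp \<mu> (exterior_algebra \<Lambda>) (indicator A) \<xi> = measure (finite_gibbs V \<Lambda> \<xi>) A"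
    if \<Lambda>: "finite \<Lambda>" and A: "A \<in> sets \<mu>" for \<Lambda> A
  proof -
    interpret gibbs_volume V "deriv V" "deriv (deriv V)" C \<mu> \<Lambda>
      by unfold_locales (rule V assms \<Lambda>)+
    show ?thesis by (rule conditional_distribution[OF A])
  qed
  then show ?thesis unfolding gibbs_measure_def by blast
qed

end
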